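(* The emptiness problem for register set automata (given an RsA $\mathcal{A}$, decide whether $L(\mathcal{A})=\emptyset$) is decidable; in particular, it is $\mathbf{F}_\omega$-complete.
   Context: Fix a finite nonempty alphabet $\Sigma$ and an infinite data domain $\mathbb{D}$. A register set automaton (RsA) is a tuple $(Q,R,\Delta,I,F)$ with $Q$ a finite set of states, $R$ a finite set of registers, $I,F\subseteq Q$ initial and final states, and transitions $q\xrightarrow{a\mid G^{\in},G^{\notin},up}s$ with $a\in\Sigma$, $G^{\in},G^{\notin}\subseteq R$ disjoint, $up\colon R\to 2^{R\cup\{\mathit{in}\}}$. Configurations are $(q,f)$ with $f\colon R\to 2^{\mathbb{D}}$; initial ones have $q\in I$ and all registers empty. A step over $(a,d)\in\Sigma\times\mathbb{D}$ is possible iff $d\in f(r)$ for all $r\in G^{\in}$ and $d\notin f(r)$ for all $r\in G^{\notin}$; afterwards each register $r$ holds $\bigcup\{f(r')\mid r'\in R\cap up(r)\}$, together with $d$ if $\mathit{in}\in up(r)$. $L(\mathcal{A})$ is the set of data words in $(\Sigma\times\mathbb{D})^*$ having a run from an initial configuration ending in a state of $F$. $\mathbf{F}_\omega$ denotes the Ackermannian complexity class in Schmitz's hierarchy of fast-growing complexity classes (closed under primitive-recursive reductions). *)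

theory Defs
  imports Main
begin

section \<open>Register set automata\<close>

datatype 'r source = In | Reg 'r

record ('q, 'r, 'a) transition =
  src :: 'q
  letter :: 'a
  guard_in :: "'r set"
  guard_notin :: "'r set"
  upd :: "'r \<Rightarrow> 'r source set"
  tgt :: 'q

record ('q, 'r, 'a) rsa =
  states :: "'q set"
  regs :: "'r set"
  transitions :: "('q, 'r, 'a) transition set"
  initial :: "'q set"
  final :: "'q set"

text \<open>
  An update is a function on the registers of the automaton. It is represented by the total
  function that is empty elsewhere, so that transitions with the same update are equal; the
  contents of everything outside \<open>regs A\<close> then remains empty along a run.
\<close>

definition wf_transition :: "'a set \<Rightarrow> 'q set \<Rightarrow> 'r set \<Rightarrow> ('q, 'r, 'a) transition \<Rightarrow> bool" where
  "wf_transition \<Sigma> Q R t \<longleftrightarrow>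
     src t \<in> Q \<and> letter t \<in> \<Sigma> \<and> tgt t \<in> Q \<and>
     guard_in t \<subseteq> R \<and> guard_notin t \<subseteq> R \<and> guard_in t \<inter> guard_notin t = {} \<and>
     (\<forall>r\<in>R. upd t r \<subseteq> insert In (Reg ` R)) \<and> (\<forall>r. r \<notin> R \<longrightarrow> upd t r = {})"

definition wf_rsa :: "'a set \<Rightarrow> ('q, 'r, 'a) rsa \<Rightarrow> bool" where
  "wf_rsa \<Sigma> A \<longleftrightarrow>
     finite (states A) \<and> finite (regs A) \<and>
     initial A \<subseteq> states A \<and> final A \<subseteq> states A \<and>
     (\<forall>t\<in>transitions A. wf_transition \<Sigma> (states A) (regs A) t)"

type_synonym ('q, 'r, 'd) rsa_config = "'q \<times> ('r \<Rightarrow> 'd set)"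

definition enabled :: "('q, 'r, 'a) transition \<Rightarrow> ('r \<Rightarrow> 'd set) \<Rightarrow> 'd \<Rightarrow> bool" where
  "enabled t f d \<longleftrightarrow> (\<forall>r\<in>guard_in t. d \<in> f r) \<and> (\<forall>r\<in>guard_notin t. d \<notin> f r)"

definition update :: "('r \<Rightarrow> 'r source set) \<Rightarrow> ('r \<Rightarrow> 'd set) \<Rightarrow> 'd \<Rightarrow> 'r \<Rightarrow> 'd set" where
  "update up f d r = \<Union> {f r' | r'. Reg r' \<in> up r} \<union> (if In \<in> up r then {d} else {})"

inductive run :: "('q, 'r, 'a) rsa \<Rightarrow> ('q, 'r, 'd) rsa_config \<Rightarrow> ('a \<times> 'd) list \<Rightarrow>
    ('q, 'r, 'd) rsa_config \<Rightarrow> bool" for A where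
  Nil: "run A c [] c"
| Cons: "t \<in> transitions A \<Longrightarrow> enabled t f d \<Longrightarrow> run A (tgt t, update (upd t) f d) w c
    \<Longrightarrow> run A (src t, f) ((letter t, d) # w) c"

definition lang :: "'a set \<Rightarrow> 'd set \<Rightarrow> ('q, 'r, 'a) rsa \<Rightarrow> ('a \<times> 'd) list set" where
  "lang \<Sigma> D A = {w \<in> lists (\<Sigma> \<times> D).
     \<exists>q\<in>initial A. \<exists>s\<in>final A. \<exists>f. run A (q, \<lambda>_. {}) w (s, f)}"


section \<open>The emptiness problem as a language of binary words\<close>

text \<open>
  Instances are automata whose states and registers are named by natural numbers. Numbers are
  written in unary, lists are preceded by their length, and finite sets are listed in increasing
  order. The transitions may be listed in any order. Letters are written through an injective
  numbering \<open>\<nu>\<close> of the fixed alphabet. Words that are no code of an automaton are not in the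
  language.
\<close>

definition enc_nat :: "nat \<Rightarrow> bool list" where
  "enc_nat n = replicate n True @ [False]"

definition enc_list :: "('b \<Rightarrow> bool list) \<Rightarrow> 'b list \<Rightarrow> bool list" where
  "enc_list e xs = enc_nat (length xs) @ concat (map e xs)"

definition enc_set :: "nat set \<Rightarrow> bool list" where
  "enc_set S = enc_list enc_nat (sorted_list_of_set S)"

fun source_num :: "nat source \<Rightarrow> nat" where
  "source_num In = 0"
| "source_num (Reg r) = Suc r"

definition enc_transition :: "('a \<Rightarrow> nat) \<Rightarrow> nat set \<Rightarrow> (nat, nat, 'a) transition \<Rightarrow> bool list" where
  "enc_transition \<nu> R t =
     enc_nat (src t) @ enc_nat (\<nu> (letter t)) @ enc_set (guard_in t) @ enc_set (guard_notin t) @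
     enc_list (\<lambda>r. enc_set (source_num ` upd t r)) (sorted_list_of_set R) @ enc_nat (tgt t)"

definition codes :: "('a \<Rightarrow> nat) \<Rightarrow> (nat, nat, 'a) rsa \<Rightarrow> bool list set" where
  "codes \<nu> A = {enc_set (states A) @ enc_set (regs A) @ enc_list (enc_transition \<nu> (regs A)) ts @
     enc_set (initial A) @ enc_set (final A) | ts. set ts = transitions A}"

definition rsa_emptiness :: "'a set \<Rightarrow> ('a \<Rightarrow> nat) \<Rightarrow> 'd set \<Rightarrow> bool list set" where
  "rsa_emptiness \<Sigma> \<nu> D =
     {w. \<exists>A :: (nat, nat, 'a) rsa. wf_rsa \<Sigma> A \<and> w \<in> codes \<nu> A \<and> lang \<Sigma> D A = {}}"

text \<open>A word is the code of at most one automaton.\<close>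

lemma enc_nat_inject: "enc_nat m @ u = enc_nat n @ v \<longleftrightarrow> m = n \<and> u = v"
proof (induction m arbitrary: n)
  case 0
  then show ?case by (cases n) (auto simp: enc_nat_def)
next
  case (Suc m)
  then show ?case by (cases n) (auto simp: enc_nat_def)
qed

lemma enc_map_inject:
  assumes "length xs = length ys"
    and "concat (map e xs) @ u = concat (map e' ys) @ v"
    and "\<And>x y u v. x \<in> set xs \<Longrightarrow> y \<in> set ys \<Longrightarrow> e x @ u = e' y @ v \<Longrightarrow> g x = g' y \<and> u = v"
  shows "map g xs = map g' ys \<and> u = v"
  using assms
proof (induction xs ys rule: list_induct2)
  case Nil
  then show ?case by simp
next
  case (Cons x xs y ys)
  have "g x = g' y \<and> concat (map e xs) @ u = concat (map e' ys) @ v"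
    by (rule Cons.prems(2)) (use Cons.prems(1) in auto)
  moreover from this have "map g xs = map g' ys \<and> u = v"
  proof (intro Cons.IH)
    show "g x' = g' y' \<and> u' = v'" if "x' \<in> set xs" "y' \<in> set ys" "e x' @ u' = e' y' @ v'"
      for x' y' u' v'
      by (rule Cons.prems(2)) (use that in auto)
  qed simp
  ultimately show ?case by simp
qed

lemma enc_list_inject:
  assumes "enc_list e xs @ u = enc_list e' ys @ v"
    and "\<And>x y u v. x \<in> set xs \<Longrightarrow> y \<in> set ys \<Longrightarrow> e x @ u = e' y @ v \<Longrightarrow> g x = g' y \<and> u = v"
  shows "map g xs = map g' ys \<and> u = v"
proof -
  have "length xs = length ys \<and> concat (map e xs) @ u = concat (map e' ys) @ v"
    using assms(1) by (simp add: enc_list_def enc_nat_inject)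
  then show ?thesis using enc_map_inject[of xs ys e u e' v g g'] assms(2) by blast
qed

lemma enc_set_inject:
  assumes "enc_set S @ u = enc_set T @ v" "finite S" "finite T"
  shows "S = T \<and> u = v"
proof -
  have "map id (sorted_list_of_set S) = map id (sorted_list_of_set T) \<and> u = v"
    using assms(1) unfolding enc_set_def
    by (rule enc_list_inject) (simp add: enc_nat_inject)
  then show ?thesis using assms(2,3) by (metis list.map_id set_sorted_list_of_set)
qed

lemma inj_source_num: "inj source_num"
proof (rule injI)
  fix x y assume "source_num x = source_num y"
  then show "x = y" by (cases x; cases y) auto
qed

lemma enc_transition_inject:
  assumes eq: "enc_transition \<nu> R t @ u = enc_transition \<nu> R t' @ v"
    and wf: "wf_transition \<Sigma> Q R t" "wf_transition \<Sigma> Q R t'"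
    and fin: "finite R" and inj: "inj_on \<nu> \<Sigma>"
  shows "t = t' \<and> u = v"
proof -
  have fing: "finite (guard_in x)" "finite (guard_notin x)" "r \<in> R \<Longrightarrow> finite (upd x r)"
    if "wf_transition \<Sigma> Q R x" for x :: "(nat, nat, 'a) transition" and r
    using that fin unfolding wf_transition_def
    by (blast intro: finite_subset finite.insertI finite_imageI)+
  let ?rs = "sorted_list_of_set R"
  let ?e = "\<lambda>x r. enc_set (source_num ` upd x r)"
  obtain a: "src t = src t'" "\<nu> (letter t) = \<nu> (letter t')"
    and b: "enc_set (guard_in t) @ enc_set (guard_notin t) @ enc_list (?e t) ?rs @ enc_nat (tgt t) @ u
          = enc_set (guard_in t') @ enc_set (guard_notin t') @ enc_list (?e t') ?rs @ enc_nat (tgt t') @ v"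
    using eq by (auto simp: enc_transition_def enc_nat_inject)
  from enc_set_inject[OF b] fing wf have c: "guard_in t = guard_in t'"
    and b2: "enc_set (guard_notin t) @ enc_list (?e t) ?rs @ enc_nat (tgt t) @ u
          = enc_set (guard_notin t') @ enc_list (?e t') ?rs @ enc_nat (tgt t') @ v" by auto
  from enc_set_inject[OF b2] fing wf have d: "guard_notin t = guard_notin t'"
    and b3: "enc_list (?e t) ?rs @ enc_nat (tgt t) @ u = enc_list (?e t') ?rs @ enc_nat (tgt t') @ v"
    by auto
  have "concat (map (?e t) ?rs) @ enc_nat (tgt t) @ u = concat (map (?e t') ?rs) @ enc_nat (tgt t') @ v"
    using b3 by (simp add: enc_list_def enc_nat_inject)
  moreover have "map (upd t) rs = map (upd t') rs \<and> u' = v'"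
    if "concat (map (?e t) rs) @ u' = concat (map (?e t') rs) @ v'" "set rs \<subseteq> R" for rs u' v'
    using that
  proof (induction rs)
    case (Cons r rs)
    have "finite (source_num ` upd t r)" "finite (source_num ` upd t' r)"
      using fing wf Cons.prems(2) by auto
    then have "source_num ` upd t r = source_num ` upd t' r \<and>
      concat (map (?e t) rs) @ u' = concat (map (?e t') rs) @ v'"
      using Cons.prems(1) enc_set_inject by force
    then show ?case using Cons.IH Cons.prems(2) by (simp add: inj_image_eq_iff[OF inj_source_num])
  qed simp
  ultimately have u: "map (upd t) ?rs = map (upd t') ?rs"
    and "enc_nat (tgt t) @ u = enc_nat (tgt t') @ v"
    using fin by (metis order_refl set_sorted_list_of_set)+
  then have "tgt t = tgt t'" "u = v" by (simp_all add: enc_nat_inject)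
  moreover have "upd t = upd t'"
  proof
    fix r show "upd t r = upd t' r"
    proof (cases "r \<in> R")
      case True
      then show ?thesis using u fin by simp
    next
      case False
      then show ?thesis using wf by (simp add: wf_transition_def)
    qed
  qed
  moreover have "letter t = letter t'"
    using a(2) wf inj by (simp add: wf_transition_def inj_on_eq_iff)
  ultimately show ?thesis using a(1) c d by simp
qed

lemma codes_unique:
  assumes "w \<in> codes \<nu> A" "w \<in> codes \<nu> B" "wf_rsa \<Sigma> A" "wf_rsa \<Sigma> B" "inj_on \<nu> \<Sigma>"
  shows "A = B"
proof -
  obtain ts us where ts: "set ts = transitions A" and us: "set us = transitions B" and
    eq: "enc_set (states A) @ enc_set (regs A) @ enc_list (enc_transition \<nu> (regs A)) ts @
           enc_set (initial A) @ enc_set (final A) @ [] =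
         enc_set (states B) @ enc_set (regs B) @ enc_list (enc_transition \<nu> (regs B)) us @
           enc_set (initial B) @ enc_set (final B) @ []"
    using assms(1,2) unfolding codes_def by auto
  have fin: "finite (states X)" "finite (regs X)" "finite (initial X)" "finite (final X)"
    if "wf_rsa \<Sigma> X" for X :: "(nat, nat, 'a) rsa"
    using that by (auto simp: wf_rsa_def intro: finite_subset)
  note fA = fin[OF assms(3)] and fB = fin[OF assms(4)]
  note e1 = enc_set_inject[OF eq fA(1) fB(1)]
  note e2 = enc_set_inject[OF conjunct2[OF e1] fA(2) fB(2)]
  have R: "regs B = regs A" and Q: "states B = states A" using e1 e2 by auto
  have e3: "map id ts = map id us \<and>
      enc_set (initial A) @ enc_set (final A) @ [] = enc_set (initial B) @ enc_set (final B) @ []"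
  proof (rule enc_list_inject)
    show "enc_list (enc_transition \<nu> (regs A)) ts @ enc_set (initial A) @ enc_set (final A) @ [] =
          enc_list (enc_transition \<nu> (regs A)) us @ enc_set (initial B) @ enc_set (final B) @ []"
      using conjunct2[OF e2] R by simp
    show "id x = id y \<and> u = v" if "x \<in> set ts" "y \<in> set us"
      "enc_transition \<nu> (regs A) x @ u = enc_transition \<nu> (regs A) y @ v" for x y u v
      using enc_transition_inject[OF that(3) _ _ fA(2) assms(5), of "states A"] that(1,2) ts us
        assms(3,4) R Q by (auto simp: wf_rsa_def)
  qed
  note e4 = enc_set_inject[OF conjunct2[OF e3] fA(3) fB(3)]
  note e5 = enc_set_inject[OF conjunct2[OF e4] fA(4) fB(4)]
  have "transitions A = transitions B" using e3 ts us by auto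
  then show ?thesis using R Q e4 e5 by simp
qed


section \<open>Deterministic multi-tape Turing machines\<close>

text \<open>
  Machines have finitely many tapes, states and tape symbols. Tapes are infinite in both
  directions. The symbol 0 is the blank; the input bits are written as the symbols 1 and 2.
\<close>

datatype move = Left | Stay | Right

record tm =
  num_tapes :: nat
  num_symbols :: nat
  num_states :: nat
  start_state :: nat
  accept_state :: nat
  reject_state :: nat
  delta :: "nat \<Rightarrow> nat list \<Rightarrow> nat \<times> (nat \<times> move) list"

definition wf_tm :: "tm \<Rightarrow> bool" where
  "wf_tm M \<longleftrightarrow>
     1 \<le> num_tapes M \<and> 3 \<le> num_symbols M \<and>
     start_state M < num_states M \<and> accept_state M < num_states M \<and>
     reject_state M < num_states M \<and> accept_state M \<noteq> reject_state M \<and>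
     (\<forall>q xs q' as. q < num_states M \<and> length xs = num_tapes M \<and> set xs \<subseteq> {..<num_symbols M} \<and>
        delta M q xs = (q', as) \<longrightarrow>
        q' < num_states M \<and> length as = num_tapes M \<and> fst ` set as \<subseteq> {..<num_symbols M})"

type_synonym tape = "(int \<Rightarrow> nat) \<times> int"
type_synonym tm_config = "nat \<times> tape list"

fun offset :: "move \<Rightarrow> int" where
  "offset Left = -1"
| "offset Stay = 0"
| "offset Right = 1"

fun act :: "nat \<times> move \<Rightarrow> tape \<Rightarrow> tape" where
  "act (x, m) (c, h) = (c(h := x), h + offset m)"

fun tm_step :: "tm \<Rightarrow> tm_config \<Rightarrow> tm_config" where
  "tm_step M (q, ts) =
     (if q = accept_state M \<or> q = reject_state M then (q, ts)
      else case delta M q (map (\<lambda>(c, h). c h) ts) of (q', as) \<Rightarrow> (q', map2 act as ts))"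

definition input_tape :: "bool list \<Rightarrow> tape" where
  "input_tape w =
     ((\<lambda>i. if 0 \<le> i \<and> i < int (length w) then (if w ! nat i then 2 else 1) else 0), 0)"

definition tm_init :: "tm \<Rightarrow> bool list \<Rightarrow> tm_config" where
  "tm_init M w = (start_state M, input_tape w # replicate (num_tapes M - 1) (\<lambda>_. 0, 0))"

text \<open>After \<open>n\<close> steps, \<open>M\<close> has halted on \<open>w\<close> and has answered whether \<open>w \<in> L\<close>.\<close>

definition answers_within :: "tm \<Rightarrow> bool list set \<Rightarrow> bool list \<Rightarrow> nat \<Rightarrow> bool" where
  "answers_within M L w n \<longleftrightarrow>
     fst ((tm_step M ^^ n) (tm_init M w)) = (if w \<in> L then accept_state M else reject_state M)"

definition decidable :: "bool list set \<Rightarrow> bool" where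
  "decidable L \<longleftrightarrow> (\<exists>M. wf_tm M \<and> (\<forall>w. \<exists>n. answers_within M L w n))"

definition DTIME :: "(nat \<Rightarrow> nat) \<Rightarrow> bool list set set" where
  "DTIME T = {L. \<exists>M c. wf_tm M \<and> (\<forall>w. \<exists>n \<le> c * T (length w) + c. answers_within M L w n)}"


section \<open>Primitive recursive functions\<close>

text \<open>
  Functions of all arities are represented as functions on lists of arguments, with missing
  arguments read as 0.
\<close>

inductive prim_rec :: "(nat list \<Rightarrow> nat) \<Rightarrow> bool" where
  zero: "prim_rec (\<lambda>_. 0)"
| succ: "prim_rec (\<lambda>xs. case xs of [] \<Rightarrow> 1 | x # _ \<Rightarrow> Suc x)"
| proj: "prim_rec (\<lambda>xs. if i < length xs then xs ! i else 0)"
| comp: "prim_rec g \<Longrightarrow> (\<forall>f\<in>set fs. prim_rec f) \<Longrightarrow> prim_rec (\<lambda>xs. g (map (\<lambda>f. f xs) fs))"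
| rec: "prim_rec f \<Longrightarrow> prim_rec g \<Longrightarrow>
    prim_rec (\<lambda>xs. case xs of [] \<Rightarrow> f [] | n # ys \<Rightarrow> rec_nat (f ys) (\<lambda>k r. g (r # k # ys)) n)"

definition prim_rec1 :: "(nat \<Rightarrow> nat) \<Rightarrow> bool" where
  "prim_rec1 p \<longleftrightarrow> (\<exists>f. prim_rec f \<and> (\<forall>n. p n = f [n]))"

text \<open>
  Functions on words are primitive recursive if they are so under the numbering of words in
  bijective base 2.
\<close>

fun word_num :: "bool list \<Rightarrow> nat" where
  "word_num [] = 0"
| "word_num (b # w) = 2 * word_num w + (if b then 2 else 1)"

definition prim_rec_word :: "(bool list \<Rightarrow> bool list) \<Rightarrow> bool" where
  "prim_rec_word h \<longleftrightarrow> (\<exists>p. prim_rec1 p \<and> (\<forall>w. word_num (h w) = p (word_num w)))"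


section \<open>The complexity class $\mathbf{F}_\omega$\<close>

text \<open>
  The fast-growing functions with Schmitz's conventions $F_{k+1}(x) = F_k^{x+1}(x)$ and
  $F_\omega(x) = F_{x+1}(x)$.
\<close>

fun fast :: "nat \<Rightarrow> nat \<Rightarrow> nat" where
  "fast 0 x = x + 1"
| "fast (Suc k) x = (fast k ^^ (x + 1)) x"

definition fast_omega :: "nat \<Rightarrow> nat" where
  "fast_omega x = fast (x + 1) x"

definition F_omega :: "bool list set set" where
  "F_omega = (\<Union>p \<in> {p. prim_rec1 p}. DTIME (\<lambda>n. fast_omega (p n)))"

definition prim_rec_reducible :: "bool list set \<Rightarrow> bool list set \<Rightarrow> bool" where
  "prim_rec_reducible K L \<longleftrightarrow> (\<exists>h. prim_rec_word h \<and> (\<forall>w. w \<in> K \<longleftrightarrow> h w \<in> L))"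

definition F_omega_complete :: "bool list set \<Rightarrow> bool" where
  "F_omega_complete L \<longleftrightarrow> L \<in> F_omega \<and> (\<forall>K\<in>F_omega. prim_rec_reducible K L)"

end

theory Submission imports Defs "HOL-Library.Nat_Bijection" begin

text \<open>Upper bound. Letters do not constrain a run, and a step only asks which registers
  contain the current datum. So a configuration matters only through its state and, for every
  nonempty set \<open>X\<close> of registers, the number of data lying in exactly the registers of
  \<open>X\<close> (the data with \<open>region f d = X\<close>). Larger numbers never hurt: a
  configuration simulates every configuration that it dominates (\<open>accepts_mono\<close>). Take
  a shortest accepting run and read it backwards. Before the last \<open>j\<close> steps only data
  read in these steps matter (\<open>accepts_restrict\<close>), so the vectors of numbers,
  restricted to such data, are bounded by \<open>j\<close>. If the vector \<open>i\<close> steps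
  before the end were dominated by that \<open>j\<close> steps before the end, with
  \<open>i < j\<close> and equal states, the run could be shortened. Hence the vectors form a
  controlled bad sequence for the product order in fewer than \<open>2 ^ card R\<close> dimensions,
  where \<open>R\<close> is the set of registers, and \<open>bad_sequence_bound\<close> limits its
  length by a level of the hierarchy that is linear in the dimension. A shortest run is therefore no
  longer than F_omega at a primitive recursive argument (\<open>short_accepting_run\<close>).

  For runs of length at most \<open>n\<close> over \<open>n\<close> data, emptiness is a primitive
  recursive predicate of the code and \<open>n\<close> (\<open>prb_bounded_empty\<close>). So is the
  comparison of F_omega with a bound (\<open>prb_fast_omega_le\<close>), although F_omega is not
  primitive recursive. A Turing machine finds a sufficient \<open>n\<close> by search and then
  evaluates the predicate (\<open>search_machine\<close>). The overhead is bounded by a fixed level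
  of the hierarchy and is absorbed by the argument of F_omega (\<open>fast_fast_omega\<close>).

  Lower bound. A Turing machine with running time F_omega of a primitive recursive function is
  simulated by a counter program. Automata can count with differences of sets: such counters can be
  incremented, decremented, copied and reset, but not tested for zero
  (\<open>net_accepts_iff\<close>). Zero tests are replaced by resets, and cheating is detected by a
  conservation law. The net unfolds \<open>fast K 1\<close> into a budget, moves units between the
  budget and the counters of the program, and finally folds the budget into \<open>fast K 1\<close>
  again. No step increases a potential, and resetting a nonzero counter at a zero test decreases it.
  So recovering the initial value certifies an honest computation (\<open>budget_net_sound\<close>),
  and an honest computation within the budget succeeds (\<open>budget_net_complete\<close>). Since
  emptiness means the absence of accepting runs, the program accepts the complement of the
  language.\<close>

section \<open>The fast-growing hierarchy\<close>

lemma funpow_infl: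
  fixes f :: "nat \<Rightarrow> nat"
  assumes "\<And>x. x \<le> f x"
  shows "x \<le> (f ^^ n) x"
  by (induction n) (use assms order_trans in auto)

lemma funpow_mono_iter:
  fixes f :: "nat \<Rightarrow> nat"
  assumes "\<And>x. x \<le> f x" and "m \<le> n"
  shows "(f ^^ m) x \<le> (f ^^ n) x"
  using funpow_infl[of f "(f ^^ m) x" "n - m"] assms
  by (metis add.commute comp_apply funpow_add le_add_diff_inverse)

lemma funpow_strict_mono: "strict_mono f \<Longrightarrow> strict_mono (f ^^ n)" for f :: "nat \<Rightarrow> nat"
  by (induction n) (auto simp: strict_mono_def)

lemma fast_gt: "x < fast k x"
proof (induction k arbitrary: x)
  case (Suc k)
  have "x < fast k x" by (rule Suc)
  also have "\<dots> \<le> (fast k ^^ x) (fast k x)"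
    by (rule funpow_infl) (simp add: Suc less_imp_le)
  also have "\<dots> = fast (Suc k) x" by (simp add: funpow_swap1)
  finally show ?case .
qed simp

lemma fast_ge: "x \<le> fast k x"
  using fast_gt[of x k] by simp

lemma strict_mono_fast: "strict_mono (fast k)"
proof (induction k)
  case (Suc k)
  have "fast (Suc k) x < fast (Suc k) (Suc x)" for x
  proof -
    have "(fast k ^^ Suc x) x < (fast k ^^ Suc x) (Suc x)"
      using funpow_strict_mono[OF Suc] by (simp add: strict_mono_less del: funpow.simps)
    also have "\<dots> \<le> (fast k ^^ Suc (Suc x)) (Suc x)"
      by (rule funpow_mono_iter) (simp_all add: fast_ge)
    finally show ?thesis by simp
  qed
  then show ?case by (rule strict_mono_Suc_iff[THEN iffD2, rule_format])
qed (simp add: strict_mono_def)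

lemma fast_le_Suc: "fast k x \<le> fast (Suc k) x"
  using funpow_mono_iter[of "fast k" 1 "x + 1" x] by (simp add: fast_ge)

lemma fast_mono: "k \<le> l \<Longrightarrow> x \<le> y \<Longrightarrow> fast k x \<le> fast l y"
proof -
  assume "k \<le> l" "x \<le> y"
  have "fast k x \<le> fast l x"
    using \<open>k \<le> l\<close> by (rule lift_Suc_mono_le[rotated]) (rule fast_le_Suc)
  also have "\<dots> \<le> fast l y"
    using strict_mono_fast \<open>x \<le> y\<close> by (simp add: strict_mono_less_eq)
  finally show ?thesis .
qed

lemma funpow_fast_mono: "m \<le> n \<Longrightarrow> x \<le> y \<Longrightarrow> (fast k ^^ m) x \<le> (fast k ^^ n) y"
proof -
  assume "m \<le> n" "x \<le> y"
  have "(fast k ^^ m) x \<le> (fast k ^^ n) x"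
    using \<open>m \<le> n\<close> by (rule funpow_mono_iter[rotated]) (rule fast_ge)
  also have "\<dots> \<le> (fast k ^^ n) y"
    using funpow_strict_mono[OF strict_mono_fast] \<open>x \<le> y\<close> by (simp add: strict_mono_less_eq)
  finally show ?thesis .
qed

lemma funpow_fast_le: "n \<le> x + 1 \<Longrightarrow> (fast k ^^ n) x \<le> fast (Suc k) x"
  using funpow_fast_mono[of n "x + 1" x x k] by simp

text \<open>The next level iterates \<open>x + 1\<close> times, hence at least twice for positive
  \<open>x\<close>. This absorbs compositions throughout; it fails at 0, which every level sends to
  1.\<close>

lemma fast_fast: "1 \<le> x \<Longrightarrow> fast k (fast k x) \<le> fast (Suc k) x"
  using funpow_fast_le[of 2 x k] by (simp add: numeral_2_eq_2)

lemma fast_ge_add: "1 \<le> x \<Longrightarrow> x + k \<le> fast k x"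
proof (induction k)
  case (Suc k)
  have "x + k + 1 \<le> fast k x + 1" using Suc by simp
  also have "\<dots> \<le> fast k (fast k x)" using fast_gt[of "fast k x" k] by simp
  also have "\<dots> \<le> fast (Suc k) x" using Suc by (simp only: fast_fast)
  finally show ?case by simp
qed simp

lemma fast_one: "fast 1 x = 2 * x + 1"
proof -
  have "(fast 0 ^^ n) x = x + n" for n by (induction n) auto
  then show ?thesis by simp
qed

text \<open>The closed form of level 2 yields the bounds on squares and exponentials, and on the
  quadratic expressions in \<open>bad_bound_fast\<close>.\<close>

lemma fast_two: "fast 2 x + 1 = 2 ^ (x + 1) * (x + 1)"
proof -
  have "(fast 1 ^^ n) x + 1 = 2 ^ n * (x + 1)" for n
    by (induction n) (simp_all add: fast_one del: fast.simps One_nat_def)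
  from this[of "x + 1"] show ?thesis by (simp add: numeral_2_eq_2)
qed

declare fast.simps [simp del]

text \<open>Functions bounded by one level of the hierarchy; the shift avoids the fixed behaviour at 0.\<close>

definition majorized :: "(nat \<Rightarrow> nat) \<Rightarrow> bool" where
  "majorized h \<longleftrightarrow> (\<exists>k. \<forall>x. h x \<le> fast k (x + 1))"

lemma majorized_mono: "majorized g \<Longrightarrow> (\<And>x. h x \<le> g x) \<Longrightarrow> majorized h"
  unfolding majorized_def using order_trans by blast

lemma majorized_const: "majorized (\<lambda>_. c)"
  unfolding majorized_def using fast_ge_add by (metis add_leE le_add2)

lemma majorized_id: "majorized (\<lambda>x. x)"
  unfolding majorized_def using fast_ge by (metis add_leE)

text \<open>One extra level absorbs the shift of the inner argument, and another one the
  composition.\<close>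

lemma majorized_comp:
  assumes "majorized f" "majorized g"
  shows "majorized (\<lambda>x. f (g x))"
proof -
  obtain k l where k: "\<And>x. f x \<le> fast k (x + 1)" and l: "\<And>x. g x \<le> fast l (x + 1)"
    using assms unfolding majorized_def by blast
  define m where "m = max k l"
  have "f (g x) \<le> fast (Suc (Suc m)) (x + 1)" for x
  proof -
    have "g x + 1 \<le> fast m (x + 1) + 1"
      using l[of x] fast_mono[of l m "x+1" "x+1"] by (simp add: m_def)
    also have "\<dots> \<le> fast m (fast m (x + 1))" using fast_gt[of "fast m (x+1)" m] by simp
    also have "\<dots> \<le> fast (Suc m) (x + 1)" by (rule fast_fast) simp
    finally have g: "g x + 1 \<le> fast (Suc m) (x + 1)" .
    have "f (g x) \<le> fast k (g x + 1)" by (rule k)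
    also have "\<dots> \<le> fast (Suc m) (fast (Suc m) (x + 1))"
      using g by (intro fast_mono) (simp_all add: m_def)
    also have "\<dots> \<le> fast (Suc (Suc m)) (x + 1)" by (rule fast_fast) simp
    finally show ?thesis .
  qed
  then show ?thesis unfolding majorized_def by blast
qed

lemma majorized_square: "majorized (\<lambda>x. x * x)"
proof -
  have "x * x \<le> fast 2 (x + 1)" for x
  proof -
    have "x * x + 1 \<le> (x + 2) * (x + 2)" by simp
    also have "\<dots> \<le> 2 ^ (x + 2) * (x + 2)" using less_exp[of "x + 2"] by (intro mult_right_mono) (simp_all only: less_imp_le le0)
    also have "\<dots> = fast 2 (x + 1) + 1" by (subst fast_two) (simp add: numeral_2_eq_2)
    finally show ?thesis by simp
  qed
  then show ?thesis unfolding majorized_def by blast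
qed

lemma majorized_exp: "majorized (\<lambda>x. 2 ^ x)"
proof -
  have "2 ^ x \<le> fast 2 (x + 1)" for x
  proof -
    have "2 ^ x + 1 \<le> (2::nat) ^ (x + 2) * (x + 2)" proof -
      have "(2::nat) ^ x + 1 \<le> 2 ^ x * 8" using one_le_power[of "2::nat" x] by linarith
      also have "\<dots> \<le> 2 ^ x * (4 * (x + 2))" by (intro mult_left_mono) simp_all
      also have "\<dots> = 2 ^ (x + 2) * (x + 2)" by (simp add: power_add algebra_simps)
      finally show ?thesis .
    qed
    also have "\<dots> = fast 2 (x + 1) + 1" by (subst fast_two) (simp add: numeral_2_eq_2)
    finally show ?thesis by simp
  qed
  then show ?thesis unfolding majorized_def by blast
qed

lemma majorized_max:
  assumes "majorized f" "majorized g"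
  shows "majorized (\<lambda>x. max (f x) (g x))"
proof -
  obtain k l where k: "\<And>x. f x \<le> fast k (x + 1)" and l: "\<And>x. g x \<le> fast l (x + 1)"
    using assms unfolding majorized_def by blast
  have "max (f x) (g x) \<le> fast (max k l) (x + 1)" for x
    using k[of x] l[of x] fast_mono[of k "max k l" "x+1" "x+1"] fast_mono[of l "max k l" "x+1" "x+1"]
    by simp
  then show ?thesis unfolding majorized_def by blast
qed

lemma majorized_add:
  assumes "majorized f" "majorized g"
  shows "majorized (\<lambda>x. f x + g x)"
proof -
  have "majorized (\<lambda>x. 2 * x + 1)"
    unfolding majorized_def using fast_one by (metis fast_mono le_add1 order_refl)
  from majorized_comp[OF this majorized_max[OF assms]] show ?thesis
    by (rule majorized_mono) simp
qed

lemma majorized_mult: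
  assumes "majorized f" "majorized g"
  shows "majorized (\<lambda>x. f x * g x)"
  using majorized_comp[OF majorized_square majorized_max[OF assms]]
  by (rule majorized_mono) (simp add: mult_le_mono)

lemma majorized_Suc: "majorized f \<Longrightarrow> majorized (\<lambda>x. Suc (f x))"
  using majorized_add[OF _ majorized_const[of 1]] by fastforce

lemma majorized_power:
  assumes "majorized f" "majorized g"
  shows "majorized (\<lambda>x. f x ^ g x)"
proof -
  have "f x ^ g x \<le> 2 ^ (f x * g x)" for x
    by (simp add: power_mult less_imp_le power_mono)
  then show ?thesis
    using majorized_comp[OF majorized_exp majorized_mult[OF assms]] by (rule majorized_mono[rotated])
qed

lemma majorized_fast: "majorized (\<lambda>x. fast k x)"
  unfolding majorized_def by (meson fast_mono le_add1 order_refl)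

lemma majorized_fast_comp: "majorized f \<Longrightarrow> majorized (\<lambda>x. fast k (f x))"
  by (rule majorized_comp[OF majorized_fast])

text \<open>Iterating a function of level \<open>k\<close> as often as a majorized function says
  costs two levels. This is what keeps primitive recursion within the hierarchy, see
  \<open>computable_rec\<close>.\<close>

lemma majorized_iter:
  assumes "majorized h" "majorized g"
  shows "majorized (\<lambda>x. (h ^^ g x) x)"
proof -
  obtain k where k: "\<And>x. h x \<le> fast k (x + 1)"
    using assms unfolding majorized_def by blast
  \<comment> \<open>After adding 1, one application of \<open>h\<close> costs one application of
    level \<open>Suc k\<close>, so that the shift does not accumulate along the iteration.\<close>
  have *: "(h ^^ n) x + 1 \<le> (fast (Suc k) ^^ n) (x + 1)" for n x
  proof (induction n)
    case (Suc n)
    have "(h ^^ Suc n) x + 1 \<le> fast k ((h ^^ n) x + 1) + 1" using k by simp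
    also have "\<dots> \<le> fast k (fast k ((h ^^ n) x + 1))"
      using fast_gt[of "fast k ((h ^^ n) x + 1)" k] by simp
    also have "\<dots> \<le> fast (Suc k) ((h ^^ n) x + 1)" by (rule fast_fast) simp
    also have "\<dots> \<le> fast (Suc k) ((fast (Suc k) ^^ n) (x + 1))" by (rule fast_mono) (use Suc in \<open>simp_all del: fast.simps\<close>)
    finally show ?case by (simp del: fast.simps)
  qed simp
  have "(h ^^ g x) x \<le> fast (Suc (Suc k)) (max x (g x) + 1)" for x
  proof -
    have "(h ^^ g x) x \<le> (fast (Suc k) ^^ g x) (x + 1)"
      using *[of "g x" x] by simp
    also have "\<dots> \<le> (fast (Suc k) ^^ g x) (max x (g x) + 1)"
      by (intro funpow_fast_mono) simp_all
    also have "\<dots> \<le> fast (Suc (Suc k)) (max x (g x) + 1)"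
      by (intro funpow_fast_le) simp
    finally show ?thesis .
  qed
  moreover have "majorized (\<lambda>x. fast (Suc (Suc k)) (max x (g x) + 1))"
    by (intro majorized_fast_comp majorized_add majorized_max majorized_id majorized_const assms)
  ultimately show ?thesis by (rule majorized_mono[rotated])
qed

lemmas majorized_intros = majorized_const majorized_id majorized_add majorized_mult majorized_Suc
  majorized_max majorized_power majorized_fast_comp

section \<open>The diagonal function F_omega and the absorption of overhead\<close>

lemma fast_omega_mono: "x \<le> y \<Longrightarrow> fast_omega x \<le> fast_omega y"
  unfolding fast_omega_def by (rule fast_mono) auto

lemma fast_omega_ge: "x \<le> fast_omega x"
  unfolding fast_omega_def by (rule fast_ge)

text \<open>A larger argument also raises the level used by the diagonal. So a fixed level applied
  after F_omega costs only an additive constant in the argument, and overhead of a fixed level does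
  not leave the complexity class.\<close>

lemma fast_fast_omega: "1 \<le> x \<Longrightarrow> fast k (fast_omega x) \<le> fast_omega (x + k + 1)"
proof -
  assume x: "1 \<le> x"
  have "fast k (fast (x + 1) x) \<le> fast (x + k + 1) (fast (x + k + 1) x)"
    by (intro fast_mono) simp_all
  also have "\<dots> \<le> fast (Suc (x + k + 1)) x" using x by (rule fast_fast)
  also have "\<dots> \<le> fast (x + k + 1 + 1) (x + k + 1)" by (intro fast_mono) simp_all
  finally show ?thesis unfolding fast_omega_def .
qed

section \<open>A calculus of primitive recursive functions\<close>

section \<open>Primitive recursion over environments\<close>

text \<open>Terms with free variables numbered from 0 are functions of an environment.\<close>

definition pr :: "((nat \<Rightarrow> nat) \<Rightarrow> nat) \<Rightarrow> bool" where
  "pr F \<longleftrightarrow> (\<exists>f n. prim_rec f \<and> (\<forall>e. F e = f (map e [0..<n])))"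

abbreviation prb :: "((nat \<Rightarrow> nat) \<Rightarrow> bool) \<Rightarrow> bool" where
  "prb P \<equiv> pr (\<lambda>e. of_bool (P e))"

text \<open>Composition with projections ignores further arguments. Large arities are all available,
  so that several functions can be brought to a common one.\<close>

lemma pr_eventually:
  assumes "pr F"
  shows "\<exists>m. \<forall>n\<ge>m. \<exists>f. prim_rec f \<and> (\<forall>e. F e = f (map e [0..<n]))"
proof -
  obtain f m where f: "prim_rec f" "\<And>e. F e = f (map e [0..<m])"
    using assms unfolding pr_def by blast
  show ?thesis
  proof (intro exI[of _ m] allI impI)
    fix n assume "m \<le> n"
    let ?ps = "map (\<lambda>i xs :: nat list. if i < length xs then xs ! i else 0) [0..<m]"
    have "prim_rec (\<lambda>xs. f (map (\<lambda>p. p xs) ?ps))"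
      by (rule prim_rec.comp[OF f(1)]) (auto intro: prim_rec.proj)
    moreover have "F e = f (map (\<lambda>p. p (map e [0..<n])) ?ps)" for e
      using \<open>m \<le> n\<close> unfolding f(2) by (intro arg_cong[of _ _ f]) (simp add: o_def)
    ultimately show "\<exists>f. prim_rec f \<and> (\<forall>e. F e = f (map e [0..<n]))" by blast
  qed
qed

lemma pr_app:
  assumes "prim_rec g" "\<forall>F\<in>set Fs. pr F"
  shows "pr (\<lambda>e. g (map (\<lambda>F. F e) Fs))"
proof -
  \<comment> \<open>\<open>ok\<close> says that all functions of the list are represented with one
    arity \<open>n\<close>; the induction takes the maximum of the thresholds.\<close>
  define ok where "ok Fs n fs \<longleftrightarrow> (\<forall>f\<in>set fs. prim_rec f) \<and>
      (\<forall>e. map (\<lambda>F. F e) Fs = map (\<lambda>f. f (map e [0..<n])) fs)"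
    for Fs :: "((nat \<Rightarrow> nat) \<Rightarrow> nat) list" and n :: nat and fs
  have "\<exists>m. \<forall>n\<ge>m. \<exists>fs. ok Fs n fs"
    using assms(2)
  proof (induction Fs)
    case Nil
    have "ok [] n []" for n by (simp add: ok_def)
    then show ?case by blast
  next
    case (Cons F Fs)
    then obtain m where m: "\<And>n. m \<le> n \<Longrightarrow> \<exists>fs. ok Fs n fs" by auto
    obtain k where k: "\<forall>n\<ge>k. \<exists>f. prim_rec f \<and> (\<forall>e. F e = f (map e [0..<n]))"
      using pr_eventually[of F] Cons.prems by auto
    have "\<exists>fs. ok (F # Fs) n fs" if n: "max m k \<le> n" for n
    proof -
      obtain fs where "ok Fs n fs" using m[of n] n by auto
      moreover obtain f where "prim_rec f" "\<forall>e. F e = f (map e [0..<n])"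
        using k n by auto
      ultimately have "ok (F # Fs) n (f # fs)" by (simp add: ok_def)
      then show ?thesis by blast
    qed
    then show ?case by blast
  qed
  then obtain m fs where "ok Fs m fs" by blast
  then have fs: "\<forall>f\<in>set fs. prim_rec f"
    "\<And>e. map (\<lambda>F. F e) Fs = map (\<lambda>f. f (map e [0..<m])) fs" by (auto simp: ok_def)
  have "prim_rec (\<lambda>xs. g (map (\<lambda>f. f xs) fs))"
    by (rule prim_rec.comp[OF assms(1) fs(1)])
  moreover have "g (map (\<lambda>F. F e) Fs) = (\<lambda>xs. g (map (\<lambda>f. f xs) fs)) (map e [0..<m])" for e
    by (simp only: fs(2))
  ultimately show ?thesis unfolding pr_def by blast
qed

lemma pr_cong: "(\<And>e. F e = G e) \<Longrightarrow> pr G \<Longrightarrow> pr F"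
proof -
  assume "\<And>e. F e = G e" "pr G"
  then have "F = G" by (intro ext)
  with \<open>pr G\<close> show ?thesis by simp
qed

text \<open>Only finitely many variables are read, so that a substitution for all variables at once
  is a finite composition.\<close>

lemma pr_subst:
  assumes "pr F" "\<And>i. pr (G i)"
  shows "pr (\<lambda>e. F (\<lambda>i. G i e))"
proof -
  obtain f n where f: "prim_rec f" "\<And>e. F e = f (map e [0..<n])"
    using assms unfolding pr_def by blast
  have "pr (\<lambda>e. f (map (\<lambda>F. F e) (map G [0..<n])))"
    by (rule pr_app[OF f(1)]) (auto intro: assms)
  then show ?thesis by (simp add: f(2) o_def)
qed

lemma pr_var: "pr (\<lambda>e. e i)"
  unfolding pr_def
  by (intro exI[of _ "\<lambda>xs. if i < length xs then xs ! i else 0"] exI[of _ "Suc i"] conjI prim_rec.proj)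
    (simp del: upt_Suc)

lemma pr_zero: "pr (\<lambda>_. 0)"
  unfolding pr_def using prim_rec.zero by auto

lemma pr_Suc: "pr a \<Longrightarrow> pr (\<lambda>e. Suc (a e))"
  using pr_app[OF prim_rec.succ, of "[a]"] by simp

lemma pr_const: "pr (\<lambda>_. c)"
  by (induction c) (auto intro: pr_zero pr_Suc)

text \<open>With these rules, closure under an operation needs to be proved only for variables as
  arguments.\<close>

lemma pr_app1: "pr (\<lambda>e. f (e 0)) \<Longrightarrow> pr a \<Longrightarrow> pr (\<lambda>e. f (a e))"
  using pr_subst[of "\<lambda>e. f (e 0)" "\<lambda>_. a"] by simp

lemma pr_app2: "pr (\<lambda>e. f (e 0) (e 1)) \<Longrightarrow> pr a \<Longrightarrow> pr b \<Longrightarrow> pr (\<lambda>e. f (a e) (b e))"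
  using pr_subst[of "\<lambda>e. f (e 0) (e 1)" "\<lambda>i. if i = 0 then a else b"] by simp

lemma pr_app3:
  "pr (\<lambda>e. f (e 0) (e 1) (e 2)) \<Longrightarrow> pr a \<Longrightarrow> pr b \<Longrightarrow> pr c \<Longrightarrow> pr (\<lambda>e. f (a e) (b e) (c e))"
  using pr_subst[of "\<lambda>e. f (e 0) (e 1) (e 2)" "\<lambda>i. if i = 0 then a else if i = 1 then b else c"]
  by simp

text \<open>In the premise for \<open>g\<close>, variable 0 is the previous value, variable 1 the
  index, and the environment is shifted by two. This is the argument order of
  \<open>prim_rec.rec\<close>.\<close>

lemma pr_rec:
  assumes "pr f" "pr (\<lambda>e. g (\<lambda>j. e (Suc (Suc j))) (e 1) (e 0))" "pr n"
  shows "pr (\<lambda>e. rec_nat (f e) (\<lambda>k r. g e k r) (n e))"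
proof -
  obtain a where a: "\<forall>n\<ge>a. \<exists>f'. prim_rec f' \<and> (\<forall>e. f e = f' (map e [0..<n]))"
    using pr_eventually[OF assms(1)] ..
  obtain b where b: "\<forall>n\<ge>b. \<exists>g'. prim_rec g' \<and>
      (\<forall>e. g (\<lambda>j. e (Suc (Suc j))) (e 1) (e 0) = g' (map e [0..<n]))"
    using pr_eventually[OF assms(2)] ..
  define m where "m = max a b"
  obtain f' where f': "prim_rec f'" "\<And>e. f e = f' (map e [0..<m])"
    using a[rule_format, of m] by (auto simp: m_def)
  obtain g' where g': "prim_rec g'"
    "\<And>e. g (\<lambda>j. e (Suc (Suc j))) (e 1) (e 0) = g' (map e [0..<Suc (Suc m)])"
    using b[rule_format, of "Suc (Suc m)"] unfolding m_def by (meson le_SucI max.cobounded2)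
  \<comment> \<open>The representation of \<open>g\<close> is read at the environment in which the
    previous value and the index stand before \<open>e\<close>.\<close>
  have g: "g e k r = g' (r # k # map e [0..<m])" for e k r
    using g'(2)[of "case_nat r (case_nat k e)"]
    by (simp add: upt_conv_Cons map_Suc_upt[symmetric] o_def del: upt_Suc)
  let ?h = "\<lambda>xs. case xs of [] \<Rightarrow> f' [] | n # ys \<Rightarrow> rec_nat (f' ys) (\<lambda>k r. g' (r # k # ys)) n"
  have "pr (\<lambda>e. ?h (map (\<lambda>F. F e) (n # map (\<lambda>i e. e i) [0..<m])))"
    by (rule pr_app[OF prim_rec.rec[OF f'(1) g'(1)]]) (auto intro: pr_var assms)
  then show ?thesis by (simp add: f'(2) g o_def)
qed

section \<open>Arithmetic, tests and bounded operators\<close>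

lemma pr_add: "pr a \<Longrightarrow> pr b \<Longrightarrow> pr (\<lambda>e. a e + b e)"
proof (rule pr_app2[of "(+)"])
  have "x + y = rec_nat x (\<lambda>k r. Suc r) y" for x y :: nat by (induction y) auto
  then show "pr (\<lambda>e. e 0 + e 1)" by (simp only:) (intro pr_rec pr_Suc pr_var)
qed

lemma pr_pred: "pr a \<Longrightarrow> pr (\<lambda>e. a e - 1)"
proof (rule pr_app1[of "\<lambda>x. x - 1"])
  have "x - 1 = rec_nat 0 (\<lambda>k r. k) x" for x :: nat by (cases x) auto
  then show "pr (\<lambda>e. e 0 - 1)" by (simp only:) (intro pr_rec pr_zero pr_var)
qed

lemma pr_diff: "pr a \<Longrightarrow> pr b \<Longrightarrow> pr (\<lambda>e. a e - b e)"
proof (rule pr_app2[of "(-)"])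
  have "x - y = rec_nat x (\<lambda>k r. r - 1) y" for x y :: nat by (induction y) auto
  then show "pr (\<lambda>e. e 0 - e 1)" by (rule pr_cong) (intro pr_rec pr_pred pr_var)
qed

lemma pr_mult: "pr a \<Longrightarrow> pr b \<Longrightarrow> pr (\<lambda>e. a e * b e)"
proof (rule pr_app2[of "(*)"])
  have "x * y = rec_nat 0 (\<lambda>k r. r + x) y" for x y :: nat by (induction y) auto
  then show "pr (\<lambda>e. e 0 * e 1)" by (simp only:) (intro pr_rec pr_add pr_zero pr_var)
qed

lemma pr_power: "pr a \<Longrightarrow> pr b \<Longrightarrow> pr (\<lambda>e. a e ^ b e)"
proof (rule pr_app2[of "(^)"])
  have "x ^ y = rec_nat 1 (\<lambda>k r. x * r) y" for x y :: nat by (induction y) auto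
  then show "pr (\<lambda>e. e 0 ^ e 1)" by (simp only:) (intro pr_rec pr_mult pr_const pr_var)
qed

lemma prb_zero: "pr a \<Longrightarrow> prb (\<lambda>e. a e = 0)"
proof (rule pr_app1[of "\<lambda>x. of_bool (x = 0)"])
  have "of_bool (x = 0) = 1 - x" for x :: nat by simp
  then show "prb (\<lambda>e. e 0 = 0)" by (simp only:) (intro pr_diff pr_const pr_var)
qed

lemma prb_le: "pr a \<Longrightarrow> pr b \<Longrightarrow> prb (\<lambda>e. a e \<le> b e)"
proof -
  assume "pr a" "pr b"
  then have "prb (\<lambda>e. a e - b e = 0)" by (intro prb_zero pr_diff)
  then show ?thesis by simp
qed

lemma prb_not: "prb P \<Longrightarrow> prb (\<lambda>e. \<not> P e)"
  using prb_zero[of "\<lambda>e. of_bool (P e)"] by simp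

lemma prb_conj: "prb P \<Longrightarrow> prb Q \<Longrightarrow> prb (\<lambda>e. P e \<and> Q e)"
  by (rule pr_cong[OF _ pr_mult[of "\<lambda>e. of_bool (P e)" "\<lambda>e. of_bool (Q e)"]]) auto

lemma prb_disj: "prb P \<Longrightarrow> prb Q \<Longrightarrow> prb (\<lambda>e. P e \<or> Q e)"
  by (rule pr_cong[OF _ prb_not[OF prb_conj[OF prb_not[of P] prb_not[of Q]]]]) auto

lemma prb_imp: "prb P \<Longrightarrow> prb Q \<Longrightarrow> prb (\<lambda>e. P e \<longrightarrow> Q e)"
  by (rule pr_cong[OF _ prb_disj[OF prb_not[of P], of Q]]) auto

lemma prb_less: "pr a \<Longrightarrow> pr b \<Longrightarrow> prb (\<lambda>e. a e < b e)"
  by (rule pr_cong[OF _ prb_not[OF prb_le[of b a]]]) auto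

lemma prb_eq: "pr a \<Longrightarrow> pr b \<Longrightarrow> prb (\<lambda>e. a e = b e)"
  by (rule pr_cong[OF _ prb_conj[OF prb_le[of a b] prb_le[of b a]]]) auto

lemma prb_iff: "prb P \<Longrightarrow> prb Q \<Longrightarrow> prb (\<lambda>e. P e \<longleftrightarrow> Q e)"
  by (rule pr_cong[OF _ prb_eq[of "\<lambda>e. of_bool (P e)" "\<lambda>e. of_bool (Q e)"]]) auto

lemma prb_const: "prb (\<lambda>_. c)"
  by (rule pr_const)

lemma pr_if: "prb P \<Longrightarrow> pr a \<Longrightarrow> pr b \<Longrightarrow> pr (\<lambda>e. if P e then a e else b e)"
  by (rule pr_cong[OF _ pr_add[OF pr_mult[of "\<lambda>e. of_bool (P e)" a] pr_mult[OF prb_not[of P], of b]]])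
    auto

lemma prb_if: "prb P \<Longrightarrow> prb A \<Longrightarrow> prb B \<Longrightarrow> prb (\<lambda>e. if P e then A e else B e)"
  by (rule pr_cong[OF _ prb_disj[OF prb_conj[of P A] prb_conj[OF prb_not[of P], of B]]]) auto

lemma prb_mem: "finite S \<Longrightarrow> pr a \<Longrightarrow> prb (\<lambda>e. a e \<in> S)"
proof (induction S rule: finite_induct)
  case empty
  show ?case using prb_const[of False] by simp
next
  case (insert x S)
  then have "prb (\<lambda>e. a e = x \<or> a e \<in> S)" by (intro prb_disj prb_eq pr_const)
  then show ?case by (rule pr_cong[rotated]) simp
qed

text \<open>Every eventually constant function is primitive recursive, as a finite case distinction.
  This is used for the transition tables of fixed machines and for the instructions of fixed
  programs.\<close>

lemma pr_finite_support: "(\<And>n. N \<le> n \<Longrightarrow> f n = c) \<Longrightarrow> pr a \<Longrightarrow> pr (\<lambda>e. f (a e))"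
proof (induction N arbitrary: f)
  case 0
  then show ?case by (simp add: pr_const)
next
  case (Suc N)
  have "pr (\<lambda>e. (f(N := c)) (a e))"
  proof (rule Suc.IH)
    show "(f(N := c)) n = c" if "N \<le> n" for n
      using Suc.prems(1)[of n] that by (cases "n = N") auto
  qed fact
  then have "pr (\<lambda>e. if a e = N then f N else (f(N := c)) (a e))"
    by (intro pr_if prb_eq pr_const Suc.prems)
  moreover have "(if a e = N then f N else (f(N := c)) (a e)) = f (a e)" for e by simp
  ultimately show ?case by simp
qed

lemma pr_shift2: "pr f \<Longrightarrow> pr (\<lambda>e. f (\<lambda>j. e (Suc (Suc j))))"
  by (rule pr_subst) (auto intro: pr_var)

lemma pr_shift: "pr f \<Longrightarrow> pr (\<lambda>e. f (\<lambda>j. e (Suc j)))"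
  by (rule pr_subst) (auto intro: pr_var)

text \<open>In the premises of the binding operators, variable 0 is the bound one.\<close>

lemma pr_bind2:
  assumes "pr (\<lambda>e. g (\<lambda>j. e (Suc j)) (e 0))"
  shows "pr (\<lambda>e. g (\<lambda>j. e (Suc (Suc j))) (e 1))"
proof -
  have "pr (\<lambda>e. if i = 0 then e 1 else e (Suc i))" for i
    by (cases i) (simp_all add: pr_var)
  from pr_subst[OF assms, of "\<lambda>i e. if i = 0 then e 1 else e (Suc i)", OF this] show ?thesis by simp
qed

lemma prb_ex:
  assumes "pr b" "prb (\<lambda>e. P (\<lambda>j. e (Suc j)) (e 0))"
  shows "prb (\<lambda>e. \<exists>i<b e. P e i)"
proof -
  have *: "of_bool (\<exists>i<n. P e i) = rec_nat (0::nat) (\<lambda>k r. if P e k then 1 else r) n" for e n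
  proof (induction n)
    case (Suc n)
    have "(\<exists>i<Suc n. P e i) \<longleftrightarrow> P e n \<or> (\<exists>i<n. P e i)" by (auto simp: less_Suc_eq)
    then show ?case
      by (cases "P e n") (simp_all add: Suc[symmetric] del: One_nat_def)
  qed simp
  show ?thesis unfolding *
    by (intro pr_rec pr_if pr_zero pr_var pr_const assms(1) pr_bind2[of "\<lambda>e i. of_bool (P e i)"] assms(2))
qed

lemma prb_all:
  assumes "pr b" "prb (\<lambda>e. P (\<lambda>j. e (Suc j)) (e 0))"
  shows "prb (\<lambda>e. \<forall>i<b e. P e i)"
  by (rule pr_cong[OF _ prb_not[OF prb_ex[OF assms(1) prb_not[OF assms(2)]]]]) auto

lemma pr_sum:
  assumes "pr b" "pr (\<lambda>e. f (\<lambda>j. e (Suc j)) (e 0))"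
  shows "pr (\<lambda>e. \<Sum>i<b e. f e i)"
proof -
  have *: "(\<Sum>i<n. f e i) = rec_nat 0 (\<lambda>k r. r + f e k) n" for e n
    by (induction n) (auto simp: less_Suc_eq)
  show ?thesis unfolding *
    by (intro pr_rec pr_add pr_zero pr_var assms(1) pr_bind2[of f] assms(2))
qed

text \<open>Bounded minimisation with default value \<open>n\<close>; the second disjunct makes a
  least element exist.\<close>

definition bounded_least :: "(nat \<Rightarrow> bool) \<Rightarrow> nat \<Rightarrow> nat" where
  "bounded_least P n = (LEAST i. P i \<or> i = n)"

lemma bounded_least_eqI: "P i \<Longrightarrow> i \<le> n \<Longrightarrow> (\<And>j. j < i \<Longrightarrow> \<not> P j) \<Longrightarrow> bounded_least P n = i"
  unfolding bounded_least_def by (rule Least_equality) (use leI in auto)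

lemma pr_bounded_least:
  assumes "pr b" "prb (\<lambda>e. P (\<lambda>j. e (Suc j)) (e 0))"
  shows "pr (\<lambda>e. bounded_least (P e) (b e))"
proof -
  \<comment> \<open>The accumulator is the current candidate: it stays once \<open>P\<close> holds
    and moves on otherwise. After \<open>n\<close> rounds, no smaller candidate satisfies
    \<open>P\<close>.\<close>
  have *: "bounded_least (P e) n = rec_nat 0 (\<lambda>k r. if P e r then r else Suc r) n" for e n
  proof -
    let ?r = "rec_nat 0 (\<lambda>k r. if P e r then r else Suc r)"
    have "?r n \<le> n \<and> (\<forall>i < ?r n. \<not> P e i) \<and> (?r n < n \<longrightarrow> P e (?r n))"
      by (induction n) (auto simp: less_Suc_eq)
    then show ?thesis
      unfolding bounded_least_def by (intro Least_equality) (auto simp: not_less[symmetric])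
  qed
  \<comment> \<open>\<open>P\<close> is applied to the accumulator, which is variable 0, so that
    only the index in variable 1 has to be skipped.\<close>
  have "prb (\<lambda>e. P (\<lambda>j. e (Suc (Suc j))) (e 0))"
  proof -
    have "pr (\<lambda>e. if i = 0 then e 0 else e (Suc i))" for i
      by (cases i) (simp_all add: pr_var)
    from pr_subst[OF assms(2), of "\<lambda>i e. if i = 0 then e 0 else e (Suc i)", OF this] show ?thesis by simp
  qed
  then show ?thesis unfolding * by (intro pr_rec pr_if pr_zero pr_Suc pr_var assms(1))
qed

lemma pr_div: "pr a \<Longrightarrow> pr b \<Longrightarrow> pr (\<lambda>e. a e div b e)"
proof (rule pr_app2[of "(div)"])
  have "x div y = (if y = 0 then 0 else bounded_least (\<lambda>q. x < (q + 1) * y) x)" for x y :: nat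
  proof (cases "y = 0")
    case False
    have "bounded_least (\<lambda>q. x < (q + 1) * y) x = x div y"
    proof (rule bounded_least_eqI)
      show "x < (x div y + 1) * y" using False by (simp add: dividend_less_div_times)
      show "\<not> x < (j + 1) * y" if "j < x div y" for j
        using that False by (metis Suc_eq_plus1 Suc_leI less_eq_div_iff_mult_less_eq neq0_conv not_less)
    qed simp
    then show ?thesis using False by simp
  qed simp
  then show "pr (\<lambda>e. e 0 div e 1)"
    by (simp only:) (intro pr_if pr_bounded_least prb_zero prb_less pr_mult pr_add pr_const pr_var)
qed

lemma pr_mod: "pr a \<Longrightarrow> pr b \<Longrightarrow> pr (\<lambda>e. a e mod b e)"
  unfolding minus_div_mult_eq_mod[symmetric] by (intro pr_diff pr_mult pr_div)

lemma pr_max: "pr a \<Longrightarrow> pr b \<Longrightarrow> pr (\<lambda>e. max (a e) (b e))"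
  unfolding max_def by (intro pr_if prb_le)

lemma pr_min: "pr a \<Longrightarrow> pr b \<Longrightarrow> pr (\<lambda>e. min (a e) (b e))"
  unfolding min_def by (intro pr_if prb_le)

lemmas pr_intros = pr_const pr_var pr_if prb_if pr_Suc pr_add pr_diff pr_mult pr_power pr_div pr_mod
  pr_max pr_min
  pr_sum pr_bounded_least prb_le prb_less prb_eq prb_iff prb_not prb_conj prb_disj prb_imp prb_ex prb_all

section \<open>Pairing, and the return to functions of one and two arguments\<close>

lemma pr_prod_encode: "pr a \<Longrightarrow> pr b \<Longrightarrow> pr (\<lambda>e. prod_encode (a e, b e))"
  unfolding prod_encode_def triangle_def by (simp del: One_nat_def) (intro pr_intros)

text \<open>The components of a pair are at most its code, so that decoding is a bounded
  search.\<close>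

lemma pr_fst_decode: "pr a \<Longrightarrow> pr (\<lambda>e. fst (prod_decode (a e)))"
proof (rule pr_app1[of "\<lambda>z. fst (prod_decode z)"])
  have "fst (prod_decode z) = bounded_least (\<lambda>x. \<exists>y<Suc z. prod_encode (x, y) = z) z" for z
  proof -
    obtain x y where xy: "prod_decode z = (x, y)" by force
    then have z: "z = prod_encode (x, y)" by (metis prod_decode_inverse)
    then show ?thesis
      using le_prod_encode_1[of x y] le_prod_encode_2[of y x]
      by (intro bounded_least_eqI[symmetric]) (auto simp: less_Suc_eq_le)
  qed
  then show "pr (\<lambda>e. fst (prod_decode (e 0)))"
    by (simp only:) (intro pr_intros pr_prod_encode)
qed

lemma pr_snd_decode: "pr a \<Longrightarrow> pr (\<lambda>e. snd (prod_decode (a e)))"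
proof (rule pr_app1[of "\<lambda>z. snd (prod_decode z)"])
  have "snd (prod_decode z) = bounded_least (\<lambda>y. \<exists>x<Suc z. prod_encode (x, y) = z) z" for z
  proof -
    obtain x y where xy: "prod_decode z = (x, y)" by force
    then have z: "z = prod_encode (x, y)" by (metis prod_decode_inverse)
    then show ?thesis
      using le_prod_encode_1[of x y] le_prod_encode_2[of y x]
      by (intro bounded_least_eqI[symmetric]) (auto simp: less_Suc_eq_le)
  qed
  then show "pr (\<lambda>e. snd (prod_decode (e 0)))"
    by (simp only:) (intro pr_intros pr_prod_encode)
qed

lemma prim_rec1_iff: "prim_rec1 p \<longleftrightarrow> pr (\<lambda>e. p (e 0))"
proof
  assume "prim_rec1 p"
  then obtain f where "prim_rec f" "\<And>n. p n = f [n]" unfolding prim_rec1_def by blast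
  then show "pr (\<lambda>e. p (e 0))" unfolding pr_def by (intro exI[of _ f] exI[of _ 1]) auto
next
  assume "pr (\<lambda>e. p (e 0))"
  from pr_eventually[OF this] obtain m where
    "\<forall>n\<ge>m. \<exists>f. prim_rec f \<and> (\<forall>e. p (e 0) = f (map e [0..<n]))" ..
  from this[rule_format, of "Suc m"] obtain f where
    f: "prim_rec f" "\<And>e. p (e 0) = f (map e [0..<Suc m])" by auto
  \<comment> \<open>The function found has \<open>Suc m\<close> arguments; all but the first are
    filled with 0 by projections that are out of range on \<open>[n]\<close>.\<close>
  have "prim_rec (\<lambda>xs. f (map (\<lambda>p. p xs) (map (\<lambda>i xs. if i < length xs then xs ! i else 0) [0..<Suc m])))"
    by (rule prim_rec.comp[OF f(1)]) (auto intro: prim_rec.proj)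
  moreover have "p n = f (map (\<lambda>p. p [n]) (map (\<lambda>i xs. if i < length xs then xs ! i else 0) [0..<Suc m]))" for n
    using f(2)[of "\<lambda>i. if i = 0 then n else 0"] by (simp add: o_def nth_Cons' cong: if_cong del: upt_Suc)
  ultimately show "prim_rec1 p" unfolding prim_rec1_def by blast
qed

lemma prE2:
  assumes "pr (\<lambda>e. f (e 0) (e 1))"
  obtains g where "prim_rec g" "\<And>x y. f x y = g [x, y]"
proof -
  obtain m where m: "\<forall>n\<ge>m. \<exists>g. prim_rec g \<and> (\<forall>e. f (e 0) (e 1) = g (map e [0..<n]))"
    using pr_eventually[OF assms] ..
  from m[rule_format, of "Suc (Suc m)"] obtain g where
    g: "prim_rec g" "\<And>e. f (e 0) (e 1) = g (map e [0..<Suc (Suc m)])" by auto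
  let ?h = "\<lambda>xs. g (map (\<lambda>p. p xs) (map (\<lambda>i xs. if i < length xs then xs ! i else 0) [0..<Suc (Suc m)]))"
  have "prim_rec ?h"
    by (rule prim_rec.comp[OF g(1)]) (auto intro: prim_rec.proj)
  moreover have "f x y = ?h [x, y]" for x y
  proof -
    have E: "map (\<lambda>i. if i = 0 then x else if i = 1 then y else 0) [0..<Suc (Suc m)] =
      map (\<lambda>p. p [x, y]) (map (\<lambda>i xs. if i < length xs then xs ! i else 0) [0..<Suc (Suc m)])"
      by (simp add: nth_Cons' del: upt_Suc)
    then show ?thesis
      unfolding E[symmetric] g(2)[symmetric] by simp
  qed
  ultimately show thesis by (rule that)
qed

section \<open>Words as numbers\<close>

abbreviation prw :: "((nat \<Rightarrow> nat) \<Rightarrow> bool list) \<Rightarrow> bool" where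
  "prw W \<equiv> pr (\<lambda>e. word_num (W e))"

text \<open>The length of the word with number \<open>x\<close>, recovered from the position of the
  leading binary digit of \<open>x + 1\<close>. The search may stop at \<open>x\<close>, because a
  word is no longer than its number.\<close>

definition num_length :: "nat \<Rightarrow> nat" where
  "num_length x = bounded_least (\<lambda>l. x + 1 < 2 ^ (l + 1)) x"

text \<open>The binary digits of \<open>word_num w + 1\<close> are a leading one and the letters of \<open>w\<close>.\<close>

lemma word_num_bounds: "2 ^ length w \<le> word_num w + 1 \<and> word_num w + 1 < 2 ^ (length w + 1)"
  by (induction w) auto

lemma length_le_word_num: "length w \<le> word_num w"
  by (induction w) auto

lemma num_length_word_num: "num_length (word_num w) = length w"
  unfolding num_length_def
proof (rule bounded_least_eqI)
  show "\<not> word_num w + 1 < 2 ^ (j + 1)" if "j < length w" for j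
  proof -
    have "(2::nat) ^ (j + 1) \<le> 2 ^ length w" using that by (intro power_increasing) auto
    then show ?thesis using word_num_bounds[of w] by linarith
  qed
qed (use word_num_bounds length_le_word_num in auto)

lemma pr_num_length: "pr a \<Longrightarrow> pr (\<lambda>e. num_length (a e))"
  by (rule pr_app1[of num_length]) (unfold num_length_def, intro pr_intros)

lemma word_num_nth: "i < length w \<Longrightarrow> w ! i \<longleftrightarrow> odd ((word_num w + 1) div 2 ^ i)"
proof (induction w arbitrary: i)
  case (Cons b w)
  have "word_num (b # w) + 1 = 2 * (word_num w + 1) + of_bool b" by simp
  then show ?case using Cons
    by (cases i) (auto simp: div_mult2_eq simp del: word_num.simps)
qed simp

text \<open>The length is expressed by the number of \<open>u\<close>, so that the right-hand side
  is a function of the two numbers only.\<close>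

lemma word_num_append: "word_num (u @ v) = word_num u + 2 ^ num_length (word_num u) * word_num v"
  unfolding num_length_word_num by (induction u) (auto simp: algebra_simps)

lemma word_num_inject: "word_num u = word_num v \<longleftrightarrow> u = v"
proof
  assume *: "word_num u = word_num v"
  then have "length u = length v" by (metis num_length_word_num)
  then show "u = v" using * word_num_nth by (intro nth_equalityI) metis+
qed simp

lemma surj_word_num: "\<exists>w. word_num w = n"
proof (induction n rule: less_induct)
  case (less n)
  show ?case
  proof (cases "n = 0")
    case False
    then obtain w where "word_num w = (n - 1) div 2" using less by force
    then have "word_num ((even n) # w) = n" using False by (auto elim!: evenE oddE)
    then show ?thesis by blast
  qed (auto intro: exI[of _ "[]"])
qed

lemma prw_append: "prw u \<Longrightarrow> prw v \<Longrightarrow> prw (\<lambda>e. u e @ v e)"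
  unfolding word_num_append by (intro pr_intros pr_num_length)

lemma prw_Nil: "prw (\<lambda>_. [])"
  by (rule pr_const)

lemma prw_if: "prb P \<Longrightarrow> prw u \<Longrightarrow> prw v \<Longrightarrow> prw (\<lambda>e. if P e then u e else v e)"
  unfolding if_distrib[of word_num] by (rule pr_if)

lemma prw_enc_nat: "pr a \<Longrightarrow> prw (\<lambda>e. enc_nat (a e))"
proof -
  \<comment> \<open>The closed form solves the recurrence in the proof below, which starts with
    value 1.\<close>
  have *: "word_num (enc_nat n) = 3 * 2 ^ n - 2" for n
  proof (induction n)
    case (Suc n)
    have "(1::nat) \<le> 2 ^ n" by simp
    moreover have "word_num (enc_nat (Suc n)) = 2 * word_num (enc_nat n) + 2" by (simp add: enc_nat_def)
    ultimately show ?case unfolding Suc power_Suc by linarith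
  qed (simp add: enc_nat_def)
  show "pr a \<Longrightarrow> ?thesis" unfolding * by (intro pr_intros)
qed

text \<open>The word grows at its right end, so that primitive recursion on the number of blocks
  suits \<open>[0..<n]\<close>; the weight of a new block is read off the number built so
  far.\<close>

lemma prw_concat_map:
  assumes "pr n" "prw (\<lambda>e. W (\<lambda>j. e (Suc j)) (e 0))"
  shows "prw (\<lambda>e. concat (map (W e) [0..<n e]))"
proof -
  have *: "word_num (concat (map (W e) [0..<n])) =
      rec_nat 0 (\<lambda>k r. r + 2 ^ num_length r * word_num (W e k)) n" for e n
    by (induction n) (simp_all add: word_num_append)
  show ?thesis unfolding *
    by (intro pr_rec pr_intros pr_num_length assms(1) pr_bind2[of "\<lambda>e i. word_num (W e i)"] assms(2))
qed

text \<open>Turns the canonical listing of a set, which the encoding uses, into a filter; its length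
  is then a bounded sum and its encoding a bounded concatenation.\<close>

lemma sorted_list_of_bounded: "sorted_list_of_set {i. i < b \<and> P i} = filter P [0..<b]"
proof -
  have "{i. i < b \<and> P i} = set (filter P [0..<b])" by auto
  then show ?thesis
    by (simp only:) (rule sorted_list_of_set.idem_if_sorted_distinct, auto simp: sorted_wrt_filter)
qed

lemma concat_map_filter: "concat (map f (filter P xs)) = concat (map (\<lambda>i. if P i then f i else []) xs)"
  by (induction xs) auto

lemma length_filter_upt: "length (filter P [0..<b]) = (\<Sum>i<b. of_bool (P i))"
  by (induction b) auto

lemma prw_enc_list_filter:
  assumes "pr b" "prb (\<lambda>e. P (\<lambda>j. e (Suc j)) (e 0))" "prw (\<lambda>e. f (\<lambda>j. e (Suc j)) (e 0))"
  shows "prw (\<lambda>e. enc_list (f e) (filter (P e) [0..<b e]))"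
  unfolding enc_list_def length_filter_upt concat_map_filter
  by (intro prw_append prw_enc_nat pr_sum prw_concat_map prw_if prw_Nil assms)

lemma prw_enc_set:
  assumes "pr b" "prb (\<lambda>e. P (\<lambda>j. e (Suc j)) (e 0))"
  shows "prw (\<lambda>e. enc_set {i. i < b e \<and> P e i})"
  unfolding enc_set_def sorted_list_of_bounded
  by (intro prw_enc_list_filter prw_enc_nat pr_var assms)

lemma prw_enc_list:
  assumes "pr n" "prw (\<lambda>e. f (\<lambda>j. e (Suc j)) (e 0))"
  shows "prw (\<lambda>e. enc_list (f e) [0..<n e])"
  unfolding enc_list_def length_upt diff_zero
  by (intro prw_append prw_enc_nat prw_concat_map assms)


section \<open>Instances as numerical data\<close>

section \<open>Automata presented by number-valued functions\<close>

text \<open>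
  A presentation \<open>\<alpha>\<close> of an automaton whose names are below \<open>b\<close> is read as follows, where
  \<open>i\<close> is the index of a transition:
  \<open>\<alpha> 0 q\<close>, \<open>\<alpha> 1 r\<close>, \<open>\<alpha> 2 q\<close>, \<open>\<alpha> 3 q\<close> tell states, registers, initial and final states,
  \<open>\<alpha> 4\<close> is the number of transitions, \<open>\<alpha> 5 i\<close>, \<open>\<alpha> 6 i\<close> and \<open>\<alpha> 10 i\<close> are source, letter
  and target, \<open>\<alpha> 7 i r\<close> and \<open>\<alpha> 8 i r\<close> tell the guards and \<open>\<alpha> 9 i r x\<close> tells the
  sources (numbered by \<open>source_num\<close>) of the update.
\<close>

type_synonym presentation = "nat \<Rightarrow> nat \<Rightarrow> nat \<Rightarrow> nat \<Rightarrow> nat"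

definition pres_set :: "nat \<Rightarrow> presentation \<Rightarrow> nat \<Rightarrow> nat set" where
  "pres_set b \<alpha> t = {q. q < b \<and> \<alpha> t q 0 0 \<noteq> 0}"

definition pres_guard :: "nat \<Rightarrow> presentation \<Rightarrow> nat \<Rightarrow> nat \<Rightarrow> nat set" where
  "pres_guard b \<alpha> t i = {r. r < b \<and> \<alpha> t i r 0 \<noteq> 0}"

text \<open>The bound is \<open>Suc b\<close> because \<open>source_num\<close> shifts the registers
  by one.\<close>

definition pres_upd :: "nat \<Rightarrow> presentation \<Rightarrow> nat \<Rightarrow> nat \<Rightarrow> nat set" where
  "pres_upd b \<alpha> i r = {x. x < Suc b \<and> \<alpha> 9 i r x \<noteq> 0}"

text \<open>Written in terms of the numbers alone, without passing through a transition, so that it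
  is visibly primitive recursive; \<open>enc_pres_trans\<close> identifies it with the given
  encoding.\<close>

definition pres_trans_code :: "nat \<Rightarrow> presentation \<Rightarrow> nat \<Rightarrow> bool list" where
  "pres_trans_code b \<alpha> i =
     enc_nat (\<alpha> 5 i 0 0) @ enc_nat (\<alpha> 6 i 0 0) @ enc_set (pres_guard b \<alpha> 7 i) @
     enc_set (pres_guard b \<alpha> 8 i) @
     enc_list (\<lambda>r. enc_set (pres_upd b \<alpha> i r)) (filter (\<lambda>r. \<alpha> 1 r 0 0 \<noteq> 0) [0..<b]) @
     enc_nat (\<alpha> 10 i 0 0)"

definition pres_code :: "nat \<Rightarrow> presentation \<Rightarrow> bool list" where
  "pres_code b \<alpha> = enc_set (pres_set b \<alpha> 0) @ enc_set (pres_set b \<alpha> 1) @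
     enc_list (pres_trans_code b \<alpha>) [0..<\<alpha> 4 0 0 0] @
     enc_set (pres_set b \<alpha> 2) @ enc_set (pres_set b \<alpha> 3)"

definition pres_trans :: "'a set \<Rightarrow> ('a \<Rightarrow> nat) \<Rightarrow> nat \<Rightarrow> presentation \<Rightarrow> nat \<Rightarrow> (nat, nat, 'a) transition" where
  "pres_trans \<Sigma> \<nu> b \<alpha> i =
     \<lparr>src = \<alpha> 5 i 0 0, letter = inv_into \<Sigma> \<nu> (\<alpha> 6 i 0 0),
      guard_in = pres_guard b \<alpha> 7 i, guard_notin = pres_guard b \<alpha> 8 i,
      upd = (\<lambda>r. if r \<in> pres_set b \<alpha> 1 then {s. source_num s \<in> pres_upd b \<alpha> i r} else {}),
      tgt = \<alpha> 10 i 0 0\<rparr>"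

definition pres_aut :: "'a set \<Rightarrow> ('a \<Rightarrow> nat) \<Rightarrow> nat \<Rightarrow> presentation \<Rightarrow> (nat, nat, 'a) rsa" where
  "pres_aut \<Sigma> \<nu> b \<alpha> =
     \<lparr>states = pres_set b \<alpha> 0, regs = pres_set b \<alpha> 1,
      transitions = pres_trans \<Sigma> \<nu> b \<alpha> ` {..<\<alpha> 4 0 0 0},
      initial = pres_set b \<alpha> 2, final = pres_set b \<alpha> 3\<rparr>"

text \<open>All quantifiers are bounded, which makes well-formedness primitive recursive.
  \<open>N\<close> is to be the finite set of the numbers of letters.\<close>

definition pres_wf :: "nat set \<Rightarrow> nat \<Rightarrow> presentation \<Rightarrow> bool" where
  "pres_wf N b \<alpha> \<longleftrightarrow>
     (\<forall>q<b. (\<alpha> 2 q 0 0 \<noteq> 0 \<longrightarrow> \<alpha> 0 q 0 0 \<noteq> 0) \<and> (\<alpha> 3 q 0 0 \<noteq> 0 \<longrightarrow> \<alpha> 0 q 0 0 \<noteq> 0)) \<and>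
     (\<forall>i<\<alpha> 4 0 0 0. \<alpha> 5 i 0 0 < b \<and> \<alpha> 0 (\<alpha> 5 i 0 0) 0 0 \<noteq> 0 \<and>
        \<alpha> 10 i 0 0 < b \<and> \<alpha> 0 (\<alpha> 10 i 0 0) 0 0 \<noteq> 0 \<and> \<alpha> 6 i 0 0 \<in> N \<and>
        (\<forall>r<b. (\<alpha> 7 i r 0 \<noteq> 0 \<longrightarrow> \<alpha> 1 r 0 0 \<noteq> 0) \<and> (\<alpha> 8 i r 0 \<noteq> 0 \<longrightarrow> \<alpha> 1 r 0 0 \<noteq> 0) \<and>
          \<not> (\<alpha> 7 i r 0 \<noteq> 0 \<and> \<alpha> 8 i r 0 \<noteq> 0) \<and>
          (\<forall>x<b. \<alpha> 1 r 0 0 \<noteq> 0 \<and> \<alpha> 9 i r (Suc x) \<noteq> 0 \<longrightarrow> \<alpha> 1 x 0 0 \<noteq> 0)))"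

lemma pres_wfD:
  assumes "pres_wf N b \<alpha>" "i < \<alpha> 4 0 0 0"
  shows "\<alpha> 5 i 0 0 \<in> pres_set b \<alpha> 0" "\<alpha> 10 i 0 0 \<in> pres_set b \<alpha> 0" "\<alpha> 6 i 0 0 \<in> N"
    "pres_guard b \<alpha> 7 i \<subseteq> pres_set b \<alpha> 1" "pres_guard b \<alpha> 8 i \<subseteq> pres_set b \<alpha> 1"
    "pres_guard b \<alpha> 7 i \<inter> pres_guard b \<alpha> 8 i = {}"
    "\<And>r x. r \<in> pres_set b \<alpha> 1 \<Longrightarrow> Suc x \<in> pres_upd b \<alpha> i r \<Longrightarrow> x \<in> pres_set b \<alpha> 1"
proof -
  note D = assms(1)[unfolded pres_wf_def, THEN conjunct2, rule_format, OF assms(2)]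
  show "\<alpha> 5 i 0 0 \<in> pres_set b \<alpha> 0" "\<alpha> 10 i 0 0 \<in> pres_set b \<alpha> 0" "\<alpha> 6 i 0 0 \<in> N"
    using D by (simp_all add: pres_set_def)
  have E: "(\<alpha> 7 i r 0 \<noteq> 0 \<longrightarrow> \<alpha> 1 r 0 0 \<noteq> 0) \<and> (\<alpha> 8 i r 0 \<noteq> 0 \<longrightarrow> \<alpha> 1 r 0 0 \<noteq> 0) \<and>
      \<not> (\<alpha> 7 i r 0 \<noteq> 0 \<and> \<alpha> 8 i r 0 \<noteq> 0) \<and>
      (\<forall>x<b. \<alpha> 1 r 0 0 \<noteq> 0 \<and> \<alpha> 9 i r (Suc x) \<noteq> 0 \<longrightarrow> \<alpha> 1 x 0 0 \<noteq> 0)" if "r < b" for r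
    using D that by blast
  show "pres_guard b \<alpha> 7 i \<subseteq> pres_set b \<alpha> 1" "pres_guard b \<alpha> 8 i \<subseteq> pres_set b \<alpha> 1"
    "pres_guard b \<alpha> 7 i \<inter> pres_guard b \<alpha> 8 i = {}"
    using E unfolding pres_guard_def pres_set_def by blast+
  show "x \<in> pres_set b \<alpha> 1" if "r \<in> pres_set b \<alpha> 1" "Suc x \<in> pres_upd b \<alpha> i r" for r x
    using E[of r] that unfolding pres_upd_def pres_set_def by simp
qed

lemma pres_wf_sets:
  assumes "pres_wf N b \<alpha>"
  shows "pres_set b \<alpha> 2 \<subseteq> pres_set b \<alpha> 0" "pres_set b \<alpha> 3 \<subseteq> pres_set b \<alpha> 0"
  using assms[unfolded pres_wf_def, THEN conjunct1] unfolding pres_set_def by blast+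

lemma pres_wf_wf_rsa:
  assumes wf: "pres_wf (\<nu> ` \<Sigma>) b \<alpha>"
  shows "wf_rsa \<Sigma> (pres_aut \<Sigma> \<nu> b \<alpha>)"
proof -
  have "wf_transition \<Sigma> (pres_set b \<alpha> 0) (pres_set b \<alpha> 1) (pres_trans \<Sigma> \<nu> b \<alpha> i)"
    if i: "i < \<alpha> 4 0 0 0" for i
  proof -
    note D = pres_wfD[OF wf i]
    have "s \<in> insert In (Reg ` pres_set b \<alpha> 1)"
      if "r \<in> pres_set b \<alpha> 1" "source_num s \<in> pres_upd b \<alpha> i r" for r s
      using D(7)[OF that(1)] that(2) by (cases s) auto
    then have "{s. source_num s \<in> pres_upd b \<alpha> i r} \<subseteq> insert In (Reg ` pres_set b \<alpha> 1)"
      if "r \<in> pres_set b \<alpha> 1" for r using that by blast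
    moreover have "inv_into \<Sigma> \<nu> (\<alpha> 6 i 0 0) \<in> \<Sigma>"
      using D(3) by (rule inv_into_into)
    ultimately show ?thesis using D(1,2,4,5,6)
      unfolding wf_transition_def pres_trans_def by simp
  qed
  moreover have "finite (pres_set b \<alpha> t)" for t by (simp add: pres_set_def)
  ultimately show ?thesis using pres_wf_sets[OF wf] unfolding wf_rsa_def pres_aut_def by simp
qed

lemma image_source_num_vimage: "source_num ` {s. source_num s \<in> X} = X"
proof -
  have "surj source_num" by (rule surjI[of _ "\<lambda>n. case n of 0 \<Rightarrow> In | Suc r \<Rightarrow> Reg r"]) (auto split: nat.split)
  then show ?thesis by (metis Collect_mem_eq surj_image_vimage_eq vimage_def)
qed

lemma enc_pres_trans:
  assumes "pres_wf (\<nu> ` \<Sigma>) b \<alpha>" "i < \<alpha> 4 0 0 0"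
  shows "enc_transition \<nu> (pres_set b \<alpha> 1) (pres_trans \<Sigma> \<nu> b \<alpha> i) = pres_trans_code b \<alpha> i"
proof -
  have n: "\<nu> (inv_into \<Sigma> \<nu> (\<alpha> 6 i 0 0)) = \<alpha> 6 i 0 0"
    using pres_wfD(3)[OF assms] by (rule f_inv_into_f)
  have xs: "filter (\<lambda>r. \<alpha> 1 r 0 0 \<noteq> 0) [0..<b] = sorted_list_of_set (pres_set b \<alpha> 1)"
    unfolding pres_set_def sorted_list_of_bounded ..
  have m: "map (\<lambda>r. enc_set (source_num ` upd (pres_trans \<Sigma> \<nu> b \<alpha> i) r)) (sorted_list_of_set (pres_set b \<alpha> 1)) =
    map (\<lambda>r. enc_set (pres_upd b \<alpha> i r)) (sorted_list_of_set (pres_set b \<alpha> 1))"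
  proof (rule map_cong[OF refl])
    fix r assume "r \<in> set (sorted_list_of_set (pres_set b \<alpha> 1))"
    then have "r \<in> pres_set b \<alpha> 1" by (simp add: pres_set_def)
    then show "enc_set (source_num ` upd (pres_trans \<Sigma> \<nu> b \<alpha> i) r) = enc_set (pres_upd b \<alpha> i r)"
      by (simp add: pres_trans_def image_source_num_vimage)
  qed
  have c: "src (pres_trans \<Sigma> \<nu> b \<alpha> i) = \<alpha> 5 i 0 0" "tgt (pres_trans \<Sigma> \<nu> b \<alpha> i) = \<alpha> 10 i 0 0"
    "\<nu> (letter (pres_trans \<Sigma> \<nu> b \<alpha> i)) = \<alpha> 6 i 0 0"
    "guard_in (pres_trans \<Sigma> \<nu> b \<alpha> i) = pres_guard b \<alpha> 7 i"
    "guard_notin (pres_trans \<Sigma> \<nu> b \<alpha> i) = pres_guard b \<alpha> 8 i"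
    by (simp_all add: pres_trans_def n)
  show ?thesis
    unfolding enc_transition_def pres_trans_code_def enc_list_def xs c m ..
qed

lemma pres_code_in_codes:
  assumes "pres_wf (\<nu> ` \<Sigma>) b \<alpha>"
  shows "pres_code b \<alpha> \<in> codes \<nu> (pres_aut \<Sigma> \<nu> b \<alpha>)"
proof -
  let ?ts = "map (pres_trans \<Sigma> \<nu> b \<alpha>) [0..<\<alpha> 4 0 0 0]"
  have *: "map (enc_transition \<nu> (pres_set b \<alpha> 1)) ?ts = map (pres_trans_code b \<alpha>) [0..<\<alpha> 4 0 0 0]"
    using enc_pres_trans[OF assms] by simp
  then have "enc_list (enc_transition \<nu> (pres_set b \<alpha> 1)) ?ts = enc_list (pres_trans_code b \<alpha>) [0..<\<alpha> 4 0 0 0]"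
    unfolding enc_list_def by (simp only: * length_map)
  then have "pres_code b \<alpha> = enc_set (states (pres_aut \<Sigma> \<nu> b \<alpha>)) @ enc_set (regs (pres_aut \<Sigma> \<nu> b \<alpha>)) @
      enc_list (enc_transition \<nu> (regs (pres_aut \<Sigma> \<nu> b \<alpha>))) ?ts @
      enc_set (initial (pres_aut \<Sigma> \<nu> b \<alpha>)) @ enc_set (final (pres_aut \<Sigma> \<nu> b \<alpha>))"
    unfolding pres_code_def by (simp add: pres_aut_def)
  moreover have "set ?ts = transitions (pres_aut \<Sigma> \<nu> b \<alpha>)"
    unfolding pres_aut_def by (simp add: atLeast0LessThan)
  ultimately show ?thesis unfolding codes_def by blast
qed

lemma pr_app5:
  assumes "pr (\<lambda>e. f (e 0) (e 1) (e 2) (e 3) (e 4))" "pr a" "pr b" "pr c" "pr d" "pr g"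
  shows "pr (\<lambda>e. f (a e) (b e) (c e) (d e) (g e))"
  using pr_subst[OF assms(1), of "\<lambda>i. if i = 0 then a else if i = 1 then b else if i = 2 then c
    else if i = 3 then d else g"] assms(2-) by simp

text \<open>A presentation is a function and cannot be an argument of a primitive recursive
  function. Hence the families \<open>A z\<close> of presentations that are primitive recursive
  uniformly in the index \<open>z\<close>.\<close>

lemma prw_pres_code:
  assumes "pr (\<lambda>e. A (e 0) (e 1) (e 2) (e 3) (e 4))" "pr b" "pr z"
  shows "prw (\<lambda>e. pres_code (b e) (A (z e)))"
proof -
  have "prw (\<lambda>e. pres_code (e 0) (A (e 1)))"
    unfolding pres_code_def pres_trans_code_def pres_set_def pres_guard_def pres_upd_def
    by (intro prw_append prw_enc_nat prw_enc_set prw_enc_list prw_enc_list_filter prb_not prb_eq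
      pr_const pr_var pr_Suc pr_app5[OF assms(1)])
  then show ?thesis
    by (rule pr_app2[of "\<lambda>b z. word_num (pres_code b (A z))"]) (fact assms)+
qed

lemma prb_pres_wf:
  assumes "pr (\<lambda>e. A (e 0) (e 1) (e 2) (e 3) (e 4))" "pr b" "pr z" "finite N"
  shows "prb (\<lambda>e. pres_wf N (b e) (A (z e)))"
proof -
  have "prb (\<lambda>e. pres_wf N (e 0) (A (e 1)))"
    unfolding pres_wf_def
    by (intro prb_all prb_imp prb_conj prb_less prb_mem assms(4) prb_not prb_eq
      pr_const pr_var pr_Suc pr_app5[OF assms(1)])
  then show ?thesis
    by (rule pr_app2[of "\<lambda>b z. of_bool (pres_wf N b (A z))"]) (fact assms)+
qed

text \<open>Unary names are shorter than the code that contains them.\<close>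

lemma length_enc_nat: "length (enc_nat n) = Suc n"
  by (simp add: enc_nat_def)

lemma length_enc_list: "x \<in> set xs \<Longrightarrow> length (e x) < length (enc_list e xs)"
  by (induction xs) (auto simp: enc_list_def length_enc_nat)

lemma length_enc_list_ge: "length xs < length (enc_list e xs)"
  by (auto simp: enc_list_def length_enc_nat)

lemma enc_set_bound: "finite S \<Longrightarrow> x \<in> S \<Longrightarrow> Suc x < length (enc_set S)"
  using length_enc_list[of x "sorted_list_of_set S" enc_nat] by (simp add: enc_set_def length_enc_nat)

text \<open>All names are written in unary inside \<open>w\<close>, so that they are smaller than
  \<open>b\<close>. The bounds on values and support make the presentation codable by a number of
  bounded size, see \<open>digits_surj\<close>.\<close>

lemma codes_presentation:
  assumes wf: "wf_rsa \<Sigma> A" and w: "w \<in> codes \<nu> A" and inj: "inj_on \<nu> \<Sigma>" and b: "length w \<le> b"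
  shows "\<exists>\<alpha>. pres_wf (\<nu> ` \<Sigma>) b \<alpha> \<and> pres_code b \<alpha> = w \<and> pres_aut \<Sigma> \<nu> b \<alpha> = A \<and>
    (\<forall>t i r x. \<alpha> t i r x \<le> b) \<and>
    (\<forall>t i r x. \<alpha> t i r x \<noteq> 0 \<longrightarrow> t \<le> 10 \<and> i \<le> b \<and> r \<le> b \<and> x \<le> b)"
proof -
  obtain ts where ts: "set ts = transitions A" and
    w: "w = enc_set (states A) @ enc_set (regs A) @ enc_list (enc_transition \<nu> (regs A)) ts @
     enc_set (initial A) @ enc_set (final A)"
    using w by (auto simp: codes_def)
  have fin: "finite (states A)" "finite (regs A)" "finite (initial A)" "finite (final A)"
    using wf by (auto simp: wf_rsa_def intro: finite_subset)
  have wft: "wf_transition \<Sigma> (states A) (regs A) t" if "t \<in> set ts" for t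
    using that wf ts by (auto simp: wf_rsa_def)
  have bq: "x < b" if "x \<in> states A" for x
    using enc_set_bound[OF fin(1) that] b w by simp
  have br: "Suc x < b" if "x \<in> regs A" for x
    using enc_set_bound[OF fin(2) that] b w by simp
  have bl: "length ts < b" using length_enc_list_ge[of ts "enc_transition \<nu> (regs A)"] b w by simp
  have bn: "\<nu> (letter t) < b" if "t \<in> set ts" for t
    using length_enc_list[OF that, of "enc_transition \<nu> (regs A)"] b w
    by (simp add: enc_transition_def length_enc_nat)
  have bn': "\<nu> (letter (ts ! i)) < b" if "i < length ts" for i using bn that by simp
  have bs: "src (ts ! i) < b" "tgt (ts ! i) < b" if "i < length ts" for i
    using wft[of "ts ! i"] that bq by (auto simp: wf_transition_def)
  \<comment> \<open>Irrelevant arguments are sent to 0, as the support has to be bounded.\<close>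
  define \<alpha> :: presentation where "\<alpha> t i r x =
    (if t = 4 \<and> i = 0 \<and> r = 0 \<and> x = 0 then length ts
     else if t = 5 \<and> i < length ts \<and> r = 0 \<and> x = 0 then src (ts ! i)
     else if t = 6 \<and> i < length ts \<and> r = 0 \<and> x = 0 then \<nu> (letter (ts ! i))
     else if t = 10 \<and> i < length ts \<and> r = 0 \<and> x = 0 then tgt (ts ! i)
     else of_bool (t = 0 \<and> i \<in> states A \<and> r = 0 \<and> x = 0 \<or> t = 1 \<and> i \<in> regs A \<and> r = 0 \<and> x = 0 \<or>
       t = 2 \<and> i \<in> initial A \<and> r = 0 \<and> x = 0 \<or> t = 3 \<and> i \<in> final A \<and> r = 0 \<and> x = 0 \<or>
       t = 7 \<and> i < length ts \<and> r \<in> guard_in (ts ! i) \<and> x = 0 \<or>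
       t = 8 \<and> i < length ts \<and> r \<in> guard_notin (ts ! i) \<and> x = 0 \<or>
       t = 9 \<and> i < length ts \<and> r \<in> regs A \<and> x \<in> source_num ` upd (ts ! i) r))" for t i r x
  have g: "\<alpha> 4 0 0 0 = length ts" "\<alpha> 0 q 0 0 \<noteq> 0 \<longleftrightarrow> q \<in> states A" "\<alpha> 1 q 0 0 \<noteq> 0 \<longleftrightarrow> q \<in> regs A"
    "\<alpha> 2 q 0 0 \<noteq> 0 \<longleftrightarrow> q \<in> initial A" "\<alpha> 3 q 0 0 \<noteq> 0 \<longleftrightarrow> q \<in> final A" for q
    by (auto simp: \<alpha>_def)
  have h: "\<alpha> 5 i 0 0 = src (ts ! i)" "\<alpha> 6 i 0 0 = \<nu> (letter (ts ! i))" "\<alpha> 10 i 0 0 = tgt (ts ! i)"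
    "\<alpha> 7 i r 0 \<noteq> 0 \<longleftrightarrow> r \<in> guard_in (ts ! i)" "\<alpha> 8 i r 0 \<noteq> 0 \<longleftrightarrow> r \<in> guard_notin (ts ! i)"
    "\<alpha> 9 i r x \<noteq> 0 \<longleftrightarrow> r \<in> regs A \<and> x \<in> source_num ` upd (ts ! i) r" if "i < length ts" for i r x
    using that by (auto simp: \<alpha>_def)
  have inR: "Suc x \<in> source_num ` upd t r \<Longrightarrow> x \<in> regs A" if "t \<in> set ts" "r \<in> regs A" for t r x
  proof -
    assume "Suc x \<in> source_num ` upd t r"
    then obtain s where s: "s \<in> upd t r" "source_num s = Suc x" by auto
    then have "s = Reg x" by (cases s) auto
    then show ?thesis using s wft[OF that(1)] that(2) by (auto simp: wf_transition_def)
  qed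
  have gR: "guard_in (ts ! i) \<subseteq> regs A" "guard_notin (ts ! i) \<subseteq> regs A"
    "guard_in (ts ! i) \<inter> guard_notin (ts ! i) = {}" "src (ts ! i) \<in> states A"
    "tgt (ts ! i) \<in> states A" "letter (ts ! i) \<in> \<Sigma>" if "i < length ts" for i
    using wft[of "ts ! i"] that by (auto simp: wf_transition_def)
  have gR': "r \<in> guard_in (ts ! i) \<Longrightarrow> i < length ts \<Longrightarrow> r \<in> regs A"
    "r \<in> guard_notin (ts ! i) \<Longrightarrow> i < length ts \<Longrightarrow> r \<in> regs A"
    "r \<in> guard_in (ts ! i) \<Longrightarrow> i < length ts \<Longrightarrow> r \<notin> guard_notin (ts ! i)" for i r
    using gR[of i] by auto
  have IF: "initial A \<subseteq> states A" "final A \<subseteq> states A" using wf by (auto simp: wf_rsa_def)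
  have pw: "pres_wf (\<nu> ` \<Sigma>) b \<alpha>"
    unfolding pres_wf_def g(1)
  proof (intro conjI allI impI)
    fix i r x assume "i < length ts" "\<alpha> 1 r 0 0 \<noteq> 0 \<and> \<alpha> 9 i r (Suc x) \<noteq> 0"
    then show "\<alpha> 1 x 0 0 \<noteq> 0" using inR[of "ts ! i" r x] by (simp only: g h) auto
  qed (use IF gR(4-6) bs in \<open>auto simp only: g h dest: gR'\<close>)
  have sets: "pres_set b \<alpha> 0 = states A" "pres_set b \<alpha> 1 = regs A" "pres_set b \<alpha> 2 = initial A"
    "pres_set b \<alpha> 3 = final A"
    unfolding pres_set_def g using bq br IF by (auto dest: Suc_lessD)
  have tr: "pres_trans \<Sigma> \<nu> b \<alpha> i = ts ! i" if "i < length ts" for i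
  proof -
    have gs: "pres_guard b \<alpha> 7 i = guard_in (ts ! i)" "pres_guard b \<alpha> 8 i = guard_notin (ts ! i)"
      unfolding pres_guard_def using h(4,5)[OF that] by (auto intro: Suc_lessD[OF br] gR'[OF _ that])
    have "inv_into \<Sigma> \<nu> (\<nu> (letter (ts ! i))) = letter (ts ! i)"
      using inj gR(6)[OF that] by simp
    moreover have "(\<lambda>r. if r \<in> regs A then {s. source_num s \<in> pres_upd b \<alpha> i r} else {}) = upd (ts ! i)"
    proof
      fix r
      show "(if r \<in> regs A then {s. source_num s \<in> pres_upd b \<alpha> i r} else {}) = upd (ts ! i) r"
      proof (cases "r \<in> regs A")
        case True
        have "source_num s \<in> source_num ` upd (ts ! i) r \<longleftrightarrow> s \<in> upd (ts ! i) r" for s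
          by (simp add: inj_image_mem_iff[OF inj_source_num])
        moreover have "source_num s < Suc b" if "s \<in> upd (ts ! i) r" for s
        proof (cases s)
          case (Reg x)
          then show ?thesis using that inR[of "ts ! i" r x] True \<open>i < length ts\<close> br[of x] by force
        qed simp
        ultimately show ?thesis using True h(6)[OF that] by (auto simp: pres_upd_def)
      next
        case False
        then show ?thesis using wft[of "ts ! i"] that by (simp add: wf_transition_def)
      qed
    qed
    ultimately show ?thesis
      unfolding pres_trans_def sets gs h(1-3)[OF that] by simp
  qed
  have aut: "pres_aut \<Sigma> \<nu> b \<alpha> = A"
  proof -
    have "pres_trans \<Sigma> \<nu> b \<alpha> ` {..<length ts} = (!) ts ` {..<length ts}"
      using tr by (intro image_cong) auto
    also have "\<dots> = transitions A" unfolding ts[symmetric] by (auto simp: set_conv_nth)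
    finally show ?thesis unfolding pres_aut_def sets g(1) by simp
  qed
  have "pres_code b \<alpha> = w"
  proof -
    have "enc_list (pres_trans_code b \<alpha>) [0..<length ts] = enc_list (enc_transition \<nu> (regs A)) ts"
    proof -
      have "map (pres_trans_code b \<alpha>) [0..<length ts] = map (enc_transition \<nu> (regs A)) ts"
        using enc_pres_trans[OF pw, unfolded sets g(1)] tr by (intro nth_equalityI) auto
      then show ?thesis by (simp add: enc_list_def)
    qed
    then show ?thesis unfolding pres_code_def sets g(1) w by simp
  qed
  moreover have "\<alpha> t i r x \<le> b" for t i r x
  proof -
    have I: "(c \<Longrightarrow> u \<le> b) \<Longrightarrow> v \<le> b \<Longrightarrow> (if c then u else v) \<le> b" for c and u v :: nat by auto
    have O: "of_bool c \<le> b" for c using bl by (cases c) auto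
    show ?thesis unfolding \<alpha>_def
      by (intro I O) (use bl in \<open>auto intro: less_imp_le[OF bs(1)] less_imp_le[OF bs(2)] less_imp_le[OF bn']\<close>)
  qed
  moreover have "t \<le> 10 \<and> i \<le> b \<and> r \<le> b \<and> x \<le> b" if "\<alpha> t i r x \<noteq> 0" for t i r x
  proof -
    have x: "x \<le> b" if "i < length ts" "r \<in> regs A" "x \<in> source_num ` upd (ts ! i) r"
      using inR[of "ts ! i" r "x - 1"] that br[of "x - 1"] by (cases x) auto
    have brl: "r \<le> b" if "r \<in> regs A" for r using br[OF that] by simp
    have bql: "q \<le> b" if "q \<in> states A" for q using bq[OF that] by simp
    from that consider "t \<in> {4,5,6,10}" "i \<le> length ts" "r = 0" "x = 0"
      | "t \<in> {0,1,2,3}" "i \<in> states A \<or> i \<in> regs A" "r = 0" "x = 0"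
      | "t \<in> {7,8}" "i < length ts" "r \<in> regs A" "x = 0"
      | "t = 9" "i < length ts" "r \<in> regs A" "x \<in> source_num ` upd (ts ! i) r"
      unfolding \<alpha>_def of_bool_def using IF gR' by (auto split: if_splits)
    then show ?thesis
    proof cases
      case 1
      then show ?thesis using bl by auto
    next
      case 2
      then show ?thesis using brl bql by auto
    next
      case 3
      then show ?thesis using bl brl by auto
    next
      case 4
      then show ?thesis using bl brl x by auto
    qed
  qed
  ultimately show ?thesis using pw aut by blast
qed

section \<open>From primitive recursive functions to Turing machines\<close>

section \<open>Counter programs\<close>

text \<open>
  Programs work on counters and on a read-only input tape with a movable head.
  \<open>CLoop c P\<close> decrements \<open>c\<close> before each execution of the body and stops when \<open>c\<close> is 0;
  \<open>CScan P\<close> runs while the head is on a letter of the input; \<open>CIncIf\<close> increments if that letter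
  is \<open>True\<close>.
\<close>

datatype com = CSkip | CInc nat | CIncIf nat | CMove move | CLoop nat com | CScan com | CSeq com com

definition symbol :: "bool list \<Rightarrow> int \<Rightarrow> nat" where
  "symbol w h = (if 0 \<le> h \<and> h < int (length w) then (if w ! nat h then 2 else 1) else 0)"

text \<open>The numbers are the exact step counts of the compiled code: a round of a loop takes a
  test and a jump back in addition to the body.\<close>

inductive big_step :: "bool list \<Rightarrow> com \<Rightarrow> (nat \<Rightarrow> nat) \<times> int \<Rightarrow> nat \<Rightarrow> (nat \<Rightarrow> nat) \<times> int \<Rightarrow> bool"
  for w where
  Skip: "big_step w CSkip \<sigma> 0 \<sigma>"
| Inc: "big_step w (CInc c) (s, h) 1 (s(c := Suc (s c)), h)"
| IncIf: "big_step w (CIncIf c) (s, h) 1 (if symbol w h = 2 then s(c := Suc (s c)) else s, h)"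
| Move: "big_step w (CMove m) (s, h) 1 (s, h + offset m)"
| LoopF: "s c = 0 \<Longrightarrow> big_step w (CLoop c P) (s, h) 1 (s, h)"
| LoopT: "s c = Suc n \<Longrightarrow> big_step w P (s(c := n), h) t \<sigma> \<Longrightarrow> big_step w (CLoop c P) \<sigma> t' \<sigma>'
    \<Longrightarrow> big_step w (CLoop c P) (s, h) (t + t' + 2) \<sigma>'"
| ScanF: "symbol w h = 0 \<Longrightarrow> big_step w (CScan P) (s, h) 1 (s, h)"
| ScanT: "symbol w h \<noteq> 0 \<Longrightarrow> big_step w P (s, h) t \<sigma> \<Longrightarrow> big_step w (CScan P) \<sigma> t' \<sigma>'
    \<Longrightarrow> big_step w (CScan P) (s, h) (t + t' + 2) \<sigma>'"
| Seq: "big_step w P \<sigma> t \<sigma>' \<Longrightarrow> big_step w Q \<sigma>' t' \<sigma>'' \<Longrightarrow> big_step w (CSeq P Q) \<sigma> (t + t') \<sigma>''"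

text \<open>A step increases at most one counter, by one, so that bounds on time also bound
  values.\<close>

lemma big_step_growth: "big_step w P \<sigma> t \<sigma>' \<Longrightarrow> fst \<sigma>' c \<le> fst \<sigma> c + t"
  by (induction rule: big_step.induct) (auto split: if_splits)

text \<open>Execution of a program that does not touch the input tape.\<close>

fun pure :: "com \<Rightarrow> bool" where
  "pure (CIncIf _) = False"
| "pure (CMove _) = False"
| "pure (CScan _) = False"
| "pure (CLoop _ P) = pure P"
| "pure (CSeq P Q) = (pure P \<and> pure Q)"
| "pure _ = True"

definition exec :: "com \<Rightarrow> (nat \<Rightarrow> nat) \<Rightarrow> nat \<Rightarrow> (nat \<Rightarrow> nat) \<Rightarrow> bool" where
  "exec P s T s' \<longleftrightarrow> pure P \<and> (\<forall>w h. \<exists>t\<le>T. big_step w P (s, h) t (s', h))"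

lemma exec_mono: "exec P s T s' \<Longrightarrow> T \<le> T' \<Longrightarrow> exec P s T' s'"
  unfolding exec_def using order_trans by blast

lemma exec_growth: "exec P s T s' \<Longrightarrow> s' c \<le> s c + T"
  unfolding exec_def using big_step_growth[of _ P "(s, _)" _ "(s', _)" c] by fastforce

lemma exec_Skip: "exec CSkip s 0 s"
  unfolding exec_def by (auto intro: big_step.Skip)

lemma exec_Inc: "exec (CInc c) s 1 (s(c := Suc (s c)))"
  unfolding exec_def using big_step.Inc by (auto intro!: exI[of _ 1])

lemma exec_Seq: "exec P s T s' \<Longrightarrow> exec Q s' T' s'' \<Longrightarrow> exec (CSeq P Q) s (T + T') s''"
proof -
  assume P: "exec P s T s'" and Q: "exec Q s' T' s''"
  have "\<exists>t\<le>T + T'. big_step w (CSeq P Q) (s, h) t (s'', h)" for w h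
  proof -
    obtain t t' where "t \<le> T" "big_step w P (s, h) t (s', h)" "t' \<le> T'" "big_step w Q (s', h) t' (s'', h)"
      using P Q unfolding exec_def by blast
    then show ?thesis by (intro exI[of _ "t + t'"]) (auto intro: big_step.Seq)
  qed
  then show ?thesis using P Q unfolding exec_def by simp
qed

lemma exec_Loop_0: "s c = 0 \<Longrightarrow> pure P \<Longrightarrow> exec (CLoop c P) s 1 s"
  unfolding exec_def using big_step.LoopF by (auto intro!: exI[of _ 1])

lemma exec_Loop_Suc:
  assumes "s c = Suc n" and P: "exec P (s(c := n)) T s'" and L: "exec (CLoop c P) s' T' s''"
  shows "exec (CLoop c P) s (T + T' + 2) s''"
proof -
  have "\<exists>t\<le>T + T' + 2. big_step w (CLoop c P) (s, h) t (s'', h)" for w h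
  proof -
    obtain t t' where "t \<le> T" "big_step w P (s(c := n), h) t (s', h)" "t' \<le> T'"
      "big_step w (CLoop c P) (s', h) t' (s'', h)"
      using P L unfolding exec_def by blast
    then show ?thesis using assms(1) by (intro exI[of _ "t + t' + 2"]) (auto intro: big_step.LoopT simp del: add_Suc_right add_2_eq_Suc')
  qed
  then show ?thesis using L unfolding exec_def by simp
qed

text \<open>\<open>S i\<close> is the store after \<open>i\<close> rounds, before the loop counter
  is decremented again; \<open>T\<close> bounds the body in every round.\<close>

lemma exec_Loop:
  assumes "\<And>i. i < n \<Longrightarrow> exec P ((S i)(c := n - Suc i)) T (S (Suc i))"
    and "\<And>i. i \<le> n \<Longrightarrow> S i c = n - i" and "pure P"
  shows "exec (CLoop c P) (S 0) (n * (T + 2) + 1) (S n)"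
proof -
  \<comment> \<open>Induction on the number \<open>j\<close> of remaining rounds.\<close>
  have "exec (CLoop c P) (S (n - j)) (j * (T + 2) + 1) (S n)" if "j \<le> n" for j
    using that
  proof (induction j)
    case 0
    show ?case using exec_Loop_0[of "S n" c P] assms(2)[of n] assms(3) by simp
  next
    case (Suc j)
    have "exec (CLoop c P) (S (n - Suc j)) (T + (j * (T + 2) + 1) + 2) (S n)"
    proof (rule exec_Loop_Suc)
      show "S (n - Suc j) c = Suc j" using assms(2)[of "n - Suc j"] Suc.prems by simp
      show "exec P ((S (n - Suc j))(c := j)) T (S (n - j))"
        using assms(1)[of "n - Suc j"] Suc.prems by (simp add: Suc_diff_Suc)
      show "exec (CLoop c P) (S (n - j)) (j * (T + 2) + 1) (S n)" using Suc by simp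
    qed
    then show ?case by (simp add: algebra_simps)
  qed
  from this[of n] show ?thesis by simp
qed

definition clear :: "nat \<Rightarrow> com" where
  "clear c = CLoop c CSkip"

lemma exec_clear: "exec (clear c) s (2 * s c + 1) (s(c := 0))"
proof -
  define S where "S i = s(c := s c - i)" for i
  have "exec (CLoop c CSkip) (S 0) (s c * (0 + 2) + 1) (S (s c))"
  proof (rule exec_Loop)
    show "exec CSkip ((S i)(c := s c - Suc i)) 0 (S (Suc i))" for i
      using exec_Skip[of "S (Suc i)"] by (simp add: S_def)
  qed (auto simp: S_def)
  then show ?thesis unfolding clear_def by (simp add: S_def mult.commute exec_mono)
qed

definition move_to :: "nat \<Rightarrow> nat \<Rightarrow> com" where
  "move_to c d = CLoop c (CInc d)"

lemma exec_move_to: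
  assumes "c \<noteq> d"
  shows "exec (move_to c d) s (3 * s c + 1) (s(c := 0, d := s d + s c))"
proof -
  define S where "S i = s(c := s c - i, d := s d + i)" for i
  have "exec (CLoop c (CInc d)) (S 0) (s c * (1 + 2) + 1) (S (s c))"
  proof (rule exec_Loop)
    fix i
    have "((S i)(c := s c - Suc i))(d := Suc (((S i)(c := s c - Suc i)) d)) = S (Suc i)"
      using assms by (auto simp: S_def)
    then show "exec (CInc d) ((S i)(c := s c - Suc i)) 1 (S (Suc i))"
      using exec_Inc[of d "(S i)(c := s c - Suc i)"] by simp
  qed (use assms in \<open>auto simp: S_def\<close>)
  from exec_mono[OF this, of "3 * s c + 1"] show ?thesis
    using assms by (simp add: move_to_def S_def)
qed

text \<open>A counter can be read only by emptying it; \<open>t\<close> remembers the value in order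
  to restore \<open>c\<close>.\<close>

definition copy_to :: "nat \<Rightarrow> nat \<Rightarrow> nat \<Rightarrow> com" where
  "copy_to c d t = CSeq (CLoop c (CSeq (CInc d) (CInc t))) (move_to t c)"

lemma exec_copy_to:
  assumes "c \<noteq> d" "c \<noteq> t" "d \<noteq> t" "s t = 0"
  shows "exec (copy_to c d t) s (7 * s c + 2) (s(d := s d + s c))"
proof -
  define S where "S i = s(c := s c - i, d := s d + i, t := i)" for i
  have "exec (CLoop c (CSeq (CInc d) (CInc t))) (S 0) (s c * (2 + 2) + 1) (S (s c))"
  proof (rule exec_Loop)
    fix i
    let ?s = "(S i)(c := s c - Suc i)"
    have "(?s(d := Suc (?s d)))(t := Suc ((?s(d := Suc (?s d))) t)) = S (Suc i)"
      using assms by (auto simp: S_def)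
    then have "exec (CSeq (CInc d) (CInc t)) ?s (1 + 1) (S (Suc i))"
      using exec_Seq[OF exec_Inc[of d ?s] exec_Inc[of t]] by simp
    then show "exec (CSeq (CInc d) (CInc t)) ?s 2 (S (Suc i))" by (simp add: numeral_2_eq_2)
  qed (use assms in \<open>auto simp: S_def\<close>)
  moreover have "exec (move_to t c) (S (s c)) (3 * s c + 1) (s(d := s d + s c))"
  proof -
    have "(S (s c))(t := 0, c := S (s c) c + S (s c) t) = s(d := s d + s c)"
      using assms by (auto simp: S_def)
    then show ?thesis using exec_move_to[of t c "S (s c)"] assms by (simp add: S_def)
  qed
  moreover have "S 0 = s" using assms by (auto simp: S_def)
  ultimately have "exec (copy_to c d t) s ((s c * (2 + 2) + 1) + (3 * s c + 1)) (s(d := s d + s c))"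
    unfolding copy_to_def using exec_Seq by metis
  then show ?thesis by (rule exec_mono) simp
qed


section \<open>Primitive recursive functions by counter programs\<close>

text \<open>A calling convention: counters from \<open>b\<close> on are scratch, 0 before and after
  the call, and inputs are preserved. The time is majorized in the sum of the inputs.\<close>

definition computes :: "com \<Rightarrow> (nat list \<Rightarrow> nat) \<Rightarrow> nat list \<Rightarrow> nat \<Rightarrow> nat \<Rightarrow> (nat \<Rightarrow> nat) \<Rightarrow> bool" where
  "computes P f ins out b B \<longleftrightarrow> majorized B \<and> (\<forall>s. (\<forall>r\<ge>b. s r = 0) \<longrightarrow> s out = 0 \<longrightarrow>
     exec P s (B (sum_list (map s ins))) (s(out := f (map s ins))))"

definition computable :: "(nat list \<Rightarrow> nat) \<Rightarrow> nat \<Rightarrow> bool" where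
  "computable f n \<longleftrightarrow> (\<forall>ins out b. length ins = n \<longrightarrow> (\<forall>r\<in>set ins. r < b \<and> r \<noteq> out) \<longrightarrow> out < b \<longrightarrow>
     (\<exists>P B. computes P f ins out b B))"

lemma computesI:
  assumes "majorized B"
    and "\<And>s. (\<And>r. b \<le> r \<Longrightarrow> s r = 0) \<Longrightarrow> s out = 0 \<Longrightarrow>
      exec P s (B (sum_list (map s ins))) (s(out := f (map s ins)))"
  shows "computes P f ins out b B"
  unfolding computes_def using assms by blast

lemma computesD:
  assumes "computes P f ins out b B" "\<And>r. b \<le> r \<Longrightarrow> s r = 0" "s out = 0" "map s ins = xs"
    and "s(out := f xs) = s'"
  shows "exec P s (B (sum_list xs)) s'"
  using assms unfolding computes_def by blast

lemma computesD0:
  assumes "computes P f ins out b B" "\<And>r. b \<le> r \<Longrightarrow> s r = 0" "s out = 0"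
  shows "exec P s (B (sum_list (map s ins))) (s(out := f (map s ins)))"
  using assms unfolding computes_def by blast

lemma computes_majorized: "computes P f ins out b B \<Longrightarrow> majorized B"
  unfolding computes_def by blast

lemma computableI:
  assumes "\<And>ins out b. length ins = n \<Longrightarrow> (\<And>r. r \<in> set ins \<Longrightarrow> r < b \<and> r \<noteq> out) \<Longrightarrow> out < b \<Longrightarrow>
     \<exists>P B. computes P f ins out b B"
  shows "computable f n"
  unfolding computable_def using assms by blast

text \<open>Passing to a level of the hierarchy makes the time bound monotone.\<close>

lemma computableD:
  assumes "computable f n" "length ins = n" "\<And>r. r \<in> set ins \<Longrightarrow> r < b \<and> r \<noteq> out" "out < b"
  shows "\<exists>P k. computes P f ins out b (\<lambda>x. fast k (x + 1))"
proof -
  obtain P B where P: "computes P f ins out b B" using assms unfolding computable_def by blast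
  then obtain k where k: "\<And>x. B x \<le> fast k (x + 1)" by (auto simp: computes_def majorized_def)
  have "computes P f ins out b (\<lambda>x. fast k (x + 1))"
  proof (rule computesI)
    show "majorized (\<lambda>x. fast k (x + 1))" by (intro majorized_intros)
    show "exec P s (fast k (sum_list (map s ins) + 1)) (s(out := f (map s ins)))"
      if "\<And>r. b \<le> r \<Longrightarrow> s r = 0" "s out = 0" for s
    proof (rule exec_mono[OF _ k])
      show "exec P s (B (sum_list (map s ins))) (s(out := f (map s ins)))"
        by (intro computesD0[OF P] that)
    qed
  qed
  then show ?thesis by blast
qed

lemma computable_eq:
  assumes "computable f n" "\<And>xs. length xs = n \<Longrightarrow> f xs = g xs"
  shows "computable g n"
proof (rule computableI)
  fix ins :: "nat list" and out b :: nat
  assume *: "length ins = n" "\<And>r. r \<in> set ins \<Longrightarrow> r < b \<and> r \<noteq> out" "out < b"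
  obtain P k where P: "computes P f ins out b (\<lambda>x. fast k (x + 1))"
    using computableD[OF assms(1) *] by blast
  have "f (map s ins) = g (map s ins)" for s using assms(2) *(1) by simp
  then have "computes P g ins out b (\<lambda>x. fast k (x + 1))" using P unfolding computes_def by simp
  then show "\<exists>P B. computes P g ins out b B" by blast
qed

lemma computes_pure: "computes P f ins out b B \<Longrightarrow> pure P"
  using computesD[of P f ins out b B "\<lambda>_. 0"] unfolding exec_def by simp

text \<open>A counter that starts at 0 cannot exceed the running time. So the time bounds of
  subprograms bound the intermediate values of compositions and recursions.\<close>

lemma computes_value:
  assumes P: "computes P f ins out b B" and s: "\<And>r. b \<le> r \<Longrightarrow> s r = 0" and "out < b" "out \<notin> set ins"
    and xs: "map s ins = xs"
  shows "f xs \<le> B (sum_list xs)"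
proof -
  have "map (s(out := 0)) ins = xs" using assms(4) xs by auto
  then have "exec P (s(out := 0)) (B (sum_list xs)) (s(out := f xs))"
    using s \<open>out < b\<close> by (intro computesD[OF P]) auto
  from exec_growth[OF this, of out] show ?thesis by simp
qed

lemma computable_zero: "computable (\<lambda>_. 0) n"
proof (rule computableI)
  fix ins :: "nat list" and out b :: nat
  have "computes CSkip (\<lambda>_. 0) ins out b (\<lambda>_. 0)"
    by (rule computesI[OF majorized_const]) (use exec_Skip in \<open>simp add: fun_upd_idem\<close>)
  then show "\<exists>P B. computes P (\<lambda>_. 0) ins out b B" by blast
qed

lemma computable_nth:
  assumes "i < n"
  shows "computable (\<lambda>xs. xs ! i) n"
proof (rule computableI)
  fix ins :: "nat list" and out b :: nat
  assume *: "length ins = n" "\<And>r. r \<in> set ins \<Longrightarrow> r < b \<and> r \<noteq> out" "out < b"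
  let ?c = "ins ! i"
  have c: "?c \<in> set ins" using * assms by simp
  have "computes (copy_to ?c out b) (\<lambda>xs. xs ! i) ins out b (\<lambda>x. 7 * x + 2)"
  proof (rule computesI)
    show "majorized (\<lambda>x. 7 * x + 2)" by (intro majorized_intros)
    fix s :: "nat \<Rightarrow> nat" assume s: "\<And>r. b \<le> r \<Longrightarrow> s r = 0" "s out = 0"
    have "exec (copy_to ?c out b) s (7 * s ?c + 2) (s(out := s out + s ?c))"
      by (rule exec_copy_to) (use *(2)[OF c] *(3) s in auto)
    moreover have "s ?c \<le> sum_list (map s ins)" using c by (intro member_le_sum_list) auto
    moreover have "s out + s ?c = map s ins ! i" using s * assms by simp
    ultimately show "exec (copy_to ?c out b) s (7 * sum_list (map s ins) + 2) (s(out := map s ins ! i))"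
      by (auto elim: exec_mono)
  qed
  then show "\<exists>P B. computes P (\<lambda>xs. xs ! i) ins out b B" by blast
qed

lemma computable_Suc:
  assumes "computable f n"
  shows "computable (\<lambda>xs. Suc (f xs)) n"
proof (rule computableI)
  fix ins :: "nat list" and out b :: nat
  assume *: "length ins = n" "\<And>r. r \<in> set ins \<Longrightarrow> r < b \<and> r \<noteq> out" "out < b"
  obtain P k where P: "computes P f ins out b (\<lambda>x. fast k (x + 1))"
    using computableD[OF assms *] by blast
  have "computes (CSeq P (CInc out)) (\<lambda>xs. Suc (f xs)) ins out b (\<lambda>x. fast k (x + 1) + 1)"
  proof (rule computesI)
    show "majorized (\<lambda>x. fast k (x + 1) + 1)" by (intro majorized_intros)
    fix s :: "nat \<Rightarrow> nat" assume s: "\<And>r. b \<le> r \<Longrightarrow> s r = 0" "s out = 0"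
    have "exec P s (fast k (sum_list (map s ins) + 1)) (s(out := f (map s ins)))"
      by (intro computesD0[OF P] s)
    from exec_Seq[OF this exec_Inc[of out]]
    show "exec (CSeq P (CInc out)) s (fast k (sum_list (map s ins) + 1) + 1) (s(out := Suc (f (map s ins))))"
      by simp
  qed
  then show "\<exists>P B. computes P (\<lambda>xs. Suc (f xs)) ins out b B" by blast
qed

lemma exec_clear_range:
  "\<exists>P. \<forall>s. exec P s (\<Sum>j<m. 2 * s (b + j) + 1) (\<lambda>r. if b \<le> r \<and> r < b + m then 0 else s r)"
proof (induction m)
  case 0
  have "(\<lambda>r. if b \<le> r \<and> r < b + 0 then 0 else s r) = s" for s :: "nat \<Rightarrow> nat" by auto
  then show ?case using exec_Skip by force
next
  case (Suc m)
  then obtain P where P: "\<And>s. exec P s (\<Sum>j<m. 2 * s (b + j) + 1) (\<lambda>r. if b \<le> r \<and> r < b + m then 0 else s r)"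
    by blast
  have "exec (CSeq P (clear (b + m))) s (\<Sum>j<Suc m. 2 * s (b + j) + 1)
    (\<lambda>r. if b \<le> r \<and> r < b + Suc m then 0 else s r)" for s
  proof -
    let ?s = "\<lambda>r. if b \<le> r \<and> r < b + m then 0 else s r"
    have "?s(b + m := 0) = (\<lambda>r. if b \<le> r \<and> r < b + Suc m then 0 else s r)" by auto
    then show ?thesis using exec_Seq[OF P[of s] exec_clear[of "b + m" ?s]] by simp
  qed
  then show ?case by blast
qed

lemma majorized_sum: "(\<And>i. i < m \<Longrightarrow> majorized (B i)) \<Longrightarrow> majorized (\<lambda>x. \<Sum>i<m. B i x)" for m :: nat
  by (induction m) (auto intro!: majorized_const majorized_add)

lemma sum_double_Suc: "(\<Sum>j<m. 2 * h j + 1) = 2 * (\<Sum>j<m. h j) + m" for m :: nat and h :: "nat \<Rightarrow> nat"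
  by (induction m) auto

text \<open>The results of \<open>fs\<close> are put into the counters \<open>b\<close>, ...,
  \<open>b + m - 1\<close>, with scratch space above them; then \<open>g\<close> is applied and the
  intermediate results are cleared.\<close>

lemma computable_comp:
  assumes g: "computable g (length fs)" and fs: "\<forall>f\<in>set fs. computable f n"
  shows "computable (\<lambda>xs. g (map (\<lambda>f. f xs) fs)) n"
proof (rule computableI)
  fix ins :: "nat list" and out b :: nat
  assume ins: "length ins = n" "\<And>r. r \<in> set ins \<Longrightarrow> r < b \<and> r \<noteq> out" "out < b"
  define m where "m = length fs"
  have "\<exists>P k. computes P (fs ! j) ins (b + j) (b + m) (\<lambda>x. fast k (x + 1))" if "j < m" for j
    using computableD[of "fs ! j" n ins "b + m" "b + j"] fs ins that by (force simp: m_def)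
  then obtain P k where P: "\<And>j. j < m \<Longrightarrow> computes (P j) (fs ! j) ins (b + j) (b + m) (\<lambda>x. fast (k j) (x + 1))"
    by metis
  define S where "S s j = (\<lambda>r. if b \<le> r \<and> r < b + j then (fs ! (r - b)) (map s ins) else s r)"
    for s :: "nat \<Rightarrow> nat" and j
  have S_ins: "map (S s j) ins = map s ins" for s j using ins(2) by (fastforce simp: S_def)
  have "\<exists>Q. \<forall>s. (\<forall>r\<ge>b. s r = 0) \<longrightarrow>
      exec Q s (\<Sum>i<j. fast (k i) (sum_list (map s ins) + 1)) (S s j)" if "j \<le> m" for j
    using that
  proof (induction j)
    case 0
    have "S s 0 = s" for s by (auto simp: S_def)
    then show ?case using exec_Skip by force
  next
    case (Suc j)
    then obtain Q where Q: "\<And>s. (\<forall>r\<ge>b. s r = 0) \<Longrightarrow>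
      exec Q s (\<Sum>i<j. fast (k i) (sum_list (map s ins) + 1)) (S s j)" by auto
    have "exec (CSeq Q (P j)) s (\<Sum>i<Suc j. fast (k i) (sum_list (map s ins) + 1)) (S s (Suc j))"
      if s: "\<forall>r\<ge>b. s r = 0" for s
    proof -
      have "exec (P j) (S s j) (fast (k j) (sum_list (map s ins) + 1)) (S s (Suc j))"
        by (rule computesD[OF P[of j] _ _ S_ins]) (use s Suc.prems in \<open>auto simp: S_def\<close>)
      then show ?thesis using exec_Seq[OF Q[OF s]] by simp
    qed
    then show ?case by blast
  qed
  then obtain Q where Q: "\<And>s. (\<forall>r\<ge>b. s r = 0) \<Longrightarrow>
      exec Q s (\<Sum>i<m. fast (k i) (sum_list (map s ins) + 1)) (S s m)" by blast
  obtain G l where G: "computes G g [b..<b + m] out (b + m) (\<lambda>x. fast l (x + 1))"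
    using computableD[OF g, of "[b..<b + m]" "b + m" out] ins(3) by (auto simp: m_def)
  obtain R where R: "\<And>s. exec R s (\<Sum>j<m. 2 * s (b + j) + 1) (\<lambda>r. if b \<le> r \<and> r < b + m then 0 else s r)"
    using exec_clear_range[of b m] by blast
  \<comment> \<open>\<open>F\<close> bounds both the total time of the inner programs and the sum of
    their results.\<close>
  define F where "F x = (\<Sum>i<m. fast (k i) (x + 1))" for x
  define B where "B x = F x + (fast l (F x + 1) + (2 * F x + m))" for x
  have "majorized F" unfolding F_def by (intro majorized_sum majorized_intros)
  then have majB: "majorized B" unfolding B_def by (intro majorized_intros)
  have "computes (CSeq Q (CSeq G R)) (\<lambda>xs. g (map (\<lambda>f. f xs) fs)) ins out b B"
  proof (rule computesI[OF majB])
    fix s :: "nat \<Rightarrow> nat" assume s: "\<And>r. b \<le> r \<Longrightarrow> s r = 0" "s out = 0"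
    let ?x = "sum_list (map s ins)"
    have Sm: "map (S s m) [b..<b + m] = map (\<lambda>f. f (map s ins)) fs"
      by (rule nth_equalityI) (auto simp: S_def m_def)
    have val: "(fs ! j) (map s ins) \<le> fast (k j) (?x + 1)" if "j < m" for j
      by (rule computes_value[OF P[OF that] _ _ _ refl]) (use s ins(2) that in fastforce)+
    have "sum_list (map (S s m) [b..<b + m]) = (\<Sum>j<m. (fs ! j) (map s ins))"
      unfolding Sm by (simp add: sum_list_sum_nth atLeast0LessThan m_def)
    also have "\<dots> \<le> F ?x" unfolding F_def by (intro sum_mono val) simp
    finally have sumF: "sum_list (map (S s m) [b..<b + m]) \<le> F ?x" .
    have e1: "exec Q s (F ?x) (S s m)" using Q[of s] s(1) by (simp add: F_def)
    have z: "\<forall>r\<ge>b + m. S s m r = 0" "S s m out = 0" using s ins by (auto simp: S_def)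
    define s2 where "s2 = (S s m)(out := g (map (S s m) [b..<b + m]))"
    have e2: "exec G (S s m) (fast l (F ?x + 1)) s2"
      by (rule exec_mono[OF computesD[OF G _ z(2) refl s2_def[symmetric]]])
        (use z sumF in \<open>auto intro: fast_mono\<close>)
    have "(\<Sum>j<m. 2 * s2 (b + j) + 1) \<le> 2 * F ?x + m"
    proof -
      have "(\<Sum>j<m. 2 * s2 (b + j) + 1) = (\<Sum>j<m. 2 * (fs ! j) (map s ins) + 1)"
        using ins by (intro sum.cong) (auto simp: s2_def S_def)
      also have "\<dots> = 2 * (\<Sum>j<m. (fs ! j) (map s ins)) + m" by (rule sum_double_Suc)
      also have "\<dots> \<le> 2 * F ?x + m" unfolding F_def by (intro add_mono mult_left_mono sum_mono val) auto
      finally show ?thesis .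
    qed
    then have e3: "exec R s2 (2 * F ?x + m) (\<lambda>r. if b \<le> r \<and> r < b + m then 0 else s2 r)"
      using R exec_mono by blast
    have "(\<lambda>r. if b \<le> r \<and> r < b + m then 0 else s2 r) = s(out := g (map (\<lambda>f. f (map s ins)) fs))"
      using s ins unfolding s2_def Sm by (auto simp: S_def)
    then show "exec (CSeq Q (CSeq G R)) s (B ?x) (s(out := g (map (\<lambda>f. f (map s ins)) fs)))"
      unfolding B_def using exec_Seq[OF e1 exec_Seq[OF e2 e3]] by simp
  qed
  then show "\<exists>P B. computes P (\<lambda>xs. g (map (\<lambda>f. f xs) fs)) ins out b B" by blast
qed

text \<open>Counter \<open>b\<close> holds the remaining rounds, \<open>b + 1\<close> the index,
  \<open>b + 2\<close> the accumulator and \<open>b + 3\<close> the new value. The time of a round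
  depends on the accumulator, so a uniform bound on all accumulators is required; it is an iteration
  of a majorized function, hence majorized.\<close>

lemma computable_rec:
  assumes f: "computable f n" and g: "computable g (Suc (Suc n))"
  shows "computable (\<lambda>xs. rec_nat (f (tl xs)) (\<lambda>k r. g (r # k # tl xs)) (hd xs)) (Suc n)"
    (is "computable ?h _")
proof (rule computableI)
  fix ins :: "nat list" and out b :: nat
  assume ins: "length ins = Suc n" "\<And>r. r \<in> set ins \<Longrightarrow> r < b \<and> r \<noteq> out" "out < b"
  obtain c ys where cy: "ins = c # ys" "length ys = n" using ins(1) by (cases ins) auto
  have ysb: "r < b" if "r \<in> set ys" for r using ins(2)[of r] that cy by auto
  have cb: "c < b" "c \<noteq> out" using ins(2)[of c] cy by auto
  obtain P k where P: "computes P f ys (b + 2) (b + 4) (\<lambda>x. fast k (x + 1))"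
    using computableD[OF f cy(2), of "b + 4" "b + 2"] ysb by force
  obtain G l where G: "computes G g ((b + 2) # (b + 1) # ys) (b + 3) (b + 4) (\<lambda>x. fast l (x + 1))"
    using computableD[OF g, of "(b + 2) # (b + 1) # ys" "b + 4" "b + 3"] ysb cy(2) by force
  define body where "body = CSeq G (CSeq (clear (b + 2)) (CSeq (move_to (b + 3) (b + 2)) (CInc (b + 1))))"
  define prog where "prog = CSeq (copy_to c b (b + 3)) (CSeq P (CSeq (CLoop b body)
    (CSeq (move_to (b + 2) out) (clear (b + 1)))))"
  \<comment> \<open>\<open>H\<close> bounds the growth in one round of the sum of accumulator, index
    and parameters; \<open>Z\<close> bounds the initial sum and the number of rounds. Iterating,
    \<open>W\<close> bounds that sum in every round.\<close>
  define H where "H z = z + fast l (z + 1) + 1" for z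
  define Z where "Z x = fast k (x + 1) + x" for x
  define W where "W x = (H ^^ Z x) (Z x)" for x
  define T where "T x = fast l (W x + 1) + ((2 * W x + 1) + ((3 * W x + 1) + 1))" for x
  define B where "B x = (7 * x + 2) + (fast k (x + 1) + ((x * (T x + 2) + 1) +
    ((3 * W x + 1) + (2 * x + 1))))" for x
  have "majorized H" unfolding H_def by (intro majorized_intros)
  moreover have "majorized Z" unfolding Z_def by (intro majorized_intros)
  ultimately have "majorized W" unfolding W_def
    by (intro majorized_comp[of "\<lambda>z. (H ^^ z) z" Z] majorized_iter majorized_id)
  then have "majorized T" unfolding T_def by (intro majorized_intros)
  then have majB: "majorized B" unfolding B_def using \<open>majorized W\<close> by (intro majorized_intros)
  have "computes prog ?h ins out b B"
  proof (rule computesI[OF majB])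
    fix s :: "nat \<Rightarrow> nat" assume s: "\<And>r. b \<le> r \<Longrightarrow> s r = 0" "s out = 0"
    let ?x = "sum_list (map s ins)" and ?y = "map s ys"
    define R where "R i = rec_nat (f ?y) (\<lambda>k r. g (r # k # ?y)) i" for i
    define N where "N = s c"
    have x: "?x = N + sum_list ?y" by (simp add: cy N_def)
    define S where "S i = s(b := N - i, b + 1 := i, b + 2 := R i)" for i
    have ysS: "map (S i) ys = ?y" "map ((S i)(b := j)) ys = ?y" for i j
      by (auto simp: S_def dest: ysb)
    have Gv: "g (r # i # ?y) \<le> fast l (r + i + sum_list ?y + 1)" for r i
    proof -
      let ?s = "s(b + 2 := r, b + 1 := i)"
      have "map ?s ys = ?y" by (auto dest: ysb)
      then have "g (r # i # ?y) \<le> fast l (sum_list (r # i # ?y) + 1)"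
        using s ysb by (intro computes_value[OF G, of ?s]) auto
      then show ?thesis by (simp add: add.assoc)
    qed
    have Fv: "f ?y \<le> fast k (sum_list ?y + 1)"
      by (rule computes_value[OF P _ _ _ refl]) (use s ysb in force)+
    have HZ: "R i + i + sum_list ?y \<le> (H ^^ i) (Z ?x)" for i
    proof (induction i)
      case 0
      have "fast k (sum_list ?y + 1) \<le> fast k (?x + 1)" by (rule fast_mono) (simp_all add: x)
      then show ?case using Fv by (simp add: R_def Z_def x)
    next
      case (Suc i)
      have "R (Suc i) \<le> fast l (R i + i + sum_list ?y + 1)" using Gv by (simp add: R_def)
      also have "\<dots> \<le> fast l ((H ^^ i) (Z ?x) + 1)" by (rule fast_mono) (use Suc in auto)
      finally have "R (Suc i) \<le> fast l ((H ^^ i) (Z ?x) + 1)" .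
      moreover have "(H ^^ Suc i) (Z ?x) = (H ^^ i) (Z ?x) + fast l ((H ^^ i) (Z ?x) + 1) + 1"
        by (simp add: H_def)
      ultimately show ?case using Suc by linarith
    qed
    have RW: "R i + i + sum_list ?y \<le> W ?x" if "i \<le> N" for i
    proof -
      have "i \<le> Z ?x" using that by (simp add: Z_def x)
      then have "(H ^^ i) (Z ?x) \<le> W ?x"
        unfolding W_def by (intro funpow_mono_iter) (simp_all add: H_def)
      then show ?thesis using HZ[of i] by simp
    qed
    have e1: "exec (copy_to c b (b + 3)) s (7 * ?x + 2) (s(b := N))"
      using exec_mono[OF exec_copy_to[of c b "b + 3" s], of "7 * ?x + 2"] cb s by (auto simp: N_def cy)
    have e2: "exec P (s(b := N)) (fast k (?x + 1)) (S 0)"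
    proof -
      have "map (s(b := N)) ys = ?y" by (auto dest: ysb)
      moreover have "(s(b := N))(b + 2 := f ?y) = S 0" using s by (auto simp: S_def R_def)
      ultimately have "exec P (s(b := N)) (fast k (sum_list ?y + 1)) (S 0)"
        using s by (intro computesD[OF P]) auto
      then show ?thesis by (rule exec_mono) (auto intro: fast_mono simp: x)
    qed
    have "pure G" using computes_pure[OF G] .
    then have "pure body" by (simp add: body_def clear_def move_to_def)
    have "exec (CLoop b body) (S 0) (N * (T ?x + 2) + 1) (S N)"
    proof (rule exec_Loop)
      fix i assume i: "i < N"
      let ?s = "(S i)(b := N - Suc i)"
      let ?r = "g (R i # i # ?y)"
      have Wi: "R i + i + sum_list ?y \<le> W ?x" "R (Suc i) + Suc i + sum_list ?y \<le> W ?x"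
        using RW[of i] RW[of "Suc i"] i by simp_all
      have r: "?r = R (Suc i)" by (simp add: R_def)
      have b1: "exec G ?s (fast l (W ?x + 1)) (?s(b + 3 := ?r))"
      proof -
        have "map ?s ((b + 2) # (b + 1) # ys) = R i # i # ?y" using ysS(2) by (simp add: S_def)
        then have "exec G ?s (fast l (sum_list (R i # i # ?y) + 1)) (?s(b + 3 := ?r))"
          using s by (intro computesD[OF G]) (auto simp: S_def)
        then show ?thesis by (rule exec_mono) (use Wi in \<open>auto intro!: fast_mono\<close>)
      qed
      have b2: "exec (clear (b + 2)) (?s(b + 3 := ?r)) (2 * W ?x + 1) (?s(b + 3 := ?r, b + 2 := 0))"
        using exec_mono[OF exec_clear[of "b + 2" "?s(b + 3 := ?r)"]] Wi by (auto simp: S_def)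
      have b3: "exec (move_to (b + 3) (b + 2)) (?s(b + 3 := ?r, b + 2 := 0)) (3 * W ?x + 1)
          (?s(b + 3 := 0, b + 2 := ?r))"
        using exec_mono[OF exec_move_to[of "b + 3" "b + 2" "?s(b + 3 := ?r, b + 2 := 0)"], of "3 * W ?x + 1"] Wi r
        by (auto simp: fun_upd_twist)
      have "(?s(b + 3 := 0, b + 2 := ?r)) (b + 1) = i" by (simp add: S_def)
      then have b4: "exec (CInc (b + 1)) (?s(b + 3 := 0, b + 2 := ?r)) 1 (?s(b + 3 := 0, b + 2 := ?r, b + 1 := Suc i))"
        using exec_Inc[of "b + 1" "?s(b + 3 := 0, b + 2 := ?r)"] by simp
      have "?s(b + 3 := 0, b + 2 := ?r, b + 1 := Suc i) = S (Suc i)"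
        using s r by (auto simp: S_def fun_eq_iff)
      then show "exec body ?s (T ?x) (S (Suc i))"
        using exec_Seq[OF b1 exec_Seq[OF b2 exec_Seq[OF b3 b4]]] by (simp add: body_def T_def)
    qed (use \<open>pure body\<close> in \<open>auto simp: S_def\<close>)
    then have e3: "exec (CLoop b body) (S 0) (?x * (T ?x + 2) + 1) (S N)"
    proof (rule exec_mono)
      show "N * (T ?x + 2) + 1 \<le> ?x * (T ?x + 2) + 1"
        by (intro add_right_mono mult_right_mono) (simp_all add: x)
    qed
    have e4: "exec (move_to (b + 2) out) (S N) (3 * W ?x + 1) ((S N)(b + 2 := 0, out := R N))"
      using exec_mono[OF exec_move_to[of "b + 2" out "S N"], of "3 * W ?x + 1"] RW[of N] ins s by (auto simp: S_def)
    have e5: "exec (clear (b + 1)) ((S N)(b + 2 := 0, out := R N)) (2 * ?x + 1)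
        ((S N)(b + 2 := 0, out := R N, b + 1 := 0))"
      using exec_mono[OF exec_clear[of "b + 1" "(S N)(b + 2 := 0, out := R N)"]] ins by (auto simp: S_def x)
    have "(S N)(b + 2 := 0, out := R N, b + 1 := 0) = s(out := R N)"
      using s ins by (auto simp: S_def fun_eq_iff)
    then have "exec prog s (B ?x) (s(out := R N))"
      unfolding prog_def B_def using exec_Seq[OF e1 exec_Seq[OF e2 exec_Seq[OF e3 exec_Seq[OF e4 e5]]]] by simp
    then show "exec prog s (B ?x) (s(out := ?h (map s ins)))" by (simp add: R_def N_def cy)
  qed
  then show "\<exists>P B. computes P ?h ins out b B" by blast
qed

lemma prim_rec_computable: "prim_rec f \<Longrightarrow> computable f n"
proof (induction arbitrary: n rule: prim_rec.induct)
  case (zero n)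
  show ?case by (rule computable_zero)
next
  case (succ n)
  show ?case
  proof (cases n)
    case 0
    show ?thesis unfolding 0
      by (rule computable_eq[OF computable_Suc[OF computable_zero]]) (simp split: list.split)
  next
    case (Suc m)
    show ?thesis unfolding Suc
      by (rule computable_eq[OF computable_Suc[OF computable_nth[of 0]]]) (auto split: list.split)
  qed
next
  case (proj i n)
  show ?case
    by (cases "i < n") (auto intro: computable_eq[OF computable_nth] computable_eq[OF computable_zero])
next
  case (comp g fs n)
  then show ?case by (intro computable_comp) auto
next
  case (rec f g n)
  show ?case
  proof (cases n)
    case 0
    then show ?thesis using rec.IH(1)[of 0] by (auto intro: computable_eq)
  next
    case (Suc m)
    show ?thesis unfolding Suc
      by (rule computable_eq[OF computable_rec[OF rec.IH]]) (auto simp: length_Suc_conv)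
  qed
qed

lemma prim_rec1_majorized: "prim_rec1 p \<Longrightarrow> majorized p"
proof -
  assume "prim_rec1 p"
  then obtain f where f: "prim_rec f" "\<And>n. p n = f [n]" by (auto simp: prim_rec1_def)
  obtain P k where P: "computes P f [0] 1 2 (\<lambda>x. fast k (x + 1))"
    using computableD[OF prim_rec_computable[OF f(1), of 1], of "[0]" 2 1] by auto
  have "p x \<le> fast k (x + 1)" for x
    using computes_value[OF P, of "(\<lambda>_. 0)(0 := x)" "[x]"] f(2) by simp
  then show ?thesis unfolding majorized_def by blast
qed

text \<open>Unbounded search for the least zero of \<open>f\<close>, followed by a primitive recursive function.\<close>

lemma search_program:
  assumes f: "prim_rec f" and g: "prim_rec g"
  shows "\<exists>C B. majorized B \<and> (\<forall>x n. f [x, n] = 0 \<longrightarrow> (\<forall>m<n. f [x, m] \<noteq> 0) \<longrightarrow>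
    exec C ((\<lambda>_. 0)(0 := x)) (B (x + n)) ((\<lambda>_. 0)(4 := g [x, n])))"
proof -
  have ins: "r < 5 \<and> r \<noteq> 2" "r < 5 \<and> r \<noteq> 4" if "r \<in> set [0, 1]" for r :: nat using that by auto
  obtain P k where P: "computes P f [0, 1] 2 5 (\<lambda>x. fast k (x + 1))"
    using computableD[where ins = "[0, 1]", OF prim_rec_computable[OF f] refl ins(1)] by auto
  obtain Q l where Q: "computes Q g [0, 1] 4 5 (\<lambda>x. fast l (x + 1))"
    using computableD[where ins = "[0, 1]", OF prim_rec_computable[OF g] refl ins(2)] by auto
  \<comment> \<open>Counter 3 is a flag that keeps the outer loop running and counter 1 is the
    candidate. If the value of \<open>f\<close> in counter 2 is nonzero, \<open>inner\<close> runs
    exactly once, as it clears this counter; it sets the flag and moves to the next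
    candidate.\<close>
  define inner where "inner = CSeq (clear 2) (CSeq (CInc 3) (CInc 1))"
  define body where "body = CSeq P (CLoop 2 inner)"
  define T where "T x = fast k (x + 1) + ((2 * fast k (x + 1) + 1 + (1 + 1)) + 1 + 2)" for x
  define B where "B x = 1 + (((x + 1) * (T x + 2) + 1) + (fast l (x + 1) + ((2 * x + 1) + (2 * x + 1))))" for x
  have "majorized T" unfolding T_def by (intro majorized_intros)
  then have majB: "majorized B" unfolding B_def by (intro majorized_intros)
  have pureP: "pure P" using computes_pure[OF P] .
  define S where "S x i j = ((\<lambda>_ :: nat. 0 :: nat)(0 := x, 1 := i, 3 := j))" for x i j
  have T_mono: "T x \<le> T y" if "x \<le> y" for x y
    unfolding T_def using fast_mono[of k k "x+1" "y+1"] that by simp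
  have bodyP: "exec P (S x i 0) (fast k (x + i + 1)) ((S x i 0)(2 := f [x, i]))" for x i
  proof -
    have "exec P (S x i 0) (fast k (sum_list [x, i] + 1)) ((S x i 0)(2 := f [x, i]))"
      by (intro computesD[OF P]) (auto simp: S_def)
    then show ?thesis by simp
  qed
  have fv: "f [x, i] \<le> fast k (x + i + 1)" for x i
    using computes_value[OF P, of "S x i 0" "[x, i]"] by (simp add: S_def)
  have step: "exec body (S x i 0) (T (x + i)) (S x (Suc i) 1)" if nz: "f [x, i] \<noteq> 0" for x i
  proof -
    let ?s = "(S x i 0)(2 := f [x, i])"
    obtain v where v: "f [x, i] = Suc v" using nz by (cases "f [x, i]") auto
    have "exec inner (?s(2 := v)) (2 * v + 1 + (1 + 1)) (S x (Suc i) 1)"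
    proof -
      have "exec (clear 2) (?s(2 := v)) (2 * v + 1) (S x i 0)"
      proof -
        have "?s(2 := v, 2 := 0) = S x i 0" by (rule ext) (simp add: S_def)
        then show ?thesis using exec_clear[of 2 "?s(2 := v)"] by simp
      qed
      moreover have "exec (CInc 3) (S x i 0) 1 (S x i 1)"
      proof -
        have "(S x i 0)(3 := Suc (S x i 0 3)) = S x i 1" by (rule ext) (simp add: S_def)
        then show ?thesis using exec_Inc[of 3 "S x i 0"] by simp
      qed
      moreover have "exec (CInc 1) (S x i 1) 1 (S x (Suc i) 1)"
      proof -
        have "(S x i 1)(1 := Suc (S x i 1 1)) = S x (Suc i) 1" by (rule ext) (simp add: S_def)
        then show ?thesis using exec_Inc[of 1 "S x i 1"] by simp
      qed
      ultimately show ?thesis unfolding inner_def by (intro exec_Seq)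
    qed
    moreover have "exec (CLoop 2 inner) (S x (Suc i) 1) 1 (S x (Suc i) 1)"
      by (rule exec_Loop_0) (auto simp: S_def inner_def clear_def)
    ultimately have "exec (CLoop 2 inner) ?s ((2 * v + 1 + (1 + 1)) + 1 + 2) (S x (Suc i) 1)"
      by (intro exec_Loop_Suc) (auto simp: v)
    then have "exec body (S x i 0) (fast k (x + i + 1) + ((2 * v + 1 + (1 + 1)) + 1 + 2)) (S x (Suc i) 1)"
      unfolding body_def using exec_Seq[OF bodyP] by blast
    then show ?thesis by (rule exec_mono) (use fv[of x i] v in \<open>simp add: T_def\<close>)
  qed
  have stop: "exec body (S x i 0) (T (x + i)) (S x i 0)" if "f [x, i] = 0" for x i
  proof -
    have "(S x i 0)(2 := f [x, i]) = S x i 0" using that by (intro ext) (simp add: S_def)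
    moreover have "exec (CLoop 2 inner) (S x i 0) 1 (S x i 0)"
      by (rule exec_Loop_0) (auto simp: S_def inner_def clear_def)
    ultimately have "exec body (S x i 0) (fast k (x + i + 1) + 1) (S x i 0)"
      unfolding body_def using exec_Seq bodyP by metis
    then show ?thesis by (rule exec_mono) (simp add: T_def)
  qed
  define C where "C = CSeq (CInc 3) (CSeq (CLoop 3 body) (CSeq Q (CSeq (clear 0) (clear 1))))"
  have "exec C ((\<lambda>_. 0)(0 := x)) (B (x + n)) ((\<lambda>_. 0)(4 := g [x, n]))"
    if n: "f [x, n] = 0" "\<forall>m<n. f [x, m] \<noteq> 0" for x n
  proof -
    have S3: "S x i 1 3 = Suc 0" "(S x i 1)(3 := 0) = S x i 0" for i by (auto simp: S_def)
    have "exec (CLoop 3 body) (S x (n - j) 1) (Suc j * (T (x + n) + 2) + 1) (S x n 0)" if "j \<le> n" for j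
      using that
    proof (induction j)
      case 0
      have "exec body ((S x n 1)(3 := 0)) (T (x + n)) (S x n 0)" using stop[OF n(1)] S3 by simp
      moreover have "exec (CLoop 3 body) (S x n 0) 1 (S x n 0)"
        by (rule exec_Loop_0) (auto simp: S_def body_def inner_def clear_def pureP)
      ultimately have "exec (CLoop 3 body) (S x n 1) (T (x + n) + 1 + 2) (S x n 0)"
        using S3(1) by (intro exec_Loop_Suc[where n = 0]) auto
      then show ?case by simp
    next
      case (Suc j)
      let ?i = "n - Suc j"
      have "exec body ((S x ?i 1)(3 := 0)) (T (x + ?i)) (S x (Suc ?i) 1)"
        using step[of x ?i] n(2) Suc.prems S3 by simp
      then have "exec body ((S x ?i 1)(3 := 0)) (T (x + n)) (S x (n - j) 1)"
        using T_mono[of "x + ?i" "x + n"] Suc.prems by (auto elim: exec_mono simp: Suc_diff_Suc)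
      then have "exec (CLoop 3 body) (S x ?i 1) (T (x + n) + (Suc j * (T (x + n) + 2) + 1) + 2) (S x n 0)"
        using S3(1) Suc by (intro exec_Loop_Suc[where n = 0]) auto
      then show ?case by (simp add: algebra_simps)
    qed
    from this[of n] have e2: "exec (CLoop 3 body) (S x 0 1) (Suc n * (T (x + n) + 2) + 1) (S x n 0)" by simp
    have e1: "exec (CInc 3) ((\<lambda>_. 0)(0 := x)) 1 (S x 0 1)"
    proof -
      have "((\<lambda>_ :: nat. 0)(0 := x))(3 := Suc (((\<lambda>_ :: nat. 0)(0 := x)) 3)) = S x 0 1" by (rule ext) (simp add: S_def)
      then show ?thesis using exec_Inc[of 3 "(\<lambda>_. 0)(0 := x)"] by simp
    qed
    have e3: "exec Q (S x n 0) (fast l (x + n + 1)) ((S x n 0)(4 := g [x, n]))"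
    proof -
      have "exec Q (S x n 0) (fast l (sum_list [x, n] + 1)) ((S x n 0)(4 := g [x, n]))"
        by (intro computesD[OF Q]) (auto simp: S_def)
      then show ?thesis by simp
    qed
    have e4: "exec (clear 0) ((S x n 0)(4 := g [x, n])) (2 * x + 1) ((S x n 0)(4 := g [x, n], 0 := 0))"
      using exec_clear[of 0 "(S x n 0)(4 := g [x, n])"] by (simp add: S_def)
    have e5: "exec (clear 1) ((S x n 0)(4 := g [x, n], 0 := 0)) (2 * n + 1) ((\<lambda>_. 0)(4 := g [x, n]))"
    proof -
      have "(S x n 0)(4 := g [x, n], 0 := 0, 1 := 0) = (\<lambda>_. 0)(4 := g [x, n])" by (rule ext) (simp add: S_def)
      then show ?thesis
        using exec_clear[of 1 "(S x n 0)(4 := g [x, n], 0 := 0)"] by (simp add: S_def)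
    qed
    have le: "Suc n * (T (x + n) + 2) \<le> (x + n + 1) * (T (x + n) + 2)"
      by (intro mult_right_mono) auto
    from exec_Seq[OF e1 exec_Seq[OF e2 exec_Seq[OF e3 exec_Seq[OF e4 e5]]]]
    show ?thesis unfolding C_def by (rule exec_mono) (use le in \<open>simp add: B_def\<close>)
  qed
  then show ?thesis using majB by blast
qed

section \<open>Compilation to jumping code\<close>

datatype instr = IInc nat nat | IIncIf nat nat | IDec nat nat nat | IJmp nat | IMove move nat | IScan nat nat

fun instr_step :: "bool list \<Rightarrow> instr \<Rightarrow> (nat \<Rightarrow> nat) \<times> int \<Rightarrow> nat \<times> (nat \<Rightarrow> nat) \<times> int" where
  "instr_step w (IInc c l) (s, h) = (l, s(c := Suc (s c)), h)"
| "instr_step w (IIncIf c l) (s, h) = (l, if symbol w h = 2 then s(c := Suc (s c)) else s, h)"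
| "instr_step w (IDec c l l') (s, h) = (if s c = 0 then (l', s, h) else (l, s(c := s c - 1), h))"
| "instr_step w (IJmp l) (s, h) = (l, s, h)"
| "instr_step w (IMove m l) (s, h) = (l, s, h + offset m)"
| "instr_step w (IScan l l') (s, h) = (if symbol w h = 0 then (l', s, h) else (l, s, h))"

definition code_step ::
  "bool list \<Rightarrow> instr list \<Rightarrow> nat \<times> (nat \<Rightarrow> nat) \<times> int \<Rightarrow> nat \<times> (nat \<Rightarrow> nat) \<times> int" where
  "code_step w cs x = (if fst x < length cs then instr_step w (cs ! fst x) (snd x) else x)"

fun code_size :: "com \<Rightarrow> nat" where
  "code_size CSkip = 0"
| "code_size (CLoop c P) = code_size P + 2"
| "code_size (CScan P) = code_size P + 2"
| "code_size (CSeq P Q) = code_size P + code_size Q"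
| "code_size _ = 1"

text \<open>Jumps are absolute; the code placed at \<open>p\<close> is left at its end
  \<open>p + code_size P\<close>.\<close>

fun compile :: "nat \<Rightarrow> com \<Rightarrow> instr list" where
  "compile p CSkip = []"
| "compile p (CInc c) = [IInc c (Suc p)]"
| "compile p (CIncIf c) = [IIncIf c (Suc p)]"
| "compile p (CMove m) = [IMove m (Suc p)]"
| "compile p (CLoop c P) = IDec c (Suc p) (p + code_size P + 2) # compile (Suc p) P @ [IJmp p]"
| "compile p (CScan P) = IScan (Suc p) (p + code_size P + 2) # compile (Suc p) P @ [IJmp p]"
| "compile p (CSeq P Q) = compile p P @ compile (p + code_size P) Q"

lemma length_compile: "length (compile p P) = code_size P"
  by (induction p P rule: compile.induct) auto

definition code_at :: "instr list \<Rightarrow> nat \<Rightarrow> instr list \<Rightarrow> bool" where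
  "code_at cs p ds \<longleftrightarrow> (\<forall>i<length ds. p + i < length cs \<and> cs ! (p + i) = ds ! i)"

lemma code_at_Cons: "code_at cs p (d # ds) \<longleftrightarrow> p < length cs \<and> cs ! p = d \<and> code_at cs (Suc p) ds"
  unfolding code_at_def by (auto simp: less_Suc_eq_0_disj all_conj_distrib)

lemma code_at_append: "code_at cs p (ds @ es) \<longleftrightarrow> code_at cs p ds \<and> code_at cs (p + length ds) es"
proof (induction ds arbitrary: p)
  case Nil
  then show ?case by (simp add: code_at_def)
next
  case (Cons d ds)
  then show ?case by (simp add: code_at_Cons)
qed

lemma code_step_at: "code_at cs p (d # ds) \<Longrightarrow> code_step w cs (p, \<sigma>) = instr_step w d \<sigma>"
  by (simp add: code_at_Cons code_step_def)

lemma funpow_trans: "(f ^^ m) x = y \<Longrightarrow> (f ^^ n) y = z \<Longrightarrow> (f ^^ (m + n)) x = z"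
  by (subst add.commute) (simp add: funpow_add)

lemma compile_correct:
  "big_step w P \<sigma> t \<sigma>' \<Longrightarrow> code_at cs p (compile p P) \<Longrightarrow>
    (code_step w cs ^^ t) (p, \<sigma>) = (p + code_size P, \<sigma>')"
proof (induction arbitrary: p rule: big_step.induct)
  case (LoopT s c n P h t \<sigma> t' \<sigma>')
  from LoopT.prems have c: "code_at cs (Suc p) (compile (Suc p) P)"
    "code_at cs (Suc p + code_size P) [IJmp p]"
    by (simp_all add: code_at_Cons code_at_append length_compile)
  have s1: "(code_step w cs ^^ 1) (p, s, h) = (Suc p, s(c := n), h)"
    using LoopT.hyps(1) by (simp add: code_step_at[OF LoopT.prems[simplified]])
  have s2: "(code_step w cs ^^ t) (Suc p, s(c := n), h) = (Suc p + code_size P, \<sigma>)"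
    by (rule LoopT.IH(1)[OF c(1)])
  have s3: "(code_step w cs ^^ 1) (Suc p + code_size P, \<sigma>) = (p, \<sigma>)"
    using code_step_at[OF c(2), of w \<sigma>] by (cases \<sigma>) simp
  have s4: "(code_step w cs ^^ t') (p, \<sigma>) = (p + code_size (CLoop c P), \<sigma>')"
    by (rule LoopT.IH(2)[OF LoopT.prems])
  from funpow_trans[OF s1 funpow_trans[OF s2 funpow_trans[OF s3 s4]]]
  show ?case by (simp add: add.commute add.left_commute)
next
  case (ScanT h P s t \<sigma> t' \<sigma>')
  from ScanT.prems have c: "code_at cs (Suc p) (compile (Suc p) P)"
    "code_at cs (Suc p + code_size P) [IJmp p]"
    by (simp_all add: code_at_Cons code_at_append length_compile)
  have s1: "(code_step w cs ^^ 1) (p, s, h) = (Suc p, s, h)"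
    using ScanT.hyps(1) by (simp add: code_step_at[OF ScanT.prems[simplified]])
  have s2: "(code_step w cs ^^ t) (Suc p, s, h) = (Suc p + code_size P, \<sigma>)"
    by (rule ScanT.IH(1)[OF c(1)])
  have s3: "(code_step w cs ^^ 1) (Suc p + code_size P, \<sigma>) = (p, \<sigma>)"
    using code_step_at[OF c(2), of w \<sigma>] by (cases \<sigma>) simp
  have s4: "(code_step w cs ^^ t') (p, \<sigma>) = (p + code_size (CScan P), \<sigma>')"
    by (rule ScanT.IH(2)[OF ScanT.prems])
  from funpow_trans[OF s1 funpow_trans[OF s2 funpow_trans[OF s3 s4]]]
  show ?case by (simp add: add.commute add.left_commute)
next
  case (Seq P \<sigma> t \<sigma>' Q t' \<sigma>'')
  then have "(code_step w cs ^^ t) (p, \<sigma>) = (p + code_size P, \<sigma>')"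
    "(code_step w cs ^^ t') (p + code_size P, \<sigma>') = (p + code_size P + code_size Q, \<sigma>'')"
    by (simp_all add: code_at_append length_compile)
  from funpow_trans[OF this] show ?case by (simp add: add.assoc)
qed (auto simp: code_step_at)

fun instr_targets :: "instr \<Rightarrow> nat set" where
  "instr_targets (IInc c l) = {l}"
| "instr_targets (IIncIf c l) = {l}"
| "instr_targets (IDec c l l') = {l, l'}"
| "instr_targets (IJmp l) = {l}"
| "instr_targets (IMove m l) = {l}"
| "instr_targets (IScan l l') = {l, l'}"

fun instr_counter :: "instr \<Rightarrow> nat" where
  "instr_counter (IInc c l) = c"
| "instr_counter (IIncIf c l) = c"
| "instr_counter (IDec c l l') = c"
| "instr_counter _ = 0"

lemma compile_targets: "i \<in> set (compile p P) \<Longrightarrow> l \<in> instr_targets i \<Longrightarrow> l \<le> p + code_size P"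
  by (induction p P rule: compile.induct) fastforce+


section \<open>Code on multi-tape Turing machines\<close>

text \<open>
  A counter is a tape whose only mark is at position 0 and whose head position is the value.
  The accepting and the rejecting state are the first two locations behind the code; the
  initial state, which writes the marks, is the third.
\<close>

definition keep :: "nat \<Rightarrow> nat list \<Rightarrow> (nat \<Rightarrow> move) \<Rightarrow> (nat \<times> move) list" where
  "keep k xs mv = map (\<lambda>j. (xs ! j, mv j)) [0..<k]"

fun instr_delta :: "nat \<Rightarrow> instr \<Rightarrow> nat list \<Rightarrow> nat \<times> (nat \<times> move) list" where
  "instr_delta k (IInc c l) xs = (l, keep k xs (\<lambda>j. if j = Suc c then Right else Stay))"
| "instr_delta k (IIncIf c l) xs =
     (l, keep k xs (\<lambda>j. if j = Suc c \<and> xs ! 0 = 2 then Right else Stay))"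
| "instr_delta k (IDec c l l') xs =
     (if xs ! Suc c = 1 then (l', keep k xs (\<lambda>_. Stay))
      else (l, keep k xs (\<lambda>j. if j = Suc c then Left else Stay)))"
| "instr_delta k (IJmp l) xs = (l, keep k xs (\<lambda>_. Stay))"
| "instr_delta k (IMove m l) xs = (l, keep k xs (\<lambda>j. if j = 0 then m else Stay))"
| "instr_delta k (IScan l l') xs = (if xs ! 0 = 0 then l' else l, keep k xs (\<lambda>_. Stay))"

definition code_tm :: "nat \<Rightarrow> instr list \<Rightarrow> tm" where
  "code_tm N cs = \<lparr>num_tapes = Suc N, num_symbols = 3, num_states = length cs + 3,
     start_state = length cs + 2, accept_state = length cs, reject_state = length cs + 1,
     delta = (\<lambda>q xs. if q < length cs then instr_delta (Suc N) (cs ! q) xs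
        else (0, (xs ! 0, Stay) # replicate N (1, Stay)))\<rparr>"

text \<open>Jumps may lead to the accepting and to the rejecting location behind the code, but not
  to the initial one.\<close>

definition code_wf :: "nat \<Rightarrow> instr list \<Rightarrow> bool" where
  "code_wf N cs \<longleftrightarrow> (\<forall>i\<in>set cs. instr_counter i < N \<and> (\<forall>l\<in>instr_targets i. l \<le> length cs + 1))"

lemma fst_instr_delta: "fst (instr_delta k i xs) \<in> instr_targets i"
  by (cases i) auto

lemma snd_instr_delta: "\<exists>mv. snd (instr_delta k i xs) = keep k xs mv"
  by (cases i) auto

lemma code_tm_wf:
  assumes "code_wf N cs"
  shows "wf_tm (code_tm N cs)"
proof -
  let ?M = "code_tm N cs"
  have "q' < num_states ?M \<and> length as = num_tapes ?M \<and> fst ` set as \<subseteq> {..<num_symbols ?M}"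
    if q: "q < num_states ?M" and xs: "length xs = num_tapes ?M" "set xs \<subseteq> {..<num_symbols ?M}"
      and d: "delta ?M q xs = (q', as)" for q xs q' as
  proof (cases "q < length cs")
    case True
    then have d': "instr_delta (Suc N) (cs ! q) xs = (q', as)" using d by (simp add: code_tm_def)
    have "q' \<in> instr_targets (cs ! q)" using fst_instr_delta[of "Suc N" "cs ! q" xs] d' by simp
    then have "q' \<le> length cs + 1" using assms True unfolding code_wf_def by (meson nth_mem)
    moreover obtain mv where "as = keep (Suc N) xs mv" using snd_instr_delta[of "Suc N" "cs ! q" xs] d' by auto
    moreover have "xs ! j < 3" if "j < Suc N" for j
    proof -
      have "xs ! j \<in> set xs" using xs(1) that by (simp add: code_tm_def)
      then show ?thesis using xs(2) by (auto simp: code_tm_def)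
    qed
    ultimately show ?thesis by (auto simp: code_tm_def keep_def)
  next
    case False
    have "xs ! 0 \<in> set xs" using xs(1) by (simp add: code_tm_def)
    then have "xs ! 0 < 3" using xs(2) by (auto simp: code_tm_def)
    then show ?thesis using d False by (auto simp: code_tm_def)
  qed
  moreover have "1 \<le> num_tapes ?M \<and> 3 \<le> num_symbols ?M \<and> start_state ?M < num_states ?M \<and>
      accept_state ?M < num_states ?M \<and> reject_state ?M < num_states ?M \<and> accept_state ?M \<noteq> reject_state ?M"
    by (simp add: code_tm_def)
  ultimately show ?thesis unfolding wf_tm_def by blast
qed

definition mark :: "int \<Rightarrow> nat" where
  "mark i = (if i = 0 then 1 else 0)"

definition tm_of :: "bool list \<Rightarrow> nat \<Rightarrow> nat \<times> (nat \<Rightarrow> nat) \<times> int \<Rightarrow> tm_config" where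
  "tm_of w N x = (fst x, (symbol w, snd (snd x)) # map (\<lambda>c. (mark, int (fst (snd x) c))) [0..<N])"

lemma act_keep: "length ts = k \<Longrightarrow>
  map2 act (keep k (map (\<lambda>(c, h). c h) ts) mv) ts = map (\<lambda>j. (fst (ts ! j), snd (ts ! j) + offset (mv j))) [0..<k]"
  by (rule nth_equalityI) (auto simp: keep_def split: prod.split)

lemma tm_of_eqI:
  assumes "fst x = l" "\<And>c. c < N \<Longrightarrow> int (fst (snd x) c) = int (s c) + offset (mv (Suc c))"
    and "snd (snd x) = h + offset (mv 0)"
  shows "(l, map (\<lambda>j. (fst (((symbol w, h) # map (\<lambda>c. (mark, int (s c))) [0..<N]) ! j),
      snd (((symbol w, h) # map (\<lambda>c. (mark, int (s c))) [0..<N]) ! j) + offset (mv j))) [0..<Suc N]) = tm_of w N x"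
  unfolding tm_of_def using assms
  by (auto intro!: nth_equalityI simp: nth_Cons' simp del: upt_Suc)

text \<open>On the two locations behind the code both the machine and the code stand still. The
  start state lies beyond; there the equation is trivial by the choice of the other branch.\<close>

lemma tm_step_code:
  assumes wf: "code_wf N cs"
  shows "tm_step (code_tm N cs) (tm_of w N (l, s, h)) =
    (if l \<le> length cs + 1 then tm_of w N (code_step w cs (l, s, h)) else tm_step (code_tm N cs) (tm_of w N (l, s, h)))"
proof (cases "l < length cs")
  case True
  let ?ts = "(symbol w, h) # map (\<lambda>c. (mark, int (s c))) [0..<N]"
  let ?xs = "map (\<lambda>(c, h). c h) ?ts"
  have i: "instr_counter (cs ! l) < N" using wf True by (auto simp: code_wf_def)
  have k: "map2 act (keep (Suc N) ?xs mv) ?ts =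
      map (\<lambda>j. (fst (?ts ! j), snd (?ts ! j) + offset (mv j))) [0..<Suc N]" for mv
    by (rule act_keep) simp
  have xs: "?xs ! 0 = symbol w h" "c < N \<Longrightarrow> ?xs ! Suc c = (if s c = 0 then 1 else 0)" for c
    by (simp_all add: mark_def)
  have st: "tm_step (code_tm N cs) (l, ?ts) =
      (fst (instr_delta (Suc N) (cs ! l) ?xs), map2 act (snd (instr_delta (Suc N) (cs ! l) ?xs)) ?ts)"
    using True by (simp add: code_tm_def case_prod_beta del: map_map list.map)
  have "(fst (instr_delta (Suc N) (cs ! l) ?xs), map2 act (snd (instr_delta (Suc N) (cs ! l) ?xs)) ?ts) =
      tm_of w N (instr_step w (cs ! l) (s, h))"
  proof (cases "cs ! l")
    case (IInc c l')
    show ?thesis unfolding IInc instr_delta.simps fst_conv snd_conv k by (rule tm_of_eqI) auto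
  next
    case (IIncIf c l')
    show ?thesis unfolding IIncIf instr_delta.simps fst_conv snd_conv k xs by (rule tm_of_eqI) auto
  next
    case (IDec c l1 l2)
    have c: "c < N" using i IDec by simp
    show ?thesis
    proof (cases "s c = 0")
      case True
      then have e: "?xs ! Suc c = 1" using c by (simp add: mark_def)
      then show ?thesis unfolding IDec instr_delta.simps if_P[OF e] fst_conv snd_conv k
        by (intro tm_of_eqI) (simp_all add: True)
    next
      case False
      then have e: "?xs ! Suc c \<noteq> 1" using c by (simp add: mark_def)
      then show ?thesis unfolding IDec instr_delta.simps if_not_P[OF e] fst_conv snd_conv k
        using False by (intro tm_of_eqI) auto
    qed
  next
    case (IJmp l')
    show ?thesis unfolding IJmp instr_delta.simps fst_conv snd_conv k by (rule tm_of_eqI) auto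
  next
    case (IMove m l')
    show ?thesis unfolding IMove instr_delta.simps fst_conv snd_conv k by (rule tm_of_eqI) auto
  next
    case (IScan l1 l2)
    show ?thesis unfolding IScan instr_delta.simps fst_conv snd_conv k xs by (rule tm_of_eqI) auto
  qed
  then show ?thesis using True st by (simp add: tm_of_def[of w N "(l, s, h)"] code_step_def del: tm_step.simps map_map list.map)
next
  case False
  then show ?thesis by (auto simp: tm_of_def code_step_def code_tm_def)
qed

lemma code_step_bound:
  assumes "code_wf N cs" "fst x \<le> length cs + 1"
  shows "fst (code_step w cs x) \<le> length cs + 1"
proof (cases "fst x < length cs")
  case True
  have "fst (instr_step w i \<sigma>) \<in> instr_targets i" for i \<sigma> by (cases i; cases \<sigma>) auto
  then show ?thesis using assms(1) True unfolding code_step_def code_wf_def by (metis nth_mem)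
qed (use assms in \<open>simp add: code_step_def\<close>)

text \<open>The additional step is the first one, which writes the marks at position 0 of the
  counter tapes.\<close>

lemma tm_steps_code:
  assumes wf: "code_wf N cs"
  shows "(tm_step (code_tm N cs) ^^ Suc t) (tm_init (code_tm N cs) w) =
    tm_of w N ((code_step w cs ^^ t) (0, \<lambda>_. 0, 0)) \<and>
    fst ((code_step w cs ^^ t) (0, \<lambda>_. 0, 0)) \<le> length cs + 1"
proof (induction t)
  case 0
  have sym: "fst (input_tape w) = symbol w" "input_tape w = (symbol w, 0)"
    by (auto simp: input_tape_def symbol_def)
  let ?ts = "(symbol w, 0) # replicate N ((\<lambda>_. 0) :: int \<Rightarrow> nat, 0 :: int)"
  have "map2 act (replicate N (1, Stay)) (replicate N ((\<lambda>_. 0), 0)) = map (\<lambda>c. (mark, int 0)) [0..<N]"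
    by (rule nth_equalityI) (auto simp: mark_def)
  then show ?case
    by (simp add: tm_init_def sym tm_of_def code_tm_def fun_upd_idem)
next
  case (Suc t)
  obtain l s h where x: "(code_step w cs ^^ t) (0, \<lambda>_. 0, 0) = (l, s, h)" by (metis prod_cases3)
  show ?case using Suc tm_step_code[OF wf, of w l s h] code_step_bound[OF wf, of "(l, s, h)" w] by (simp add: x)
qed


section \<open>Reading the input\<close>

lemma symbol_nth: "i < length w \<Longrightarrow> symbol w (int i) = (if w ! i then 2 else 1)"
  by (simp add: symbol_def)

lemma scan_right:
  "i \<le> length w \<Longrightarrow> \<exists>t \<le> 3 * (length w - i) + 1. big_step w (CScan (CMove Right)) (s, int i) t (s, int (length w))"
proof (induction "length w - i" arbitrary: i)
  case 0
  then have "symbol w (int i) = 0" "i = length w" by (auto simp: symbol_def)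
  then show ?case using big_step.ScanF[of w "int i" "CMove Right" s] by auto
next
  case (Suc n)
  then have i: "i < length w" by simp
  have "n = length w - Suc i" using Suc.hyps(2) by simp
  then obtain t where t: "t \<le> 3 * (length w - Suc i) + 1"
    "big_step w (CScan (CMove Right)) (s, int (Suc i)) t (s, int (length w))"
    using Suc.hyps(1)[of "Suc i"] i by auto
  have "big_step w (CMove Right) (s, int i) 1 (s, int (Suc i))"
    using big_step.Move[of w Right s "int i"] by (simp add: add.commute)
  moreover have "symbol w (int i) \<noteq> 0" using i by (simp add: symbol_nth)
  ultimately have "big_step w (CScan (CMove Right)) (s, int i) (1 + t + 2) (s, int (length w))"
    using t(2) big_step.ScanT by blast
  moreover have "1 + t + 2 \<le> 3 * (length w - i) + 1" using t(1) i by linarith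
  ultimately show ?case by blast
qed

lemma exec_double:
  "exec (CSeq (CLoop 0 (CSeq (CInc 1) (CInc 1))) (move_to 1 0)) ((\<lambda>_. 0)(0 := x)) (10 * x + 2) ((\<lambda>_. 0)(0 := 2 * x))"
proof -
  define S where "S i = (\<lambda>_ :: nat. 0 :: nat)(0 := x - i, 1 := 2 * i)" for i
  have "exec (CLoop 0 (CSeq (CInc 1) (CInc 1))) (S 0) (x * (2 + 2) + 1) (S x)"
  proof (rule exec_Loop)
    fix i
    let ?s = "(S i)(0 := x - Suc i)"
    have "(?s(1 := Suc (?s 1)))(1 := Suc ((?s(1 := Suc (?s 1))) 1)) = S (Suc i)"
      by (auto simp: S_def)
    then show "exec (CSeq (CInc 1) (CInc 1)) ?s 2 (S (Suc i))"
      using exec_Seq[OF exec_Inc[of 1 ?s] exec_Inc[of 1]] by (simp add: numeral_2_eq_2)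
  qed (auto simp: S_def)
  moreover have "exec (move_to 1 0) (S x) (3 * (2 * x) + 1) ((\<lambda>_. 0)(0 := 2 * x))"
  proof -
    have "(S x)(1 := 0, 0 := S x 0 + S x 1) = (\<lambda>_. 0)(0 := 2 * x)" by (auto simp: S_def)
    then show ?thesis using exec_move_to[of 1 0 "S x"] by (simp add: S_def)
  qed
  moreover have "S 0 = (\<lambda>_. 0)(0 := x)" by (auto simp: S_def)
  ultimately have "exec (CSeq (CLoop 0 (CSeq (CInc 1) (CInc 1))) (move_to 1 0)) ((\<lambda>_. 0)(0 := x))
      ((x * (2 + 2) + 1) + (3 * (2 * x) + 1)) ((\<lambda>_. 0)(0 := 2 * x))"
    by (metis exec_Seq)
  then show ?thesis by (rule exec_mono) simp
qed

lemma word_num_drop_le: "word_num (drop i w) \<le> word_num w"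
proof (induction w arbitrary: i)
  case (Cons b w)
  show ?case
  proof (cases i)
    case (Suc j)
    then show ?thesis using Cons.IH[of j] by simp
  qed simp
qed simp

text \<open>One round of Horner's rule from the last letter to the first: double the number, then
  add 1 for \<open>False\<close> and 2 for \<open>True\<close>.\<close>

definition read_letter :: com where
  "read_letter = CSeq (CSeq (CLoop 0 (CSeq (CInc 1) (CInc 1))) (move_to 1 0))
    (CSeq (CInc 0) (CSeq (CIncIf 0) (CMove Left)))"

definition load :: com where
  "load = CSeq (CScan (CMove Right)) (CSeq (CMove Left) (CScan read_letter))"

lemma read_letter_correct:
  assumes "i < length w"
  shows "\<exists>t \<le> 10 * word_num w + 5. big_step w read_letter ((\<lambda>_. 0)(0 := word_num (drop (Suc i) w)), int i) t
    ((\<lambda>_. 0)(0 := word_num (drop i w)), int i - 1)"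
proof -
  let ?v = "word_num (drop (Suc i) w)" and ?S = "\<lambda>v. (\<lambda>_ :: nat. 0 :: nat)(0 := v)"
  obtain t where t: "t \<le> 10 * ?v + 2"
    "big_step w (CSeq (CLoop 0 (CSeq (CInc 1) (CInc 1))) (move_to 1 0)) (?S ?v, int i) t (?S (2 * ?v), int i)"
    using exec_double[of ?v] unfolding exec_def by blast
  have b1: "big_step w (CInc 0) (?S (2 * ?v), int i) 1 (?S (2 * ?v + 1), int i)"
    using big_step.Inc[of w 0 "?S (2 * ?v)" "int i"] by simp
  have "word_num (drop i w) = 2 * ?v + (if w ! i then 2 else 1)"
    using assms by (simp add: Cons_nth_drop_Suc[symmetric])
  then have "(if symbol w (int i) = 2 then (?S (2 * ?v + 1))(0 := Suc (?S (2 * ?v + 1) 0)) else ?S (2 * ?v + 1))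
      = ?S (word_num (drop i w))"
    using assms by (auto simp: symbol_nth)
  then have b2: "big_step w (CIncIf 0) (?S (2 * ?v + 1), int i) 1 (?S (word_num (drop i w)), int i)"
    using big_step.IncIf[of w 0 "?S (2 * ?v + 1)" "int i"] by simp
  have b3: "big_step w (CMove Left) (?S (word_num (drop i w)), int i) 1 (?S (word_num (drop i w)), int i - 1)"
    using big_step.Move[of w Left "?S (word_num (drop i w))" "int i"] by simp
  have "big_step w read_letter (?S ?v, int i) (t + (1 + (1 + 1))) (?S (word_num (drop i w)), int i - 1)"
    unfolding read_letter_def by (rule big_step.Seq[OF t(2) big_step.Seq[OF b1 big_step.Seq[OF b2 b3]]])
  moreover have "t + (1 + (1 + 1)) \<le> 10 * word_num w + 5"
    using t(1) word_num_drop_le[of "Suc i" w] by linarith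
  ultimately show ?thesis by blast
qed

lemma scan_left:
  "i \<le> length w \<Longrightarrow> \<exists>t \<le> i * (10 * word_num w + 7) + 1.
    big_step w (CScan read_letter) ((\<lambda>_. 0)(0 := word_num (drop i w)), int i - 1) t ((\<lambda>_. 0)(0 := word_num w), -1)"
proof (induction i)
  case 0
  show ?case using big_step.ScanF[of w "-1" read_letter] by (auto simp: symbol_def)
next
  case (Suc i)
  then obtain t where t: "t \<le> i * (10 * word_num w + 7) + 1"
    "big_step w (CScan read_letter) ((\<lambda>_. 0)(0 := word_num (drop i w)), int i - 1) t ((\<lambda>_. 0)(0 := word_num w), -1)"
    by (meson Suc_leD)
  obtain u where u: "u \<le> 10 * word_num w + 5"
    "big_step w read_letter ((\<lambda>_. 0)(0 := word_num (drop (Suc i) w)), int i) u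
    ((\<lambda>_. 0)(0 := word_num (drop i w)), int i - 1)"
    using read_letter_correct[of i w] Suc.prems by auto
  have "symbol w (int i) \<noteq> 0" using Suc.prems by (simp add: symbol_nth)
  from big_step.ScanT[OF this u(2) t(2)]
  have "big_step w (CScan read_letter) ((\<lambda>_. 0)(0 := word_num (drop (Suc i) w)), int (Suc i) - 1)
    (u + t + 2) ((\<lambda>_. 0)(0 := word_num w), -1)" by simp
  moreover have "u + t + 2 \<le> Suc i * (10 * word_num w + 7) + 1" using u(1) t(1) by simp
  ultimately show ?case by blast
qed

lemma load_correct:
  "\<exists>t \<le> word_num w * (10 * word_num w + 10) + 4. big_step w load (\<lambda>_. 0, 0) t ((\<lambda>_. 0)(0 := word_num w), -1)"
proof -
  obtain t where t: "t \<le> 3 * length w + 1" "big_step w (CScan (CMove Right)) (\<lambda>_. 0, 0) t (\<lambda>_. 0, int (length w))"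
    using scan_right[of 0 w "\<lambda>_. 0"] by auto
  have m: "big_step w (CMove Left) (\<lambda>_. 0, int (length w)) 1 (\<lambda>_. 0, int (length w) - 1)"
    using big_step.Move[of w Left "\<lambda>_. 0" "int (length w)"] by simp
  have "(\<lambda>_ :: nat. 0)(0 := word_num (drop (length w) w)) = (\<lambda>_. 0)" by auto
  then obtain u where u: "u \<le> length w * (10 * word_num w + 7) + 1"
    "big_step w (CScan read_letter) (\<lambda>_. 0, int (length w) - 1) u ((\<lambda>_. 0)(0 := word_num w), -1)"
    using scan_left[of "length w" w] by (metis order_refl)
  have "big_step w load (\<lambda>_. 0, 0) (t + (1 + u)) ((\<lambda>_. 0)(0 := word_num w), -1)"
    unfolding load_def by (rule big_step.Seq[OF t(2) big_step.Seq[OF m u(2)]])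
  moreover have "length w * (10 * word_num w + 10) \<le> word_num w * (10 * word_num w + 10)"
    by (intro mult_right_mono length_le_word_num) simp
  then have "t + (1 + u) \<le> word_num w * (10 * word_num w + 10) + 4"
    using t(1) u(1) by (simp add: algebra_simps)
  ultimately show ?thesis by blast
qed

text \<open>One machine serves all words and languages: it searches for the least zero
  \<open>n\<close> of \<open>f\<close> and lets \<open>g\<close> decide. The bound on the time
  depends on the word only through \<open>word_num w + n\<close>.\<close>

theorem search_machine:
  assumes f: "prim_rec f" and g: "prim_rec g"
  shows "\<exists>M B. wf_tm M \<and> majorized B \<and> (\<forall>L w n. f [word_num w, n] = 0 \<longrightarrow> (\<forall>m<n. f [word_num w, m] \<noteq> 0) \<longrightarrow>
    (g [word_num w, n] \<noteq> 0 \<longleftrightarrow> w \<in> L) \<longrightarrow> (\<exists>t \<le> B (word_num w + n). answers_within M L w t))"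
proof -
  obtain C B where B: "majorized B" and C: "\<And>x n. f [x, n] = 0 \<Longrightarrow> (\<forall>m<n. f [x, m] \<noteq> 0) \<Longrightarrow>
    exec C ((\<lambda>_. 0)(0 := x)) (B (x + n)) ((\<lambda>_. 0)(4 := g [x, n]))"
    using search_program[OF assms] by blast
  obtain k where k: "\<And>x. B x \<le> fast k (x + 1)" using B by (auto simp: majorized_def)
  define P where "P = CSeq load C"
  define sz where "sz = code_size P"
  \<comment> \<open>The last instruction tests the answer in counter 4; its targets are the
    accepting and the rejecting state.\<close>
  define cs where "cs = compile 0 P @ [IDec 4 (sz + 1) (sz + 2)]"
  have len: "length cs = sz + 1" by (simp add: cs_def length_compile sz_def)
  define N where "N = Suc (Max (instr_counter ` set cs))"
  have "l \<le> length cs + 1" if "i \<in> set cs" "l \<in> instr_targets i" for i l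
    using that compile_targets[of i 0 P l] by (auto simp: cs_def length_compile sz_def)
  moreover have "instr_counter i < N" if "i \<in> set cs" for i
    using that by (simp add: N_def less_Suc_eq_le)
  ultimately have wf: "code_wf N cs" by (simp add: code_wf_def)
  define B' where "B' x = (x * (10 * x + 10) + 4) + fast k (x + 1) + 2" for x
  have "majorized B'" unfolding B'_def by (intro majorized_intros)
  moreover have "\<exists>t \<le> B' (word_num w + n). answers_within (code_tm N cs) L w t"
    if n: "f [word_num w, n] = 0" "\<forall>m<n. f [word_num w, m] \<noteq> 0" and L: "g [word_num w, n] \<noteq> 0 \<longleftrightarrow> w \<in> L" for L w n
  proof -
    let ?x = "word_num w"
    obtain t where t: "t \<le> ?x * (10 * ?x + 10) + 4" "big_step w load (\<lambda>_. 0, 0) t ((\<lambda>_. 0)(0 := ?x), -1)"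
      using load_correct by blast
    obtain u where u: "u \<le> B (?x + n)" "big_step w C ((\<lambda>_. 0)(0 := ?x), -1) u ((\<lambda>_. 0)(4 := g [?x, n]), -1)"
      using C[OF n] unfolding exec_def by blast
    have "big_step w P (\<lambda>_. 0, 0) (t + u) ((\<lambda>_. 0)(4 := g [?x, n]), -1)"
      unfolding P_def by (rule big_step.Seq[OF t(2) u(2)])
    moreover have "code_at cs 0 (compile 0 P)" by (simp add: code_at_def cs_def nth_append)
    ultimately have s1: "(code_step w cs ^^ (t + u)) (0, \<lambda>_. 0, 0) = (sz, (\<lambda>_. 0)(4 := g [?x, n]), -1)"
      using compile_correct unfolding sz_def by (metis add_0)
    have "cs ! sz = IDec 4 (sz + 1) (sz + 2)" by (simp add: cs_def nth_append length_compile sz_def)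
    then have s2: "fst (code_step w cs (sz, (\<lambda>_. 0)(4 := g [?x, n]), -1)) = (if w \<in> L then sz + 1 else sz + 2)"
      using L by (auto simp: code_step_def len)
    have "fst ((tm_step (code_tm N cs) ^^ Suc (Suc (t + u))) (tm_init (code_tm N cs) w)) =
        (if w \<in> L then sz + 1 else sz + 2)"
      using tm_steps_code[OF wf, of "Suc (t + u)" w] s1 s2 by (simp add: tm_of_def)
    then have "answers_within (code_tm N cs) L w (Suc (Suc (t + u)))"
      unfolding answers_within_def by (simp add: code_tm_def len)
    moreover have "Suc (Suc (t + u)) \<le> B' (?x + n)"
    proof -
      have "?x * (10 * ?x + 10) \<le> (?x + n) * (10 * (?x + n) + 10)" by (intro mult_mono) auto
      then show ?thesis unfolding B'_def using t(1) u(1) k[of "?x + n"] by linarith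
    qed
    ultimately show ?thesis by blast
  qed
  ultimately show ?thesis using code_tm_wf[OF wf] by blast
qed

section \<open>The Ackermannian bound on shortest accepting runs\<close>

section \<open>The length of controlled bad sequences\<close>

text \<open>
  A slice \<open>(q, F, v)\<close> consists of the vectors that are labelled \<open>q\<close> and agree with \<open>v\<close>
  on \<open>F\<close>; its level is the number of the free coordinates in \<open>I - F\<close>. After an element \<open>x\<close> of a
  slice, a bad sequence meets this slice only in the slices that fix a further coordinate to a
  value smaller than that of \<open>x\<close>.
\<close>

type_synonym ('q, 'i) slice = "'q \<times> 'i set \<times> ('i \<Rightarrow> nat)"

definition in_slice :: "'q \<times> ('i \<Rightarrow> nat) \<Rightarrow> ('q, 'i) slice \<Rightarrow> bool" where
  "in_slice x S \<longleftrightarrow> fst x = fst S \<and> (\<forall>c\<in>fst (snd S). snd x c = snd (snd S) c)"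

definition level :: "'i set \<Rightarrow> ('q, 'i) slice \<Rightarrow> nat" where
  "level I S = card (I - fst (snd S))"

definition bad :: "'i set \<Rightarrow> (nat \<Rightarrow> 'q \<times> ('i \<Rightarrow> nat)) \<Rightarrow> nat \<Rightarrow> bool" where
  "bad I u n \<longleftrightarrow> (\<forall>j<n. \<forall>i<j. \<not> (fst (u i) = fst (u j) \<and> (\<forall>c\<in>I. snd (u i) c \<le> snd (u j) c)))"

definition controlled :: "'i set \<Rightarrow> nat \<Rightarrow> (nat \<Rightarrow> 'q \<times> ('i \<Rightarrow> nat)) \<Rightarrow> nat \<Rightarrow> bool" where
  "controlled I m u n \<longleftrightarrow> (\<forall>i<n. \<forall>c\<in>I. snd (u i) c \<le> m + i)"

text \<open>
  \<open>bad_bound d k s m\<close> bounds the length of bad sequences of norm at most \<open>m\<close> in \<open>s\<close> slices of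
  level \<open>k\<close> and \<open>m\<close> slices of smaller levels, where \<open>d\<close> is the dimension: the sequence stays for
  at most \<open>bad_bound d (k - 1) m m\<close> steps in the slices of smaller levels.
\<close>

fun bad_bound :: "nat \<Rightarrow> nat \<Rightarrow> nat \<Rightarrow> nat \<Rightarrow> nat" where
  "bad_bound d 0 s m = s"
| "bad_bound d (Suc k) 0 m = bad_bound d k m m"
| "bad_bound d (Suc k) (Suc s) m =
     bad_bound d k m m + 1 + bad_bound d (Suc k) s (m + d * (m + bad_bound d k m m) + bad_bound d k m m + 1)"

lemma bad_shift: "bad I u n \<Longrightarrow> bad I (\<lambda>i. u (j + i)) (n - j)"
  unfolding bad_def by auto

lemma bad_prefix: "bad I u n \<Longrightarrow> j \<le> n \<Longrightarrow> bad I u j"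
  unfolding bad_def by auto

text \<open>Induction along \<open>bad_bound\<close>. The sequence can stay only for a bounded time
  in slices of smaller levels. The first element outside lies in a slice of top level, and removing
  it from the list costs a bounded number of new slices of smaller level, by badness. Then the
  argument is repeated with fewer top slices, more low slices and a larger norm.\<close>

lemma bad_length:
  fixes u :: "nat \<Rightarrow> 'q \<times> ('i \<Rightarrow> nat)" and SS :: "('q, 'i) slice set"
  assumes I: "finite I"
  shows "card I \<le> d \<Longrightarrow> finite SS \<Longrightarrow> (\<And>S. S \<in> SS \<Longrightarrow> level I S \<le> k \<and> fst (snd S) \<subseteq> I) \<Longrightarrow>
    card {S \<in> SS. level I S = k} \<le> s \<Longrightarrow> card {S \<in> SS. level I S < k} \<le> m \<Longrightarrow>
    bad I u n \<Longrightarrow> controlled I m u n \<Longrightarrow> (\<And>i. i < n \<Longrightarrow> \<exists>S\<in>SS. in_slice (u i) S) \<Longrightarrow>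
    n \<le> bad_bound d k s m"
proof (induction d k s m arbitrary: SS u n rule: bad_bound.induct)
  case (1 d s m SS u n)
  obtain f where f: "\<And>i. i < n \<Longrightarrow> f i \<in> SS \<and> in_slice (u i) (f i)" using 1(8) by metis
  \<comment> \<open>A slice of level 0 fixes all coordinates, so that two elements in one slice
    would be comparable.\<close>
  have "inj_on f {..<n}"
  proof (rule linorder_inj_onI)
    fix i j assume ij: "i < j" "i \<in> {..<n}" "j \<in> {..<n}"
    show "f i \<noteq> f j"
    proof
      assume eq: "f i = f j"
      have "level I (f i) = 0" "fst (snd (f i)) \<subseteq> I" using f[of i] 1(3)[of "f i"] ij by auto
      then have "fst (snd (f i)) = I" using I by (auto simp: level_def)
      then have "fst (u i) = fst (u j) \<and> (\<forall>c\<in>I. snd (u i) c = snd (u j) c)"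
        using f[of i] f[of j] eq ij by (simp add: in_slice_def)
      then show False using 1(6) ij unfolding bad_def by (metis lessThan_iff order_refl)
    qed
  qed auto
  then have "card {..<n} \<le> card SS" using f 1(2) by (intro card_inj_on_le) auto
  moreover have "{S \<in> SS. level I S = 0} = SS" using 1(3) by auto
  ultimately show ?case using 1(4) by simp
next
  case (2 d k m SS u n)
  have none: "{S \<in> SS. level I S = Suc k} = {}" using 2(5) 2(3) by simp
  have lev: "level I S \<le> k" if "S \<in> SS" for S
  proof -
    have "level I S \<noteq> Suc k" using none that by blast
    then show ?thesis using 2(4)[OF that] by simp
  qed
  have "card {S \<in> SS. level I S = k} \<le> card {S \<in> SS. level I S < Suc k}"
    "card {S \<in> SS. level I S < k} \<le> card {S \<in> SS. level I S < Suc k}"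
    using 2(3) by (auto intro!: card_mono)
  then show ?case
    unfolding bad_bound.simps using 2(6)
    by (intro 2(1)[of SS u n] 2(2,3,7,8,9)) (use lev 2(4) in auto)
next
  case (3 d k s m SS u n)
  define L where "L = bad_bound d k m m"
  define low where "low = {S \<in> SS. level I S < Suc k}"
  have low: "finite low" "card low \<le> m" using "3.prems"(2,5) by (simp_all add: low_def)
  have stay: "j \<le> L" if j: "j \<le> n" and l: "\<And>i. i < j \<Longrightarrow> \<exists>S\<in>low. in_slice (u i) S" for j
    unfolding L_def
  proof (rule "3.IH"(1)[of low u j])
    show "card {S \<in> low. level I S = k} \<le> m" "card {S \<in> low. level I S < k} \<le> m"
      using low card_mono[of low "{S \<in> low. level I S = k}"] card_mono[of low "{S \<in> low. level I S < k}"]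
      by auto
    show "controlled I m u j" using "3.prems"(7) j by (auto simp: controlled_def)
  qed (use "3.prems"(1) low "3.prems"(3) j l bad_prefix[OF "3.prems"(6) j] in \<open>auto simp: low_def\<close>)
  show ?case
  proof (cases "\<forall>i<n. \<exists>S\<in>low. in_slice (u i) S")
    case True
    then have "n \<le> L" by (intro stay) auto
    then show ?thesis by (simp add: L_def)
  next
    case False
    \<comment> \<open>The first element outside of the low slices. It lies in a slice
      \<open>S\<close> of top level, which is replaced by the low slices in
      \<open>T\<close>.\<close>
    define j where "j = (LEAST i. i < n \<and> \<not> (\<exists>S\<in>low. in_slice (u i) S))"
    have j: "j < n" "\<not> (\<exists>S\<in>low. in_slice (u j) S)"
      using LeastI_ex[of "\<lambda>i. i < n \<and> \<not> (\<exists>S\<in>low. in_slice (u i) S)"] False unfolding j_def by blast+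
    have jL: "j \<le> L"
    proof (rule stay)
      show "\<exists>S\<in>low. in_slice (u i) S" if "i < j" for i
        using not_less_Least[OF that[unfolded j_def]] that j(1) by auto
    qed (use j in simp)
    obtain S where S: "S \<in> SS" "in_slice (u j) S" using "3.prems"(8)[OF j(1)] by blast
    obtain q F v where S': "S = (q, F, v)" by (metis prod_cases3)
    have "S \<notin> low" using S(2) j(2) by blast
    then have lS: "level I S = Suc k" using "3.prems"(3)[OF S(1)] S(1) by (simp add: low_def)
    have F: "F \<subseteq> I" using "3.prems"(3)[OF S(1)] S' by simp
    define T where "T = (\<lambda>(c, a). (q, insert c F, v(c := a))) ` (SIGMA c:I - F. {..<snd (u j) c})"
    have finT: "finite T" unfolding T_def using I by auto
    have cT: "card T \<le> d * (m + L)"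
    proof -
      have "card T \<le> card (SIGMA c:I - F. {..<snd (u j) c})"
        unfolding T_def using I by (intro card_image_le) auto
      also have "\<dots> = (\<Sum>c\<in>I - F. snd (u j) c)" using I by (subst card_SigmaI) auto
      also have "\<dots> \<le> (\<Sum>c\<in>I - F. m + L)"
        using "3.prems"(7) j(1) jL unfolding controlled_def by (intro sum_mono) (fastforce intro: order_trans)
      also have "\<dots> \<le> d * (m + L)"
      proof -
        have "card (I - F) \<le> d" using card_mono[of I "I - F"] I "3.prems"(1) by simp
        then have "card (I - F) * (m + L) \<le> d * (m + L)" by (rule mult_right_mono) simp
        then show ?thesis by simp
      qed
      finally show ?thesis .
    qed
    have levT: "level I S' \<le> k \<and> fst (snd S') \<subseteq> I" if S'T: "S' \<in> T" for S'
    proof -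
      obtain c a where c: "c \<in> I - F" "S' = (q, insert c F, v(c := a))" using S'T by (auto simp: T_def)
      have "I - insert c F = (I - F) - {c}" by auto
      then have "level I S' = k" using c lS I S' by (simp add: level_def)
      then show ?thesis using c F by auto
    qed
    \<comment> \<open>Bounds the number of all low slices, old and new, as well as the norm of the
      tail, which starts after at most \<open>L + 1\<close> elements.\<close>
    define m' where "m' = m + d * (m + L) + L + 1"
    define SS' where "SS' = (SS - {S}) \<union> T"
    have "n - Suc j \<le> bad_bound d (Suc k) s m'"
      unfolding m'_def L_def
    proof (rule "3.IH"(4)[of SS' "\<lambda>i. u (Suc j + i)"])
      show "card I \<le> d" by (rule "3.prems"(1))
      show "finite SS'" using "3.prems"(2) finT by (simp add: SS'_def)
      show "level I S' \<le> Suc k \<and> fst (snd S') \<subseteq> I" if "S' \<in> SS'" for S'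
        using that "3.prems"(3)[of S'] levT[of S'] by (auto simp: SS'_def)
      have "{S' \<in> SS'. level I S' = Suc k} = {S' \<in> SS. level I S' = Suc k} - {S}"
        using levT by (fastforce simp: SS'_def)
      then show "card {S' \<in> SS'. level I S' = Suc k} \<le> s"
        using "3.prems"(2,4) S(1) lS by simp
      have "{S' \<in> SS'. level I S' < Suc k} \<subseteq> low \<union> T" by (auto simp: SS'_def low_def)
      then have "card {S' \<in> SS'. level I S' < Suc k} \<le> card (low \<union> T)"
        using low finT by (intro card_mono) auto
      also have "\<dots> \<le> m + d * (m + L)" using card_Un_le[of low T] low cT by linarith
      finally show "card {S' \<in> SS'. level I S' < Suc k}
        \<le> m + d * (m + bad_bound d k m m) + bad_bound d k m m + 1" by (simp add: L_def)
      show "bad I (\<lambda>i. u (Suc j + i)) (n - Suc j)" by (rule bad_shift[OF "3.prems"(6)])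
      have "snd (u (Suc j + i)) c \<le> m' + i" if "i < n - Suc j" "c \<in> I" for i c
      proof -
        have "snd (u (Suc j + i)) c \<le> m + (Suc j + i)"
          using "3.prems"(7)[unfolded controlled_def, rule_format, of "Suc j + i" c] that by simp
        then show ?thesis using jL by (simp add: m'_def)
      qed
      then show "controlled I (m + d * (m + bad_bound d k m m) + bad_bound d k m m + 1)
          (\<lambda>i. u (Suc j + i)) (n - Suc j)"
        by (simp add: controlled_def m'_def L_def)
      fix i assume i: "i < n - Suc j"
      let ?y = "u (Suc j + i)"
      have "Suc j + i < n" using i by simp
      then obtain S2 where S2: "S2 \<in> SS" "in_slice ?y S2" using "3.prems"(8) by blast
      show "\<exists>S\<in>SS'. in_slice (u (Suc j + i)) S"
      proof (cases "S2 = S")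
        case False
        then show ?thesis using S2 by (auto simp: SS'_def)
      next
        case True
        have q: "fst (u j) = q" "fst ?y = q" using S(2) S2(2) True S' by (auto simp: in_slice_def)
        \<comment> \<open>By badness, a later element of \<open>S\<close> is smaller than
          \<open>u j\<close> in some coordinate. It is not in \<open>F\<close>, where all elements
          of \<open>S\<close> agree, so that one of the new slices contains the element.\<close>
        then obtain c where c: "c \<in> I" "snd ?y c < snd (u j) c"
          using "3.prems"(6) \<open>Suc j + i < n\<close> unfolding bad_def
          by (metis add_Suc less_add_Suc1 not_le_imp_less)
        have "c \<notin> F" using S(2) S2(2) True S' c(2) by (auto simp: in_slice_def)
        then have "(q, insert c F, v(c := snd ?y c)) \<in> T"
          using c unfolding T_def by (intro image_eqI[of _ _ "(c, snd ?y c)"]) auto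
        moreover have "in_slice ?y (q, insert c F, v(c := snd ?y c))"
          using S2(2) True S' q by (auto simp: in_slice_def)
        ultimately show ?thesis by (auto simp: SS'_def)
      qed
    qed
    then show ?thesis using jL j(1) by (simp add: L_def m'_def)
  qed
qed

text \<open>A dimension costs two levels: one for the quadratic growth of the parameter after one
  top slice, and one for repeating this for \<open>m\<close> slices.\<close>

lemma bad_bound_fast: "1 \<le> m \<Longrightarrow> d \<le> m \<Longrightarrow> bad_bound d k m m \<le> fast (2 * k + 2) m"
proof (induction k arbitrary: m)
  case 0
  then show ?case using fast_ge by simp
next
  case (Suc k)
  define e where "e = 2 * k + 2"
  have J: "m + d * (m + L) + L + 1 \<le> fast (Suc e) m" "L + m \<le> fast (Suc e) m"
    if m: "1 \<le> m" "d \<le> m" and L: "L = bad_bound d k m m" for m L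
  proof -
    let ?f = "fast e m"
    have Lf: "L \<le> ?f" using Suc.IH[OF m] by (simp add: L e_def)
    have mf: "m \<le> ?f" by (rule fast_ge)
    have f2: "fast 2 ?f \<le> fast (Suc e) m"
    proof -
      have "fast 2 ?f \<le> fast e ?f" by (rule fast_mono) (simp_all add: e_def)
      also have "\<dots> \<le> fast (Suc e) m" by (rule fast_fast[OF m(1)])
      finally show ?thesis .
    qed
    have "d * (m + L) \<le> ?f * (?f + ?f)" using m(2) mf Lf by (intro mult_mono) auto
    then have "m + d * (m + L) + L + 1 + 1 \<le> 2 * ((?f + 1) * (?f + 1))"
      using mf Lf by (simp add: algebra_simps)
    also have "\<dots> \<le> 2 * (2 ^ ?f * (?f + 1))"
      using less_exp[of ?f] by (intro mult_left_mono mult_right_mono) (simp_all only: Suc_leI Suc_eq_plus1[symmetric] le0)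
    also have "\<dots> = fast 2 ?f + 1" unfolding fast_two by simp
    finally show "m + d * (m + L) + L + 1 \<le> fast (Suc e) m" using f2 by simp
    then show "L + m \<le> fast (Suc e) m" by simp
  qed
  have "bad_bound d (Suc k) s m + m \<le> (fast (Suc e) ^^ Suc s) m" if "1 \<le> m" "d \<le> m" for s m
    using that
  proof (induction s arbitrary: m)
    case 0
    then show ?case using J(2)[of m] by simp
  next
    case (Suc s)
    let ?L = "bad_bound d k m m"
    let ?m = "m + d * (m + ?L) + ?L + 1"
    have "bad_bound d (Suc k) (Suc s) m + m \<le> bad_bound d (Suc k) s ?m + ?m" by simp
    also have "\<dots> \<le> (fast (Suc e) ^^ Suc s) ?m" by (rule Suc.IH) (use Suc.prems in auto)
    also have "\<dots> \<le> (fast (Suc e) ^^ Suc s) (fast (Suc e) m)"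
      by (rule funpow_fast_mono) (use J(1)[OF Suc.prems refl] in auto)
    also have "\<dots> = (fast (Suc e) ^^ Suc (Suc s)) m" by (simp add: funpow_swap1)
    finally show ?case .
  qed
  from this[of m m] Suc.prems have "bad_bound d (Suc k) m m \<le> (fast (Suc e) ^^ Suc m) m" by linarith
  also have "\<dots> = fast (Suc (Suc e)) m" unfolding fast.simps(2)[of "Suc e" m] by simp
  finally show ?case by (simp add: e_def)
qed

text \<open>The sequence is covered by one unrestricted slice for each label, all of level
  \<open>card I\<close>.\<close>

lemma bad_sequence_bound:
  fixes u :: "nat \<Rightarrow> 'q \<times> ('i \<Rightarrow> nat)"
  assumes I: "finite I" and Q: "finite Q" and u: "bad I u n" "controlled I m u n" "\<And>i. i < n \<Longrightarrow> fst (u i) \<in> Q"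
    and m: "1 \<le> m" "card I \<le> m" "card Q \<le> m"
  shows "n \<le> fast (2 * card I + 2) m"
proof -
  define SS where "SS = (\<lambda>q. (q, {} :: 'i set, \<lambda>_ :: 'i. 0 :: nat)) ` Q"
  have lev: "level I S = card I \<and> fst (snd S) \<subseteq> I" if "S \<in> SS" for S
    using that by (auto simp: SS_def level_def)
  have "finite SS" "card SS \<le> m" using Q m(3) card_image_le[OF Q] by (auto simp: SS_def intro: order_trans)
  have "n \<le> bad_bound (card I) (card I) m m"
  proof (rule bad_length[OF I order_refl, of SS _ _ _ u])
    show "card {S \<in> SS. level I S = card I} \<le> m"
      using card_mono[OF \<open>finite SS\<close>, of "{S \<in> SS. level I S = card I}"] \<open>card SS \<le> m\<close> by auto
    have none: "{S \<in> SS. level I S < card I} = {}" using lev by auto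
    show "card {S \<in> SS. level I S < card I} \<le> m" unfolding none by simp
    show "\<exists>S\<in>SS. in_slice (u i) S" if "i < n" for i
      using u(3)[OF that] by (force simp: SS_def in_slice_def)
  qed (use \<open>finite SS\<close> lev u in auto)
  also have "\<dots> \<le> fast (2 * card I + 2) m" by (rule bad_bound_fast[OF m(1,2)])
  finally show ?thesis .
qed


section \<open>Short accepting runs\<close>

text \<open>Acceptance in exactly \<open>n\<close> steps with the word forgotten; every transition
  brings its own letter, so that letters do not influence emptiness.\<close>

primrec accepts :: "('q, 'r, 'a) rsa \<Rightarrow> 'd set \<Rightarrow> nat \<Rightarrow> 'q \<Rightarrow> ('r \<Rightarrow> 'd set) \<Rightarrow> bool" where
  "accepts A D 0 q f \<longleftrightarrow> q \<in> final A"
| "accepts A D (Suc n) q f \<longleftrightarrow> (\<exists>t\<in>transitions A. src t = q \<and>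
     (\<exists>d\<in>D. enabled t f d \<and> accepts A D n (tgt t) (update (upd t) f d)))"

lemma accepts_SucI:
  "t \<in> transitions A \<Longrightarrow> src t = q \<Longrightarrow> d \<in> D \<Longrightarrow> enabled t f d \<Longrightarrow>
    accepts A D n (tgt t) (update (upd t) f d) \<Longrightarrow> accepts A D (Suc n) q f"
  by auto

lemma accepts_run:
  "accepts A D n q f \<longleftrightarrow> (\<exists>w s g. length w = n \<and> snd ` set w \<subseteq> D \<and> s \<in> final A \<and> run A (q, f) w (s, g))"
proof (induction n arbitrary: q f)
  case 0
  show ?case by (auto intro: run.Nil elim: run.cases)
next
  case (Suc n)
  show ?case
  proof
    assume "accepts A D (Suc n) q f"
    then obtain t d where t: "t \<in> transitions A" "src t = q" "d \<in> D" "enabled t f d"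
      "accepts A D n (tgt t) (update (upd t) f d)" by auto
    then obtain w s g where w: "length w = n" "snd ` set w \<subseteq> D" "s \<in> final A"
      "run A (tgt t, update (upd t) f d) w (s, g)" using Suc by blast
    have "run A (q, f) ((letter t, d) # w) (s, g)" using run.Cons[OF t(1) t(4) w(4)] t(2) by simp
    then show "\<exists>w s g. length w = Suc n \<and> snd ` set w \<subseteq> D \<and> s \<in> final A \<and> run A (q, f) w (s, g)"
      using w t(3) by (intro exI[of _ "(letter t, d) # w"]) auto
  next
    assume "\<exists>w s g. length w = Suc n \<and> snd ` set w \<subseteq> D \<and> s \<in> final A \<and> run A (q, f) w (s, g)"
    then obtain w s g where w: "length w = Suc n" "snd ` set w \<subseteq> D" "s \<in> final A" "run A (q, f) w (s, g)"
      by blast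
    from w(4) show "accepts A D (Suc n) q f"
    proof cases
      case Nil
      then show ?thesis using w by simp
    next
      case (Cons t d w')
      then have "accepts A D n (tgt t) (update (upd t) f d)" using Suc w by auto
      then show ?thesis using Cons w by auto
    qed
  qed
qed

lemma run_letters:
  "run A c w c' \<Longrightarrow> \<forall>t\<in>transitions A. letter t \<in> \<Sigma> \<Longrightarrow> fst ` set w \<subseteq> \<Sigma>"
  by (induction rule: run.induct) auto

lemma lang_empty_iff:
  assumes "wf_rsa \<Sigma> A"
  shows "lang \<Sigma> D A = {} \<longleftrightarrow> (\<forall>n. \<forall>q\<in>initial A. \<not> accepts A D n q (\<lambda>_. {}))"
proof -
  have l: "\<forall>t\<in>transitions A. letter t \<in> \<Sigma>" using assms by (auto simp: wf_rsa_def wf_transition_def)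
  show ?thesis
  proof
    assume L: "lang \<Sigma> D A = {}"
    show "\<forall>n. \<forall>q\<in>initial A. \<not> accepts A D n q (\<lambda>_. {})"
    proof (intro allI ballI notI)
      fix n q assume q: "q \<in> initial A" "accepts A D n q (\<lambda>_. {})"
      then obtain w s g where w: "snd ` set w \<subseteq> D" "s \<in> final A" "run A (q, \<lambda>_. {}) w (s, g)"
        unfolding accepts_run by blast
      have "fst ` set w \<subseteq> \<Sigma>" by (rule run_letters[OF w(3) l])
      then have "w \<in> lists (\<Sigma> \<times> D)" using w(1) by (auto simp: in_lists_conv_set image_subset_iff mem_Times_iff)
      then have "w \<in> lang \<Sigma> D A" unfolding lang_def using q(1) w(2,3) by blast
      then show False using L by simp
    qed
  next
    assume N: "\<forall>n. \<forall>q\<in>initial A. \<not> accepts A D n q (\<lambda>_. {})"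
    show "lang \<Sigma> D A = {}"
    proof (rule equals0I)
      fix w assume "w \<in> lang \<Sigma> D A"
      then obtain q s f where w: "w \<in> lists (\<Sigma> \<times> D)" "q \<in> initial A" "s \<in> final A" "run A (q, \<lambda>_. {}) w (s, f)"
        unfolding lang_def by blast
      then have "snd ` set w \<subseteq> D" by (auto simp: in_lists_conv_set)
      then have "accepts A D (length w) q (\<lambda>_. {})" unfolding accepts_run using w by blast
      then show False using N w(2) by blast
    qed
  qed
qed

text \<open>Guards and updates act on a datum only through its region; up to renaming of data, the
  contents are given by the number of data for each region.\<close>

definition region :: "('r \<Rightarrow> 'd set) \<Rightarrow> 'd \<Rightarrow> 'r set" where
  "region f d = {r. d \<in> f r}"

text \<open>The configuration with contents \<open>f\<close> is dominated by that with contents \<open>g\<close>.\<close>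

definition embeds :: "'d set \<Rightarrow> ('r \<Rightarrow> 'd set) \<Rightarrow> ('r \<Rightarrow> 'd set) \<Rightarrow> bool" where
  "embeds D f g \<longleftrightarrow> finite {d. region g d \<noteq> {}} \<and> (\<exists>\<iota>. inj_on \<iota> {d. region f d \<noteq> {}} \<and>
     (\<forall>d. region f d \<noteq> {} \<longrightarrow> region g (\<iota> d) = region f d \<and> \<iota> d \<in> D))"

lemma region_update:
  "region (update up f d) e = {r. (\<exists>r'\<in>region f e. Reg r' \<in> up r) \<or> In \<in> up r \<and> e = d}"
  by (auto simp: region_def update_def)

lemma enabled_region: "enabled t f d \<longleftrightarrow> guard_in t \<subseteq> region f d \<and> guard_notin t \<inter> region f d = {}"
  by (auto simp: enabled_def region_def)

text \<open>Monotonicity of the transition system: the larger configuration mimics each step with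
  the image of the datum and ignores its surplus data.\<close>

lemma accepts_mono:
  assumes D: "infinite D" and A: "accepts A D n q f" and E: "embeds D f g"
  shows "accepts A D n q g"
  using A E
proof (induction n arbitrary: q f g)
  case (Suc n)
  then obtain t d where t: "t \<in> transitions A" "src t = q" "d \<in> D" "enabled t f d"
    "accepts A D n (tgt t) (update (upd t) f d)" by auto
  obtain \<iota> where fin: "finite {d. region g d \<noteq> {}}" and \<iota>: "inj_on \<iota> {d. region f d \<noteq> {}}"
    "\<And>d. region f d \<noteq> {} \<Longrightarrow> region g (\<iota> d) = region f d \<and> \<iota> d \<in> D"
    using Suc.prems(2) unfolding embeds_def by blast
  have "\<exists>d'\<in>D. \<exists>\<iota>'. d' = \<iota>' d \<and> inj_on \<iota>' (insert d {d. region f d \<noteq> {}}) \<and>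
    (\<forall>e. region f e \<noteq> {} \<or> e = d \<longrightarrow> region g (\<iota>' e) = region f e \<and> \<iota>' e \<in> D)"
  proof (cases "region f d = {}")
    case False
    then have "insert d {d. region f d \<noteq> {}} = {d. region f d \<noteq> {}}" by auto
    then show ?thesis using \<iota> False by (intro bexI[of _ "\<iota> d"] exI[of _ \<iota>]) auto
  next
    case True
    \<comment> \<open>A datum in no register is matched with one in no register of \<open>g\<close>;
      it exists because \<open>D\<close> is infinite and \<open>g\<close> stores finitely many
      data.\<close>
    obtain d' where d': "d' \<in> D" "region g d' = {}"
      using D fin by (metis (mono_tags, lifting) finite_subset mem_Collect_eq subsetI)
    have "d' \<notin> \<iota> ` {d. region f d \<noteq> {}}" using \<iota>(2) d'(2) by auto
    then have "inj_on (\<iota>(d := d')) (insert d {d. region f d \<noteq> {}})"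
      using \<iota>(1) by (auto simp: inj_on_def)
    then show ?thesis using \<iota> True d' by (intro bexI[of _ d'] exI[of _ "\<iota>(d := d')"]) auto
  qed
  then obtain \<iota>' where \<iota>': "\<iota>' d \<in> D" "inj_on \<iota>' (insert d {d. region f d \<noteq> {}})"
    "\<And>e. region f e \<noteq> {} \<or> e = d \<Longrightarrow> region g (\<iota>' e) = region f e \<and> \<iota>' e \<in> D" by blast
  have "enabled t g (\<iota>' d)" using t(4) \<iota>'(3)[of d] by (simp add: enabled_region)
  moreover have "embeds D (update (upd t) f d) (update (upd t) g (\<iota>' d))"
    unfolding embeds_def
  proof (intro conjI exI[of _ \<iota>'] allI impI)
    have sub: "{e. region (update (upd t) f d) e \<noteq> {}} \<subseteq> insert d {d. region f d \<noteq> {}}"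
      unfolding region_update by auto
    then show "inj_on \<iota>' {e. region (update (upd t) f d) e \<noteq> {}}" by (rule inj_on_subset[OF \<iota>'(2)])
    have "{e. region (update (upd t) g (\<iota>' d)) e \<noteq> {}} \<subseteq> insert (\<iota>' d) {d. region g d \<noteq> {}}"
      unfolding region_update by auto
    then show "finite {e. region (update (upd t) g (\<iota>' d)) e \<noteq> {}}" using fin finite_subset by auto
    fix e assume "region (update (upd t) f d) e \<noteq> {}"
    then have e: "e \<in> insert d {d. region f d \<noteq> {}}" using sub by blast
    then have *: "region g (\<iota>' e) = region f e" "\<iota>' e \<in> D" using \<iota>'(3)[of e] by auto
    \<comment> \<open>Injectivity ensures that the source \<open>In\<close> concerns corresponding
      data on both sides.\<close>
    have "\<iota>' e = \<iota>' d \<longleftrightarrow> e = d" using \<iota>'(2) e by (auto simp: inj_on_def)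
    then show "region (update (upd t) g (\<iota>' d)) (\<iota>' e) = region (update (upd t) f d) e" "\<iota>' e \<in> D"
      unfolding region_update using * by auto
  qed
  ultimately show ?case using Suc.IH[OF t(5)] t(1,2) \<iota>'(1) by auto
qed simp

definition run_seq :: "('q, 'r, 'a) rsa \<Rightarrow> 'd set \<Rightarrow> nat \<Rightarrow> (nat \<Rightarrow> 'q) \<Rightarrow> (nat \<Rightarrow> 'r \<Rightarrow> 'd set) \<Rightarrow>
    (nat \<Rightarrow> ('q, 'r, 'a) transition) \<Rightarrow> (nat \<Rightarrow> 'd) \<Rightarrow> bool" where
  "run_seq A D n qs fs ts ds \<longleftrightarrow> (\<forall>i<n. ts i \<in> transitions A \<and> src (ts i) = qs i \<and> ds i \<in> D \<and>
     enabled (ts i) (fs i) (ds i) \<and> tgt (ts i) = qs (Suc i) \<and> fs (Suc i) = update (upd (ts i)) (fs i) (ds i))"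

lemma accepts_run_seq:
  "accepts A D n q f \<longleftrightarrow> (\<exists>qs fs ts ds. run_seq A D n qs fs ts ds \<and> qs 0 = q \<and> fs 0 = f \<and> qs n \<in> final A)"
proof (induction n arbitrary: q f)
  case 0
  show ?case by (auto simp: run_seq_def intro: exI[of _ "\<lambda>_. q"] exI[of _ "\<lambda>_. f"])
next
  case (Suc n)
  show ?case
  proof
    assume "accepts A D (Suc n) q f"
    then obtain t d where t: "t \<in> transitions A" "src t = q" "d \<in> D" "enabled t f d"
      "accepts A D n (tgt t) (update (upd t) f d)" by auto
    then obtain qs fs ts ds where s: "run_seq A D n qs fs ts ds" "qs 0 = tgt t"
      "fs 0 = update (upd t) f d" "qs n \<in> final A" using Suc by blast
    have "run_seq A D (Suc n) (case_nat q qs) (case_nat f fs) (case_nat t ts) (case_nat d ds)"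
      using s(1-3) t unfolding run_seq_def by (auto simp: less_Suc_eq_0_disj)
    then show "\<exists>qs fs ts ds. run_seq A D (Suc n) qs fs ts ds \<and> qs 0 = q \<and> fs 0 = f \<and> qs (Suc n) \<in> final A"
      using s(4) by (intro exI[of _ "case_nat q qs"] exI[of _ "case_nat f fs"]) auto
  next
    assume "\<exists>qs fs ts ds. run_seq A D (Suc n) qs fs ts ds \<and> qs 0 = q \<and> fs 0 = f \<and> qs (Suc n) \<in> final A"
    then obtain qs fs ts ds where s: "run_seq A D (Suc n) qs fs ts ds" "qs 0 = q" "fs 0 = f" "qs (Suc n) \<in> final A"
      by blast
    then have "run_seq A D n (\<lambda>i. qs (Suc i)) (\<lambda>i. fs (Suc i)) (\<lambda>i. ts (Suc i)) (\<lambda>i. ds (Suc i))"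
      unfolding run_seq_def
    proof (intro allI impI)
      fix i assume "i < n"
      then show "ts (Suc i) \<in> transitions A \<and> src (ts (Suc i)) = qs (Suc i) \<and> ds (Suc i) \<in> D \<and>
        enabled (ts (Suc i)) (fs (Suc i)) (ds (Suc i)) \<and> tgt (ts (Suc i)) = qs (Suc (Suc i)) \<and>
        fs (Suc (Suc i)) = update (upd (ts (Suc i))) (fs (Suc i)) (ds (Suc i))"
        using s(1)[unfolded run_seq_def, rule_format, of "Suc i"] by simp
    qed
    then have "accepts A D n (qs 1) (fs 1)" using Suc[of "qs 1" "fs 1"] s(4) by force
    then show "accepts A D (Suc n) q f" using s by (auto simp: run_seq_def intro!: bexI[of _ "ts 0"] bexI[of _ "ds 0"])
  qed
qed

lemma accepts_restrict:
  assumes "run_seq A D n qs fs ts ds" "qs n \<in> final A" "j \<le> n" "ds ` {n - j..<n} \<subseteq> E"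
  shows "accepts A D j (qs (n - j)) (\<lambda>r. fs (n - j) r \<inter> E)"
  using assms(3,4)
proof (induction j)
  case (Suc j)
  let ?i = "n - Suc j"
  have i: "?i < n" "Suc ?i = n - j" using Suc.prems by auto
  then have s: "ts ?i \<in> transitions A" "src (ts ?i) = qs ?i" "ds ?i \<in> D" "enabled (ts ?i) (fs ?i) (ds ?i)"
    "tgt (ts ?i) = qs (n - j)" "fs (n - j) = update (upd (ts ?i)) (fs ?i) (ds ?i)"
    using assms(1) unfolding run_seq_def by (metis)+
  have E: "ds ?i \<in> E" using Suc.prems i by auto
  have "(\<lambda>r. fs (n - j) r \<inter> E) = update (upd (ts ?i)) (\<lambda>r. fs ?i r \<inter> E) (ds ?i)"
    using E unfolding s(6) update_def by (intro ext) auto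
  moreover have "accepts A D j (qs (n - j)) (\<lambda>r. fs (n - j) r \<inter> E)"
    using Suc.prems by (intro Suc.IH) (auto simp: image_subset_iff)
  moreover have "enabled (ts ?i) (\<lambda>r. fs ?i r \<inter> E) (ds ?i)" using s(4) E by (simp add: enabled_def)
  ultimately have "accepts A D j (tgt (ts ?i)) (update (upd (ts ?i)) (\<lambda>r. fs ?i r \<inter> E) (ds ?i))"
    "enabled (ts ?i) (\<lambda>r. fs ?i r \<inter> E) (ds ?i)" using s(5) by simp_all
  then show ?case using accepts_SucI[OF s(1-3)] by blast
qed (use assms in simp)

lemma accepts_prefix:
  assumes "run_seq A D n qs fs ts ds" "a \<le> n" "accepts A D k (qs a) (fs a)"
  shows "accepts A D (a + k) (qs 0) (fs 0)"
proof -
  have "accepts A D (j + k) (qs (a - j)) (fs (a - j))" if "j \<le> a" for j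
    using that
  proof (induction j)
    case (Suc j)
    let ?i = "a - Suc j"
    have "?i < n" "Suc ?i = a - j" using Suc.prems assms(2) by auto
    then have s: "ts ?i \<in> transitions A" "src (ts ?i) = qs ?i" "ds ?i \<in> D" "enabled (ts ?i) (fs ?i) (ds ?i)"
      "tgt (ts ?i) = qs (a - j)" "fs (a - j) = update (upd (ts ?i)) (fs ?i) (ds ?i)"
      using assms(1) unfolding run_seq_def by metis+
    have "accepts A D (j + k) (qs (a - j)) (fs (a - j))" using Suc by simp
    then have "accepts A D (j + k) (tgt (ts ?i)) (update (upd (ts ?i)) (fs ?i) (ds ?i))"
      using s(5,6) by simp
    then show ?case unfolding add_Suc using accepts_SucI[OF s(1-4)] by blast
  qed (use assms(3) in simp)
  from this[of a] show ?thesis by simp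
qed

text \<open>Injections for the single regions are glued together; their ranges are disjoint, as the
  region of an image is that of its preimage.\<close>

lemma embeds_of_counts:
  assumes fin: "finite {d. region g d \<noteq> {}}" "finite {d. region f d \<noteq> {}}" and D: "\<And>r. g r \<subseteq> D"
    and R: "\<And>d. region f d \<subseteq> R"
    and le: "\<And>X. X \<in> Pow R - {{}} \<Longrightarrow> card {d. region f d = X} \<le> card {d. region g d = X}"
  shows "embeds D f g"
proof -
  have "\<exists>\<iota>. inj_on \<iota> {d. region f d = X} \<and> \<iota> ` {d. region f d = X} \<subseteq> {d. region g d = X}" if "X \<noteq> {}" for X
  proof (cases "X \<subseteq> R")
    case True
    have "{d. region f d = X} \<subseteq> {d. region f d \<noteq> {}}" "{d. region g d = X} \<subseteq> {d. region g d \<noteq> {}}" using that by auto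
    then have "finite {d. region f d = X}" "finite {d. region g d = X}" using fin finite_subset by blast+
    then show ?thesis using card_le_inj[of "{d. region f d = X}" "{d. region g d = X}"] le[of X] True that by blast
  next
    case False
    then have "{d. region f d = X} = {}" using R by blast
    then show ?thesis by auto
  qed
  then obtain j where j: "\<And>X. X \<noteq> {} \<Longrightarrow> inj_on (j X) {d. region f d = X} \<and> j X ` {d. region f d = X} \<subseteq> {d. region g d = X}"
    by metis
  define \<iota> where "\<iota> d = j (region f d) d" for d
  have reg: "region g (\<iota> d) = region f d" if "region f d \<noteq> {}" for d
    using j[OF that] by (auto simp: \<iota>_def)
  have "inj_on \<iota> {d. region f d \<noteq> {}}"
  proof (rule inj_onI)
    fix d e assume *: "d \<in> {d. region f d \<noteq> {}}" "e \<in> {d. region f d \<noteq> {}}" "\<iota> d = \<iota> e"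
    then have "region f d = region f e" using reg[of d] reg[of e] by simp
    then show "d = e" using * j[of "region f d"] unfolding inj_on_def \<iota>_def by auto
  qed
  moreover have "\<iota> d \<in> D" if "region f d \<noteq> {}" for d
    using reg[OF that] that D by (auto simp: region_def)
  ultimately show ?thesis unfolding embeds_def using fin(1) reg by blast
qed

text \<open>A shortest accepting run, read backwards with irrelevant data removed, yields a bad
  sequence with as many elements as the run has configurations. Its dimension is the number of
  nonempty sets of registers.\<close>

lemma short_accepting_run:
  fixes A :: "('q, 'r, 'a) rsa" and D :: "'d set"
  assumes wf: "wf_rsa \<Sigma> A" and D: "infinite D" and q: "q \<in> initial A" and acc: "accepts A D n q (\<lambda>_. {})"
  shows "\<exists>k \<le> fast (2 * 2 ^ card (regs A) + 2) (2 ^ card (regs A) + card (states A)). accepts A D k q (\<lambda>_. {})"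
proof -
  let ?R = "regs A"
  define N where "N = (LEAST n. accepts A D n q (\<lambda>_. {}))"
  have N: "accepts A D N q (\<lambda>_. {})" unfolding N_def using acc by (rule LeastI)
  have min: "\<not> accepts A D k q (\<lambda>_. {})" if "k < N" for k using not_less_Least[OF that[unfolded N_def]] .
  obtain qs fs ts ds where s: "run_seq A D N qs fs ts ds" "qs 0 = q" "fs 0 = (\<lambda>_. {})" "qs N \<in> final A"
    using accepts_run_seq[THEN iffD1, OF N] by blast
  have wft: "wf_transition \<Sigma> (states A) ?R (ts i)" if "i < N" for i
  proof -
    have "ts i \<in> transitions A" using s(1) that by (simp add: run_seq_def)
    then show ?thesis using wf by (simp add: wf_rsa_def)
  qed
  have inv: "(\<forall>d. region (fs i) d \<subseteq> ?R) \<and> finite {d. region (fs i) d \<noteq> {}} \<and> (\<forall>r. fs i r \<subseteq> D) \<and> qs i \<in> states A"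
    if "i \<le> N" for i
    using that
  proof (induction i)
    case 0
    show ?case using s q wf by (auto simp: region_def wf_rsa_def)
  next
    case (Suc i)
    then have i: "i < N" "fs (Suc i) = update (upd (ts i)) (fs i) (ds i)" "qs (Suc i) = tgt (ts i)" "ds i \<in> D"
      using s(1) by (auto simp: run_seq_def)
    have "region (fs (Suc i)) d \<subseteq> ?R" for d
    proof
      fix r assume "r \<in> region (fs (Suc i)) d"
      then have "upd (ts i) r \<noteq> {}" unfolding i(2) region_update by auto
      then show "r \<in> ?R" using wft[OF i(1)] unfolding wf_transition_def by blast
    qed
    moreover have "{d. region (fs (Suc i)) d \<noteq> {}} \<subseteq> insert (ds i) {d. region (fs i) d \<noteq> {}}"
      unfolding i(2) region_update by auto
    then have "finite {d. region (fs (Suc i)) d \<noteq> {}}" using Suc by (auto intro: finite_subset)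
    moreover have "fs (Suc i) r \<subseteq> D" for r using Suc i(4) unfolding i(2) update_def by auto
    moreover have "qs (Suc i) \<in> states A" using wft[OF i(1)] i(3) by (simp add: wf_transition_def)
    ultimately show ?case by blast
  qed
  \<comment> \<open>\<open>E j\<close> are the data read in the last \<open>j\<close> steps, and
    \<open>g j\<close> are the contents before these steps, restricted to
    \<open>E j\<close>.\<close>
  define E where "E j = ds ` {N - j..<N}" for j
  define g where "g j = (\<lambda>r. fs (N - j) r \<inter> E j)" for j
  have acc_g: "accepts A D j (qs (N - j)) (g j)" if "j \<le> N" for j
    unfolding g_def E_def by (rule accepts_restrict[OF s(1,4) that]) simp
  have reg_g: "region (g j) d = (if d \<in> E j then region (fs (N - j)) d else {})" for j d
    by (auto simp: region_def g_def)
  have fin_g: "finite {d. region (g j) d \<noteq> {}}" for j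
    by (rule finite_subset[of _ "E j"]) (auto simp: reg_g E_def)
  define I where "I = Pow ?R - {{}}"
  have finR: "finite ?R" "finite (states A)" using wf by (auto simp: wf_rsa_def)
  have I: "finite I" "card I \<le> 2 ^ card ?R"
    unfolding I_def using finR card_Diff_subset[of "{{}}" "Pow ?R"] by (auto simp: card_Pow)
  define u where "u j = (qs (N - j), \<lambda>X. card {d. region (g j) d = X})" for j
  let ?m = "2 ^ card ?R + card (states A)"
  have "Suc N \<le> fast (2 * card I + 2) ?m"
  proof (rule bad_sequence_bound[OF I(1) finR(2), of u])
    show "bad I u (Suc N)"
      unfolding bad_def
    proof (intro allI impI notI)
      fix j i assume ij: "j < Suc N" "i < j"
        and le: "fst (u i) = fst (u j) \<and> (\<forall>c\<in>I. snd (u i) c \<le> snd (u j) c)"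
      have e1: "embeds D (g i) (g j)"
      proof (rule embeds_of_counts)
        show "g j r \<subseteq> D" for r using inv[of "N - j"] by (auto simp: g_def)
        show "region (g i) d \<subseteq> ?R" for d using inv[of "N - i"] by (auto simp: reg_g)
        show "card {d. region (g i) d = X} \<le> card {d. region (g j) d = X}" if "X \<in> Pow ?R - {{}}" for X
          using le that by (auto simp: u_def I_def)
      qed (rule fin_g)+
      \<comment> \<open>A datum in \<open>E j\<close> keeps its region under the restriction, and
        the other data have empty region in \<open>g j\<close>.\<close>
      have e2: "embeds D (g j) (fs (N - j))"
        unfolding embeds_def
        using inv[of "N - j"] by (intro conjI exI[of _ id]) (auto simp: reg_g, auto simp: region_def)
      have "accepts A D i (qs (N - i)) (g i)" using acc_g ij by simp
      then have "accepts A D i (qs (N - j)) (g i)" using le by (simp add: u_def)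
      then have "accepts A D i (qs (N - j)) (fs (N - j))"
        by (rule accepts_mono[OF D accepts_mono[OF D _ e1] e2])
      \<comment> \<open>After \<open>N - j\<close> steps of the run, \<open>i\<close> more steps
        suffice, which beats the minimal length as \<open>i < j\<close>.\<close>
      then have "accepts A D (N - j + i) q (\<lambda>_. {})"
        using accepts_prefix[OF s(1), of "N - j" i] s(2,3) by simp
      moreover have "N - j + i < N" using ij by linarith
      ultimately show False using min by blast
    qed
    show "controlled I ?m u (Suc N)"
      unfolding controlled_def
    proof (intro allI impI ballI)
      fix j X assume j: "j < Suc N" "X \<in> I"
      have "{d. region (g j) d = X} \<subseteq> E j" using j(2) by (auto simp: reg_g I_def)
      then have "card {d. region (g j) d = X} \<le> card (E j)" by (intro card_mono) (auto simp: E_def)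
      also have "\<dots> \<le> card {N - j..<N}" unfolding E_def by (rule card_image_le) simp
      also have "\<dots> \<le> ?m + j" using j(1) by simp
      finally show "snd (u j) X \<le> ?m + j" by (simp add: u_def)
    qed
    show "fst (u i) \<in> states A" if "i < Suc N" for i using inv[of "N - i"] by (simp add: u_def)
    have "1 \<le> (2 :: nat) ^ card ?R" by (rule one_le_power) simp
    then show "1 \<le> ?m" by linarith
  qed (use I in auto)
  also have "\<dots> \<le> fast (2 * 2 ^ card ?R + 2) ?m" using I(2) by (intro fast_mono) auto
  finally show ?thesis using N by (intro exI[of _ N]) auto
qed

section \<open>Bounded emptiness as a primitive recursive predicate\<close>

section \<open>Functions coded by digits\<close>

lemma digit_sum:
  fixes B :: nat
  assumes "\<And>i. i < K \<Longrightarrow> f i < B"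
  shows "(\<Sum>i<K. f i * B ^ i) < B ^ K" "j < K \<Longrightarrow> (\<Sum>i<K. f i * B ^ i) div B ^ j mod B = f j"
proof -
  have "(\<Sum>i<K. f i * B ^ i) < B ^ K \<and> (\<forall>j<K. (\<Sum>i<K. f i * B ^ i) div B ^ j mod B = f j)"
    using assms
  proof (induction K arbitrary: f)
    case (Suc K)
    let ?z = "\<Sum>i<K. f (Suc i) * B ^ i"
    have IH: "?z < B ^ K" "j < K \<Longrightarrow> ?z div B ^ j mod B = f (Suc j)" for j
      using Suc.IH[of "\<lambda>i. f (Suc i)"] Suc.prems by auto
    have f0: "f 0 < B" using Suc.prems by simp
    have z: "(\<Sum>i<Suc K. f i * B ^ i) = f 0 + B * ?z"
      by (subst sum.lessThan_Suc_shift) (simp add: sum_distrib_left algebra_simps)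
    have "f 0 + B * ?z < B * Suc ?z" using f0 by simp
    also have "\<dots> \<le> B * B ^ K" using IH(1) by (intro mult_left_mono) auto
    finally have "f 0 + B * ?z < B ^ Suc K" by simp
    moreover have "(f 0 + B * ?z) div B ^ j mod B = f j" if "j < Suc K" for j
      using that f0 IH(2) by (cases j) (simp_all add: div_mult2_eq)
    ultimately show ?case unfolding z by blast
  qed simp
  then show "(\<Sum>i<K. f i * B ^ i) < B ^ K" "j < K \<Longrightarrow> (\<Sum>i<K. f i * B ^ i) div B ^ j mod B = f j"
    by auto
qed

text \<open>A table with four arguments below \<open>M\<close> and values below \<open>B\<close>,
  stored in \<open>z\<close> in base \<open>B\<close>, and 0 outside.\<close>

definition digits :: "nat \<Rightarrow> nat \<Rightarrow> nat \<Rightarrow> presentation" where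
  "digits B M z t i r x =
     (if t < M \<and> i < M \<and> r < M \<and> x < M then z div B ^ (((t * M + i) * M + r) * M + x) mod B else 0)"

lemma add_mult_less: "a < m \<Longrightarrow> r < k \<Longrightarrow> a * k + r < m * k" for a :: nat
proof -
  assume "a < m" "r < k"
  then have "a * k + r < Suc a * k" by simp
  also have "\<dots> \<le> m * k" using \<open>a < m\<close> by (intro mult_right_mono) auto
  finally show ?thesis .
qed

text \<open>Turns the existence of a bounded table into a bounded quantifier over numbers.\<close>

lemma digits_surj:
  assumes "\<And>t i r x. \<alpha> t i r x < B" "\<And>t i r x. \<alpha> t i r x \<noteq> 0 \<Longrightarrow> t < M \<and> i < M \<and> r < M \<and> x < M"
  shows "\<exists>z < B ^ (M ^ 4). digits B M z = \<alpha>"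
proof -
  define f where "f j = \<alpha> (j div M div M div M) (j div M div M mod M) (j div M mod M) (j mod M)" for j
  define z where "z = (\<Sum>i<M ^ 4. f i * B ^ i)"
  have f: "f i < B" for i using assms(1) by (simp add: f_def)
  have "digits B M z t i r x = \<alpha> t i r x" for t i r x
  proof (cases "t < M \<and> i < M \<and> r < M \<and> x < M")
    case True
    let ?j = "((t * M + i) * M + r) * M + x"
    have "?j < M * M * M * M" using True by (intro add_mult_less) auto
    then have "?j < M ^ 4" by (simp add: power4_eq_xxxx)
    then have "z div B ^ ?j mod B = f ?j" unfolding z_def by (intro digit_sum(2) f)
    also have "f ?j = \<alpha> t i r x" using True by (simp add: f_def)
    finally show ?thesis using True by (simp add: digits_def)
  next
    case False
    then show ?thesis using assms(2)[of t i r x] by (auto simp: digits_def)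
  qed
  moreover have "z < B ^ (M ^ 4)" unfolding z_def by (intro digit_sum(1) f)
  ultimately show ?thesis by (intro exI[of _ z]) (auto simp: fun_eq_iff)
qed

lemma digits_less: "0 < B \<Longrightarrow> digits B M z t i r x < B"
  by (simp add: digits_def)

lemma pr_digits:
  assumes "pr B" "pr M" "pr z" "pr t" "pr i" "pr r" "pr x"
  shows "pr (\<lambda>e. digits (B e) (M e) (z e) (t e) (i e) (r e) (x e))"
  unfolding digits_def by (intro pr_intros assms)


section \<open>The inverse of the fast-growing function\<close>

text \<open>Level \<open>k\<close> of the hierarchy, cut off at \<open>n + 1\<close>, as a number in base \<open>n + 2\<close>.\<close>

definition table_app :: "nat \<Rightarrow> nat \<Rightarrow> nat \<Rightarrow> nat" where
  "table_app n z y = (if y \<le> n then z div (n + 2) ^ y mod (n + 2) else n + 1)"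

definition fast_table :: "nat \<Rightarrow> nat \<Rightarrow> nat" where
  "fast_table n k = rec_nat (\<Sum>y<n + 1. (y + 1) * (n + 2) ^ y)
     (\<lambda>_ z. \<Sum>y<n + 1. rec_nat y (\<lambda>_ v. table_app n z v) (y + 1) * (n + 2) ^ y) k"

text \<open>Cutting off at \<open>n + 1\<close> commutes with iteration, because all levels are
  inflationary.\<close>

lemma fast_table: "table_app n (fast_table n k) y = min (fast k y) (n + 1)"
proof (induction k arbitrary: y)
  case 0
  have "(\<Sum>y<n + 1. (y + 1) * (n + 2) ^ y) div (n + 2) ^ y mod (n + 2) = y + 1" if "y \<le> n" for y
    by (rule digit_sum(2)) (use that in auto)
  then show ?case by (simp add: table_app_def fast_table_def fast.simps)
next
  case (Suc k)
  let ?z = "fast_table n k"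
  have it: "rec_nat y (\<lambda>_ v. table_app n ?z v) j = min ((fast k ^^ j) y) (n + 1)" if "y \<le> n" for y j
  proof (induction j)
    case (Suc j)
    show ?case
    proof (cases "(fast k ^^ j) y \<le> n")
      case True
      then show ?thesis using Suc \<open>\<And>y. table_app n ?z y = _ y\<close> by simp
    next
      case False
      \<comment> \<open>Once a value exceeds \<open>n\<close>, it does so forever, and the table
        keeps it at \<open>n + 1\<close>.\<close>
      then have "n + 1 \<le> fast k ((fast k ^^ j) y)" "n + 1 \<le> fast k (n + 1)"
        using fast_ge[of "(fast k ^^ j) y" k] fast_ge[of "n + 1" k] by linarith+
      then show ?thesis using Suc False \<open>\<And>y. table_app n ?z y = _ y\<close>[of "n + 1"] by simp
    qed
  qed (use that in simp)
  have t: "fast_table n (Suc k) =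
      (\<Sum>y<n + 1. rec_nat y (\<lambda>_ v. table_app n ?z v) (y + 1) * (n + 2) ^ y)"
    by (simp add: fast_table_def)
  have "fast_table n (Suc k) div (n + 2) ^ y mod (n + 2) = rec_nat y (\<lambda>_ v. table_app n ?z v) (y + 1)"
    if "y \<le> n" for y
    unfolding t by (rule digit_sum(2)) (use that it in \<open>auto simp del: rec_nat_add_eq_if old.nat.simps(7)\<close>)
  then show ?case
    using it[of y "y + 1"] fast_ge[of y "Suc k"] by (auto simp: table_app_def fast.simps(2) simp del: funpow.simps)
qed

lemma pr_table_app: "pr n \<Longrightarrow> pr z \<Longrightarrow> pr y \<Longrightarrow> pr (\<lambda>e. table_app (n e) (z e) (y e))"
  unfolding table_app_def by (intro pr_intros)

lemma pr_fast_table: "pr n \<Longrightarrow> pr k \<Longrightarrow> pr (\<lambda>e. fast_table (n e) (k e))"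
proof (rule pr_app2[of fast_table])
  show "pr (\<lambda>e. fast_table (e 0) (e 1))"
    unfolding fast_table_def by (intro pr_rec pr_intros pr_table_app)
qed

text \<open>To compare F_omega with \<open>n\<close>, values beyond \<open>n\<close> need not be
  known, so that finite tables of size bounded in \<open>n\<close> suffice at each level.\<close>

lemma prb_fast_omega_le: "pr a \<Longrightarrow> pr b \<Longrightarrow> prb (\<lambda>e. fast_omega (a e) \<le> b e)"
proof -
  assume "pr a" "pr b"
  have "fast_omega x \<le> n \<longleftrightarrow> table_app n (fast_table n (x + 1)) x \<le> n" for x n
    unfolding fast_table fast_omega_def by auto
  then show ?thesis
    by (simp only:) (intro pr_intros pr_table_app pr_fast_table \<open>pr a\<close> \<open>pr b\<close>)
qed


section \<open>Bounded emptiness\<close>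

lemma accepts_subset: "accepts A D n q f \<Longrightarrow> D \<subseteq> E \<Longrightarrow> accepts A E n q f"
proof (induction n arbitrary: q f)
  case (Suc n)
  then obtain t d where t: "t \<in> transitions A" "src t = q" "d \<in> D" "enabled t f d"
    "accepts A D n (tgt t) (update (upd t) f d)" by auto
  have "accepts A E n (tgt t) (update (upd t) f d)" by (rule Suc.IH[OF t(5) Suc.prems(2)])
  then show ?case by (rule accepts_SucI[OF t(1,2) subsetD[OF Suc.prems(2) t(3)] t(4)])
qed simp

lemma accepts_finite:
  "accepts A D n q f \<Longrightarrow> \<exists>S\<subseteq>D. finite S \<and> card S \<le> n \<and> accepts A S n q f"
proof (induction n arbitrary: q f)
  case 0
  then show ?case by (intro exI[of _ "{}"]) auto
next
  case (Suc n)
  then obtain t d where t: "t \<in> transitions A" "src t = q" "d \<in> D" "enabled t f d"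
    "accepts A D n (tgt t) (update (upd t) f d)" by auto
  obtain S where S: "S \<subseteq> D" "finite S" "card S \<le> n" "accepts A S n (tgt t) (update (upd t) f d)"
    using Suc.IH[OF t(5)] by blast
  have "accepts A (insert d S) n (tgt t) (update (upd t) f d)"
    by (rule accepts_subset[OF S(4) subset_insertI])
  then have "accepts A (insert d S) (Suc n) q f"
    by (rule accepts_SucI[OF t(1,2) insertI1 t(4)])
  then show ?case using S t(3) by (intro exI[of _ "insert d S"]) (auto simp: card_insert_if)
qed

lemma update_image: "update up (\<lambda>r. \<iota> ` f r) (\<iota> d) = (\<lambda>r. \<iota> ` update up f d r)"
proof
  fix r
  have "\<iota> ` update up f d r = \<Union> ((`) \<iota> ` {f r' | r'. Reg r' \<in> up r}) \<union> \<iota> ` (if In \<in> up r then {d} else {})"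
    unfolding update_def image_Un image_Union by blast
  also have "(`) \<iota> ` {f r' | r'. Reg r' \<in> up r} = {\<iota> ` f r' | r'. Reg r' \<in> up r}" by blast
  also have "\<iota> ` (if In \<in> up r then {d} else {}) = (if In \<in> up r then {\<iota> d} else {})" by simp
  finally show "update up (\<lambda>r. \<iota> ` f r) (\<iota> d) r = \<iota> ` update up f d r" unfolding update_def ..
qed

lemma accepts_rename:
  "accepts A D n q f \<Longrightarrow> inj_on \<iota> D \<Longrightarrow> \<iota> ` D \<subseteq> E \<Longrightarrow> (\<And>r. f r \<subseteq> D) \<Longrightarrow> accepts A E n q (\<lambda>r. \<iota> ` f r)"
proof (induction n arbitrary: q f)
  case (Suc n)
  from Suc.prems(1) obtain t d where t: "t \<in> transitions A" "src t = q" "d \<in> D" "enabled t f d"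
    "accepts A D n (tgt t) (update (upd t) f d)" by auto
  have "\<iota> d \<in> \<iota> ` f r \<longleftrightarrow> d \<in> f r" for r
    by (rule inj_on_image_mem_iff[OF Suc.prems(2) t(3) Suc.prems(4)])
  then have e: "enabled t (\<lambda>r. \<iota> ` f r) (\<iota> d)" using t(4) by (simp add: enabled_def)
  have "update (upd t) f d r \<subseteq> D" for r
    using Suc.prems(4) t(3) unfolding update_def by (simp add: Sup_le_iff) blast
  then have "accepts A E n (tgt t) (\<lambda>r. \<iota> ` update (upd t) f d r)"
    by (rule Suc.IH[OF t(5) Suc.prems(2,3)])
  then have "accepts A E n (tgt t) (update (upd t) (\<lambda>r. \<iota> ` f r) (\<iota> d))"
    unfolding update_image .
  moreover have "\<iota> d \<in> E" using Suc.prems(3) t(3) by blast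
  ultimately show ?case using accepts_SucI[OF t(1,2) _ e] by blast
qed simp

text \<open>A run of \<open>k\<close> steps reads at most \<open>k\<close> data, and acceptance from
  empty registers is invariant under renaming. So an infinite domain may be exchanged for
  \<open>n\<close> numbers.\<close>

lemma accepts_data:
  assumes "infinite D" "k \<le> n"
  shows "accepts A {..<n} k q (\<lambda>_. {}) \<longleftrightarrow> accepts A D k q (\<lambda>_. {})"
proof
  assume a: "accepts A {..<n} k q (\<lambda>_. {})"
  obtain S where S: "finite S" "card S = n" "S \<subseteq> D" using infinite_arbitrarily_large[OF assms(1)] by metis
  have "\<exists>\<iota>. bij_betw \<iota> {..<n} S"
    by (rule finite_same_card_bij) (simp_all add: S)
  then obtain \<iota> where "bij_betw \<iota> {..<n} S" ..
  then have "inj_on \<iota> {..<n}" "\<iota> ` {..<n} \<subseteq> D" using S(3) by (auto simp: bij_betw_def)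
  from accepts_rename[OF a this] show "accepts A D k q (\<lambda>_. {})" by simp
next
  assume "accepts A D k q (\<lambda>_. {})"
  from accepts_finite[OF this] show "accepts A {..<n} k q (\<lambda>_. {})"
  proof (elim exE conjE)
    fix S assume S: "finite S" "card S \<le> k" and a: "accepts A S k q (\<lambda>_. {})"
    have "\<exists>\<iota>. \<iota> ` S \<subseteq> {..<n} \<and> inj_on \<iota> S"
      by (rule card_le_inj) (use S assms(2) in simp_all)
    then show ?thesis
    proof (elim exE conjE)
      fix \<iota> assume "\<iota> ` S \<subseteq> {..<n}" "inj_on \<iota> S"
      from accepts_rename[OF a this(2,1)] show ?thesis by simp
    qed
  qed
qed

text \<open>
  A certificate \<open>\<zeta>\<close> of an accepting run with data below \<open>n\<close>: \<open>\<zeta> 0 i\<close>, \<open>\<zeta> 1 i\<close>, \<open>\<zeta> 2 i\<close> are the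
  state, the index of the transition and the datum at time \<open>i\<close>, and \<open>\<zeta> 3 i r d\<close> tells whether
  register \<open>r\<close> contains \<open>d\<close>.
\<close>

definition run_cert :: "nat \<Rightarrow> presentation \<Rightarrow> nat \<Rightarrow> nat \<Rightarrow> presentation \<Rightarrow> bool" where
  "run_cert b \<alpha> n k \<zeta> \<longleftrightarrow>
     \<zeta> 0 0 0 0 < b \<and> \<alpha> 2 (\<zeta> 0 0 0 0) 0 0 \<noteq> 0 \<and> \<zeta> 0 k 0 0 < b \<and> \<alpha> 3 (\<zeta> 0 k 0 0) 0 0 \<noteq> 0 \<and>
     (\<forall>r<b. \<forall>d<n. \<zeta> 3 0 r d = 0) \<and>
     (\<forall>i<k. \<zeta> 1 i 0 0 < \<alpha> 4 0 0 0 \<and> \<alpha> 5 (\<zeta> 1 i 0 0) 0 0 = \<zeta> 0 i 0 0 \<and>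
       \<alpha> 10 (\<zeta> 1 i 0 0) 0 0 = \<zeta> 0 (Suc i) 0 0 \<and> \<zeta> 2 i 0 0 < n \<and>
       (\<forall>r<b. (\<alpha> 7 (\<zeta> 1 i 0 0) r 0 \<noteq> 0 \<longrightarrow> \<zeta> 3 i r (\<zeta> 2 i 0 0) \<noteq> 0) \<and>
         (\<alpha> 8 (\<zeta> 1 i 0 0) r 0 \<noteq> 0 \<longrightarrow> \<zeta> 3 i r (\<zeta> 2 i 0 0) = 0) \<and>
         (\<forall>d<n. \<zeta> 3 (Suc i) r d \<noteq> 0 \<longleftrightarrow> \<alpha> 1 r 0 0 \<noteq> 0 \<and>
           ((\<exists>r'<b. \<alpha> 9 (\<zeta> 1 i 0 0) r (Suc r') \<noteq> 0 \<and> \<zeta> 3 i r' d \<noteq> 0) \<or>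
            \<alpha> 9 (\<zeta> 1 i 0 0) r 0 \<noteq> 0 \<and> d = \<zeta> 2 i 0 0))))"

lemma update_pres_trans:
  "update (upd (pres_trans \<Sigma> \<nu> b \<alpha> i)) f d r = {e. r \<in> pres_set b \<alpha> 1 \<and>
     ((\<exists>r'<b. \<alpha> 9 i r (Suc r') \<noteq> 0 \<and> e \<in> f r') \<or> \<alpha> 9 i r 0 \<noteq> 0 \<and> e = d)}"
  by (auto simp: update_def pres_trans_def pres_upd_def)

lemma run_cert_accepts:
  assumes "run_cert b \<alpha> n k \<zeta>"
  shows "\<exists>q\<in>initial (pres_aut \<Sigma> \<nu> b \<alpha>). accepts (pres_aut \<Sigma> \<nu> b \<alpha>) {..<n} k q (\<lambda>_. {})"
proof
  let ?A = "pres_aut \<Sigma> \<nu> b \<alpha>"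
  define fs where "fs i r = {d. r < b \<and> d < n \<and> \<zeta> 3 i r d \<noteq> 0}" for i r
  let ?ts = "\<lambda>i. pres_trans \<Sigma> \<nu> b \<alpha> (\<zeta> 1 i 0 0)"
  note c = assms[unfolded run_cert_def]
  show "\<zeta> 0 0 0 0 \<in> initial ?A" using c by (simp add: pres_aut_def pres_set_def)
  have "run_seq ?A {..<n} k (\<lambda>i. \<zeta> 0 i 0 0) fs ?ts (\<lambda>i. \<zeta> 2 i 0 0)"
    unfolding run_seq_def
  proof (intro allI impI)
    fix i assume i: "i < k"
    let ?t = "\<zeta> 1 i 0 0" and ?d = "\<zeta> 2 i 0 0"
    have s: "?t < \<alpha> 4 0 0 0" "\<alpha> 5 ?t 0 0 = \<zeta> 0 i 0 0" "\<alpha> 10 ?t 0 0 = \<zeta> 0 (Suc i) 0 0" "?d < n"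
      and g: "\<And>r. r < b \<Longrightarrow> (\<alpha> 7 ?t r 0 \<noteq> 0 \<longrightarrow> \<zeta> 3 i r ?d \<noteq> 0) \<and> (\<alpha> 8 ?t r 0 \<noteq> 0 \<longrightarrow> \<zeta> 3 i r ?d = 0)"
      and u: "\<And>r d. r < b \<Longrightarrow> d < n \<Longrightarrow> \<zeta> 3 (Suc i) r d \<noteq> 0 \<longleftrightarrow> \<alpha> 1 r 0 0 \<noteq> 0 \<and>
           ((\<exists>r'<b. \<alpha> 9 ?t r (Suc r') \<noteq> 0 \<and> \<zeta> 3 i r' d \<noteq> 0) \<or> \<alpha> 9 ?t r 0 \<noteq> 0 \<and> d = ?d)"
      using c i by blast+
    have "enabled (?ts i) (fs i) ?d"
      using g s(4) unfolding enabled_def fs_def pres_trans_def pres_guard_def by simp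
    moreover have "fs (Suc i) = update (upd (?ts i)) (fs i) ?d"
    proof
      fix r show "fs (Suc i) r = update (upd (?ts i)) (fs i) ?d r"
      proof (rule set_eqI)
        fix d
        have "d \<in> fs (Suc i) r \<longleftrightarrow> r < b \<and> d < n \<and> \<alpha> 1 r 0 0 \<noteq> 0 \<and>
           ((\<exists>r'<b. \<alpha> 9 ?t r (Suc r') \<noteq> 0 \<and> \<zeta> 3 i r' d \<noteq> 0) \<or> \<alpha> 9 ?t r 0 \<noteq> 0 \<and> d = ?d)"
          unfolding fs_def using u[of r d] by blast
        also have "\<dots> \<longleftrightarrow> d \<in> update (upd (?ts i)) (fs i) ?d r"
          unfolding update_pres_trans fs_def pres_set_def using s(4) by blast
        finally show "d \<in> fs (Suc i) r \<longleftrightarrow> d \<in> update (upd (?ts i)) (fs i) ?d r" .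
      qed
    qed
    moreover have "?ts i \<in> transitions ?A" using s(1) by (simp add: pres_aut_def)
    ultimately show "?ts i \<in> transitions ?A \<and> src (?ts i) = \<zeta> 0 i 0 0 \<and> ?d \<in> {..<n} \<and>
        enabled (?ts i) (fs i) ?d \<and> tgt (?ts i) = \<zeta> 0 (Suc i) 0 0 \<and>
        fs (Suc i) = update (upd (?ts i)) (fs i) ?d"
      using s(2,3,4) by (simp add: pres_trans_def)
  qed
  moreover have "fs 0 = (\<lambda>_. {})"
  proof -
    have "\<forall>r<b. \<forall>d<n. \<zeta> 3 0 r d = 0" using c by blast
    then show ?thesis by (intro ext) (auto simp: fs_def)
  qed
  moreover have "\<zeta> 0 k 0 0 \<in> final ?A" using c by (simp add: pres_aut_def pres_set_def)
  ultimately show "accepts ?A {..<n} k (\<zeta> 0 0 0 0) (\<lambda>_. {})"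
    unfolding accepts_run_seq by (intro exI[of _ "\<lambda>i. \<zeta> 0 i 0 0"] exI[of _ fs] exI[of _ ?ts] exI[of _ "\<lambda>i. \<zeta> 2 i 0 0"]) simp
qed

lemma accepts_run_cert:
  assumes wf: "pres_wf N b \<alpha>" and l: "\<alpha> 4 0 0 0 \<le> b" and k: "k \<le> n"
    and q: "q \<in> initial (pres_aut \<Sigma> \<nu> b \<alpha>)" and a: "accepts (pres_aut \<Sigma> \<nu> b \<alpha>) {..<n} k q (\<lambda>_. {})"
  shows "\<exists>\<zeta>. run_cert b \<alpha> n k \<zeta> \<and> (\<forall>t i r x. \<zeta> t i r x < b + n + 12) \<and>
    (\<forall>t i r x. \<zeta> t i r x \<noteq> 0 \<longrightarrow> t < b + n + 12 \<and> i < b + n + 12 \<and> r < b + n + 12 \<and> x < b + n + 12)"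
proof -
  let ?A = "pres_aut \<Sigma> \<nu> b \<alpha>"
  obtain qs fs ts ds where s: "run_seq ?A {..<n} k qs fs ts ds" and q0: "qs 0 = q" and f0: "fs 0 = (\<lambda>_. {})"
    and qk: "qs k \<in> final ?A" using a[unfolded accepts_run_seq] by blast
  have st: "ts i \<in> transitions ?A \<and> src (ts i) = qs i \<and> ds i < n \<and>
     enabled (ts i) (fs i) (ds i) \<and> tgt (ts i) = qs (Suc i) \<and> fs (Suc i) = update (upd (ts i)) (fs i) (ds i)"
    if "i < k" for i using s that unfolding run_seq_def by simp
  have "\<exists>j. j < \<alpha> 4 0 0 0 \<and> ts i = pres_trans \<Sigma> \<nu> b \<alpha> j" if "i < k" for i
    using st[OF that] by (auto simp: pres_aut_def)
  then obtain \<tau> where \<tau>: "\<And>i. i < k \<Longrightarrow> \<tau> i < \<alpha> 4 0 0 0 \<and> ts i = pres_trans \<Sigma> \<nu> b \<alpha> (\<tau> i)" by metis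
  have qb: "qs i < b" if "i \<le> k" for i
  proof (cases i)
    case 0
    then show ?thesis using q q0 by (simp add: pres_aut_def pres_set_def)
  next
    case (Suc j)
    then have "qs i = \<alpha> 10 (\<tau> j) 0 0" using st[of j] \<tau>[of j] that by (simp add: pres_trans_def)
    then show ?thesis using pres_wfD(2)[OF wf, of "\<tau> j"] \<tau>[of j] that Suc by (simp add: pres_set_def)
  qed
  define \<zeta> :: presentation where "\<zeta> t i r x =
    (if t = 0 \<and> i \<le> k \<and> r = 0 \<and> x = 0 then qs i
     else if t = 1 \<and> i < k \<and> r = 0 \<and> x = 0 then \<tau> i
     else if t = 2 \<and> i < k \<and> r = 0 \<and> x = 0 then ds i
     else if t = 3 \<and> i \<le> k \<and> r < b \<and> x < n \<and> x \<in> fs i r then 1 else 0)" for t i r x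
  have z: "i \<le> k \<Longrightarrow> \<zeta> 0 i 0 0 = qs i" "i < k \<Longrightarrow> \<zeta> 1 i 0 0 = \<tau> i" "i < k \<Longrightarrow> \<zeta> 2 i 0 0 = ds i"
    "i \<le> k \<Longrightarrow> r < b \<Longrightarrow> d < n \<Longrightarrow> \<zeta> 3 i r d \<noteq> 0 \<longleftrightarrow> d \<in> fs i r" for i r d
    by (simp_all add: \<zeta>_def del: One_nat_def)
  have "run_cert b \<alpha> n k \<zeta>"
    unfolding run_cert_def
  proof (intro conjI allI impI)
    show "\<zeta> 0 0 0 0 < b" "\<zeta> 0 k 0 0 < b" using qb by (simp_all add: z)
    show "\<alpha> 2 (\<zeta> 0 0 0 0) 0 0 \<noteq> 0" using q q0 by (simp add: z pres_aut_def pres_set_def)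
    show "\<alpha> 3 (\<zeta> 0 k 0 0) 0 0 \<noteq> 0" using qk by (simp add: z pres_aut_def pres_set_def)
    show "\<zeta> 3 0 r d = 0" for r d using f0 by (simp add: \<zeta>_def)
    fix i assume i: "i < k"
    note zi = z(1)[of i] z(1)[of "Suc i"] z(2,3)[OF i]
    show "\<zeta> 1 i 0 0 < \<alpha> 4 0 0 0" "\<zeta> 2 i 0 0 < n" using i st \<tau> by (simp_all add: zi del: One_nat_def)
    show "\<alpha> 5 (\<zeta> 1 i 0 0) 0 0 = \<zeta> 0 i 0 0" "\<alpha> 10 (\<zeta> 1 i 0 0) 0 0 = \<zeta> 0 (Suc i) 0 0"
      using i st[OF i] \<tau>[OF i] by (simp_all add: zi pres_trans_def del: One_nat_def)
    fix r assume r: "r < b"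
    have en: "enabled (pres_trans \<Sigma> \<nu> b \<alpha> (\<tau> i)) (fs i) (ds i)" "ds i < n" using st[OF i] \<tau>[OF i] by (simp_all del: One_nat_def)
    show "\<zeta> 3 i r (\<zeta> 2 i 0 0) \<noteq> 0" if "\<alpha> 7 (\<zeta> 1 i 0 0) r 0 \<noteq> 0"
      using en that r i z(4)[of i r "ds i"] by (simp add: zi enabled_def pres_trans_def pres_guard_def del: One_nat_def)
    show "\<zeta> 3 i r (\<zeta> 2 i 0 0) = 0" if "\<alpha> 8 (\<zeta> 1 i 0 0) r 0 \<noteq> 0"
      using en that r i z(4)[of i r "ds i"] by (simp add: zi enabled_def pres_trans_def pres_guard_def del: One_nat_def)
    fix d assume d: "d < n"
    have "fs (Suc i) = update (upd (pres_trans \<Sigma> \<nu> b \<alpha> (\<tau> i))) (fs i) (ds i)" using st[OF i] \<tau>[OF i] by simp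
    then have "d \<in> fs (Suc i) r \<longleftrightarrow> r \<in> pres_set b \<alpha> 1 \<and>
       ((\<exists>r'<b. \<alpha> 9 (\<tau> i) r (Suc r') \<noteq> 0 \<and> d \<in> fs i r') \<or> \<alpha> 9 (\<tau> i) r 0 \<noteq> 0 \<and> d = ds i)"
      unfolding update_pres_trans by simp
    moreover have "\<zeta> 3 (Suc i) r d \<noteq> 0 \<longleftrightarrow> d \<in> fs (Suc i) r" using i r d by (intro z(4)) auto
    moreover have "\<zeta> 3 i r' d \<noteq> 0 \<longleftrightarrow> d \<in> fs i r'" if "r' < b" for r' using i d that by (intro z(4)) auto
    moreover have "r \<in> pres_set b \<alpha> 1 \<longleftrightarrow> \<alpha> 1 r 0 0 \<noteq> 0" using r by (simp add: pres_set_def)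
    ultimately show "\<zeta> 3 (Suc i) r d \<noteq> 0 \<longleftrightarrow> \<alpha> 1 r 0 0 \<noteq> 0 \<and>
           ((\<exists>r'<b. \<alpha> 9 (\<zeta> 1 i 0 0) r (Suc r') \<noteq> 0 \<and> \<zeta> 3 i r' d \<noteq> 0) \<or>
            \<alpha> 9 (\<zeta> 1 i 0 0) r 0 \<noteq> 0 \<and> d = \<zeta> 2 i 0 0)"
      unfolding zi(3,4) by blast
  qed
  moreover have "\<zeta> t i r x < b + n + 12" for t i r x
  proof -
    have "\<tau> i < b" "ds i < n" if "i < k" using \<tau>[OF that] st[OF that] l by auto
    then show ?thesis using qb[of i] unfolding \<zeta>_def by (auto simp: less_imp_le trans_less_add1 trans_less_add2)
  qed
  moreover have "t < b + n + 12 \<and> i < b + n + 12 \<and> r < b + n + 12 \<and> x < b + n + 12" if "\<zeta> t i r x \<noteq> 0" for t i r x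
    using that k unfolding \<zeta>_def by (simp split: if_splits)
  ultimately show ?thesis by blast
qed

text \<open>Certificates range over the numbers that code tables of sufficient size; 12 leaves room
  for the table index.\<close>

definition no_run :: "nat \<Rightarrow> presentation \<Rightarrow> nat \<Rightarrow> bool" where
  "no_run b \<alpha> n \<longleftrightarrow> \<not> (\<exists>k<Suc n. \<exists>y < (b + n + 12) ^ ((b + n + 12) ^ 4).
     run_cert b \<alpha> n k (digits (b + n + 12) (b + n + 12) y))"

lemma no_run_iff:
  assumes "pres_wf N b \<alpha>" "\<alpha> 4 0 0 0 \<le> b"
  shows "no_run b \<alpha> n \<longleftrightarrow>
    (\<forall>k\<le>n. \<forall>q\<in>initial (pres_aut \<Sigma> \<nu> b \<alpha>). \<not> accepts (pres_aut \<Sigma> \<nu> b \<alpha>) {..<n} k q (\<lambda>_. {}))"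
proof
  assume no: "no_run b \<alpha> n"
  show "\<forall>k\<le>n. \<forall>q\<in>initial (pres_aut \<Sigma> \<nu> b \<alpha>). \<not> accepts (pres_aut \<Sigma> \<nu> b \<alpha>) {..<n} k q (\<lambda>_. {})"
  proof (intro allI impI ballI notI)
    fix k q assume k: "k \<le> n" and q: "q \<in> initial (pres_aut \<Sigma> \<nu> b \<alpha>)"
      "accepts (pres_aut \<Sigma> \<nu> b \<alpha>) {..<n} k q (\<lambda>_. {})"
    obtain \<zeta> where z: "run_cert b \<alpha> n k \<zeta>" "\<And>t i r x. \<zeta> t i r x < b + n + 12"
      "\<And>t i r x. \<zeta> t i r x \<noteq> 0 \<Longrightarrow> t < b + n + 12 \<and> i < b + n + 12 \<and> r < b + n + 12 \<and> x < b + n + 12"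
      using accepts_run_cert[OF assms k q] by blast
    have "\<exists>y < (b + n + 12) ^ ((b + n + 12) ^ 4). digits (b + n + 12) (b + n + 12) y = \<zeta>"
      by (rule digits_surj) (fact z(2), fact z(3))
    then obtain y where "y < (b + n + 12) ^ ((b + n + 12) ^ 4)" "digits (b + n + 12) (b + n + 12) y = \<zeta>"
      by blast
    then have "\<exists>k<Suc n. \<exists>y < (b + n + 12) ^ ((b + n + 12) ^ 4).
        run_cert b \<alpha> n k (digits (b + n + 12) (b + n + 12) y)"
      using z(1) k by (intro exI[of _ k] conjI exI[of _ y]) simp_all
    then show False using no unfolding no_run_def by simp
  qed
next
  assume none: "\<forall>k\<le>n. \<forall>q\<in>initial (pres_aut \<Sigma> \<nu> b \<alpha>). \<not> accepts (pres_aut \<Sigma> \<nu> b \<alpha>) {..<n} k q (\<lambda>_. {})"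
  have "\<not> run_cert b \<alpha> n k \<zeta>" if "k < Suc n" for k \<zeta>
  proof
    assume "run_cert b \<alpha> n k \<zeta>"
    from run_cert_accepts[OF this, of \<Sigma> \<nu>] none that show False by (metis less_Suc_eq_le)
  qed
  then show "no_run b \<alpha> n" unfolding no_run_def by simp
qed

text \<open>Some presentation has a code with number \<open>x\<close> and no accepting run up to
  \<open>n\<close>. As words are no longer than their numbers, \<open>x\<close> also bounds the
  names.\<close>

definition bounded_empty :: "nat set \<Rightarrow> nat \<Rightarrow> nat \<Rightarrow> bool" where
  "bounded_empty N x n \<longleftrightarrow> (\<exists>z < (x + 1) ^ ((x + 12) ^ 4).
     pres_wf N x (digits (x + 1) (x + 12) z) \<and> word_num (pres_code x (digits (x + 1) (x + 12) z)) = x \<and>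
     no_run x (digits (x + 1) (x + 12) z) n)"

lemma bounded_empty_iff:
  fixes \<Sigma> :: "'a set" and D :: "'d set"
  assumes inj: "inj_on \<nu> \<Sigma>" and D: "infinite D"
    and n: "fast_omega (2 * 2 ^ word_num w + 2 ^ word_num w + word_num w + 2) \<le> n"
  shows "bounded_empty (\<nu> ` \<Sigma>) (word_num w) n \<longleftrightarrow> w \<in> rsa_emptiness \<Sigma> \<nu> D"
proof -
  let ?x = "word_num w"
  have lang: "no_run ?x \<alpha> n \<longleftrightarrow> lang \<Sigma> D (pres_aut \<Sigma> \<nu> ?x \<alpha>) = {}"
    if wf: "pres_wf (\<nu> ` \<Sigma>) ?x \<alpha>" and l: "\<alpha> 4 0 0 0 \<le> ?x" for \<alpha>
  proof -
    let ?A = "pres_aut \<Sigma> \<nu> ?x \<alpha>"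
    have wfA: "wf_rsa \<Sigma> ?A" by (rule pres_wf_wf_rsa[OF wf])
    have c: "card (pres_set ?x \<alpha> t) \<le> ?x" for t
      using card_mono[of "{..<?x}" "pres_set ?x \<alpha> t"] by (auto simp: pres_set_def)
    have cR: "card (regs ?A) \<le> ?x" "card (states ?A) \<le> ?x" using c by (simp_all add: pres_aut_def)
    have p: "(2::nat) ^ card (regs ?A) \<le> 2 ^ ?x" using cR(1) by (intro power_increasing) auto
    \<comment> \<open>The argument of \<open>fast_omega\<close> was chosen to exceed both the level
      and the argument in \<open>short_accepting_run\<close>, given at most \<open>?x\<close> states
      and registers.\<close>
    have "fast (2 * 2 ^ card (regs ?A) + 2) (2 ^ card (regs ?A) + card (states ?A)) \<le>
      fast (2 * 2 ^ ?x + 2 ^ ?x + ?x + 2 + 1) (2 * 2 ^ ?x + 2 ^ ?x + ?x + 2)"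
      using p cR by (intro fast_mono) linarith+
    also have "\<dots> \<le> n" using n by (simp add: fast_omega_def)
    finally have le: "fast (2 * 2 ^ card (regs ?A) + 2) (2 ^ card (regs ?A) + card (states ?A)) \<le> n" .
    note nr = no_run_iff[OF wf l, of n \<Sigma> \<nu>] and le_D = lang_empty_iff[OF wfA, of D]
    show ?thesis
    proof
      assume "no_run ?x \<alpha> n"
      show "lang \<Sigma> D ?A = {}"
      proof (rule ccontr)
        assume "lang \<Sigma> D ?A \<noteq> {}"
        then obtain m q where q: "q \<in> initial ?A" "accepts ?A D m q (\<lambda>_. {})" using le_D by auto
        from short_accepting_run[OF wfA D q] show False
        proof (elim exE conjE)
          fix k assume "k \<le> fast (2 * 2 ^ card (regs ?A) + 2) (2 ^ card (regs ?A) + card (states ?A))"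
            and a: "accepts ?A D k q (\<lambda>_. {})"
          then have k: "k \<le> n" using le by simp
          then have "accepts ?A {..<n} k q (\<lambda>_. {})" using a by (simp only: accepts_data[OF D k])
          then show False using nr \<open>no_run ?x \<alpha> n\<close> k q(1) by simp
        qed
      qed
    next
      assume L: "lang \<Sigma> D ?A = {}"
      have "\<not> accepts ?A {..<n} k q (\<lambda>_. {})" if k: "k \<le> n" and "q \<in> initial ?A" for k q
        unfolding accepts_data[OF D k] using L le_D that by simp
      then show "no_run ?x \<alpha> n" using nr by simp
    qed
  qed
  show ?thesis
  proof
    assume "bounded_empty (\<nu> ` \<Sigma>) ?x n"
    then obtain z where z: "pres_wf (\<nu> ` \<Sigma>) ?x (digits (?x + 1) (?x + 12) z)"
      "word_num (pres_code ?x (digits (?x + 1) (?x + 12) z)) = ?x" "no_run ?x (digits (?x + 1) (?x + 12) z) n"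
      unfolding bounded_empty_def by blast
    let ?\<alpha> = "digits (?x + 1) (?x + 12) z"
    have "?\<alpha> 4 0 0 0 \<le> ?x" using digits_less[of "?x + 1" "?x + 12" z 4 0 0 0] by simp
    then have "lang \<Sigma> D (pres_aut \<Sigma> \<nu> ?x ?\<alpha>) = {}" using lang[OF z(1)] z(3) by blast
    moreover have "w \<in> codes \<nu> (pres_aut \<Sigma> \<nu> ?x ?\<alpha>)"
      using pres_code_in_codes[OF z(1)] z(2) by (simp add: word_num_inject)
    ultimately show "w \<in> rsa_emptiness \<Sigma> \<nu> D"
      using pres_wf_wf_rsa[OF z(1)] unfolding rsa_emptiness_def by blast
  next
    assume "w \<in> rsa_emptiness \<Sigma> \<nu> D"
    then obtain A :: "(nat, nat, 'a) rsa" where A: "wf_rsa \<Sigma> A" "w \<in> codes \<nu> A" "lang \<Sigma> D A = {}"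
      unfolding rsa_emptiness_def by blast
    obtain \<alpha> where a: "pres_wf (\<nu> ` \<Sigma>) ?x \<alpha>" "pres_code ?x \<alpha> = w" "pres_aut \<Sigma> \<nu> ?x \<alpha> = A"
      "\<And>t i r x. \<alpha> t i r x \<le> ?x" "\<And>t i r x. \<alpha> t i r x \<noteq> 0 \<Longrightarrow> t \<le> 10 \<and> i \<le> ?x \<and> r \<le> ?x \<and> x \<le> ?x"
      using codes_presentation[OF A(1,2) inj length_le_word_num] by blast
    have "\<exists>z < (?x + 1) ^ ((?x + 12) ^ 4). digits (?x + 1) (?x + 12) z = \<alpha>"
    proof (rule digits_surj)
      show "\<alpha> t i r x < ?x + 1" for t i r x using a(4)[of t i r x] by simp
      show "t < ?x + 12 \<and> i < ?x + 12 \<and> r < ?x + 12 \<and> x < ?x + 12" if "\<alpha> t i r x \<noteq> 0" for t i r x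
        using a(5)[OF that] by auto
    qed
    then obtain z where z: "z < (?x + 1) ^ ((?x + 12) ^ 4)" "digits (?x + 1) (?x + 12) z = \<alpha>" by blast
    have "no_run ?x \<alpha> n" using lang[OF a(1)] a(4) A(3) a(3) by simp
    then show "bounded_empty (\<nu> ` \<Sigma>) ?x n"
      unfolding bounded_empty_def using a(1,2) z by (intro exI[of _ z]) simp
  qed
qed

lemma prb_run_cert:
  assumes "pr (\<lambda>e. A (e 0) (e 1) (e 2) (e 3) (e 4))" "pr (\<lambda>e. Z (e 0) (e 1) (e 2) (e 3) (e 4))"
    "pr b" "pr a" "pr n" "pr k" "pr z"
  shows "prb (\<lambda>e. run_cert (b e) (A (a e)) (n e) (k e) (Z (z e)))"
proof -
  have "prb (\<lambda>e. run_cert (e 0) (A (e 1)) (e 2) (e 3) (Z (e 4)))"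
    unfolding run_cert_def
    by (intro prb_all prb_ex prb_imp prb_iff prb_conj prb_disj prb_less prb_not prb_eq
      pr_const pr_var pr_Suc pr_app5[OF assms(1)] pr_app5[OF assms(2)])
  then show ?thesis
    by (rule pr_app5[of "\<lambda>b a n k z. of_bool (run_cert b (A a) n k (Z z))"]) (fact assms)+
qed

lemma prb_bounded_empty: "finite N \<Longrightarrow> prb (\<lambda>e. bounded_empty N (e 0) (e 1))"
proof -
  assume N: "finite N"
  \<comment> \<open>Base and digits are packed into one index by pairing, to match the families in
    \<open>prb_pres_wf\<close> and \<open>prw_pres_code\<close>; 11 because the base
    \<open>x + 1\<close> and the range \<open>x + 12\<close> differ by it.\<close>
  define A where "A p = digits (fst (prod_decode p)) (fst (prod_decode p) + 11) (snd (prod_decode p))" for p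
  define Z where "Z p = digits (fst (prod_decode p)) (fst (prod_decode p)) (snd (prod_decode p))" for p
  have prA: "pr (\<lambda>e. A (e 0) (e 1) (e 2) (e 3) (e 4))"
    unfolding A_def by (intro pr_digits pr_fst_decode pr_snd_decode pr_intros)
  have prZ: "pr (\<lambda>e. Z (e 0) (e 1) (e 2) (e 3) (e 4))"
    unfolding Z_def by (intro pr_digits pr_fst_decode pr_snd_decode pr_intros)
  have a: "digits (x + 1) (x + 12) z = A (prod_encode (x + 1, z))" for x z
    by (simp add: A_def add.commute)
  have z: "digits (b + n + 12) (b + n + 12) z = Z (prod_encode (b + n + 12, z))" for b n z
    by (simp add: Z_def)
  show ?thesis unfolding bounded_empty_def no_run_def z a
    by (intro prb_ex prb_conj prb_not prb_pres_wf prb_eq prb_run_cert prw_pres_code prA prZ N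
      pr_prod_encode pr_power pr_add pr_const pr_var pr_Suc)
qed

section \<open>The upper bound\<close>

text \<open>The machine searches for the least \<open>n\<close> with F_omega of \<open>q x\<close>
  at most \<open>n\<close>. This is the value itself, found without computing an Ackermannian
  function directly, and \<open>bounded_empty\<close> is then correct for it.\<close>

lemma rsa_emptiness_upper:
  fixes \<Sigma> :: "'a set" and D :: "'d set"
  assumes "finite \<Sigma>" and inj: "inj_on \<nu> \<Sigma>" and D: "infinite D"
  shows "decidable (rsa_emptiness \<Sigma> \<nu> D)" "rsa_emptiness \<Sigma> \<nu> D \<in> F_omega"
proof -
  let ?L = "rsa_emptiness \<Sigma> \<nu> D"
  define q where "q x = 2 * 2 ^ x + 2 ^ x + x + 2" for x :: nat
  have pr_q: "pr a \<Longrightarrow> pr (\<lambda>e. q (a e))" for a unfolding q_def by (intro pr_intros)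
  have "prb (\<lambda>e. \<not> fast_omega (q (e 0)) \<le> e 1)"
    by (intro prb_not prb_fast_omega_le pr_q pr_var)
  then obtain f where f: "prim_rec f" "\<And>x n. of_bool (\<not> fast_omega (q x) \<le> n) = f [x, n]"
    by (rule prE2) (rule that)
  have "prb (\<lambda>e. bounded_empty (\<nu> ` \<Sigma>) (e 0) (e 1))"
    using assms(1) by (intro prb_bounded_empty) simp
  then obtain g where g: "prim_rec g" "\<And>x n. of_bool (bounded_empty (\<nu> ` \<Sigma>) x n) = g [x, n]"
    by (rule prE2) (rule that)
  obtain M B where M: "wf_tm M" "majorized B" and run: "\<And>L w n. f [word_num w, n] = 0 \<Longrightarrow>
      \<forall>m<n. f [word_num w, m] \<noteq> 0 \<Longrightarrow> (g [word_num w, n] \<noteq> 0 \<longleftrightarrow> w \<in> L) \<Longrightarrow>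
      \<exists>t \<le> B (word_num w + n). answers_within M L w t"
    using search_machine[OF f(1) g(1)] by blast
  obtain k where k: "\<And>x. B x \<le> fast k (x + 1)" using M(2) by (auto simp: majorized_def)
  \<comment> \<open>The number of a word of length \<open>n\<close> is at most
    \<open>2 ^ (n + 1)\<close>; the constant comes from absorbing level \<open>k + 2\<close> by
    \<open>fast_fast_omega\<close>.\<close>
  define p where "p n = q (2 ^ (n + 1)) + k + 3" for n
  have ans: "\<exists>t \<le> fast_omega (p (length w)). answers_within M ?L w t" for w
  proof -
    let ?x = "word_num w"
    let ?F = "fast_omega (q ?x)"
    have "\<exists>t \<le> B (?x + ?F). answers_within M ?L w t"
    proof (rule run)
      show "f [?x, ?F] = 0" using f(2)[of ?x ?F] by simp
      show "\<forall>m<?F. f [?x, m] \<noteq> 0" using f(2)[of ?x, symmetric] by simp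
      show "g [?x, ?F] \<noteq> 0 \<longleftrightarrow> w \<in> ?L"
        using bounded_empty_iff[OF inj D, of w ?F] g(2)[of ?x ?F, symmetric] by (simp add: q_def)
    qed
    moreover have "B (?x + ?F) \<le> fast_omega (p (length w))"
    proof -
      have F: "?x \<le> ?F" "1 \<le> ?F" using fast_omega_ge[of "q ?x"] by (simp_all add: q_def)
      have "B (?x + ?F) \<le> fast k (?x + ?F + 1)" by (rule k)
      also have "\<dots> \<le> fast (k + 1) (fast (k + 1) ?F)"
      proof (rule fast_mono)
        have "?x + ?F + 1 \<le> fast 1 ?F" using F by (simp only: fast_one)
        also have "\<dots> \<le> fast (k + 1) ?F" by (rule fast_mono) simp_all
        finally show "?x + ?F + 1 \<le> fast (k + 1) ?F" .
      qed simp
      also have "\<dots> \<le> fast (k + 2) ?F" using fast_fast[OF F(2), of "k + 1"] by simp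
      also have "\<dots> \<le> fast_omega (q ?x + (k + 2) + 1)" by (rule fast_fast_omega) (simp add: q_def)
      also have "\<dots> \<le> fast_omega (p (length w))"
      proof (rule fast_omega_mono)
        have x: "?x \<le> 2 ^ (length w + 1)" using word_num_bounds[of w] by linarith
        then have "(2::nat) ^ ?x \<le> 2 ^ (2 ^ (length w + 1))" by (intro power_increasing) auto
        then show "q ?x + (k + 2) + 1 \<le> p (length w)" using x unfolding p_def q_def by linarith
      qed
      finally show ?thesis .
    qed
    ultimately show ?thesis using order_trans by blast
  qed
  then show "decidable ?L" unfolding decidable_def using M(1) by blast
  have "prim_rec1 p" unfolding prim_rec1_iff p_def by (intro pr_intros pr_q)
  moreover have "?L \<in> DTIME (\<lambda>n. fast_omega (p n))"
    unfolding DTIME_def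
  proof (rule CollectI, rule exI[of _ M], rule exI[of _ "1 :: nat"], intro conjI allI)
    show "wf_tm M" by (rule M)
    show "\<exists>t \<le> 1 * fast_omega (p (length w)) + 1. answers_within M ?L w t" for w
      using ans[of w] by (metis add.commute le_add2 mult_1 order_trans)
  qed
  ultimately show "?L \<in> F_omega" unfolding F_omega_def by blast
qed

section \<open>Lower bound: Ackermannian computations in register set automata\<close>

section \<open>Turing machines by primitive recursive functions\<close>

primrec nest :: "nat list \<Rightarrow> nat" where
  "nest [] = 0"
| "nest (x # xs) = prod_encode (x, nest xs)"

text \<open>The index depends only on the machine at hand, so that each \<open>entry i\<close> is a
  fixed composition of decodings.\<close>

definition entry :: "nat \<Rightarrow> nat \<Rightarrow> nat" where
  "entry i z = fst (prod_decode (((\<lambda>z. snd (prod_decode z)) ^^ i) z))"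

lemma entry_nest: "i < length xs \<Longrightarrow> entry i (nest xs) = xs ! i"
proof (induction xs arbitrary: i)
  case (Cons x xs)
  show ?case
  proof (cases i)
    case (Suc j)
    then show ?thesis using Cons by (simp add: entry_def funpow_Suc_right del: funpow.simps)
  qed (simp add: entry_def)
qed simp

lemma pr_entry: "pr a \<Longrightarrow> pr (\<lambda>e. entry i (a e))"
proof -
  assume "pr a"
  then have "pr (\<lambda>e. ((\<lambda>z. snd (prod_decode z)) ^^ i) (a e))"
    by (induction i) (auto intro: pr_snd_decode)
  then show ?thesis unfolding entry_def by (rule pr_fst_decode)
qed

lemma pr_nest: "(\<And>i. i \<in> set is \<Longrightarrow> pr (F i)) \<Longrightarrow> pr (\<lambda>e. nest (map (\<lambda>i. F i e) is))"
  by (induction "is") (auto intro: pr_zero pr_prod_encode)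

text \<open>A tape as two numbers in base \<open>b\<close>: the cells to the left of the head, and the others.\<close>

definition tape_rep :: "nat \<Rightarrow> tape \<Rightarrow> nat \<Rightarrow> nat \<Rightarrow> bool" where
  "tape_rep b T l r \<longleftrightarrow> (\<forall>i. l div b ^ i mod b = fst T (snd T - 1 - int i) \<and>
     r div b ^ i mod b = fst T (snd T + int i))"

definition move_num :: "move \<Rightarrow> nat" where
  "move_num m = (case m of Left \<Rightarrow> 0 | Stay \<Rightarrow> 1 | Right \<Rightarrow> 2)"

definition new_left :: "nat \<Rightarrow> nat \<Rightarrow> nat \<Rightarrow> nat \<Rightarrow> nat" where
  "new_left b s m l = (if m = 0 then l div b else if m = 1 then l else l * b + s)"

definition new_right :: "nat \<Rightarrow> nat \<Rightarrow> nat \<Rightarrow> nat \<Rightarrow> nat \<Rightarrow> nat" where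
  "new_right b s m l r = (if m = 0 then (r div b * b + s) * b + l mod b
     else if m = 1 then r div b * b + s else r div b)"

lemma tape_rep_act:
  assumes rep: "tape_rep b T l r" and s: "s < b"
  shows "tape_rep b (act (s, m) T) (new_left b s (move_num m) l) (new_right b s (move_num m) l r)"
proof -
  obtain c h where T: "T = (c, h)" by (cases T)
  have L: "l div b ^ i mod b = c (h - 1 - int i)" and R: "r div b ^ i mod b = c (h + int i)" for i
    using rep by (simp_all add: tape_rep_def T)
  have b: "0 < b" using s by simp
  have digit: "(x * b + y) div b ^ i mod b = (if i = 0 then y else x div b ^ (i - 1) mod b)" if "y < b" for x y i
    using that by (cases i) (simp_all add: div_mult2_eq)
  have shift: "x div b div b ^ i mod b = x div b ^ Suc i mod b" for x i
    by (simp add: div_mult2_eq)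
  have R': "(r div b * b + s) div b ^ i mod b = (c(h := s)) (h + int i)" for i
  proof (cases i)
    case 0
    then show ?thesis using digit[OF s, of "r div b" 0] by simp
  next
    case (Suc j)
    have "(r div b * b + s) div b ^ i mod b = r div b div b ^ j mod b"
      using digit[OF s, of "r div b" i] Suc by (simp only: diff_Suc_1 nat.simps if_False)
    also have "\<dots> = c (h + int i)" unfolding shift R Suc ..
    finally show ?thesis by (simp add: Suc)
  qed
  have L': "l div b ^ i mod b = (c(h := s)) (h - 1 - int i)" for i using L[of i] by simp
  have l0: "l mod b = (c(h := s)) (h - 1)" using L'[of 0] by simp
  show ?thesis
  proof (cases m)
    case Left
    have "l div b div b ^ i mod b = (c(h := s)) (h - 1 - 1 - int i)" for i
      unfolding shift L' by (simp add: algebra_simps)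
    moreover have "((r div b * b + s) * b + l mod b) div b ^ i mod b = (c(h := s)) (h - 1 + int i)" for i
    proof (cases i)
      case 0
      have "((r div b * b + s) * b + l mod b) div b ^ i mod b = l mod b" using 0 by simp
      then show ?thesis unfolding l0 by (simp add: 0 del: fun_upd_apply)
    next
      case (Suc j)
      have "((r div b * b + s) * b + l mod b) div b ^ i mod b = (r div b * b + s) div b ^ j mod b"
        using digit[of "l mod b" "r div b * b + s" i] b Suc by (simp only: diff_Suc_1 nat.simps if_False mod_less_divisor)
      then show ?thesis unfolding R' by (simp add: Suc del: fun_upd_apply)
    qed
    ultimately show ?thesis
      by (simp add: T Left tape_rep_def move_num_def new_left_def new_right_def del: fun_upd_apply)
  next
    case Stay
    then show ?thesis using L' R'
      by (simp add: T tape_rep_def move_num_def new_left_def new_right_def del: fun_upd_apply)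
  next
    case Right
    have "(l * b + s) div b ^ i mod b = (c(h := s)) (h + 1 - 1 - int i)" for i
    proof (cases i)
      case 0
      then show ?thesis using s by simp
    next
      case (Suc j)
      have "(l * b + s) div b ^ i mod b = l div b ^ j mod b"
        using digit[OF s, of l i] Suc by (simp only: diff_Suc_1 nat.simps if_False)
      also have "\<dots> = (c(h := s)) (h - 1 - int j)" by (rule L')
      also have "h - 1 - int j = h + 1 - 1 - int i" using Suc by simp
      finally show ?thesis .
    qed
    moreover have "r div b div b ^ i mod b = (c(h := s)) (h + 1 + int i)" for i
    proof -
      have "r div b div b ^ i mod b = (r div b * b + s) div b ^ Suc i mod b"
        using digit[OF s, of "r div b" "Suc i"] by (simp only: diff_Suc_1 nat.simps if_False)
      then show ?thesis unfolding R' by (simp add: algebra_simps)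
    qed
    ultimately show ?thesis
      by (simp add: T Right tape_rep_def move_num_def new_left_def new_right_def del: fun_upd_apply)
  qed
qed

text \<open>
  A configuration as a vector: the state, then the left parts and the right parts of the tapes.
\<close>

definition conf_rep :: "tm \<Rightarrow> tm_config \<Rightarrow> (nat \<Rightarrow> nat) \<Rightarrow> bool" where
  "conf_rep M x v \<longleftrightarrow> v 0 = fst x \<and> fst x < num_states M \<and> length (snd x) = num_tapes M \<and>
     (\<forall>j<num_tapes M. tape_rep (num_symbols M) (snd x ! j) (v (Suc j)) (v (Suc (num_tapes M + j))))"

text \<open>State and scanned symbols as one number in mixed radix, by which the transition table is
  addressed.\<close>

definition read_index :: "tm \<Rightarrow> (nat \<Rightarrow> nat) \<Rightarrow> nat" where
  "read_index M v = v 0 + num_states M *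
     (\<Sum>j<num_tapes M. v (Suc (num_tapes M + j)) mod num_symbols M * num_symbols M ^ j)"

text \<open>In halting states the entry keeps the state and the symbols, as \<open>tm_step\<close>
  does.\<close>

definition table :: "tm \<Rightarrow> nat \<Rightarrow> nat \<times> (nat \<times> move) list" where
  "table M n = (let q = n mod num_states M;
     xs = map (\<lambda>j. n div num_states M div num_symbols M ^ j mod num_symbols M) [0..<num_tapes M]
     in if q = accept_state M \<or> q = reject_state M then (q, map (\<lambda>x. (x, Stay)) xs) else delta M q xs)"

definition table_size :: "tm \<Rightarrow> nat" where
  "table_size M = num_states M * num_symbols M ^ num_tapes M"

text \<open>0 outside of the finite table, so that \<open>pr_finite_support\<close> applies.\<close>

definition table_state :: "tm \<Rightarrow> nat \<Rightarrow> nat" where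
  "table_state M n = (if n < table_size M then fst (table M n) else 0)"

definition table_symbol :: "tm \<Rightarrow> nat \<Rightarrow> nat \<Rightarrow> nat" where
  "table_symbol M j n = (if n < table_size M then fst (snd (table M n) ! j) else 0)"

definition table_move :: "tm \<Rightarrow> nat \<Rightarrow> nat \<Rightarrow> nat" where
  "table_move M j n = (if n < table_size M then move_num (snd (snd (table M n) ! j)) else 0)"

definition vector_step :: "tm \<Rightarrow> (nat \<Rightarrow> nat) \<Rightarrow> nat \<Rightarrow> nat" where
  "vector_step M v i = (let n = read_index M v; k = num_tapes M; b = num_symbols M in
     if i = 0 then table_state M n
     else if i \<le> k then new_left b (table_symbol M (i - 1) n) (table_move M (i - 1) n) (v i)
     else new_right b (table_symbol M (i - 1 - k) n) (table_move M (i - 1 - k) n) (v (i - k)) (v i))"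

lemma conf_rep_step:
  assumes wf: "wf_tm M" and rep: "conf_rep M x v"
  shows "conf_rep M (tm_step M x) (vector_step M v)"
proof -
  obtain q ts where x: "x = (q, ts)" by (cases x)
  let ?k = "num_tapes M" and ?b = "num_symbols M" and ?Q = "num_states M"
  define xs where "xs = map (\<lambda>(c, h). c h) ts"
  define n where "n = read_index M v"
  have q: "v 0 = q" "q < ?Q" and len: "length ts = ?k" using rep by (simp_all add: conf_rep_def x)
  have tr: "tape_rep ?b (ts ! j) (v (Suc j)) (v (Suc (?k + j)))" if "j < ?k" for j
    using rep that by (simp add: conf_rep_def x)
  have b: "0 < ?b" using wf by (simp add: wf_tm_def)
  have xs: "xs ! j = v (Suc (?k + j)) mod ?b" if "j < ?k" for j
  proof -
    have "v (Suc (?k + j)) div ?b ^ 0 mod ?b = fst (ts ! j) (snd (ts ! j) + int 0)"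
      using tr[OF that] unfolding tape_rep_def by blast
    then show ?thesis using that len by (simp add: xs_def case_prod_beta)
  qed
  have lxs: "length xs = ?k" by (simp add: xs_def len)
  have sxs: "set xs \<subseteq> {..<?b}"
    using xs lxs b by (auto simp: in_set_conv_nth)
  define S where "S = (\<Sum>j<?k. v (Suc (?k + j)) mod ?b * ?b ^ j)"
  have S: "S < ?b ^ ?k" "j < ?k \<Longrightarrow> S div ?b ^ j mod ?b = v (Suc (?k + j)) mod ?b" for j
    unfolding S_def using b by (intro digit_sum; simp)+
  have n: "n = q + ?Q * S" by (simp add: n_def read_index_def S_def q)
  have nQ: "n mod ?Q = q" "n div ?Q = S" using q by (simp_all add: n)
  have nT: "n < table_size M"
  proof -
    have "n < ?Q * Suc S" using q by (simp add: n)
    also have "\<dots> \<le> table_size M" unfolding table_size_def using S(1) by (intro mult_left_mono) auto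
    finally show ?thesis .
  qed
  have "map (\<lambda>j. n div ?Q div ?b ^ j mod ?b) [0..<?k] = xs"
    using S(2) xs lxs by (intro nth_equalityI) (simp_all add: nQ)
  then have tab: "table M n = (if q = accept_state M \<or> q = reject_state M then (q, map (\<lambda>x. (x, Stay)) xs) else delta M q xs)"
    unfolding table_def Let_def nQ by simp
  obtain q' as where ta: "table M n = (q', as)" by (cases "table M n")
  have q': "q' < ?Q \<and> length as = ?k \<and> fst ` set as \<subseteq> {..<?b}"
  proof (cases "q = accept_state M \<or> q = reject_state M")
    case True
    then show ?thesis using tab ta q sxs lxs by auto
  next
    case False
    then have "delta M q xs = (q', as)" using tab ta by simp
    then show ?thesis using wf q lxs sxs unfolding wf_tm_def by blast
  qed
  have step: "tm_step M x = (q', map2 act as ts)"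
  proof (cases "q = accept_state M \<or> q = reject_state M")
    case True
    have "act (xs ! j, Stay) (ts ! j) = ts ! j" if "j < ?k" for j
      using that len by (cases "ts ! j") (simp add: xs_def)
    then have "map2 act (map (\<lambda>x. (x, Stay)) xs) ts = ts"
      using lxs len by (intro nth_equalityI) auto
    then show ?thesis using True tab ta by (auto simp: x)
  next
    case False
    then have "delta M q xs = (q', as)" using tab ta by simp
    then show ?thesis using False by (simp add: x xs_def)
  qed
  have "tape_rep ?b (map2 act as ts ! j) (vector_step M v (Suc j)) (vector_step M v (Suc (?k + j)))" if j: "j < ?k" for j
  proof -
    have "as ! j \<in> set as" using q' j by simp
    then have s: "fst (as ! j) < ?b" using q' by auto
    have "map2 act as ts ! j = act (fst (as ! j), snd (as ! j)) (ts ! j)" using j q' len by simp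
    moreover have "vector_step M v (Suc j) = new_left ?b (fst (as ! j)) (move_num (snd (as ! j))) (v (Suc j))"
      "vector_step M v (Suc (?k + j)) =
        new_right ?b (fst (as ! j)) (move_num (snd (as ! j))) (v (Suc j)) (v (Suc (?k + j)))"
      using j nT ta by (simp_all add: vector_step_def Let_def n_def[symmetric] table_symbol_def table_move_def)
    ultimately show ?thesis using tape_rep_act[OF tr[OF j] s] by (simp only:)
  qed
  moreover have "vector_step M v 0 = q'" using nT ta by (simp add: vector_step_def Let_def n_def[symmetric] table_state_def)
  ultimately show ?thesis using q' len by (simp add: conf_rep_def step)
qed

text \<open>The binary digits of \<open>x + 1\<close> below the leading one are the bits of the
  input; adding 1 gives the tape symbols 1 and 2.\<close>

definition init_vector :: "tm \<Rightarrow> nat \<Rightarrow> nat \<Rightarrow> nat" where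
  "init_vector M x i = (if i = 0 then start_state M
     else if i = Suc (num_tapes M) then (\<Sum>j<num_length x. ((x + 1) div 2 ^ j mod 2 + 1) * num_symbols M ^ j)
     else 0)"

lemma conf_rep_init:
  assumes wf: "wf_tm M"
  shows "conf_rep M (tm_init M w) (init_vector M (word_num w))"
proof -
  let ?b = "num_symbols M" and ?k = "num_tapes M" and ?x = "word_num w"
  have b: "3 \<le> ?b" and k: "1 \<le> ?k" using wf by (auto simp: wf_tm_def)
  define d where "d j = (?x + 1) div 2 ^ j mod 2 + 1" for j
  define r where "r = (\<Sum>j<length w. d j * ?b ^ j)"
  have db: "d j < ?b" for j
  proof -
    have "(?x + 1) div 2 ^ j mod 2 < 2" by simp
    then show ?thesis using b unfolding d_def by linarith
  qed
  have dw: "d j = (if w ! j then 2 else 1)" if "j < length w" for j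
    using word_num_nth[OF that] by (simp add: d_def odd_iff_mod_2_eq_one)
  have r: "r div ?b ^ i mod ?b = fst (input_tape w) (int i)" for i
  proof (cases "i < length w")
    case True
    then have "r div ?b ^ i mod ?b = d i" unfolding r_def by (intro digit_sum(2) db)
    then show ?thesis using True dw by (simp add: input_tape_def)
  next
    case False
    have "r < ?b ^ length w" unfolding r_def by (intro digit_sum(1) db)
    also have "\<dots> \<le> ?b ^ i" using False b by (intro power_increasing) auto
    finally show ?thesis using False by (simp add: input_tape_def)
  qed
  have r_eq: "init_vector M ?x (Suc ?k) = r"
    by (simp add: init_vector_def r_def d_def num_length_word_num)
  have "tape_rep ?b (snd (tm_init M w) ! j) (init_vector M ?x (Suc j)) (init_vector M ?x (Suc (?k + j)))"
    if j: "j < ?k" for j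
  proof (cases j)
    case 0
    have "tape_rep ?b (input_tape w) 0 r"
      using r by (auto simp: tape_rep_def input_tape_def)
    then show ?thesis using 0 k r_eq by (simp add: tm_init_def init_vector_def)
  next
    case (Suc i)
    then show ?thesis using j by (simp add: tm_init_def init_vector_def tape_rep_def)
  qed
  moreover have "start_state M < num_states M" using wf by (simp add: wf_tm_def)
  ultimately show ?thesis using k by (simp add: conf_rep_def tm_init_def init_vector_def)
qed

definition tm_number :: "tm \<Rightarrow> nat \<Rightarrow> nat \<Rightarrow> nat" where
  "tm_number M x n = rec_nat (nest (map (init_vector M x) [0..<Suc (2 * num_tapes M)]))
     (\<lambda>_ z. nest (map (vector_step M (\<lambda>i. entry i z)) [0..<Suc (2 * num_tapes M)])) n"

lemma conf_rep_cong:
  assumes "conf_rep M x v" "\<And>i. i < Suc (2 * num_tapes M) \<Longrightarrow> v i = u i"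
  shows "conf_rep M x u"
proof -
  have "v 0 = u 0" "v (Suc j) = u (Suc j)" "v (Suc (num_tapes M + j)) = u (Suc (num_tapes M + j))"
    if "j < num_tapes M" for j using assms(2) that by auto
  moreover have "v 0 = u 0" by (rule assms(2)) simp
  ultimately show ?thesis using assms(1) unfolding conf_rep_def by simp
qed

lemma tm_number:
  assumes wf: "wf_tm M"
  shows "entry 0 (tm_number M (word_num w) n) = fst ((tm_step M ^^ n) (tm_init M w))"
proof -
  let ?m = "Suc (2 * num_tapes M)"
  have "conf_rep M ((tm_step M ^^ n) (tm_init M w)) (\<lambda>i. entry i (tm_number M (word_num w) n))"
  proof (induction n)
    case 0
    show ?case
      by (simp add: tm_number_def del: upt_Suc)
        (rule conf_rep_cong[OF conf_rep_init[OF wf]], simp add: entry_nest del: upt_Suc)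
  next
    case (Suc n)
    show ?case
      by (simp add: tm_number_def del: upt_Suc)
        (rule conf_rep_cong[OF conf_rep_step[OF wf Suc[unfolded tm_number_def]]],
          simp add: entry_nest tm_number_def del: upt_Suc)
  qed
  then show ?thesis by (simp add: conf_rep_def)
qed

lemma pr_tm_number: "pr (\<lambda>e. tm_number M (e 0) (e 1))"
proof -
  let ?m = "Suc (2 * num_tapes M)"
  have tab: "pr a \<Longrightarrow> pr (\<lambda>e. table_state M (a e))" "pr a \<Longrightarrow> pr (\<lambda>e. table_symbol M j (a e))"
    "pr a \<Longrightarrow> pr (\<lambda>e. table_move M j (a e))" for a j
    by (rule pr_finite_support[of "table_size M" _ 0]; simp add: table_state_def table_symbol_def table_move_def)+
  have init: "pr a \<Longrightarrow> pr (\<lambda>e. init_vector M (a e) i)" for a i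
  proof (rule pr_app1[of "\<lambda>x. init_vector M x i"])
    show "pr (\<lambda>e. init_vector M (e 0) i)"
      unfolding init_vector_def by (intro pr_intros pr_num_length)
  qed
  have idx: "pr (\<lambda>e. read_index M (\<lambda>i. entry i (e 0)))"
  proof -
    have *: "pr (\<lambda>e. \<Sum>j<m. entry (Suc (c + j)) (e 0) mod b * b ^ j)" for m b c :: nat
      by (induction m) (auto intro!: pr_intros pr_entry)
    show ?thesis unfolding read_index_def by (intro pr_add pr_mult pr_const pr_entry pr_var *)
  qed
  have step: "pr (\<lambda>e. vector_step M (\<lambda>i. entry i (e 0)) i)" for i
    unfolding vector_step_def Let_def new_left_def new_right_def
    by (intro pr_intros tab idx pr_entry)
  show ?thesis unfolding tm_number_def
  proof (intro pr_rec pr_var)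
    show "pr (\<lambda>e. nest (map (init_vector M (e 0)) [0..<?m]))"
      by (intro pr_nest[where F = "\<lambda>i e. init_vector M (e 0) i"] init pr_var)
    show "pr (\<lambda>e. nest (map (vector_step M (\<lambda>i. entry i (e 0))) [0..<?m]))"
      by (intro pr_nest[where F = "\<lambda>i e. vector_step M (\<lambda>i. entry i (e 0)) i"] step)
  qed
qed

section \<open>Copy nets\<close>

text \<open>
  A net with counters below \<open>C\<close> and transitions \<open>i < L\<close> from \<open>sc i\<close> to \<open>tg i\<close>. Kind 0 increments
  the counter \<open>ar i\<close>, kind 1 decrements it and blocks at 0, and the other kinds assign the counters
  simultaneously: \<open>c\<close> gets 0 if \<open>sg i c = 0\<close>, and otherwise the value of \<open>sg i c - 1\<close>.
\<close>

record net =
  num_counters :: nat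
  num_trans :: nat
  sc :: "nat \<Rightarrow> nat"
  kd :: "nat \<Rightarrow> nat"
  ar :: "nat \<Rightarrow> nat"
  sg :: "nat \<Rightarrow> nat \<Rightarrow> nat"
  tg :: "nat \<Rightarrow> nat"

definition effect :: "net \<Rightarrow> nat \<Rightarrow> (nat \<Rightarrow> nat) \<Rightarrow> (nat \<Rightarrow> nat) \<Rightarrow> bool" where
  "effect T i s s' \<longleftrightarrow>
     (if kd T i = 0 then s' = s(ar T i := Suc (s (ar T i)))
      else if kd T i = 1 then s (ar T i) \<noteq> 0 \<and> s' = s(ar T i := s (ar T i) - 1)
      else s' = (\<lambda>c. if sg T i c = 0 then 0 else s (sg T i c - 1)))"

primrec net_accepts :: "net \<Rightarrow> nat \<Rightarrow> nat \<Rightarrow> nat \<Rightarrow> (nat \<Rightarrow> nat) \<Rightarrow> bool" where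
  "net_accepts T fin 0 l s \<longleftrightarrow> l = fin"
| "net_accepts T fin (Suc n) l s \<longleftrightarrow>
     (\<exists>i<num_trans T. sc T i = l \<and> (\<exists>s'. effect T i s s' \<and> net_accepts T fin n (tg T i) s'))"

definition net_wf :: "nat \<Rightarrow> net \<Rightarrow> bool" where
  "net_wf b T \<longleftrightarrow> 2 * num_counters T \<le> b \<and>
     (\<forall>i<num_trans T. sc T i < b \<and> tg T i < b \<and> ar T i < num_counters T \<and>
       (\<forall>c. sg T i c \<le> num_counters T))"

text \<open>
  The value of counter \<open>c\<close> is the number of data in register \<open>2 c\<close> but not in register \<open>2 c + 1\<close>.
  Since registers can only grow by single data, decrementing marks a datum in \<open>2 c + 1\<close>.
\<close>

definition net_pres :: "net \<Rightarrow> nat \<Rightarrow> nat \<Rightarrow> presentation" where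
  "net_pres T fin a t i r x =
    (if t = 0 then 1
     else if t = 1 then of_bool (i < 2 * num_counters T)
     else if t = 2 then of_bool (i = 0)
     else if t = 3 then of_bool (i = fin)
     else if t = 4 then num_trans T
     else if t = 5 then sc T i
     else if t = 6 then a
     else if t = 7 then of_bool (kd T i = 1 \<and> r = 2 * ar T i)
     else if t = 8 then of_bool (kd T i = 0 \<and> r = 2 * ar T i \<or> kd T i = 1 \<and> r = 2 * ar T i + 1)
     else if t = 9 then
       of_bool (if x = 0 then kd T i = 0 \<and> r = 2 * ar T i \<or> kd T i = 1 \<and> r = 2 * ar T i + 1
         else if kd T i \<le> 1 then x - 1 = r
         else sg T i (r div 2) \<noteq> 0 \<and> x - 1 = 2 * (sg T i (r div 2) - 1) + r mod 2)
     else tg T i)"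

lemma net_pres_wf:
  assumes "net_wf b T" "a \<in> N"
  shows "pres_wf N b (net_pres T fin a)"
  unfolding pres_wf_def
proof (intro conjI allI impI)
  fix i assume "i < net_pres T fin a 4 0 0 0"
  then have i: "i < num_trans T" by (simp add: net_pres_def)
  then have w: "sc T i < b" "tg T i < b" "ar T i < num_counters T" "\<And>c. sg T i c \<le> num_counters T"
    using assms(1) by (auto simp: net_wf_def)
  show "net_pres T fin a 5 i 0 0 < b" "net_pres T fin a 10 i 0 0 < b" using w by (simp_all add: net_pres_def)
  fix r assume r: "r < b"
  show "net_pres T fin a 1 r 0 0 \<noteq> 0" if "net_pres T fin a 7 i r 0 \<noteq> 0"
    using that w(3) by (auto simp: net_pres_def)
  show "net_pres T fin a 1 r 0 0 \<noteq> 0" if "net_pres T fin a 8 i r 0 \<noteq> 0"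
    using that w(3) by (auto simp: net_pres_def)
  show "\<not> (net_pres T fin a 7 i r 0 \<noteq> 0 \<and> net_pres T fin a 8 i r 0 \<noteq> 0)" by (auto simp: net_pres_def)
  fix x assume "net_pres T fin a 1 r 0 0 \<noteq> 0 \<and> net_pres T fin a 9 i r (Suc x) \<noteq> 0"
  then have x: "r < 2 * num_counters T"
    "if kd T i \<le> 1 then x = r else sg T i (r div 2) \<noteq> 0 \<and> x = 2 * (sg T i (r div 2) - 1) + r mod 2"
    by (simp_all add: net_pres_def split: if_splits)
  have "x < 2 * num_counters T"
  proof (cases "kd T i \<le> 1")
    case False
    have "r mod 2 < 2" by simp
    then show ?thesis using False x(2) w(4)[of "r div 2"] by simp linarith
  qed (use x in simp)
  then show "net_pres T fin a 1 x 0 0 \<noteq> 0" by (simp add: net_pres_def)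
qed (use assms(2) in \<open>auto simp: net_pres_def\<close>)

definition counts :: "net \<Rightarrow> 'd set \<Rightarrow> (nat \<Rightarrow> 'd set) \<Rightarrow> (nat \<Rightarrow> nat) \<Rightarrow> bool" where
  "counts T D f s \<longleftrightarrow> (\<forall>r. finite (f r) \<and> f r \<subseteq> D) \<and> (\<forall>c<num_counters T. f (2 * c + 1) \<subseteq> f (2 * c) \<and>
     card (f (2 * c) - f (2 * c + 1)) = s c)"

text \<open>An increment adds a datum outside of register \<open>2 c\<close>, hence outside of
  \<open>2 c + 1\<close>; a decrement marks a datum of the difference. An assignment copies or
  empties both registers of a counter together, which preserves inclusion and difference.\<close>

lemma net_effect_step:
  fixes f :: "nat \<Rightarrow> 'd set" and T fin \<nu> \<Sigma> and a b :: nat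
  defines "t \<equiv> \<lambda>i. pres_trans \<Sigma> \<nu> b (net_pres T fin a) i"
  assumes wf: "net_wf b T" and i: "i < num_trans T" and c: "counts T D f s" and en: "enabled (t i) f d" and d: "d \<in> D"
  shows "\<exists>s'. effect T i s s' \<and> counts T D (update (upd (t i)) f d) s'"
proof -
  let ?C = "num_counters T" and ?f = "update (upd (t i)) f d"
  have w: "ar T i < ?C" "2 * ?C \<le> b" "\<And>c. sg T i c \<le> ?C" using wf i by (auto simp: net_wf_def)
  have fin: "finite (f r)" "f r \<subseteq> D" for r using c by (auto simp: counts_def)
  have cnt: "f (2 * c + 1) \<subseteq> f (2 * c)" "card (f (2 * c) - f (2 * c + 1)) = s c" if "c < ?C" for c
    using assms(4) that by (auto simp: counts_def)
  have upd: "?f r = {e. r < 2 * ?C \<and> ((\<exists>r'<b. net_pres T fin a 9 i r (Suc r') \<noteq> 0 \<and> e \<in> f r') \<or>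
      net_pres T fin a 9 i r 0 \<noteq> 0 \<and> e = d)}" for r
  proof -
    have "r \<in> pres_set b (net_pres T fin a) 1 \<longleftrightarrow> r < 2 * ?C" using w(2) by (auto simp: pres_set_def net_pres_def)
    then show ?thesis unfolding t_def update_pres_trans by simp
  qed
  have fin': "finite (?f r) \<and> ?f r \<subseteq> D" for r
  proof -
    have "?f r \<subseteq> insert d (\<Union>r'<b. f r')" unfolding upd by auto
    then show ?thesis using fin d by (auto intro: finite_subset)
  qed
  consider (inc) "kd T i = 0" | (dec) "kd T i = 1" | (asg) "1 < kd T i" by linarith
  then show ?thesis
  proof cases
    case inc
    have u: "?f r = (if r = 2 * ar T i then insert d (f r) else f r)" if "r < 2 * ?C" for r
      using that w unfolding upd by (auto simp: net_pres_def inc)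
    have nd: "d \<notin> f (2 * ar T i)"
      using en w unfolding t_def enabled_def pres_trans_def pres_guard_def by (auto simp: net_pres_def inc)
    then have nd': "d \<notin> f (2 * ar T i + 1)" using cnt(1)[OF w(1)] by blast
    have "counts T D ?f (s(ar T i := Suc (s (ar T i))))"
      unfolding counts_def
    proof (intro conjI allI impI)
      fix c assume c: "c < ?C"
      have odd: "2 * c + 1 \<noteq> 2 * ar T i" by presburger
      have e: "?f (2 * c + 1) = f (2 * c + 1)" "?f (2 * c) = (if c = ar T i then insert d (f (2 * c)) else f (2 * c))"
        using u[of "2 * c + 1"] u[of "2 * c"] c odd by simp_all
      show "?f (2 * c + 1) \<subseteq> ?f (2 * c)" using cnt(1)[OF c] unfolding e by auto
      have "insert d (f (2 * c)) - f (2 * c + 1) = insert d (f (2 * c) - f (2 * c + 1))" if "c = ar T i"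
        using nd' that by auto
      then show "card (?f (2 * c) - ?f (2 * c + 1)) = (s(ar T i := Suc (s (ar T i)))) c"
        unfolding e using cnt(2)[OF c] nd fin by (cases "c = ar T i") simp_all
    qed (use fin' in auto)
    then show ?thesis using inc by (auto simp: effect_def)
  next
    case dec
    have u: "?f r = (if r = 2 * ar T i + 1 then insert d (f r) else f r)" if "r < 2 * ?C" for r
      using that w unfolding upd by (auto simp: net_pres_def dec)
    have nd: "d \<in> f (2 * ar T i)" "d \<notin> f (2 * ar T i + 1)"
      using en w unfolding t_def enabled_def pres_trans_def pres_guard_def by (auto simp: net_pres_def dec)
    then have "f (2 * ar T i) - f (2 * ar T i + 1) \<noteq> {}" by auto
    then have pos: "s (ar T i) \<noteq> 0" using cnt(2)[OF w(1)] fin by (metis card_0_eq finite_Diff)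
    have "counts T D ?f (s(ar T i := s (ar T i) - 1))"
      unfolding counts_def
    proof (intro conjI allI impI)
      fix c assume c: "c < ?C"
      have odd: "2 * c \<noteq> 2 * ar T i + 1" by presburger
      have e: "?f (2 * c) = f (2 * c)" "?f (2 * c + 1) = (if c = ar T i then insert d (f (2 * c + 1)) else f (2 * c + 1))"
        using u[of "2 * c + 1"] u[of "2 * c"] c odd by simp_all
      show "?f (2 * c + 1) \<subseteq> ?f (2 * c)" using cnt(1)[OF c] nd unfolding e by auto
      have "f (2 * c) - insert d (f (2 * c + 1)) = (f (2 * c) - f (2 * c + 1)) - {d}" by auto
      then show "card (?f (2 * c) - ?f (2 * c + 1)) = (s(ar T i := s (ar T i) - 1)) c"
        unfolding e using cnt(2)[OF c] nd fin by (auto simp: card_Diff_singleton)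
    qed (use fin' in auto)
    then show ?thesis using dec pos by (auto simp: effect_def)
  next
    case asg
    have u: "?f r = (if sg T i (r div 2) = 0 then {} else f (2 * (sg T i (r div 2) - 1) + r mod 2))"
      if "r < 2 * ?C" for r
    proof -
      have "2 * (sg T i (r div 2) - 1) + r mod 2 < b" if "sg T i (r div 2) \<noteq> 0"
      proof -
        have "r mod 2 < 2" by simp
        then show ?thesis using w(3)[of "r div 2"] w(2) that by linarith
      qed
      then show ?thesis using that asg unfolding upd by (auto simp: net_pres_def)
    qed
    have "counts T D ?f (\<lambda>c. if sg T i c = 0 then 0 else s (sg T i c - 1))"
      unfolding counts_def
    proof (intro conjI allI impI)
      fix c assume c: "c < ?C"
      have e: "?f (2 * c) = (if sg T i c = 0 then {} else f (2 * (sg T i c - 1)))"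
        "?f (2 * c + 1) = (if sg T i c = 0 then {} else f (2 * (sg T i c - 1) + 1))"
        using u[of "2 * c + 1"] u[of "2 * c"] c by simp_all
      have "sg T i c - 1 < ?C" if "sg T i c \<noteq> 0" using w(3)[of c] that by linarith
      then show "?f (2 * c + 1) \<subseteq> ?f (2 * c)"
        "card (?f (2 * c) - ?f (2 * c + 1)) = (if sg T i c = 0 then 0 else s (sg T i c - 1))"
        unfolding e using cnt[of "sg T i c - 1"] by auto
    qed (use fin' in auto)
    then show ?thesis using asg by (auto simp: effect_def)
  qed
qed

text \<open>Increments find a fresh datum because \<open>D\<close> is infinite and registers are
  finite, decrements find one in the nonempty difference.\<close>

lemma net_enabled:
  fixes f :: "nat \<Rightarrow> 'd set"
  assumes D: "infinite D" and wf: "net_wf b T" and i: "i < num_trans T" and c: "counts T D f s"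
    and e: "effect T i s s'"
  shows "\<exists>d\<in>D. enabled (pres_trans \<Sigma> \<nu> b (net_pres T fin a) i) f d"
proof -
  let ?C = "num_counters T"
  have w: "ar T i < ?C" using wf i by (auto simp: net_wf_def)
  have cnt: "finite (f (2 * ar T i))" "card (f (2 * ar T i) - f (2 * ar T i + 1)) = s (ar T i)" "f (2 * ar T i) \<subseteq> D"
    using c w by (auto simp: counts_def)
  consider (inc) "kd T i = 0" | (dec) "kd T i = 1" | (asg) "1 < kd T i" by linarith
  then show ?thesis
  proof cases
    case inc
    have "infinite (D - f (2 * ar T i))" using D cnt(1) by (rule Diff_infinite_finite[rotated])
    then obtain d where "d \<in> D" "d \<notin> f (2 * ar T i)" using infinite_imp_nonempty by auto
    then show ?thesis
      using inc by (intro bexI[of _ d]) (auto simp: enabled_def pres_trans_def pres_guard_def net_pres_def)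
  next
    case dec
    then have "card (f (2 * ar T i) - f (2 * ar T i + 1)) \<noteq> 0" using e cnt(2) by (simp add: effect_def)
    then obtain d where "d \<in> f (2 * ar T i)" "d \<notin> f (2 * ar T i + 1)" by (metis Diff_iff card.empty ex_in_conv)
    then show ?thesis
      using dec cnt(3) by (intro bexI[of _ d]) (auto simp: enabled_def pres_trans_def pres_guard_def net_pres_def)
  next
    case asg
    obtain d where "d \<in> D" using D infinite_imp_nonempty by auto
    then show ?thesis
      using asg by (intro bexI[of _ d]) (auto simp: enabled_def pres_trans_def pres_guard_def net_pres_def)
  qed
qed

lemma effect_fun: "effect T i s s' \<Longrightarrow> effect T i s s'' \<Longrightarrow> s' = s''"
  by (auto simp: effect_def split: if_splits)

lemma net_accepts_iff:
  fixes D :: "'d set"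
  assumes D: "infinite D" and wf: "net_wf b T" and fin: "fin < b" and c: "counts T D f s"
  shows "accepts (pres_aut \<Sigma> \<nu> b (net_pres T fin a)) D n l f \<longleftrightarrow> net_accepts T fin n l s"
  using c
proof (induction n arbitrary: l f s)
  case 0
  have "pres_set b (net_pres T fin a) 3 = {fin}" using fin by (auto simp: pres_set_def net_pres_def)
  then show ?case by (simp add: pres_aut_def)
next
  case (Suc n)
  let ?A = "pres_aut \<Sigma> \<nu> b (net_pres T fin a)" and ?t = "pres_trans \<Sigma> \<nu> b (net_pres T fin a)"
  have st: "src (?t i) = sc T i" "tgt (?t i) = tg T i" for i by (simp_all add: pres_trans_def net_pres_def)
  have tr: "transitions ?A = ?t ` {..<num_trans T}" by (simp add: pres_aut_def net_pres_def)
  show ?case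
  proof
    assume "accepts ?A D (Suc n) l f"
    then obtain i d where i: "i < num_trans T" "sc T i = l" "d \<in> D" "enabled (?t i) f d"
      "accepts ?A D n (tg T i) (update (upd (?t i)) f d)"
      using tr st by auto
    obtain s' where s': "effect T i s s'" "counts T D (update (upd (?t i)) f d) s'"
      using net_effect_step[OF wf i(1) Suc.prems i(4,3)] by (elim exE conjE)
    have "net_accepts T fin n (tg T i) s'" using Suc.IH[OF s'(2)] i(5) by simp
    then show "net_accepts T fin (Suc n) l s" using i(1,2) s'(1) by auto
  next
    assume "net_accepts T fin (Suc n) l s"
    then obtain i s' where i: "i < num_trans T" "sc T i = l" "effect T i s s'" "net_accepts T fin n (tg T i) s'"
      by auto
    from net_enabled[OF D wf i(1) Suc.prems i(3), of \<Sigma> \<nu> fin a]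
    obtain d where d: "d \<in> D" "enabled (?t i) f d" ..
    obtain s2 where s2: "effect T i s s2" "counts T D (update (upd (?t i)) f d) s2"
      using net_effect_step[OF wf i(1) Suc.prems d(2,1)] by (elim exE conjE)
    have "accepts ?A D n (tgt (?t i)) (update (upd (?t i)) f d)"
      using Suc.IH[OF s2(2)] i(4) effect_fun[OF i(3) s2(1)] st by simp
    moreover have "?t i \<in> transitions ?A" using i(1) tr by simp
    ultimately show "accepts ?A D (Suc n) l f" using accepts_SucI d st(1) i(2) by metis
  qed
qed

lemma net_lang:
  fixes D :: "'d set"
  assumes D: "infinite D" and wf: "net_wf b T" and fin: "fin < b" and a: "a \<in> \<nu> ` \<Sigma>"
  shows "pres_code b (net_pres T fin a) \<in> codes \<nu> (pres_aut \<Sigma> \<nu> b (net_pres T fin a))"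
    and "wf_rsa \<Sigma> (pres_aut \<Sigma> \<nu> b (net_pres T fin a))"
    and "lang \<Sigma> D (pres_aut \<Sigma> \<nu> b (net_pres T fin a)) = {} \<longleftrightarrow> (\<forall>n. \<not> net_accepts T fin n 0 (\<lambda>_. 0))"
proof -
  have pw: "pres_wf (\<nu> ` \<Sigma>) b (net_pres T fin a)" by (rule net_pres_wf[OF wf a])
  show "pres_code b (net_pres T fin a) \<in> codes \<nu> (pres_aut \<Sigma> \<nu> b (net_pres T fin a))"
    by (rule pres_code_in_codes[OF pw])
  show wfA: "wf_rsa \<Sigma> (pres_aut \<Sigma> \<nu> b (net_pres T fin a))" by (rule pres_wf_wf_rsa[OF pw])
  have "initial (pres_aut \<Sigma> \<nu> b (net_pres T fin a)) = {0}"
    using fin by (auto simp: pres_aut_def pres_set_def net_pres_def)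
  moreover have c: "counts T D (\<lambda>_. {}) (\<lambda>_. 0)" by (simp add: counts_def)
  ultimately show "lang \<Sigma> D (pres_aut \<Sigma> \<nu> b (net_pres T fin a)) = {} \<longleftrightarrow> (\<forall>n. \<not> net_accepts T fin n 0 (\<lambda>_. 0))"
    unfolding lang_empty_iff[OF wfA] using net_accepts_iff[OF D wf fin c, of \<Sigma> \<nu> a] by simp
qed

text \<open>Membership only says that some automaton with this code has empty language; by
  \<open>codes_unique\<close> it is the intended one.\<close>

lemma rsa_code_emptiness:
  fixes D :: "'d set"
  assumes "infinite D" "net_wf b T" "fin < b" "a \<in> \<nu> ` \<Sigma>" and inj: "inj_on \<nu> \<Sigma>"
  shows "pres_code b (net_pres T fin a) \<in> rsa_emptiness \<Sigma> \<nu> D \<longleftrightarrow> (\<forall>n. \<not> net_accepts T fin n 0 (\<lambda>_. 0))"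
proof -
  note N = net_lang[OF assms(1-4)]
  let ?w = "pres_code b (net_pres T fin a)" and ?A = "pres_aut \<Sigma> \<nu> b (net_pres T fin a)"
  have "?w \<in> rsa_emptiness \<Sigma> \<nu> D \<longleftrightarrow> lang \<Sigma> D ?A = {}"
  proof
    assume "?w \<in> rsa_emptiness \<Sigma> \<nu> D"
    then obtain A where A: "wf_rsa \<Sigma> A" "?w \<in> codes \<nu> A" "lang \<Sigma> D A = {}"
      unfolding rsa_emptiness_def by (elim CollectE exE conjE)
    then show "lang \<Sigma> D ?A = {}" using codes_unique[OF A(2) N(1) A(1) N(2) inj] by simp
  next
    assume "lang \<Sigma> D ?A = {}"
    then show "?w \<in> rsa_emptiness \<Sigma> \<nu> D" unfolding rsa_emptiness_def using N(1,2) by (intro CollectI exI conjI)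
  qed
  then show ?thesis using N(3) by simp
qed

section \<open>Towers of fast-growing functions\<close>

text \<open>Applies level \<open>i\<close> of the hierarchy \<open>a i\<close> times for all
  \<open>i < j\<close>, with the low levels innermost.\<close>

primrec tower :: "nat \<Rightarrow> (nat \<Rightarrow> nat) \<Rightarrow> nat \<Rightarrow> nat" where
  "tower 0 a x = x"
| "tower (Suc j) a x = (fast j ^^ a j) (tower j a x)"

text \<open>An inequality between the values of the lowest \<open>m\<close> levels is preserved by
  the levels above.\<close>

lemma tower_lift:
  assumes "m \<le> j" "tower m a x \<le> tower m a' x'" "\<And>i. m \<le> i \<Longrightarrow> i < j \<Longrightarrow> a i \<le> a' i"
  shows "tower j a x \<le> tower j a' x'"
  using assms(1)
proof (induction j rule: dec_induct)
  case base
  show ?case by (rule assms(2))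
next
  case (step n)
  then show ?case using assms(3)[of n] by (auto intro: funpow_fast_mono)
qed

lemma tower_mono: "(\<And>i. i < j \<Longrightarrow> a i \<le> a' i) \<Longrightarrow> x \<le> x' \<Longrightarrow> tower j a x \<le> tower j a' x'"
  by (rule tower_lift[of 0]) auto

lemma tower_ge: "x \<le> tower j a x"
  by (induction j) (auto intro: order_trans funpow_infl fast_ge)

lemma tower_strict: "x < x' \<Longrightarrow> tower j a x < tower j a x'"
  by (induction j) (auto simp: strict_mono_less[OF funpow_strict_mono[OF strict_mono_fast]])

lemma tower_cong: "(\<And>i. i < j \<Longrightarrow> a i = a' i) \<Longrightarrow> x = x' \<Longrightarrow> tower j a x = tower j a' x'"
  by (intro antisym tower_mono) auto

lemma tower_zero: "(\<And>i. i < j \<Longrightarrow> a i = 0) \<Longrightarrow> tower j a x = x"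
  by (induction j) auto

lemma fast_0: "fast 0 x = Suc x"
  by (simp add: fast.simps)

lemma tower_0:
  assumes "0 < j" "\<And>i. i < j \<Longrightarrow> a' i = (if i = 0 then Suc (a 0) else a i)"
  shows "tower j a' x = tower j a (Suc x)"
proof -
  have "tower 1 a' x = tower 1 a (Suc x)"
    using assms by (simp add: funpow_Suc_right fast_0 del: funpow.simps)
  then show ?thesis
    using assms tower_lift[of 1 j a' x a "Suc x"] tower_lift[of 1 j a "Suc x" a' x] by (intro antisym) auto
qed

text \<open>One application of level \<open>Suc p\<close> is worth \<open>m + 1\<close> applications
  of level \<open>p\<close> to \<open>m\<close>. So trading it for \<open>Suc z\<close> of them, and
  forgetting the lower levels, does not increase the value.\<close>

lemma tower_unfold:
  assumes p: "Suc p < j" and z: "z \<le> m" and a': "\<And>i. i < p \<Longrightarrow> a' i = 0" "a' p = Suc z"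
    and a: "a (Suc p) = Suc (a' (Suc p))" "\<And>i. Suc p < i \<Longrightarrow> i < j \<Longrightarrow> a' i = a i"
  shows "tower j a' m \<le> tower j a m"
proof (rule tower_lift)
  show "Suc (Suc p) \<le> j" using p by simp
  have "tower (Suc p) a' m = (fast p ^^ Suc z) m" using a' by (simp add: tower_zero del: funpow.simps)
  also have "\<dots> \<le> (fast p ^^ (m + 1)) m" by (rule funpow_fast_mono) (use z in auto)
  also have "\<dots> = fast (Suc p) m" by (simp add: fast.simps(2))
  also have "\<dots> \<le> fast (Suc p) (tower (Suc p) a m)" by (intro fast_mono tower_ge order_refl)
  finally have "(fast (Suc p) ^^ a' (Suc p)) (tower (Suc p) a' m) \<le>
    (fast (Suc p) ^^ a' (Suc p)) (fast (Suc p) (tower (Suc p) a m))" by (intro funpow_fast_mono order_refl)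
  then show "tower (Suc (Suc p)) a' m \<le> tower (Suc (Suc p)) a m"
    by (simp add: tower.simps(2)[of "Suc p"] a(1) funpow_Suc_right del: funpow.simps tower.simps(2))
  show "a' i \<le> a i" if "Suc (Suc p) \<le> i" "i < j" for i using a(2)[of i] that by simp
qed

text \<open>The reverse exchange: \<open>Suc z\<close> applications of level \<open>p\<close> become
  one of level \<open>Suc p\<close> at \<open>z\<close>. Surplus applications, and the part of the
  argument beyond \<open>z\<close>, are lost.\<close>

lemma tower_fold:
  assumes p: "Suc p < j" and z: "z \<le> m" and a': "\<And>i. i \<le> p \<Longrightarrow> a' i = 0"
    and a: "Suc z \<le> a p" "a' (Suc p) = Suc (a (Suc p))" "\<And>i. Suc p < i \<Longrightarrow> i < j \<Longrightarrow> a' i = a i"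
  shows "tower j a' z \<le> tower j a m"
proof (rule tower_lift)
  show "Suc (Suc p) \<le> j" using p by simp
  have "fast (Suc p) z = (fast p ^^ (z + 1)) z" by (simp add: fast.simps(2))
  also have "\<dots> \<le> (fast p ^^ a p) (tower p a m)"
    by (rule funpow_fast_mono) (use a(1) z tower_ge[of m p a] in auto)
  finally have "(fast (Suc p) ^^ a (Suc p)) (fast (Suc p) z) \<le> (fast (Suc p) ^^ a (Suc p)) (tower (Suc p) a m)"
    by (intro funpow_fast_mono) auto
  moreover have "tower (Suc p) a' z = z" using a' by (intro tower_zero) auto
  ultimately show "tower (Suc (Suc p)) a' z \<le> tower (Suc (Suc p)) a m"
    by (simp add: tower.simps(2)[of "Suc p"] a(2) funpow_Suc_right del: funpow.simps tower.simps(2))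
  show "a' i \<le> a i" if "Suc (Suc p) \<le> i" "i < j" for i using a(3)[of i] that by simp
qed

declare tower.simps(2) [simp del]


section \<open>Counter machines with an Ackermannian budget\<close>

text \<open>
  Instructions of kind 0 increment, those of kind 1 decrement or, at 0, jump to \<open>iu\<close>, and the
  others jump.
\<close>

record machine =
  m_len :: nat
  m_counters :: nat
  ik :: "nat \<Rightarrow> nat"
  ic :: "nat \<Rightarrow> nat"
  it :: "nat \<Rightarrow> nat"
  iu :: "nat \<Rightarrow> nat"
  m_acc :: nat

definition m_step :: "machine \<Rightarrow> nat \<times> (nat \<Rightarrow> nat) \<Rightarrow> nat \<times> (nat \<Rightarrow> nat)" where
  "m_step A x = (let l = fst x; c = snd x in
     if l < m_len A then
       if ik A l = 0 then (it A l, c(ic A l := Suc (c (ic A l))))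
       else if ik A l = 1 then
         if c (ic A l) = 0 then (iu A l, c) else (it A l, c(ic A l := c (ic A l) - 1))
       else (it A l, c)
     else x)"

definition m_reach :: "machine \<Rightarrow> nat \<times> (nat \<Rightarrow> nat) \<Rightarrow> bool" where
  "m_reach A x \<longleftrightarrow> (\<exists>t. (m_step A ^^ t) (0, \<lambda>_. 0) = x)"

definition m_wf :: "machine \<Rightarrow> bool" where
  "m_wf A \<longleftrightarrow> m_acc A \<le> m_len A + 1 \<and>
     (\<forall>l<m_len A. ic A l < m_counters A \<and> it A l \<le> m_len A + 1 \<and> iu A l \<le> m_len A + 1)"

lemma m_reach_step: "m_reach A x \<Longrightarrow> m_reach A (m_step A x)"
  unfolding m_reach_def by (metis comp_apply funpow.simps(2))

text \<open>
  The net has the budget in counter 0, an auxiliary counter 1, counters \<open>i + 2\<close> for the exponents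
  \<open>i \<le> K\<close> of a tower, and counters \<open>K + 3 + j\<close> for the counters of the machine. In location
  \<open>loc 2 0\<close>, it unfolds the tower \<open>fast K 1\<close> into the budget, in \<open>loc 6 l\<close>, it runs the machine
  from the budget, and in \<open>loc 8 0\<close>, it folds the budget to a tower again. Where the counters should
  be 0, they are reset, which makes the value of the tower smaller unless they are 0.
\<close>

definition loc :: "nat \<Rightarrow> nat \<Rightarrow> nat" where
  "loc t p = 32 * p + t"

text \<open>An entry consists of source, kind, counter and target. Rules 0 and 1 set up
  \<open>fast K 1\<close>, 2 to 6 unfold it, 7 to 10 start and run the machine, 11 leaves it, 12 to
  20 fold the budget, and 21 and 22 check that the argument 1 and one application of level
  \<open>K\<close> have been recovered. All other pairs \<open>u\<close>, \<open>p\<close> give a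
  loop at an isolated location.\<close>

definition budget_rule :: "nat \<Rightarrow> machine \<Rightarrow> nat \<Rightarrow> nat \<Rightarrow> nat \<times> nat \<times> nat \<times> nat" where
  "budget_rule K A u p =
    (if u = 0 \<and> p = 0 then (loc 0 0, 0, 0, loc 1 0)
     else if u = 1 \<and> p = 0 then (loc 1 0, 0, K + 2, loc 2 0)
     else if u = 2 \<and> p = 0 then (loc 2 0, 1, 2, loc 3 0)
     else if u = 3 \<and> p = 0 then (loc 3 0, 0, 0, loc 2 0)
     else if u = 4 \<and> p < K then (loc 2 0, 1, p + 3, loc 4 p)
     else if u = 5 \<and> p < K then (loc 4 p, 2, 0, loc 5 p)
     else if u = 6 \<and> p < K then (loc 5 p, 0, p + 2, loc 2 0)
     else if u = 7 \<and> p = 0 then (loc 2 0, 2, 0, loc 6 0)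
     else if u = 8 \<and> p < m_len A \<and> ik A p = 0 then (loc 6 p, 1, 0, loc 7 p)
     else if u = 9 \<and> p < m_len A \<and> ik A p = 0 then (loc 7 p, 0, K + 3 + ic A p, loc 6 (it A p))
     else if u = 8 \<and> p < m_len A \<and> ik A p = 1 then (loc 6 p, 1, K + 3 + ic A p, loc 7 p)
     else if u = 9 \<and> p < m_len A \<and> ik A p = 1 then (loc 7 p, 0, 0, loc 6 (it A p))
     else if u = 10 \<and> p < m_len A \<and> ik A p = 1 then (loc 6 p, 2, 0, loc 6 (iu A p))
     else if u = 8 \<and> p < m_len A then (loc 6 p, 2, 0, loc 6 (it A p))
     else if u = 11 \<and> p = 0 then (loc 6 (m_acc A), 2, 0, loc 8 0)
     else if u = 12 \<and> p = 0 then (loc 8 0, 1, 0, loc 9 0)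
     else if u = 13 \<and> p = 0 then (loc 9 0, 0, 2, loc 8 0)
     else if u = 14 \<and> p < K then (loc 8 0, 1, p + 2, loc 10 p)
     else if u = 15 \<and> p < K then (loc 10 p, 2, 0, loc 11 p)
     else if u = 16 \<and> p < K then (loc 11 p, 1, p + 2, loc 12 p)
     else if u = 17 \<and> p < K then (loc 12 p, 1, 0, loc 13 p)
     else if u = 18 \<and> p < K then (loc 13 p, 0, 1, loc 11 p)
     else if u = 19 \<and> p < K then (loc 11 p, 2, 0, loc 14 p)
     else if u = 20 \<and> p < K then (loc 14 p, 0, p + 3, loc 8 0)
     else if u = 21 \<and> p = 0 then (loc 8 0, 1, 0, loc 15 0)
     else if u = 22 \<and> p = 0 then (loc 15 0, 1, K + 2, loc 16 0)
     else (loc 17 0, 2, 0, loc 17 0))"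

text \<open>In the coding of \<open>sg\<close>, 0 resets, \<open>Suc c\<close> keeps the value, and
  1 and 2 copy the budget and the auxiliary counter. Rule 5 makes the budget the exponent of level
  \<open>p\<close>; rule 19 makes the amount transferred by the loop of rules 16 to 18 the new
  budget.\<close>

definition budget_assign :: "nat \<Rightarrow> machine \<Rightarrow> nat \<Rightarrow> nat \<Rightarrow> nat \<Rightarrow> nat" where
  "budget_assign K A u p c =
    (if K + 3 + m_counters A \<le> c then 0
     else if u = 5 \<and> c = p + 2 then 1
     else if u = 5 \<and> 2 \<le> c \<and> c < p + 2 then 0
     else if u = 7 \<and> 2 \<le> c \<and> c < K + 3 then 0
     else if u = 10 \<and> c = K + 3 + ic A p then 0
     else if u = 15 \<and> c = 1 then 0
     else if u = 19 \<and> c = 0 then 2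
     else if u = 19 \<and> 2 \<le> c \<and> c \<le> p + 2 then 0
     else Suc c)"

definition budget_net :: "nat \<Rightarrow> machine \<Rightarrow> net" where
  "budget_net K A = \<lparr>num_counters = K + 3 + m_counters A, num_trans = 32 * (K + m_len A + 1),
     sc = (\<lambda>i. fst (budget_rule K A (i mod 32) (i div 32))),
     kd = (\<lambda>i. fst (snd (budget_rule K A (i mod 32) (i div 32)))),
     ar = (\<lambda>i. fst (snd (snd (budget_rule K A (i mod 32) (i div 32))))),
     sg = (\<lambda>i. budget_assign K A (i mod 32) (i div 32)),
     tg = (\<lambda>i. snd (snd (snd (budget_rule K A (i mod 32) (i div 32)))))\<rparr>"

definition op_effect :: "nat \<Rightarrow> machine \<Rightarrow> nat \<Rightarrow> nat \<Rightarrow> nat \<Rightarrow> nat \<Rightarrow> (nat \<Rightarrow> nat) \<Rightarrow> (nat \<Rightarrow> nat) \<Rightarrow> bool" where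
  "op_effect K A u p k r s s' \<longleftrightarrow>
     (if k = 0 then s' = s(r := Suc (s r))
      else if k = 1 then s r \<noteq> 0 \<and> s' = s(r := s r - 1)
      else s' = (\<lambda>c. if budget_assign K A u p c = 0 then 0 else s (budget_assign K A u p c - 1)))"

lemma budget_net_sel:
  "num_counters (budget_net K A) = K + 3 + m_counters A"
  "num_trans (budget_net K A) = 32 * (K + m_len A + 1)"
  "sc (budget_net K A) i = fst (budget_rule K A (i mod 32) (i div 32))"
  "kd (budget_net K A) i = fst (snd (budget_rule K A (i mod 32) (i div 32)))"
  "ar (budget_net K A) i = fst (snd (snd (budget_rule K A (i mod 32) (i div 32))))"
  "sg (budget_net K A) i = budget_assign K A (i mod 32) (i div 32)"
  "tg (budget_net K A) i = snd (snd (snd (budget_rule K A (i mod 32) (i div 32))))"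
  unfolding budget_net_def by simp_all

lemma effect_budget_net:
  "effect (budget_net K A) i s s' \<longleftrightarrow> op_effect K A (i mod 32) (i div 32)
     (fst (snd (budget_rule K A (i mod 32) (i div 32))))
     (fst (snd (snd (budget_rule K A (i mod 32) (i div 32))))) s s'"
  unfolding effect_def op_effect_def budget_net_sel ..

definition net_step :: "nat \<Rightarrow> machine \<Rightarrow> nat \<times> (nat \<Rightarrow> nat) \<Rightarrow> nat \<times> (nat \<Rightarrow> nat) \<Rightarrow> bool" where
  "net_step K A x y \<longleftrightarrow> (\<exists>u<32. \<exists>p<K + m_len A + 1. \<exists>k r.
     budget_rule K A u p = (fst x, k, r, fst y) \<and> op_effect K A u p k r (snd x) (snd y))"

lemma net_step_iff:
  "(\<exists>i<num_trans (budget_net K A). sc (budget_net K A) i = l \<and> tg (budget_net K A) i = l' \<and>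
     effect (budget_net K A) i s s') \<longleftrightarrow> net_step K A (l, s) (l', s')"
proof
  assume "\<exists>i<num_trans (budget_net K A). sc (budget_net K A) i = l \<and> tg (budget_net K A) i = l' \<and>
     effect (budget_net K A) i s s'"
  then obtain i where i: "i < 32 * (K + m_len A + 1)" "sc (budget_net K A) i = l" "tg (budget_net K A) i = l'"
    "effect (budget_net K A) i s s'" by (auto simp: budget_net_sel)
  obtain k r where r: "budget_rule K A (i mod 32) (i div 32) = (l, k, r, l')"
    using i(2,3) by (cases "budget_rule K A (i mod 32) (i div 32)") (auto simp: budget_net_sel)
  have "i div 32 < K + m_len A + 1" using i(1) by (simp add: less_mult_imp_div_less mult.commute)
  moreover have "op_effect K A (i mod 32) (i div 32) k r s s'"
    using i(4) r by (simp add: effect_budget_net)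
  ultimately show "net_step K A (l, s) (l', s')"
    unfolding net_step_def using r by (intro exI[of _ "i mod 32"] conjI exI[of _ "i div 32"] exI[of _ k] exI[of _ r]) simp_all
next
  assume "net_step K A (l, s) (l', s')"
  then obtain u p k r where up: "u < 32" "p < K + m_len A + 1" "budget_rule K A u p = (l, k, r, l')"
    "op_effect K A u p k r s s'" unfolding net_step_def by auto
  let ?i = "32 * p + u"
  have "?i mod 32 = u" "?i div 32 = p" using up(1) by simp_all
  moreover have "?i < 32 * (K + m_len A + 1)"
  proof -
    have "32 * Suc p \<le> 32 * (K + m_len A + 1)" using up(2) by (intro mult_le_mono2) simp
    then show ?thesis using up(1) by simp
  qed
  ultimately show "\<exists>i<num_trans (budget_net K A). sc (budget_net K A) i = l \<and> tg (budget_net K A) i = l' \<and>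
     effect (budget_net K A) i s s'"
    using up(3,4) by (intro exI[of _ ?i]) (simp add: budget_net_sel effect_budget_net)
qed

lemma net_accepts_Suc:
  "net_accepts (budget_net K A) fin (Suc n) l s \<longleftrightarrow>
    (\<exists>l' s'. net_step K A (l, s) (l', s') \<and> net_accepts (budget_net K A) fin n l' s')"
  unfolding net_step_iff[symmetric] by auto

lemma net_accepts_reach:
  "(net_step K A)\<^sup>*\<^sup>* x (fin, s') \<Longrightarrow> \<exists>n. net_accepts (budget_net K A) fin n (fst x) (snd x)"
proof (induction x rule: converse_rtranclp_induct)
  case base
  then show ?case by (intro exI[of _ 0]) simp
next
  case (step x y)
  then obtain n where "net_accepts (budget_net K A) fin n (fst y) (snd y)" by auto
  then have "net_accepts (budget_net K A) fin (Suc n) (fst x) (snd x)"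
    unfolding net_accepts_Suc using step(1) by (intro exI[of _ "fst y"] exI[of _ "snd y"]) simp
  then show ?case ..
qed


subsection \<open>Soundness\<close>

definition exps :: "(nat \<Rightarrow> nat) \<Rightarrow> nat \<Rightarrow> nat" where
  "exps s i = s (i + 2)"

definition mcount :: "nat \<Rightarrow> machine \<Rightarrow> (nat \<Rightarrow> nat) \<Rightarrow> nat \<Rightarrow> nat" where
  "mcount K A s j = (if j < m_counters A then s (K + 3 + j) else 0)"

definition msum :: "nat \<Rightarrow> machine \<Rightarrow> (nat \<Rightarrow> nat) \<Rightarrow> nat" where
  "msum K A s = (\<Sum>j<m_counters A. s (K + 3 + j))"

definition total :: "nat \<Rightarrow> machine \<Rightarrow> (nat \<Rightarrow> nat) \<Rightarrow> nat" where
  "total K A s = s 0 + msum K A s"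

definition raise :: "(nat \<Rightarrow> nat) \<Rightarrow> nat \<Rightarrow> nat \<Rightarrow> nat \<Rightarrow> nat" where
  "raise a p n = a(p := a p + n)"

text \<open>No transition increases the potential, and a dishonest reset decreases it.\<close>

definition potential :: "nat \<Rightarrow> machine \<Rightarrow> nat \<times> (nat \<Rightarrow> nat) \<Rightarrow> nat" where
  "potential K A x = (let t = fst x mod 32; p = fst x div 32; s = snd x; a = exps s in
    if t = 2 then tower (Suc K) a (total K A s)
    else if t = 3 then tower (Suc K) a (Suc (total K A s))
    else if t = 4 then tower (Suc K) (raise a (Suc p) 1) (total K A s)
    else if t = 5 then tower (Suc K) (raise a p 1) (total K A s)
    else if t = 6 then tower (Suc K) a (total K A s)
    else if t = 7 then tower (Suc K) a (Suc (total K A s))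
    else if t = 8 then tower (Suc K) a (s 0)
    else if t = 9 then tower (Suc K) a (Suc (s 0))
    else if t = 10 then tower (Suc K) (raise a p 1) (s 0)
    else if t = 11 then tower (Suc K) (raise a p (Suc (s 1))) (s 0 + s 1)
    else if t = 12 then tower (Suc K) (raise a p (Suc (Suc (s 1)))) (s 0 + s 1)
    else if t = 13 then tower (Suc K) (raise a p (Suc (Suc (s 1)))) (Suc (s 0 + s 1))
    else if t = 14 then tower (Suc K) (raise a (Suc p) 1) (s 0)
    else if t = 15 then tower (Suc K) a (Suc (s 0))
    else tower (Suc K) (raise a K 1) (Suc (s 0)))"

lemma loc_simps [simp]: "t < 32 \<Longrightarrow> loc t p mod 32 = t" "t < 32 \<Longrightarrow> loc t p div 32 = p"
  by (simp_all add: loc_def)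

lemma loc_inject: "t < 32 \<Longrightarrow> t' < 32 \<Longrightarrow> loc t p = loc t' p' \<longleftrightarrow> t = t' \<and> p = p'"
  by (metis loc_simps)

text \<open>The tags 2 to 16 cover all locations after the initialisation and exclude the isolated
  one.\<close>

lemma net_step_cases:
  assumes "net_step K A (l, s) (l', s')" "2 \<le> l mod 32" "l mod 32 \<le> 16"
  obtains (r2) "l = loc 2 0" "l' = loc 3 0" "s 2 \<noteq> 0" "s' = s(2 := s 2 - 1)"
  | (r3) "l = loc 3 0" "l' = loc 2 0" "s' = s(0 := Suc (s 0))"
  | (r4) p where "p < K" "l = loc 2 0" "l' = loc 4 p" "s (p + 3) \<noteq> 0" "s' = s(p + 3 := s (p + 3) - 1)"
  | (r5) p where "p < K" "l = loc 4 p" "l' = loc 5 p" "op_effect K A 5 p 2 0 s s'"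
  | (r6) p where "p < K" "l = loc 5 p" "l' = loc 2 0" "s' = s(p + 2 := Suc (s (p + 2)))"
  | (r7) "l = loc 2 0" "l' = loc 6 0" "op_effect K A 7 0 2 0 s s'"
  | (r8) p where "p < m_len A" "ik A p = 0" "l = loc 6 p" "l' = loc 7 p" "s 0 \<noteq> 0" "s' = s(0 := s 0 - 1)"
  | (r9) p where "p < m_len A" "ik A p = 0" "l = loc 7 p" "l' = loc 6 (it A p)"
      "s' = s(K + 3 + ic A p := Suc (s (K + 3 + ic A p)))"
  | (rdec) p where "p < m_len A" "ik A p = 1" "l = loc 6 p" "l' = loc 7 p" "s (K + 3 + ic A p) \<noteq> 0"
      "s' = s(K + 3 + ic A p := s (K + 3 + ic A p) - 1)"
  | (rdec2) p where "p < m_len A" "ik A p = 1" "l = loc 7 p" "l' = loc 6 (it A p)" "s' = s(0 := Suc (s 0))"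
  | (r10) p where "p < m_len A" "ik A p = 1" "l = loc 6 p" "l' = loc 6 (iu A p)" "op_effect K A 10 p 2 0 s s'"
  | (rjmp) p where "p < m_len A" "ik A p \<noteq> 0" "ik A p \<noteq> 1" "l = loc 6 p" "l' = loc 6 (it A p)"
      "op_effect K A 8 p 2 0 s s'"
  | (r11) "l = loc 6 (m_acc A)" "l' = loc 8 0" "op_effect K A 11 0 2 0 s s'"
  | (r12) "l = loc 8 0" "l' = loc 9 0" "s 0 \<noteq> 0" "s' = s(0 := s 0 - 1)"
  | (r13) "l = loc 9 0" "l' = loc 8 0" "s' = s(2 := Suc (s 2))"
  | (r14) p where "p < K" "l = loc 8 0" "l' = loc 10 p" "s (p + 2) \<noteq> 0" "s' = s(p + 2 := s (p + 2) - 1)"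
  | (r15) p where "p < K" "l = loc 10 p" "l' = loc 11 p" "op_effect K A 15 p 2 0 s s'"
  | (r16) p where "p < K" "l = loc 11 p" "l' = loc 12 p" "s (p + 2) \<noteq> 0" "s' = s(p + 2 := s (p + 2) - 1)"
  | (r17) p where "p < K" "l = loc 12 p" "l' = loc 13 p" "s 0 \<noteq> 0" "s' = s(0 := s 0 - 1)"
  | (r18) p where "p < K" "l = loc 13 p" "l' = loc 11 p" "s' = s(1 := Suc (s 1))"
  | (r19) p where "p < K" "l = loc 11 p" "l' = loc 14 p" "op_effect K A 19 p 2 0 s s'"
  | (r20) p where "p < K" "l = loc 14 p" "l' = loc 8 0" "s' = s(p + 3 := Suc (s (p + 3)))"
  | (r21) "l = loc 8 0" "l' = loc 15 0" "s 0 \<noteq> 0" "s' = s(0 := s 0 - 1)"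
  | (r22) "l = loc 15 0" "l' = loc 16 0" "s (K + 2) \<noteq> 0" "s' = s(K + 2 := s (K + 2) - 1)"
proof -
  obtain u p k r where R: "budget_rule K A u p = (l, k, r, l')" and E: "op_effect K A u p k r s s'"
    using assms(1) unfolding net_step_def by auto
  have E0: "s' = s(r := Suc (s r))" if "k = 0" using E that by (simp add: op_effect_def)
  have E1: "s r \<noteq> 0" "s' = s(r := s r - 1)" if "k = 1" using E that by (simp_all add: op_effect_def)
  have nl: "l \<noteq> loc 0 0" "l \<noteq> loc 1 0" "l \<noteq> loc 17 0" using assms(2,3) by auto
  consider (c0) "u = 2 \<and> p = 0"
    | (c1) "u = 3 \<and> p = 0"
    | (c2) "u = 4 \<and> p < K"
    | (c3) "u = 5 \<and> p < K"
    | (c4) "u = 6 \<and> p < K"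
    | (c5) "u = 7 \<and> p = 0"
    | (c6) "u = 8 \<and> p < m_len A \<and> ik A p = 0"
    | (c7) "u = 9 \<and> p < m_len A \<and> ik A p = 0"
    | (c8) "u = 8 \<and> p < m_len A \<and> ik A p = 1"
    | (c9) "u = 9 \<and> p < m_len A \<and> ik A p = 1"
    | (c10) "u = 10 \<and> p < m_len A \<and> ik A p = 1"
    | (c11) "u = 8 \<and> p < m_len A \<and> ik A p \<noteq> 0 \<and> ik A p \<noteq> 1"
    | (c12) "u = 11 \<and> p = 0"
    | (c13) "u = 12 \<and> p = 0"
    | (c14) "u = 13 \<and> p = 0"
    | (c15) "u = 14 \<and> p < K"
    | (c16) "u = 15 \<and> p < K"
    | (c17) "u = 16 \<and> p < K"
    | (c18) "u = 17 \<and> p < K"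
    | (c19) "u = 18 \<and> p < K"
    | (c20) "u = 19 \<and> p < K"
    | (c21) "u = 20 \<and> p < K"
    | (c22) "u = 21 \<and> p = 0"
    | (c23) "u = 22 \<and> p = 0"
    | (first) "u = 0 \<and> p = 0 \<or> u = 1 \<and> p = 0"
    | (other) "\<not> (u = 0 \<and> p = 0)" "\<not> (u = 1 \<and> p = 0)"
        "\<not> (u = 2 \<and> p = 0)"
        "\<not> (u = 3 \<and> p = 0)"
        "\<not> (u = 4 \<and> p < K)"
        "\<not> (u = 5 \<and> p < K)"
        "\<not> (u = 6 \<and> p < K)"
        "\<not> (u = 7 \<and> p = 0)"
        "\<not> (u = 8 \<and> p < m_len A \<and> ik A p = 0)"
        "\<not> (u = 9 \<and> p < m_len A \<and> ik A p = 0)"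
        "\<not> (u = 8 \<and> p < m_len A \<and> ik A p = 1)"
        "\<not> (u = 9 \<and> p < m_len A \<and> ik A p = 1)"
        "\<not> (u = 10 \<and> p < m_len A \<and> ik A p = 1)"
        "\<not> (u = 8 \<and> p < m_len A)"
        "\<not> (u = 11 \<and> p = 0)"
        "\<not> (u = 12 \<and> p = 0)"
        "\<not> (u = 13 \<and> p = 0)"
        "\<not> (u = 14 \<and> p < K)"
        "\<not> (u = 15 \<and> p < K)"
        "\<not> (u = 16 \<and> p < K)"
        "\<not> (u = 17 \<and> p < K)"
        "\<not> (u = 18 \<and> p < K)"
        "\<not> (u = 19 \<and> p < K)"
        "\<not> (u = 20 \<and> p < K)"
        "\<not> (u = 21 \<and> p = 0)"
        "\<not> (u = 22 \<and> p = 0)"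
    by argo
  then show thesis
  proof cases
    case c0
    with R have "k = 1" by (simp add: budget_rule_def)
    with R E1 c0 show ?thesis by (intro that(1)) (simp_all add: budget_rule_def)
  next
    case c1
    with R have "k = 0" by (simp add: budget_rule_def)
    with R E0 c1 show ?thesis by (intro that(2)) (simp_all add: budget_rule_def)
  next
    case c2
    with R have "k = 1" by (simp add: budget_rule_def)
    with R E1 c2 show ?thesis by (intro that(3)[of p]) (simp_all add: budget_rule_def)
  next
    case c3
    with R have "k = 2" by (simp add: budget_rule_def)
    with R E c3 show ?thesis by (intro that(4)[of p]) (simp_all add: budget_rule_def)
  next
    case c4
    with R have "k = 0" by (simp add: budget_rule_def)
    with R E0 c4 show ?thesis by (intro that(5)[of p]) (simp_all add: budget_rule_def)
  next
    case c5
    with R have "k = 2" by (simp add: budget_rule_def)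
    with R E c5 show ?thesis by (intro that(6)) (simp_all add: budget_rule_def)
  next
    case c6
    with R have "k = 1" by (simp add: budget_rule_def)
    with R E1 c6 show ?thesis by (intro that(7)[of p]) (simp_all add: budget_rule_def)
  next
    case c7
    with R have "k = 0" by (simp add: budget_rule_def)
    with R E0 c7 show ?thesis by (intro that(8)[of p]) (simp_all add: budget_rule_def)
  next
    case c8
    with R have "k = 1" by (simp add: budget_rule_def)
    with R E1 c8 show ?thesis by (intro that(9)[of p]) (simp_all add: budget_rule_def)
  next
    case c9
    with R have "k = 0" by (simp add: budget_rule_def)
    with R E0 c9 show ?thesis by (intro that(10)[of p]) (simp_all add: budget_rule_def)
  next
    case c10
    with R have "k = 2" by (simp add: budget_rule_def)
    with R E c10 show ?thesis by (intro that(11)[of p]) (simp_all add: budget_rule_def)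
  next
    case c11
    with R have "k = 2" by (simp add: budget_rule_def)
    with R E c11 show ?thesis by (intro that(12)[of p]) (simp_all add: budget_rule_def)
  next
    case c12
    with R have "k = 2" by (simp add: budget_rule_def)
    with R E c12 show ?thesis by (intro that(13)) (simp_all add: budget_rule_def)
  next
    case c13
    with R have "k = 1" by (simp add: budget_rule_def)
    with R E1 c13 show ?thesis by (intro that(14)) (simp_all add: budget_rule_def)
  next
    case c14
    with R have "k = 0" by (simp add: budget_rule_def)
    with R E0 c14 show ?thesis by (intro that(15)) (simp_all add: budget_rule_def)
  next
    case c15
    with R have "k = 1" by (simp add: budget_rule_def)
    with R E1 c15 show ?thesis by (intro that(16)[of p]) (simp_all add: budget_rule_def)
  next
    case c16
    with R have "k = 2" by (simp add: budget_rule_def)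
    with R E c16 show ?thesis by (intro that(17)[of p]) (simp_all add: budget_rule_def)
  next
    case c17
    with R have "k = 1" by (simp add: budget_rule_def)
    with R E1 c17 show ?thesis by (intro that(18)[of p]) (simp_all add: budget_rule_def)
  next
    case c18
    with R have "k = 1" by (simp add: budget_rule_def)
    with R E1 c18 show ?thesis by (intro that(19)[of p]) (simp_all add: budget_rule_def)
  next
    case c19
    with R have "k = 0" by (simp add: budget_rule_def)
    with R E0 c19 show ?thesis by (intro that(20)[of p]) (simp_all add: budget_rule_def)
  next
    case c20
    with R have "k = 2" by (simp add: budget_rule_def)
    with R E c20 show ?thesis by (intro that(21)[of p]) (simp_all add: budget_rule_def)
  next
    case c21
    with R have "k = 0" by (simp add: budget_rule_def)
    with R E0 c21 show ?thesis by (intro that(22)[of p]) (simp_all add: budget_rule_def)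
  next
    case c22
    with R have "k = 1" by (simp add: budget_rule_def)
    with R E1 c22 show ?thesis by (intro that(23)) (simp_all add: budget_rule_def)
  next
    case c23
    with R have "k = 1" by (simp add: budget_rule_def)
    with R E1 c23 show ?thesis by (intro that(24)) (simp_all add: budget_rule_def)
  next
    case first
    with R nl show ?thesis by (auto simp: budget_rule_def)
  next
    case other
    with R have "l = loc 17 0" unfolding budget_rule_def by (simp only: if_False prod.inject)
    with nl show ?thesis by simp
  qed
qed

lemma sum_fun_upd: "j < m \<Longrightarrow> (\<Sum>i<m. (c(j := v)) i) + c j = (\<Sum>i<m. c i) + v" for c :: "nat \<Rightarrow> nat"
proof (induction m)
  case (Suc m)
  show ?case
  proof (cases "j = m")
    case True
    have "(\<Sum>i<m. (c(j := v)) i) = (\<Sum>i<m. c i)" using True by (intro sum.cong) auto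
    then show ?thesis using True by simp
  next
    case False
    then show ?thesis using Suc by simp
  qed
qed simp

lemma msum_low: "r < K + 3 \<Longrightarrow> msum K A (s(r := v)) = msum K A s"
  unfolding msum_def by (intro sum.cong) auto

lemma msum_high: "j < m_counters A \<Longrightarrow> msum K A (s(K + 3 + j := v)) + s (K + 3 + j) = msum K A s + v"
proof -
  assume j: "j < m_counters A"
  have "(s(K + 3 + j := v)) (K + 3 + i) = ((\<lambda>i. s (K + 3 + i))(j := v)) i" for i by simp
  then show ?thesis unfolding msum_def using sum_fun_upd[OF j, of "\<lambda>i. s (K + 3 + i)" v] by simp
qed

lemma mcount_low: "r < K + 3 \<Longrightarrow> mcount K A (s(r := v)) = mcount K A s"
  unfolding mcount_def by (intro ext) auto

lemma mcount_high: "j < m_counters A \<Longrightarrow> mcount K A (s(K + 3 + j := v)) = (mcount K A s)(j := v)"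
  unfolding mcount_def by (intro ext) auto

lemma msum_cong: "(\<And>j. j < m_counters A \<Longrightarrow> s (K + 3 + j) = s' (K + 3 + j)) \<Longrightarrow> msum K A s = msum K A s'"
  unfolding msum_def by (intro sum.cong) auto

lemma mcount_cong: "(\<And>j. j < m_counters A \<Longrightarrow> s (K + 3 + j) = s' (K + 3 + j)) \<Longrightarrow> mcount K A s = mcount K A s'"
  unfolding mcount_def by (intro ext) auto

lemma assign_value:
  assumes "op_effect K A u p 2 0 s s'"
  shows "s' c = (if budget_assign K A u p c = 0 then 0 else s (budget_assign K A u p c - 1))"
  using assms by (simp add: op_effect_def)

lemma assign_jump:
  assumes "op_effect K A u p 2 0 s s'" "u = 8 \<or> u = 11"
  shows "c < K + 3 + m_counters A \<Longrightarrow> s' c = s c"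
  using assms(2) unfolding assign_value[OF assms(1)] budget_assign_def by auto

lemma assign_unfold:
  assumes "op_effect K A 5 p 2 0 s s'" "p < K"
  shows "s' 0 = s 0" "exps s' p = s 0" "i < p \<Longrightarrow> exps s' i = 0" "p < i \<Longrightarrow> i \<le> K \<Longrightarrow> exps s' i = exps s i"
    "j < m_counters A \<Longrightarrow> s' (K + 3 + j) = s (K + 3 + j)"
  using assms(2) unfolding exps_def assign_value[OF assms(1)] budget_assign_def by (auto simp: ac_simps)

lemma assign_start:
  assumes "op_effect K A 7 p 2 0 s s'"
  shows "s' 0 = s 0" "i \<le> K \<Longrightarrow> exps s' i = 0" "j < m_counters A \<Longrightarrow> s' (K + 3 + j) = s (K + 3 + j)"
  unfolding exps_def assign_value[OF assms(1)] budget_assign_def by (auto simp: ac_simps)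

lemma assign_test:
  assumes "op_effect K A 10 p 2 0 s s'" "ic A p < m_counters A"
  shows "s' 0 = s 0" "i \<le> K \<Longrightarrow> exps s' i = exps s i"
    "j < m_counters A \<Longrightarrow> s' (K + 3 + j) = (if j = ic A p then 0 else s (K + 3 + j))"
  using assms(2) unfolding exps_def assign_value[OF assms(1)] budget_assign_def by (auto simp: ac_simps)

lemma assign_aux:
  assumes "op_effect K A 15 p 2 0 s s'"
  shows "s' 0 = s 0" "s' 1 = 0" "i \<le> K \<Longrightarrow> exps s' i = exps s i"
  unfolding exps_def assign_value[OF assms(1)] budget_assign_def by (auto simp: ac_simps)

lemma assign_fold:
  assumes "op_effect K A 19 p 2 0 s s'" "p < K"
  shows "s' 0 = s 1" "i \<le> p \<Longrightarrow> exps s' i = 0" "p < i \<Longrightarrow> i \<le> K \<Longrightarrow> exps s' i = exps s i"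
  using assms(2) unfolding exps_def assign_value[OF assms(1)] budget_assign_def by (auto simp: ac_simps)

text \<open>Unfolding and folding obey the tower inequalities, moves between the budget and the
  machine keep their sum, and resets lose units only. Within a rule of several steps, the potential
  still counts the units in transit.\<close>

lemma potential_step:
  assumes wf: "m_wf A" and st: "net_step K A (l, s) (l', s')" and t: "2 \<le> l mod 32" "l mod 32 \<le> 16"
  shows "potential K A (l', s') \<le> potential K A (l, s) \<and> 2 \<le> l' mod 32 \<and> l' mod 32 \<le> 16"
proof -
  have ic: "ic A p < m_counters A" if "p < m_len A" for p using wf that by (simp add: m_wf_def)
  note defs = potential_def Let_def total_def
  show ?thesis
    using st t
  proof (cases rule: net_step_cases)
    case r2
    have "tower (Suc K) (exps s) x = tower (Suc K) (exps s') (Suc x)" for x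
      by (rule tower_0) (use r2 in \<open>auto simp: exps_def numeral_2_eq_2\<close>)
    then show ?thesis using r2 by (simp add: defs msum_low)
  next
    case r3
    then show ?thesis by (auto simp: defs msum_low exps_def intro!: tower_mono)
  next
    case (r4 p)
    then show ?thesis by (auto simp: numeral_3_eq_3 defs msum_low exps_def raise_def intro!: tower_mono)
  next
    case (r5 p)
    \<comment> \<open>Here the exponent of level \<open>p\<close> has become the budget; with the
      pending increment this is one more than the budget, which is at most the total.\<close>
    have "tower (Suc K) (raise (exps s') p 1) (total K A s) \<le> tower (Suc K) (raise (exps s) (Suc p) 1) (total K A s)"
      by (rule tower_unfold[of p _ "s 0"]) (use r5(1) assign_unfold[OF r5(4,1)] in \<open>auto simp: raise_def total_def\<close>)
    moreover have "total K A s' = total K A s"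
      unfolding total_def using assign_unfold[OF r5(4,1)] msum_cong[of A s' K s] by simp
    ultimately show ?thesis using r5 by (simp add: potential_def Let_def)
  next
    case (r6 p)
    then show ?thesis by (auto simp: defs msum_low exps_def raise_def intro!: tower_mono)
  next
    case r7
    have "total K A s' = total K A s"
      unfolding total_def using assign_start[OF r7(3)] msum_cong[of A s' K s] by simp
    moreover have "tower (Suc K) (exps s') (total K A s) = total K A s"
      by (rule tower_zero) (use assign_start[OF r7(3)] in auto)
    ultimately show ?thesis using r7 tower_ge by (simp add: potential_def Let_def)
  next
    case (r8 p)
    then show ?thesis by (auto simp: defs msum_low exps_def intro!: tower_mono)
  next
    case (r9 p)
    then have "msum K A s' = Suc (msum K A s)"
      using msum_high[OF ic[OF r9(1)], of K s "Suc (s (K + 3 + ic A p))"] by simp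
    then show ?thesis using r9 by (auto simp: defs exps_def intro!: tower_mono)
  next
    case (rdec p)
    then have "Suc (msum K A s') = msum K A s"
      using msum_high[OF ic[OF rdec(1)], of K s "s (K + 3 + ic A p) - 1"] by simp
    then show ?thesis using rdec by (auto simp: defs exps_def intro!: tower_mono)
  next
    case (rdec2 p)
    then show ?thesis by (auto simp: defs msum_low exps_def intro!: tower_mono)
  next
    case (r10 p)
    note a = assign_test[OF r10(5) ic[OF r10(1)]]
    have "msum K A s' \<le> msum K A s" unfolding msum_def by (intro sum_mono) (simp add: a(3))
    then show ?thesis using r10 a by (auto simp: defs intro!: tower_mono)
  next
    case (rjmp p)
    note a = assign_jump[OF rjmp(6)]
    have "msum K A s' = msum K A s" by (rule msum_cong) (simp add: a)
    then show ?thesis using rjmp a by (auto simp: defs exps_def intro!: tower_mono)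
  next
    case r11
    note a = assign_jump[OF r11(3)]
    show ?thesis using r11 a by (auto simp: defs exps_def intro!: tower_mono)
  next
    case r12
    then show ?thesis by (auto simp: defs exps_def intro!: tower_mono)
  next
    case r13
    have "tower (Suc K) (exps s') x = tower (Suc K) (exps s) (Suc x)" for x
      by (rule tower_0) (use r13 in \<open>auto simp: exps_def numeral_2_eq_2\<close>)
    then show ?thesis using r13 by (simp add: defs)
  next
    case (r14 p)
    then show ?thesis by (auto simp: defs exps_def raise_def intro!: tower_mono)
  next
    case (r15 p)
    then show ?thesis using assign_aux[OF r15(4)] by (auto simp: defs raise_def intro!: tower_mono)
  next
    case (r16 p)
    then show ?thesis by (auto simp: defs exps_def raise_def intro!: tower_mono)
  next
    case (r17 p)
    then show ?thesis by (auto simp: defs exps_def raise_def intro!: tower_mono)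
  next
    case (r18 p)
    then show ?thesis by (auto simp: defs exps_def raise_def intro!: tower_mono)
  next
    case (r19 p)
    note a = assign_fold[OF r19(4,1)]
    have "tower (Suc K) (raise (exps s') (Suc p) 1) (s 1) \<le> tower (Suc K) (raise (exps s) p (Suc (s 1))) (s 0 + s 1)"
      by (rule tower_fold[of p]) (use r19(1) a in \<open>auto simp: raise_def\<close>)
    then show ?thesis using r19 a(1) by (simp add: defs)
  next
    case (r20 p)
    then show ?thesis by (auto simp: numeral_3_eq_3 defs exps_def raise_def intro!: tower_mono)
  next
    case r21
    then show ?thesis by (auto simp: defs exps_def intro!: tower_mono)
  next
    case r22
    then show ?thesis by (auto simp: defs exps_def raise_def intro!: tower_mono)
  qed
qed

text \<open>While the machine runs, its counters in the net show a truly reachable configuration. In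
  the middle of a decrement, one unit is added back. Afterwards it only matters that an accepting
  configuration was reachable.\<close>

definition honest :: "nat \<Rightarrow> machine \<Rightarrow> nat \<times> (nat \<Rightarrow> nat) \<Rightarrow> bool" where
  "honest K A x \<longleftrightarrow> (let t = fst x mod 32; p = fst x div 32; c = mcount K A (snd x) in
    if t \<le> 5 then c = (\<lambda>_. 0)
    else if t = 6 then m_reach A (p, c)
    else if t = 7 then p < m_len A \<and> (ik A p = 0 \<and> m_reach A (p, c) \<or>
      ik A p = 1 \<and> m_reach A (p, c(ic A p := Suc (c (ic A p)))))
    else \<exists>c. m_reach A (m_acc A, c))"

text \<open>The only way to leave the true run of the machine is a zero test on a nonzero counter,
  which would lower the potential.\<close>

lemma honest_step:
  assumes wf: "m_wf A" and st: "net_step K A (l, s) (l', s')" and t: "2 \<le> l mod 32" "l mod 32 \<le> 16"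
    and h: "honest K A (l, s)" and eq: "potential K A (l', s') = potential K A (l, s)"
  shows "honest K A (l', s')"
proof -
  have ic: "ic A p < m_counters A" if "p < m_len A" for p using wf that by (simp add: m_wf_def)
  note defs = honest_def Let_def
  show ?thesis
    using st t
  proof (cases rule: net_step_cases)
    case (r5 p)
    have "mcount K A s' = mcount K A s" by (rule mcount_cong) (rule assign_unfold(5)[OF r5(4,1)])
    then show ?thesis using h r5 by (simp add: defs)
  next
    case r7
    have "mcount K A s' = mcount K A s" by (rule mcount_cong) (rule assign_start(3)[OF r7(3)])
    moreover have "m_reach A (0, \<lambda>_. 0)" unfolding m_reach_def by (rule exI[of _ 0]) simp
    ultimately show ?thesis using h r7 by (simp add: defs)
  next
    case (r9 p)
    have "m_step A (p, mcount K A s) = (it A p, mcount K A s')"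
      using r9 ic[OF r9(1)] by (simp add: m_step_def mcount_high) (simp add: mcount_def)
    then show ?thesis using h r9 m_reach_step[of A "(p, mcount K A s)"] by (simp add: defs)
  next
    case (rdec p)
    have "mcount K A s' = (mcount K A s)(ic A p := s (K + 3 + ic A p) - 1)"
      using rdec ic[OF rdec(1)] by (simp add: mcount_high)
    moreover have "mcount K A s (ic A p) = s (K + 3 + ic A p)" using ic[OF rdec(1)] by (simp add: mcount_def)
    ultimately have "(mcount K A s')(ic A p := Suc (mcount K A s' (ic A p))) = mcount K A s"
      using rdec(5) by (auto simp: fun_eq_iff)
    then show ?thesis using h rdec by (simp add: defs)
  next
    case (rdec2 p)
    let ?c = "(mcount K A s)(ic A p := Suc (mcount K A s (ic A p)))"
    have "m_step A (p, ?c) = (it A p, mcount K A s)"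
      using rdec2 by (simp add: m_step_def)
    moreover have "m_reach A (p, ?c)" using h rdec2 by (simp add: defs)
    ultimately have "m_reach A (it A p, mcount K A s)" using m_reach_step by metis
    then show ?thesis using rdec2 by (simp add: defs mcount_low)
  next
    case (r10 p)
    note a = assign_test[OF r10(5) ic[OF r10(1)]]
    \<comment> \<open>Resetting a nonzero counter lowers the total, and towers are strictly monotone
      in their argument.\<close>
    have zero: "s (K + 3 + ic A p) = 0"
    proof (rule ccontr)
      assume nz: "s (K + 3 + ic A p) \<noteq> 0"
      have "msum K A s' < msum K A s"
        unfolding msum_def
        by (rule sum_strict_mono_ex1) (use nz ic[OF r10(1)] in \<open>auto simp: a(3)\<close>)
      then have "total K A s' < total K A s" using a(1) by (simp add: total_def)
      then have "tower (Suc K) (exps s') (total K A s') < tower (Suc K) (exps s') (total K A s)"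
        by (rule tower_strict)
      also have "\<dots> = tower (Suc K) (exps s) (total K A s)" by (rule tower_cong) (simp_all add: a(2))
      finally show False using eq r10 by (simp add: potential_def Let_def)
    qed
    have "mcount K A s' = mcount K A s" by (rule mcount_cong) (simp add: a(3) zero)
    moreover have "m_step A (p, mcount K A s) = (iu A p, mcount K A s)"
      using r10 zero by (simp add: m_step_def mcount_def)
    ultimately show ?thesis using h r10 m_reach_step[of A "(p, mcount K A s)"] by (simp add: defs)
  next
    case (rjmp p)
    have "mcount K A s' = mcount K A s" by (rule mcount_cong) (simp add: assign_jump[OF rjmp(6)])
    moreover have "m_step A (p, mcount K A s) = (it A p, mcount K A s)"
      using rjmp by (simp add: m_step_def)
    ultimately show ?thesis using h rjmp m_reach_step[of A "(p, mcount K A s)"] by (simp add: defs)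
  next
    case r11
    then show ?thesis using h by (auto simp: defs)
  qed (use h in \<open>auto simp: defs mcount_low\<close>)
qed

lemma potential_final:
  "tower (Suc K) (\<lambda>i. if i = K then 1 else 0) 1 \<le> potential K A (loc 16 0, s)"
  by (auto simp: potential_def Let_def raise_def intro!: tower_mono)

text \<open>The final location is worth at least \<open>fast K 1\<close>, and no step increases the
  potential.\<close>

lemma net_accepts_potential:
  assumes wf: "m_wf A"
  shows "net_accepts (budget_net K A) (loc 16 0) n l s \<Longrightarrow> 2 \<le> l mod 32 \<Longrightarrow> l mod 32 \<le> 16 \<Longrightarrow>
    tower (Suc K) (\<lambda>i. if i = K then 1 else 0) 1 \<le> potential K A (l, s)"
proof (induction n arbitrary: l s)
  case 0
  then show ?case using potential_final by simp
next
  case (Suc n)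
  then obtain l' s' where st: "net_step K A (l, s) (l', s')" "net_accepts (budget_net K A) (loc 16 0) n l' s'"
    unfolding net_accepts_Suc by blast
  note P = potential_step[OF wf st(1) Suc.prems(2,3)]
  have "tower (Suc K) (\<lambda>i. if i = K then 1 else 0) 1 \<le> potential K A (l', s')"
    by (rule Suc.IH[OF st(2)]) (use P in auto)
  also have "\<dots> \<le> potential K A (l, s)" using P by simp
  finally show ?case .
qed

text \<open>The potential starts no higher than it has to end, so that it is constant along the run
  and \<open>honest_step\<close> applies everywhere.\<close>

lemma net_accepts_honest:
  assumes wf: "m_wf A"
  shows "net_accepts (budget_net K A) (loc 16 0) n l s \<Longrightarrow> 2 \<le> l mod 32 \<Longrightarrow> l mod 32 \<le> 16 \<Longrightarrow>
    potential K A (l, s) \<le> tower (Suc K) (\<lambda>i. if i = K then 1 else 0) 1 \<Longrightarrow> honest K A (l, s) \<Longrightarrow>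
    \<exists>c. m_reach A (m_acc A, c)"
proof (induction n arbitrary: l s)
  case 0
  then have "l = loc 16 0" by simp
  then show ?case using 0(5) by (simp add: honest_def)
next
  case (Suc n)
  then obtain l' s' where st: "net_step K A (l, s) (l', s')" "net_accepts (budget_net K A) (loc 16 0) n l' s'"
    unfolding net_accepts_Suc by blast
  note P = potential_step[OF wf st(1) Suc.prems(2,3)]
  have "tower (Suc K) (\<lambda>i. if i = K then 1 else 0) 1 \<le> potential K A (l', s')"
    by (rule net_accepts_potential[OF wf st(2)]) (use P in auto)
  then have eq: "potential K A (l', s') = potential K A (l, s)" using P Suc.prems(4) by simp
  have "honest K A (l', s')" by (rule honest_step[OF wf st(1) Suc.prems(2,3,5) eq])
  then show ?case using Suc.IH[OF st(2)] P Suc.prems(4) by simp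
qed

lemma net_step_first:
  assumes "net_step K A (loc 0 0, s) (l', s')"
  shows "l' = loc 1 0 \<and> s' = s(0 := Suc (s 0))"
proof -
  obtain u p k r where R: "budget_rule K A u p = (loc 0 0, k, r, l')" and E: "op_effect K A u p k r s s'"
    using assms unfolding net_step_def by auto
  have "u = 0 \<and> p = 0"
    using R unfolding budget_rule_def by (auto simp: loc_inject split: if_splits)
  then show ?thesis using R E by (simp add: budget_rule_def op_effect_def)
qed

lemma net_step_second:
  assumes "net_step K A (loc 1 0, s) (l', s')"
  shows "l' = loc 2 0 \<and> s' = s(K + 2 := Suc (s (K + 2)))"
proof -
  obtain u p k r where R: "budget_rule K A u p = (loc 1 0, k, r, l')" and E: "op_effect K A u p k r s s'"
    using assms unfolding net_step_def by auto
  have "u = 1 \<and> p = 0"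
    using R unfolding budget_rule_def by (auto simp: loc_inject split: if_splits)
  then show ?thesis using R E by (simp add: budget_rule_def op_effect_def)
qed

lemma budget_net_sound:
  assumes wf: "m_wf A" and acc: "net_accepts (budget_net K A) (loc 16 0) n 0 (\<lambda>_. 0)"
  shows "\<exists>c. m_reach A (m_acc A, c)"
proof -
  have l0: "(0::nat) = loc 0 0" by (simp add: loc_def)
  obtain n1 where "n = Suc n1" using acc by (cases n) (auto simp: loc_def)
  with acc obtain l1 s1 where 1: "net_step K A (loc 0 0, \<lambda>_. 0) (l1, s1)"
    "net_accepts (budget_net K A) (loc 16 0) n1 l1 s1" using net_accepts_Suc l0 by metis
  have s1: "l1 = loc 1 0" "s1 = (\<lambda>_. 0)(0 := 1)" using net_step_first[OF 1(1)] by simp_all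
  obtain n2 where "n1 = Suc n2" using 1(2) s1(1) by (cases n1) (auto simp: loc_def)
  with 1(2) obtain l2 s2 where 2: "net_step K A (loc 1 0, s1) (l2, s2)"
    "net_accepts (budget_net K A) (loc 16 0) n2 l2 s2" using net_accepts_Suc s1(1) by metis
  have s2: "l2 = loc 2 0" "s2 = (\<lambda>_. 0)(0 := 1, K + 2 := 1)" using net_step_second[OF 2(1)] s1(2) by simp_all
  have "mcount K A s2 = (\<lambda>_. 0)" by (auto simp: mcount_def s2(2))
  then have "honest K A (l2, s2)" by (simp add: honest_def s2(1))
  moreover have "potential K A (l2, s2) \<le> tower (Suc K) (\<lambda>i. if i = K then 1 else 0) 1"
  proof -
    have "msum K A s2 = 0" by (simp add: msum_def s2(2))
    then show ?thesis
      by (auto simp: potential_def Let_def s2 total_def exps_def intro!: tower_mono)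
  qed
  ultimately show ?thesis using net_accepts_honest[OF wf 2(2)] s2(1) by simp
qed

subsection \<open>Completeness\<close>

definition mk :: "nat \<Rightarrow> machine \<Rightarrow> (nat \<Rightarrow> nat) \<Rightarrow> nat \<Rightarrow> nat \<Rightarrow> (nat \<Rightarrow> nat) \<Rightarrow> nat \<Rightarrow> nat" where
  "mk K A a x y c = (\<lambda>i. if i = 0 then x else if i = 1 then y else if i < K + 3 then a (i - 2)
     else if i < K + 3 + m_counters A then c (i - (K + 3)) else 0)"

abbreviation reaches :: "nat \<Rightarrow> machine \<Rightarrow> nat \<times> (nat \<Rightarrow> nat) \<Rightarrow> nat \<times> (nat \<Rightarrow> nat) \<Rightarrow> bool" where
  "reaches K A \<equiv> (net_step K A)\<^sup>*\<^sup>*"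

lemma net_stepI:
  assumes "budget_rule K A u p = (l, k, r, l')" "op_effect K A u p k r s s'" "u < 32" "p < K + m_len A + 1"
  shows "net_step K A (l, s) (l', s')"
  using assms unfolding net_step_def by auto

lemma mk_simps:
  "mk K A a x y c 0 = x" "mk K A a x y c (Suc 0) = y" "i \<le> K \<Longrightarrow> mk K A a x y c (i + 2) = a i"
  "j < m_counters A \<Longrightarrow> mk K A a x y c (K + 3 + j) = c j"
  by (simp_all add: mk_def)

lemma mk_upd:
  "(mk K A a x y c)(0 := v) = mk K A a v y c"
  "(mk K A a x y c)(Suc 0 := v) = mk K A a x v c"
  "i \<le> K \<Longrightarrow> (mk K A a x y c)(i + 2 := v) = mk K A (a(i := v)) x y c"
  "j < m_counters A \<Longrightarrow> (mk K A a x y c)(K + 3 + j := v) = mk K A a x y (c(j := v))"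
  by (auto simp: mk_def fun_eq_iff)

lemma mk_cong: "(\<And>i. i \<le> K \<Longrightarrow> a i = a' i) \<Longrightarrow> mk K A a x y c = mk K A a' x y c"
  by (auto simp: mk_def fun_eq_iff)

lemma inc_step:
  assumes "budget_rule K A u p = (l, 0, r, l')" "u < 32" "p < K + m_len A + 1" "s' = s(r := Suc (s r))"
  shows "net_step K A (l, s) (l', s')"
  by (rule net_stepI[OF assms(1) _ assms(2,3)]) (simp add: op_effect_def assms(4))

lemma dec_step:
  assumes "budget_rule K A u p = (l, 1, r, l')" "u < 32" "p < K + m_len A + 1" "s r = Suc v" "s' = s(r := v)"
  shows "net_step K A (l, s) (l', s')"
  by (rule net_stepI[OF assms(1) _ assms(2,3)]) (simp add: op_effect_def assms(4,5))

lemma assign_step: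
  assumes "budget_rule K A u p = (l, 2, 0, l')" "u < 32" "p < K + m_len A + 1"
    and "\<And>c. s' c = (if budget_assign K A u p c = 0 then 0 else s (budget_assign K A u p c - 1))"
  shows "net_step K A (l, s) (l', s')"
  by (rule net_stepI[OF assms(1) _ assms(2,3)]) (simp add: op_effect_def assms(4) fun_eq_iff)

lemma reaches_step2: "net_step K A x y \<Longrightarrow> net_step K A y z \<Longrightarrow> reaches K A x z"
  by (rule converse_rtranclp_into_rtranclp[OF _ r_into_rtranclp])

lemma reaches_step3: "net_step K A x y \<Longrightarrow> net_step K A y z \<Longrightarrow> net_step K A z v \<Longrightarrow> reaches K A x v"
  by (rule converse_rtranclp_into_rtranclp[OF _ reaches_step2])

lemma forward_0:
  assumes "a 0 = Suc m"
  shows "reaches K A (loc 2 0, mk K A a x y c) (loc 2 0, mk K A (a(0 := m)) (Suc x) y c)"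
proof (rule reaches_step2)
  show "net_step K A (loc 2 0, mk K A a x y c) (loc 3 0, mk K A (a(0 := m)) x y c)"
    by (rule dec_step[of K A 2 0 _ 2 _ _ m])
      (use assms mk_simps(3)[of 0 K A a x y c] mk_upd(3)[of 0 K A a x y c m] in
        \<open>simp_all add: budget_rule_def numeral_2_eq_2\<close>)
  show "net_step K A (loc 3 0, mk K A (a(0 := m)) x y c) (loc 2 0, mk K A (a(0 := m)) (Suc x) y c)"
    by (rule inc_step[of K A 3 0 _ 0]) (simp_all add: budget_rule_def mk_upd(1,2) mk_simps(1,2))
qed

lemma forward_Suc:
  assumes p: "p < K" and a: "a (Suc p) = Suc m" "\<And>i. i \<le> p \<Longrightarrow> a i = 0"
  shows "reaches K A (loc 2 0, mk K A a x y c) (loc 2 0, mk K A (a(Suc p := m, p := Suc x)) x y c)"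
proof -
  have "net_step K A (loc 2 0, mk K A a x y c) (loc 4 p, mk K A (a(Suc p := m)) x y c)"
    by (rule dec_step[of K A 4 p _ "p + 3" _ _ m])
      (use p a(1) mk_simps(3)[of "Suc p" K A a x y c] mk_upd(3)[of "Suc p" K A a x y c m] in
        \<open>simp_all add: budget_rule_def numeral_3_eq_3\<close>)
  moreover have "net_step K A (loc 4 p, mk K A (a(Suc p := m)) x y c) (loc 5 p, mk K A (a(Suc p := m, p := x)) x y c)"
  proof (rule assign_step[of K A 5 p])
    show "mk K A (a(Suc p := m, p := x)) x y c d = (if budget_assign K A 5 p d = 0 then 0
        else mk K A (a(Suc p := m)) x y c (budget_assign K A 5 p d - 1))" for d
    proof -
      have "d - 2 < p" if "2 \<le> d" "d < p + 2" using that by linarith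
      then show ?thesis using p a(2)[of "d - 2"] by (auto simp: mk_def budget_assign_def)
    qed
  qed (use p in \<open>simp_all add: budget_rule_def\<close>)
  moreover have "net_step K A (loc 5 p, mk K A (a(Suc p := m, p := x)) x y c)
      (loc 2 0, mk K A (a(Suc p := m, p := Suc x)) x y c)"
    by (rule inc_step[of K A 6 p _ "p + 2"])
      (use p mk_simps(3)[of p K A "a(Suc p := m, p := x)" x y c] mk_upd(3)[of p K A "a(Suc p := m, p := x)" x y c "Suc x"] in
        \<open>simp_all add: budget_rule_def\<close>)
  ultimately show ?thesis by (rule reaches_step3)
qed

text \<open>Follows the recursion of \<open>fast\<close>: one application of level
  \<open>Suc p\<close> unfolds to \<open>Suc x\<close> applications of level \<open>p\<close>, which
  are executed one by one.\<close>

lemma forward: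
  assumes "p \<le> K" "a p = Suc m" "\<And>i. i < p \<Longrightarrow> a i = 0"
  shows "reaches K A (loc 2 0, mk K A a x y c) (loc 2 0, mk K A (a(p := m)) (fast p x) y c)"
  using assms
proof (induction p arbitrary: a m x)
  case 0
  show ?case unfolding fast_0 by (rule forward_0) (rule 0(2))
next
  case (Suc p)
  note step = Suc.IH
  have pK: "p \<le> K" using Suc.prems(1) by simp
  define b where "b = a(Suc p := m)"
  have b: "b i = 0" if "i \<le> p" for i using Suc.prems(3)[of i] that by (simp add: b_def)
  have bp: "b(p := 0) = b" using b[of p] by (simp add: fun_upd_idem)
  have it: "reaches K A (loc 2 0, mk K A (b(p := n)) z y c) (loc 2 0, mk K A b ((fast p ^^ n) z) y c)" for n z
  proof (induction n arbitrary: z)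
    case 0
    show ?case unfolding bp by simp
  next
    case (Suc n)
    have "reaches K A (loc 2 0, mk K A (b(p := Suc n)) z y c)
      (loc 2 0, mk K A ((b(p := Suc n))(p := n)) (fast p z) y c)"
      by (rule step) (use pK b in simp_all)
    from rtranclp_trans[OF this[unfolded fun_upd_upd] Suc.IH[of "fast p z"]] show ?case
      unfolding funpow_Suc_right o_apply .
  qed
  have "reaches K A (loc 2 0, mk K A a x y c) (loc 2 0, mk K A (b(p := Suc x)) x y c)"
    unfolding b_def by (rule forward_Suc) (use Suc.prems in simp_all)
  from rtranclp_trans[OF this it] show ?case unfolding b_def fast.simps(2)[of p x] Suc_eq_plus1[of x, symmetric] .
qed

lemma backward_0:
  "reaches K A (loc 8 0, mk K A a (Suc x) y c) (loc 8 0, mk K A (a(0 := Suc (a 0))) x y c)"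
proof (rule reaches_step2)
  show "net_step K A (loc 8 0, mk K A a (Suc x) y c) (loc 9 0, mk K A a x y c)"
    by (rule dec_step[of K A 12 0 _ 0 _ _ x]) (simp_all add: budget_rule_def mk_upd(1,2) mk_simps(1,2))
  show "net_step K A (loc 9 0, mk K A a x y c) (loc 8 0, mk K A (a(0 := Suc (a 0))) x y c)"
    by (rule inc_step[of K A 13 0 _ 2])
      (use mk_simps(3)[of 0 K A a x y c] mk_upd(3)[of 0 K A a x y c "Suc (a 0)"] in
        \<open>simp_all add: budget_rule_def numeral_2_eq_2\<close>)
qed

lemma backward_loop:
  assumes p: "p < K"
  shows "reaches K A (loc 11 p, mk K A (a(p := j)) j i c) (loc 11 p, mk K A (a(p := 0)) 0 (i + j) c)"
proof (induction j arbitrary: i)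
  case 0
  show ?case unfolding add_0_right by (rule rtranclp.rtrancl_refl)
next
  case (Suc j)
  have "net_step K A (loc 11 p, mk K A (a(p := Suc j)) (Suc j) i c) (loc 12 p, mk K A (a(p := j)) (Suc j) i c)"
    by (rule dec_step[of K A 16 p _ "p + 2" _ _ j])
      (use p mk_simps(3)[of p K A "a(p := Suc j)" "Suc j" i c] mk_upd(3)[of p K A "a(p := Suc j)" "Suc j" i c j] in
        \<open>simp_all add: budget_rule_def\<close>)
  moreover have "net_step K A (loc 12 p, mk K A (a(p := j)) (Suc j) i c) (loc 13 p, mk K A (a(p := j)) j i c)"
    by (rule dec_step[of K A 17 p _ 0 _ _ j]) (use p in \<open>simp_all add: budget_rule_def mk_upd(1,2) mk_simps(1,2)\<close>)
  moreover have "net_step K A (loc 13 p, mk K A (a(p := j)) j i c) (loc 11 p, mk K A (a(p := j)) j (Suc i) c)"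
    by (rule inc_step[of K A 18 p _ 1]) (use p in \<open>simp_all add: budget_rule_def mk_upd(1,2) mk_simps(1,2)\<close>)
  ultimately have "reaches K A (loc 11 p, mk K A (a(p := Suc j)) (Suc j) i c)
      (loc 11 p, mk K A (a(p := j)) j (Suc i) c)"
    by (rule reaches_step3)
  from rtranclp_trans[OF this Suc.IH] show ?case unfolding add_Suc add_Suc_right .
qed

lemma backward_Suc:
  assumes p: "p < K" and a: "a p = Suc x" "\<And>i. i < p \<Longrightarrow> a i = 0"
  shows "reaches K A (loc 8 0, mk K A a x y c) (loc 8 0, mk K A (a(p := 0, Suc p := Suc (a (Suc p)))) x x c)"
proof -
  have "net_step K A (loc 8 0, mk K A a x y c) (loc 10 p, mk K A (a(p := x)) x y c)"
    by (rule dec_step[of K A 14 p _ "p + 2" _ _ x])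
      (use p a(1) mk_simps(3)[of p K A a x y c] mk_upd(3)[of p K A a x y c x] in \<open>simp_all add: budget_rule_def\<close>)
  moreover have "net_step K A (loc 10 p, mk K A (a(p := x)) x y c) (loc 11 p, mk K A (a(p := x)) x 0 c)"
  proof (rule assign_step[of K A 15 p])
    show "mk K A (a(p := x)) x 0 c d = (if budget_assign K A 15 p d = 0 then 0
        else mk K A (a(p := x)) x y c (budget_assign K A 15 p d - 1))" for d
      using p by (simp add: mk_def budget_assign_def)
  qed (use p in \<open>simp_all add: budget_rule_def\<close>)
  ultimately have r1: "reaches K A (loc 8 0, mk K A a x y c) (loc 11 p, mk K A (a(p := x)) x 0 c)"
    by (rule reaches_step2)
  have r2: "reaches K A (loc 11 p, mk K A (a(p := x)) x 0 c) (loc 11 p, mk K A (a(p := 0)) 0 (0 + x) c)"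
    by (rule backward_loop[OF p])
  have "net_step K A (loc 11 p, mk K A (a(p := 0)) 0 (0 + x) c) (loc 14 p, mk K A (a(p := 0)) x x c)"
  proof (rule assign_step[of K A 19 p])
    show "mk K A (a(p := 0)) x x c d = (if budget_assign K A 19 p d = 0 then 0
        else mk K A (a(p := 0)) 0 (0 + x) c (budget_assign K A 19 p d - 1))" for d
    proof -
      have "d - 2 < p \<or> d = p + 2" if "2 \<le> d" "d \<le> p + 2" using that by linarith
      then show ?thesis using p a(2)[of "d - 2"] by (auto simp: mk_def budget_assign_def)
    qed
  qed (use p in \<open>simp_all add: budget_rule_def\<close>)
  moreover have "net_step K A (loc 14 p, mk K A (a(p := 0)) x x c)
      (loc 8 0, mk K A (a(p := 0, Suc p := Suc (a (Suc p)))) x x c)"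
    by (rule inc_step[of K A 20 p _ "p + 3"])
      (use p mk_simps(3)[of "Suc p" K A "a(p := 0)" x x c] mk_upd(3)[of "Suc p" K A "a(p := 0)" x x c "Suc (a (Suc p))"] in
        \<open>simp_all add: budget_rule_def numeral_3_eq_3\<close>)
  ultimately have r3: "reaches K A (loc 11 p, mk K A (a(p := 0)) 0 (0 + x) c)
      (loc 8 0, mk K A (a(p := 0, Suc p := Suc (a (Suc p)))) x x c)"
    by (rule reaches_step2)
  show ?thesis by (rule rtranclp_trans[OF r1 rtranclp_trans[OF r2 r3]])
qed

text \<open>Inverse to \<open>forward\<close>: \<open>Suc x\<close> applications of level
  \<open>p\<close> are peeled off the budget until \<open>x\<close> is left. Then exponent and
  budget match, and \<open>backward_Suc\<close> folds them without loss. The auxiliary counter keeps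
  an irrelevant value.\<close>

lemma backward:
  assumes "p \<le> K" "\<And>i. i < p \<Longrightarrow> a i = 0"
  shows "\<exists>y'. reaches K A (loc 8 0, mk K A a (fast p x) y c) (loc 8 0, mk K A (a(p := Suc (a p))) x y' c)"
  using assms
proof (induction p arbitrary: a x y)
  case 0
  show ?case unfolding fast_0 by (rule exI) (rule backward_0)
next
  case (Suc p)
  note step = Suc.IH
  have pK: "p \<le> K" using Suc.prems(1) by simp
  have a0: "a i = 0" if "i \<le> p" for i using Suc.prems(2)[of i] that by simp
  have ap: "a(p := 0) = a" using a0[of p] by (simp add: fun_upd_idem)
  have "\<exists>y'. reaches K A (loc 8 0, mk K A (a(p := m)) ((fast p ^^ n) x) y c)
      (loc 8 0, mk K A (a(p := m + n)) x y' c)" for n m y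
  proof (induction n arbitrary: m y)
    case 0
    show ?case unfolding add_0_right funpow.simps id_apply by (rule exI) (rule rtranclp.rtrancl_refl)
  next
    case (Suc n)
    have "\<exists>y'. reaches K A (loc 8 0, mk K A (a(p := m)) (fast p ((fast p ^^ n) x)) y c)
      (loc 8 0, mk K A ((a(p := m))(p := Suc ((a(p := m)) p))) ((fast p ^^ n) x) y' c)"
      by (rule step[of "a(p := m)"]) (use pK a0 in simp_all)
    then obtain y1 where y1: "reaches K A (loc 8 0, mk K A (a(p := m)) (fast p ((fast p ^^ n) x)) y c)
      (loc 8 0, mk K A (a(p := Suc m)) ((fast p ^^ n) x) y1 c)" unfolding fun_upd_upd fun_upd_same by (rule exE)
    obtain y2 where "reaches K A (loc 8 0, mk K A (a(p := Suc m)) ((fast p ^^ n) x) y1 c)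
      (loc 8 0, mk K A (a(p := Suc m + n)) x y2 c)" by (rule exE[OF Suc.IH[of "Suc m" y1]])
    from rtranclp_trans[OF y1 this] show ?case
      unfolding funpow.simps o_apply add_Suc add_Suc_right by (rule exI[of _ y2])
  qed
  then obtain y1 where "reaches K A (loc 8 0, mk K A (a(p := 0)) ((fast p ^^ Suc x) x) y c)
      (loc 8 0, mk K A (a(p := 0 + Suc x)) x y1 c)" by (rule exE)
  then have y1: "reaches K A (loc 8 0, mk K A a (fast (Suc p) x) y c) (loc 8 0, mk K A (a(p := Suc x)) x y1 c)"
    unfolding ap fast.simps(2)[of p x] Suc_eq_plus1[of x, symmetric] add_0 .
  have "reaches K A (loc 8 0, mk K A (a(p := Suc x)) x y1 c)
    (loc 8 0, mk K A ((a(p := Suc x))(p := 0, Suc p := Suc ((a(p := Suc x)) (Suc p)))) x x c)"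
    by (rule backward_Suc) (use Suc.prems(1) a0 in simp_all)
  moreover have "(a(p := Suc x))(p := 0, Suc p := Suc ((a(p := Suc x)) (Suc p))) = a(Suc p := Suc (a (Suc p)))"
    using ap by simp
  ultimately have "reaches K A (loc 8 0, mk K A (a(p := Suc x)) x y1 c)
    (loc 8 0, mk K A (a(Suc p := Suc (a (Suc p)))) x x c)" by (simp only:)
  from rtranclp_trans[OF y1 this] show ?case by (rule exI[of _ x])
qed

text \<open>The budget pays for increments and is refunded by decrements. At most \<open>t\<close>
  units are out after \<open>t\<close> steps, so that a budget \<open>N\<close> with
  \<open>t \<le> N\<close> never runs dry.\<close>

lemma machine_run:
  assumes wf: "m_wf A" and run: "(m_step A ^^ t) (0, \<lambda>_. 0) = (l, c)" and N: "t \<le> N"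
  shows "(\<Sum>j<m_counters A. c j) \<le> t \<and>
    reaches K A (loc 6 0, mk K A (\<lambda>_. 0) N 0 (\<lambda>_. 0)) (loc 6 l, mk K A (\<lambda>_. 0) (N - (\<Sum>j<m_counters A. c j)) 0 c)"
  using run N
proof (induction t arbitrary: l c)
  case 0
  then have "l = 0" "c = (\<lambda>_. 0)" by simp_all
  then show ?case by simp
next
  case (Suc t)
  let ?S = "\<lambda>c. \<Sum>j<m_counters A. c j"
  let ?M = "\<lambda>c. mk K A (\<lambda>_. 0) (N - ?S c) 0 c"
  obtain l1 c1 where x1: "(m_step A ^^ t) (0, \<lambda>_. 0) = (l1, c1)" by (cases "(m_step A ^^ t) (0, \<lambda>_. 0)")
  have IH: "?S c1 \<le> t" "reaches K A (loc 6 0, mk K A (\<lambda>_. 0) N 0 (\<lambda>_. 0)) (loc 6 l1, ?M c1)"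
    using Suc.IH[OF x1] Suc.prems(2) by simp_all
  have st: "m_step A (l1, c1) = (l, c)" using Suc.prems(1) x1 by simp
  have "?S c \<le> Suc t \<and> reaches K A (loc 6 l1, ?M c1) (loc 6 l, ?M c)"
  proof (cases "l1 < m_len A")
    case False
    then show ?thesis using st IH(1) by (simp add: m_step_def)
  next
    case True
    then have ic: "ic A l1 < m_counters A" using wf by (simp add: m_wf_def)
    have p: "l1 < K + m_len A + 1" using True by simp
    consider (inc) "ik A l1 = 0" | (zero) "ik A l1 = 1" "c1 (ic A l1) = 0"
      | (dec) v where "ik A l1 = 1" "c1 (ic A l1) = Suc v" | (jmp) "ik A l1 \<noteq> 0" "ik A l1 \<noteq> 1"
      using not0_implies_Suc by blast
    then show ?thesis
    proof cases
      case inc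
      have c: "l = it A l1" "c = c1(ic A l1 := Suc (c1 (ic A l1)))" using st True inc by (auto simp: m_step_def)
      have S: "?S c = Suc (?S c1)" using sum_fun_upd[OF ic, of c1 "Suc (c1 (ic A l1))"] by (simp add: c(2))
      have N: "N - ?S c1 = Suc (N - ?S c)" using S IH(1) Suc.prems(2) by linarith
      have "net_step K A (loc 6 l1, ?M c1) (loc 7 l1, mk K A (\<lambda>_. 0) (N - ?S c) 0 c1)"
        by (rule dec_step[of K A 8 l1 _ 0 _ _ "N - ?S c"])
          (use True inc p N in \<open>simp_all add: budget_rule_def mk_upd(1,2) mk_simps(1,2)\<close>)
      moreover have "net_step K A (loc 7 l1, mk K A (\<lambda>_. 0) (N - ?S c) 0 c1) (loc 6 l, ?M c)"
        by (rule inc_step[of K A 9 l1 _ "K + 3 + ic A l1"])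
          (use True inc p c mk_simps(4)[OF ic] mk_upd(4)[OF ic] in \<open>simp_all add: budget_rule_def\<close>)
      ultimately show ?thesis using S IH(1) reaches_step2 by simp
    next
      case zero
      have c: "l = iu A l1" "c = c1" using st True zero by (auto simp: m_step_def)
      have "net_step K A (loc 6 l1, ?M c1) (loc 6 l, ?M c)"
      proof (rule assign_step[of K A 10 l1])
        show "?M c d = (if budget_assign K A 10 l1 d = 0 then 0 else ?M c1 (budget_assign K A 10 l1 d - 1))" for d
          using zero c ic by (auto simp: mk_def budget_assign_def)
      qed (use True zero p c in \<open>simp_all add: budget_rule_def\<close>)
      then show ?thesis using IH(1) c by auto
    next
      case (dec v)
      have c: "l = it A l1" "c = c1(ic A l1 := v)" using st True dec by (auto simp: m_step_def)
      have S: "Suc (?S c) = ?S c1" using sum_fun_upd[OF ic, of c1 v] dec by (simp add: c(2))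
      have N: "N - ?S c = Suc (N - ?S c1)" using S IH(1) Suc.prems(2) by linarith
      have "net_step K A (loc 6 l1, ?M c1) (loc 7 l1, mk K A (\<lambda>_. 0) (N - ?S c1) 0 c)"
        by (rule dec_step[of K A 8 l1 _ "K + 3 + ic A l1" _ _ v])
          (use True dec p c mk_simps(4)[OF ic] mk_upd(4)[OF ic] in \<open>simp_all add: budget_rule_def\<close>)
      moreover have "net_step K A (loc 7 l1, mk K A (\<lambda>_. 0) (N - ?S c1) 0 c) (loc 6 l, ?M c)"
        by (rule inc_step[of K A 9 l1 _ 0])
          (use True dec p c N in \<open>simp_all add: budget_rule_def mk_upd(1,2) mk_simps(1,2)\<close>)
      ultimately show ?thesis using S IH(1) reaches_step2 by simp
    next
      case jmp
      have c: "l = it A l1" "c = c1" using st True jmp by (auto simp: m_step_def)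
      have "net_step K A (loc 6 l1, ?M c1) (loc 6 l, ?M c)"
        by (rule assign_step[of K A 8 l1]) (use True jmp p c in \<open>auto simp: budget_rule_def mk_def budget_assign_def\<close>)
      then show ?thesis using IH(1) c by auto
    qed
  qed
  then show ?case using rtranclp_trans[OF IH(2)] by simp
qed

lemma budget_net_complete:
  assumes wf: "m_wf A" and run: "(m_step A ^^ t) (0, \<lambda>_. 0) = (m_acc A, \<lambda>_. 0)" and t: "t \<le> fast K 1"
  shows "\<exists>n. net_accepts (budget_net K A) (loc 16 0) n 0 (\<lambda>_. 0)"
proof -
  let ?e = "(\<lambda>_. 0)(K := Suc 0) :: nat \<Rightarrow> nat" and ?z = "\<lambda>_ :: nat. 0 :: nat"
  have "net_step K A (loc 0 0, mk K A ?z 0 0 ?z) (loc 1 0, mk K A ?z 1 0 ?z)"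
    by (rule inc_step[of K A 0 0 _ 0]) (simp_all add: budget_rule_def mk_upd(1,2) mk_simps(1,2))
  moreover have "net_step K A (loc 1 0, mk K A ?z 1 0 ?z) (loc 2 0, mk K A ?e 1 0 ?z)"
    by (rule inc_step[of K A 1 0 _ "K + 2"])
      (use mk_simps(3)[of K K A ?z 1 0 ?z] mk_upd(3)[of K K A ?z 1 0 ?z "Suc 0"] in \<open>simp_all add: budget_rule_def\<close>)
  ultimately have r1: "reaches K A (loc 0 0, mk K A ?z 0 0 ?z) (loc 2 0, mk K A ?e 1 0 ?z)" by (rule reaches_step2)
  have r2: "reaches K A (loc 2 0, mk K A ?e 1 0 ?z) (loc 2 0, mk K A (?e(K := 0)) (fast K 1) 0 ?z)"
    by (rule forward) auto
  have e: "?e(K := 0) = ?z" by auto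
  have r3: "net_step K A (loc 2 0, mk K A (?e(K := 0)) (fast K 1) 0 ?z) (loc 6 0, mk K A ?z (fast K 1) 0 ?z)"
    unfolding e
  proof (rule assign_step[of K A 7 0])
    show "mk K A ?z (fast K 1) 0 ?z d = (if budget_assign K A 7 0 d = 0 then 0
        else mk K A ?z (fast K 1) 0 ?z (budget_assign K A 7 0 d - 1))" for d
      by (simp add: mk_def budget_assign_def)
  qed (simp_all add: budget_rule_def)
  \<comment> \<open>The machine ends with all counters 0, so that the whole budget has been
    refunded.\<close>
  have r4: "reaches K A (loc 6 0, mk K A ?z (fast K 1) 0 ?z) (loc 6 (m_acc A), mk K A ?z (fast K 1) 0 ?z)"
    using machine_run[OF wf run t, of K] by simp
  have r5: "net_step K A (loc 6 (m_acc A), mk K A ?z (fast K 1) 0 ?z) (loc 8 0, mk K A ?z (fast K 1) 0 ?z)"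
  proof (rule assign_step[of K A 11 0])
    show "mk K A ?z (fast K 1) 0 ?z d = (if budget_assign K A 11 0 d = 0 then 0
        else mk K A ?z (fast K 1) 0 ?z (budget_assign K A 11 0 d - 1))" for d
      by (simp add: mk_def budget_assign_def)
  qed (simp_all add: budget_rule_def)
  have "\<exists>y. reaches K A (loc 8 0, mk K A ?z (fast K 1) 0 ?z) (loc 8 0, mk K A (?z(K := Suc (?z K))) 1 y ?z)"
    by (rule backward) simp_all
  then obtain y where r6: "reaches K A (loc 8 0, mk K A ?z (fast K 1) 0 ?z) (loc 8 0, mk K A ?e 1 y ?z)"
    by (rule exE)
  have "net_step K A (loc 8 0, mk K A ?e 1 y ?z) (loc 15 0, mk K A ?e 0 y ?z)"
    by (rule dec_step[of K A 21 0 _ 0 _ _ 0]) (simp_all add: budget_rule_def mk_upd(1,2) mk_simps(1,2))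
  moreover have "net_step K A (loc 15 0, mk K A ?e 0 y ?z) (loc 16 0, mk K A (?e(K := 0)) 0 y ?z)"
    by (rule dec_step[of K A 22 0 _ "K + 2" _ _ 0])
      (use mk_simps(3)[of K K A ?e 0 y ?z] mk_upd(3)[of K K A ?e 0 y ?z 0] in \<open>simp_all add: budget_rule_def\<close>)
  ultimately have r7: "reaches K A (loc 8 0, mk K A ?e 1 y ?z) (loc 16 0, mk K A (?e(K := 0)) 0 y ?z)"
    by (rule reaches_step2)
  have "reaches K A (loc 0 0, mk K A ?z 0 0 ?z) (loc 16 0, mk K A (?e(K := 0)) 0 y ?z)"
    by (rule rtranclp_trans[OF rtranclp_trans[OF r1 r2] converse_rtranclp_into_rtranclp[OF r3
      rtranclp_trans[OF r4 converse_rtranclp_into_rtranclp[OF r5 rtranclp_trans[OF r6 r7]]]]])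
  moreover have "mk K A ?z 0 0 ?z = ?z" by (auto simp: mk_def)
  ultimately show ?thesis using net_accepts_reach[of K A "(loc 0 0, ?z)" "loc 16 0"] by (simp add: loc_def)
qed

section \<open>Counter machines for programs\<close>

text \<open>Kind 3 stands for instructions on the input tape, which do not occur in the code of a
  \<open>pure\<close> program.\<close>

fun instr_kind :: "instr \<Rightarrow> nat" where
  "instr_kind (IInc c l) = 0"
| "instr_kind (IDec c l l') = 1"
| "instr_kind (IJmp l) = 2"
| "instr_kind _ = 3"

fun instr_next :: "instr \<Rightarrow> nat" where
  "instr_next (IInc c l) = l"
| "instr_next (IDec c l l') = l"
| "instr_next (IJmp l) = l"
| "instr_next _ = 0"

fun instr_else :: "instr \<Rightarrow> nat" where
  "instr_else (IDec c l l') = l'"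
| "instr_else _ = 0"

lemma instr_kind_compile: "pure P \<Longrightarrow> i \<in> set (compile p P) \<Longrightarrow> instr_kind i \<le> 2"
  by (induction p P rule: compile.induct) auto

definition tested_code :: "com \<Rightarrow> instr list" where
  "tested_code P = compile 0 P @ [IDec 4 (code_size P + 1) (code_size P + 2)]"

definition code_counters :: "instr list \<Rightarrow> nat" where
  "code_counters cs = Suc (Max (instr_counter ` set cs))"

definition lookup :: "(instr \<Rightarrow> nat) \<Rightarrow> instr list \<Rightarrow> nat \<Rightarrow> nat" where
  "lookup f cs j = (if j < length cs then f (cs ! j) else 0)"

text \<open>The net starts with counters 0, so that the input is built in: the first
  \<open>x\<close> instructions count it up in counter 0.\<close>

definition program_machine :: "instr list \<Rightarrow> nat \<Rightarrow> machine" where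
  "program_machine cs x = \<lparr>m_len = x + length cs, m_counters = code_counters cs,
     ik = (\<lambda>l. if l < x then 0 else lookup instr_kind cs (l - x)),
     ic = (\<lambda>l. if l < x then 0 else lookup instr_counter cs (l - x)),
     it = (\<lambda>l. if l < x then Suc l else x + lookup instr_next cs (l - x)),
     iu = (\<lambda>l. if l < x then 0 else x + lookup instr_else cs (l - x)),
     m_acc = x + length cs\<rparr>"

lemma program_machine_sel:
  "m_len (program_machine cs x) = x + length cs"
  "m_counters (program_machine cs x) = code_counters cs"
  "ik (program_machine cs x) l = (if l < x then 0 else lookup instr_kind cs (l - x))"
  "ic (program_machine cs x) l = (if l < x then 0 else lookup instr_counter cs (l - x))"
  "it (program_machine cs x) l = (if l < x then Suc l else x + lookup instr_next cs (l - x))"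
  "iu (program_machine cs x) l = (if l < x then 0 else x + lookup instr_else cs (l - x))"
  "m_acc (program_machine cs x) = x + length cs"
  by (simp_all add: program_machine_def)

lemma length_tested_code: "length (tested_code P) = code_size P + 1"
  by (simp add: tested_code_def length_compile)

lemma program_machine_wf: "m_wf (program_machine (tested_code P) x)"
proof -
  let ?cs = "tested_code P"
  have t: "l \<le> code_size P + 2" if "i \<in> set ?cs" "l \<in> instr_targets i" for i l
    using that compile_targets[of i 0 P l] by (auto simp: tested_code_def)
  have n: "instr_next i \<le> code_size P + 2" "instr_else i \<le> code_size P + 2" if "i \<in> set ?cs" for i
    using t[OF that] by (cases i; simp; fail)+
  have c: "instr_counter i < code_counters cs" if "i \<in> set cs" for i cs
    using that by (simp add: code_counters_def less_Suc_eq_le)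
  have "lookup instr_counter ?cs j < code_counters ?cs" "lookup instr_next ?cs j \<le> code_size P + 2"
    "lookup instr_else ?cs j \<le> code_size P + 2" for j
    using n[OF nth_mem, of j] c[OF nth_mem, of j ?cs] by (simp_all add: lookup_def code_counters_def)
  then show ?thesis
    unfolding m_wf_def program_machine_sel length_tested_code by (auto simp: code_counters_def)
qed

lemma program_machine_load:
  "n \<le> x \<Longrightarrow> (m_step (program_machine cs x) ^^ n) (0, \<lambda>_. 0) = (n, (\<lambda>_. 0)(0 := n))"
proof (induction n)
  case 0
  show ?case by auto
next
  case (Suc n)
  have "m_step (program_machine cs x) (n, (\<lambda>_. 0)(0 := n)) = (Suc n, (\<lambda>_. 0)(0 := Suc n))"
    using Suc.prems by (auto simp: m_step_def program_machine_sel)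
  with Suc.IH[OF Suc_leD[OF Suc.prems]] show ?case unfolding funpow.simps o_apply by (simp only:)
qed

lemma program_machine_step:
  assumes "\<And>i. i \<in> set cs \<Longrightarrow> instr_kind i \<le> 2"
  shows "m_step (program_machine cs x) (x + p, s) =
    (x + fst (code_step w cs (p, s, h)), fst (snd (code_step w cs (p, s, h))))"
proof (cases "p < length cs")
  case True
  then have "instr_kind (cs ! p) \<le> 2" using assms by simp
  then show ?thesis using True
    by (cases "cs ! p") (auto simp: m_step_def program_machine_sel code_step_def lookup_def)
next
  case False
  then show ?thesis by (simp add: m_step_def program_machine_sel code_step_def)
qed

lemma program_machine_steps:
  assumes "\<And>i. i \<in> set cs \<Longrightarrow> instr_kind i \<le> 2" "(code_step w cs ^^ t) (p, s, h) = (p', s', h')"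
  shows "(m_step (program_machine cs x) ^^ t) (x + p, s) = (x + p', s')"
  using assms(2)
proof (induction t arbitrary: p' s' h')
  case 0
  then show ?case by simp
next
  case (Suc t)
  obtain q u k where q: "(code_step w cs ^^ t) (p, s, h) = (q, u, k)" by (cases "(code_step w cs ^^ t) (p, s, h)")
  show ?case
    using Suc.IH[OF q] Suc.prems q program_machine_step[OF assms(1), where x = x and p = q and s = u and w = w and h = k] by simp
qed

text \<open>The last decrement tests the answer and removes it, so that answer 1 leaves all counters
  0 at the accepting location.\<close>

lemma program_machine_run:
  assumes C: "exec C ((\<lambda>_. 0)(0 := x)) T ((\<lambda>_. 0)(4 := v))"
  shows "\<exists>t \<le> x + T + 1. (m_step (program_machine (tested_code C) x) ^^ t) (0, \<lambda>_. 0) =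
    (x + code_size C + (if v = 0 then 2 else 1), (\<lambda>_. 0)(4 := v - 1))"
proof -
  let ?cs = "tested_code C" and ?A = "program_machine (tested_code C) x"
  have pure: "pure C" using C by (simp add: exec_def)
  have k: "instr_kind i \<le> 2" if "i \<in> set ?cs" for i
    using that instr_kind_compile[OF pure, of i 0] by (auto simp: tested_code_def)
  obtain t where t: "t \<le> T" "big_step [] C ((\<lambda>_. 0)(0 := x), 0) t ((\<lambda>_. 0)(4 := v), 0)"
    using C unfolding exec_def by blast
  have "code_at ?cs 0 (compile 0 C)" by (simp add: code_at_def tested_code_def nth_append)
  from compile_correct[OF t(2) this]
  have c: "(code_step [] ?cs ^^ t) (0, (\<lambda>_. 0)(0 := x), 0) = (code_size C, (\<lambda>_. 0)(4 := v), 0)" by simp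
  have s1: "(m_step ?A ^^ x) (0, \<lambda>_. 0) = (x, (\<lambda>_. 0)(0 := x))" by (rule program_machine_load) simp
  have s2: "(m_step ?A ^^ t) (x, (\<lambda>_. 0)(0 := x)) = (x + code_size C, (\<lambda>_. 0)(4 := v))"
    using program_machine_steps[OF k c, of x] by simp
  have "?cs ! code_size C = IDec 4 (code_size C + 1) (code_size C + 2)"
    by (simp add: tested_code_def nth_append length_compile)
  then have s3: "(m_step ?A ^^ 1) (x + code_size C, (\<lambda>_. 0)(4 := v)) =
      (x + code_size C + (if v = 0 then 2 else 1), (\<lambda>_. 0)(4 := v - 1))"
    using program_machine_step[OF k, where x = x and p = "code_size C" and s = "(\<lambda>_. 0)(4 := v)" and w = "[]" and h = 0]
    by (auto simp: code_step_def length_tested_code)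
  show ?thesis
    using funpow_trans[OF s1 funpow_trans[OF s2 s3]] t(1) by (intro exI[of _ "x + (t + 1)"]) simp
qed

lemma m_step_halted: "m_len A \<le> l \<Longrightarrow> (m_step A ^^ n) (l, c) = (l, c)"
  by (induction n) (simp_all add: m_step_def)

text \<open>The machine is deterministic, so that it halts at one location only; a rejecting run
  excludes acceptance.\<close>

lemma m_reach_halted:
  assumes "m_reach A (l, c)" "m_reach A (l', c')" "m_len A \<le> l" "m_len A \<le> l'"
  shows "l = l'"
proof -
  obtain m n where m: "(m_step A ^^ m) (0, \<lambda>_. 0) = (l, c)" and n: "(m_step A ^^ n) (0, \<lambda>_. 0) = (l', c')"
    using assms(1,2) unfolding m_reach_def by (elim exE)
  have "(m_step A ^^ (m + n)) (0, \<lambda>_. 0) = (l, c)" by (rule funpow_trans[OF m m_step_halted[OF assms(3)]])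
  moreover have "(m_step A ^^ (n + m)) (0, \<lambda>_. 0) = (l', c')" by (rule funpow_trans[OF n m_step_halted[OF assms(4)]])
  ultimately show ?thesis by (simp add: add.commute)
qed

lemma program_net_accepts:
  assumes C: "exec C ((\<lambda>_. 0)(0 := x)) T ((\<lambda>_. 0)(4 := of_bool P))" and T: "x + T + 1 \<le> fast K 1"
  shows "(\<exists>n. net_accepts (budget_net K (program_machine (tested_code C) x)) (loc 16 0) n 0 (\<lambda>_. 0)) \<longleftrightarrow> P"
proof -
  let ?A = "program_machine (tested_code C) x"
  obtain t where t: "t \<le> x + T + 1" "(m_step ?A ^^ t) (0, \<lambda>_. 0) =
      (x + code_size C + (if (of_bool P :: nat) = 0 then 2 else 1), (\<lambda>_. 0)(4 := of_bool P - 1))"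
    using program_machine_run[OF C] by (elim exE conjE)
  have "(\<lambda>_. 0)(4 := of_bool P - 1) = (\<lambda>_ :: nat. 0 :: nat)" by auto
  with t(2) have run: "(m_step ?A ^^ t) (0, \<lambda>_. 0) = (x + code_size C + (if P then 1 else 2), \<lambda>_. 0)" by simp
  show ?thesis
  proof
    assume "\<exists>n. net_accepts (budget_net K ?A) (loc 16 0) n 0 (\<lambda>_. 0)"
    then obtain n where "net_accepts (budget_net K ?A) (loc 16 0) n 0 (\<lambda>_. 0)" ..
    from budget_net_sound[OF program_machine_wf this] obtain c where c: "m_reach ?A (m_acc ?A, c)" ..
    have "m_reach ?A (x + code_size C + (if P then 1 else 2), \<lambda>_. 0)" using run unfolding m_reach_def ..
    from m_reach_halted[OF this c] show P
      by (cases P) (simp_all add: program_machine_sel length_tested_code)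
  next
    assume P
    then have "(m_step ?A ^^ t) (0, \<lambda>_. 0) = (m_acc ?A, \<lambda>_. 0)"
      using run by (simp add: program_machine_sel length_tested_code)
    then show "\<exists>n. net_accepts (budget_net K ?A) (loc 16 0) n 0 (\<lambda>_. 0)"
      by (rule budget_net_complete[OF program_machine_wf]) (use t(1) T in simp)
  qed
qed


section \<open>The lower bound\<close>

definition in_range :: "nat \<Rightarrow> nat \<Rightarrow> nat \<times> nat \<times> nat \<times> nat \<Rightarrow> bool" where
  "in_range b C r \<longleftrightarrow> fst r < b \<and> fst (snd (snd r)) < C \<and> snd (snd (snd r)) < b"

lemma in_range_if: "(P \<Longrightarrow> in_range b C r) \<Longrightarrow> in_range b C r' \<Longrightarrow> in_range b C (if P then r else r')"
  by simp

text \<open>Exceeds all locations of the net and the number of registers, of which there are two for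
  each counter.\<close>

definition net_bound :: "nat \<Rightarrow> machine \<Rightarrow> nat" where
  "net_bound K A = 32 * (K + m_len A + 3) + 2 * (K + 3 + m_counters A)"

lemma budget_net_wf:
  assumes "m_wf A"
  shows "net_wf (net_bound K A) (budget_net K A)"
proof -
  have wf: "ic A p < m_counters A" "it A p \<le> m_len A + 1" "iu A p \<le> m_len A + 1" if "p < m_len A" for p
    using assms that by (auto simp: m_wf_def)
  have acc: "m_acc A \<le> m_len A + 1" using assms by (simp add: m_wf_def)
  have "in_range (net_bound K A) (K + 3 + m_counters A) (budget_rule K A u p)" if "p < K + m_len A + 1" for u p
    unfolding budget_rule_def
    by (intro in_range_if; use that wf[of p] acc in \<open>simp add: in_range_def net_bound_def loc_def\<close>)
  moreover have "i div 32 < K + m_len A + 1" if "i < 32 * (K + m_len A + 1)" for i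
    using that by (simp add: less_mult_imp_div_less mult.commute)
  moreover have "budget_assign K A u p c \<le> K + 3 + m_counters A" for u p c
    by (simp add: budget_assign_def)
  ultimately show ?thesis unfolding net_wf_def budget_net_sel in_range_def by (simp add: net_bound_def)
qed

definition pr4 :: "((nat \<Rightarrow> nat) \<Rightarrow> nat \<times> nat \<times> nat \<times> nat) \<Rightarrow> bool" where
  "pr4 R \<longleftrightarrow> pr (\<lambda>e. fst (R e)) \<and> pr (\<lambda>e. fst (snd (R e))) \<and> pr (\<lambda>e. fst (snd (snd (R e)))) \<and>
     pr (\<lambda>e. snd (snd (snd (R e))))"

lemma pr4_if: "prb P \<Longrightarrow> pr4 R \<Longrightarrow> pr4 S \<Longrightarrow> pr4 (\<lambda>e. if P e then R e else S e)"
  unfolding pr4_def if_distrib[of fst] if_distrib[of snd] by (auto intro: pr_if)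

lemma pr4_tuple: "pr a \<Longrightarrow> pr b \<Longrightarrow> pr c \<Longrightarrow> pr d \<Longrightarrow> pr4 (\<lambda>e. (a e, b e, c e, d e))"
  by (simp add: pr4_def)

lemma pr_budget_rule:
  assumes "pr K" "pr u" "pr p" "pr (\<lambda>e. m_len (A e))" "pr (\<lambda>e. m_acc (A e))" "pr (\<lambda>e. ik (A e) (p e))"
    "pr (\<lambda>e. ic (A e) (p e))" "pr (\<lambda>e. it (A e) (p e))" "pr (\<lambda>e. iu (A e) (p e))"
  shows "pr4 (\<lambda>e. budget_rule (K e) (A e) (u e) (p e))"
  unfolding budget_rule_def loc_def by (intro pr4_if pr4_tuple pr_intros assms)

lemma pr_budget_assign:
  assumes "pr K" "pr u" "pr p" "pr c" "pr (\<lambda>e. m_counters (A e))" "pr (\<lambda>e. ic (A e) (p e))"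
  shows "pr (\<lambda>e. budget_assign (K e) (A e) (u e) (p e) (c e))"
  unfolding budget_assign_def by (intro pr_intros assms)

lemma pr_lookup: "pr a \<Longrightarrow> pr (\<lambda>e. lookup f cs (a e))"
  by (rule pr_finite_support[of "length cs" _ 0]) (simp_all add: lookup_def)

lemma pr_program_net:
  assumes K: "pr (\<lambda>e. K (e 0))"
  shows "pr (\<lambda>e. net_pres (budget_net (K (e 0)) (program_machine cs (e 0))) fin a (e 1) (e 2) (e 3) (e 4))"
proof -
  let ?A = "\<lambda>e. program_machine cs (e 0)"
  have sel: "pr (\<lambda>e. m_len (?A e))" "pr (\<lambda>e. m_counters (?A e))" "pr (\<lambda>e. m_acc (?A e))"
    "pr p \<Longrightarrow> pr (\<lambda>e. ik (?A e) (p e))" "pr p \<Longrightarrow> pr (\<lambda>e. ic (?A e) (p e))"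
    "pr p \<Longrightarrow> pr (\<lambda>e. it (?A e) (p e))" "pr p \<Longrightarrow> pr (\<lambda>e. iu (?A e) (p e))" for p
    unfolding program_machine_sel by (intro pr_intros pr_lookup; assumption)+
  have rule: "pr4 (\<lambda>e. budget_rule (K (e 0)) (?A e) (e 2 mod 32) (e 2 div 32))"
    by (intro pr_budget_rule K sel pr_intros)
  have asg: "pr c \<Longrightarrow> pr (\<lambda>e. budget_assign (K (e 0)) (?A e) (e 2 mod 32) (e 2 div 32) (c e))" for c
    by (intro pr_budget_assign K sel pr_intros; assumption)
  show ?thesis
    unfolding net_pres_def budget_net_sel
    by (intro pr_intros asg K sel rule[unfolded pr4_def, THEN conjunct1]
      rule[unfolded pr4_def, THEN conjunct2, THEN conjunct1]
      rule[unfolded pr4_def, THEN conjunct2, THEN conjunct2, THEN conjunct1]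
      rule[unfolded pr4_def, THEN conjunct2, THEN conjunct2, THEN conjunct2])
qed

lemma tm_step_halted:
  assumes "fst x = accept_state M \<or> fst x = reject_state M" "m \<le> n" "(tm_step M ^^ m) y = x"
  shows "(tm_step M ^^ n) y = x"
proof -
  have "tm_step M x = x" using assms(1) by (cases x) auto
  then have "(tm_step M ^^ k) x = x" for k by (induction k) auto
  from funpow_trans[OF assms(3) this[of "n - m"]] show ?thesis using assms(2) by simp
qed

lemma fast_one_ge: "k < fast k 1"
proof (induction k)
  case (Suc k)
  have "fast (Suc k) 1 = fast k (fast k 1)" by (simp add: fast.simps(2))
  then show ?case using Suc fast_gt[of "fast k 1" k] by simp
qed (simp add: fast_0)

text \<open>The argument can be produced by the level itself, so that a budget of the form
  \<open>fast K 1\<close> suffices.\<close>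

lemma fast_omega_le_fast: "fast_omega m \<le> fast (m + 2) 1"
proof -
  have "fast_omega m \<le> fast (m + 1) (fast (m + 1) 1)"
    unfolding fast_omega_def by (rule fast_mono) (use fast_one_ge[of "m + 1"] in simp_all)
  also have "\<dots> = fast (m + 2) 1" by (simp add: fast.simps(2))
  finally show ?thesis .
qed

text \<open>The configuration after \<open>n\<close> steps is primitive recursive in the word and
  \<open>n\<close>, so that the halting time is found by search. The answer is inverted, as
  membership in \<open>L\<close> has to become emptiness.\<close>

lemma machine_program:
  assumes M: "wf_tm M"
  shows "\<exists>C B. majorized B \<and> (\<forall>L w n. answers_within M L w n \<longrightarrow>
    (\<exists>T \<le> B (word_num w + n). exec C ((\<lambda>_. 0)(0 := word_num w)) T ((\<lambda>_. 0)(4 := of_bool (w \<notin> L)))))"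
proof -
  define S where "S x n = entry 0 (tm_number M x n)" for x n
  have S: "S (word_num w) n = fst ((tm_step M ^^ n) (tm_init M w))" for w n
    unfolding S_def by (rule tm_number[OF M])
  have prS: "pr (\<lambda>e. S (e 0) (e 1))" unfolding S_def by (intro pr_entry pr_tm_number)
  have "pr (\<lambda>e. of_bool (\<not> (S (e 0) (e 1) = accept_state M \<or> S (e 0) (e 1) = reject_state M)) :: nat)"
    by (intro pr_intros prS)
  then obtain f where f: "prim_rec f"
    "\<And>x n. of_bool (\<not> (S x n = accept_state M \<or> S x n = reject_state M)) = f [x, n]"
    by (rule prE2) (rule that)
  have "pr (\<lambda>e. of_bool (S (e 0) (e 1) = reject_state M) :: nat)" by (intro pr_intros prS)
  then obtain g where g: "prim_rec g" "\<And>x n. of_bool (S x n = reject_state M) = g [x, n]"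
    by (rule prE2) (rule that)
  obtain C B where B: "majorized B" and C: "\<forall>x n. f [x, n] = 0 \<longrightarrow> (\<forall>m<n. f [x, m] \<noteq> 0) \<longrightarrow>
    exec C ((\<lambda>_. 0)(0 := x)) (B (x + n)) ((\<lambda>_. 0)(4 := g [x, n]))"
    using search_program[OF f(1) g(1)] by (elim exE conjE)
  obtain k where k: "\<And>x. B x \<le> fast k (x + 1)" using B by (auto simp: majorized_def)
  have "\<exists>T \<le> fast k (word_num w + n + 1). exec C ((\<lambda>_. 0)(0 := word_num w)) T ((\<lambda>_. 0)(4 := of_bool (w \<notin> L)))"
    if n: "answers_within M L w n" for L w n
  proof -
    let ?halted = "\<lambda>n. S (word_num w) n = accept_state M \<or> S (word_num w) n = reject_state M"
    \<comment> \<open>The search stops at the least halting time, which may be earlier than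
      \<open>n\<close>; later configurations are the same.\<close>
    define m where "m = (LEAST n. ?halted n)"
    have "?halted n" using n unfolding answers_within_def S by simp
    then have m: "?halted m" "m \<le> n" unfolding m_def by (rule LeastI, rule Least_le)
    have "S (word_num w) n = S (word_num w) m"
      using tm_step_halted[OF m(1)[unfolded S] m(2) refl] unfolding S by simp
    moreover have "accept_state M \<noteq> reject_state M" using M by (simp add: wf_tm_def)
    ultimately have "g [word_num w, m] = of_bool (w \<notin> L)"
      using n unfolding g(2)[symmetric] answers_within_def S[symmetric] by (cases "w \<in> L") simp_all
    moreover have "f [word_num w, m] = 0" using m(1) unfolding f(2)[symmetric] by simp
    moreover have "f [word_num w, i] \<noteq> 0" if "i < m" for i
      using not_less_Least[of i ?halted] that unfolding f(2)[symmetric] m_def by simp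
    ultimately have "exec C ((\<lambda>_. 0)(0 := word_num w)) (B (word_num w + m)) ((\<lambda>_. 0)(4 := of_bool (w \<notin> L)))"
      using C[rule_format, of "word_num w" m] by simp
    moreover have "B (word_num w + m) \<le> fast k (word_num w + n + 1)"
      by (rule order_trans[OF k]) (rule fast_mono, use m(2) in simp_all)
    ultimately show ?thesis by (intro exI conjI)
  qed
  moreover have "majorized (\<lambda>x. fast k (x + 1))" by (intro majorized_intros)
  ultimately show ?thesis by (intro exI[of _ C] exI[of _ "\<lambda>x. fast k (x + 1)"]) simp
qed

text \<open>A word is mapped to the code of the net that runs the program on it with budget
  \<open>fast K 1\<close>. The level \<open>K\<close> is a primitive recursive function of the word,
  and so is the code, although the budget is Ackermannian.\<close>

lemma rsa_emptiness_hard: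
  fixes D :: "'d set"
  assumes \<Sigma>: "\<Sigma> \<noteq> {}" "inj_on \<nu> \<Sigma>" and D: "infinite D" and L: "L \<in> F_omega"
  shows "prim_rec_reducible L (rsa_emptiness \<Sigma> \<nu> D)"
proof -
  obtain a where a: "a \<in> \<nu> ` \<Sigma>" using \<Sigma>(1) by auto
  obtain p where p: "prim_rec1 p" and "L \<in> DTIME (\<lambda>n. fast_omega (p n))" using L by (auto simp: F_omega_def)
  from this(2) obtain M c where M: "wf_tm M"
    "\<And>w. \<exists>n \<le> c * fast_omega (p (length w)) + c. answers_within M L w n"
    unfolding DTIME_def by (elim CollectE exE conjE) (rule that, assumption, erule spec)
  obtain C B where B: "majorized B" and C: "\<forall>L w n. answers_within M L w n \<longrightarrow>
    (\<exists>T \<le> B (word_num w + n). exec C ((\<lambda>_. 0)(0 := word_num w)) T ((\<lambda>_. 0)(4 := of_bool (w \<notin> L))))"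
    using machine_program[OF M(1)] by (elim exE conjE)
  obtain k where k: "\<And>x. B x \<le> fast k (x + 1)" using B by (auto simp: majorized_def)
  \<comment> \<open>For \<open>z\<close> at least the input number and the bound on F_omega, this
    covers loading the input, running the program and the final test.\<close>
  have "majorized (\<lambda>z. z + fast k (z + (c * z + c) + 1) + 1)" by (intro majorized_intros)
  then obtain j where j: "\<And>z. z + fast k (z + (c * z + c) + 1) + 1 \<le> fast j (z + 1)"
    unfolding majorized_def by blast
  define q where "q x = p (num_length x) + x + 1" for x
  \<comment> \<open>The constant is the sum of \<open>Suc j + 1\<close> from
    \<open>fast_fast_omega\<close> and 2 from \<open>fast_omega_le_fast\<close>.\<close>
  define K where "K x = q x + j + 4" for x
  have "pr (\<lambda>e. p (num_length (e 0)))"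
    by (rule pr_app1[of p]) (use p in \<open>simp_all add: prim_rec1_iff pr_num_length pr_var\<close>)
  then have prK: "pr (\<lambda>e. K (e 0))" unfolding K_def q_def by (intro pr_intros)
  have bound: "x + B (x + n) + 1 \<le> fast (K x) 1" if n: "n \<le> c * fast_omega (p (num_length x)) + c" for x n
  proof -
    let ?z = "fast_omega (q x)"
    have z: "x \<le> ?z" "1 \<le> ?z" using fast_omega_ge[of "q x"] by (simp_all add: q_def)
    have "fast_omega (p (num_length x)) \<le> ?z" by (rule fast_omega_mono) (simp add: q_def)
    then have "c * fast_omega (p (num_length x)) \<le> c * ?z" by (rule mult_le_mono2)
    then have n': "n \<le> c * ?z + c" using n by linarith
    have "B (x + n) \<le> fast k (x + n + 1)" by (rule k)
    also have "\<dots> \<le> fast k (?z + (c * ?z + c) + 1)" by (rule fast_mono) (use z n' in simp_all)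
    finally have "x + B (x + n) + 1 \<le> ?z + fast k (?z + (c * ?z + c) + 1) + 1" using z(1) by linarith
    also have "\<dots> \<le> fast j (?z + 1)" by (rule j)
    also have "\<dots> \<le> fast j (fast j ?z)" by (rule fast_mono) (use fast_gt[of ?z j] in simp_all)
    also have "\<dots> \<le> fast (Suc j) ?z" by (rule fast_fast[OF z(2)])
    also have "\<dots> \<le> fast_omega (q x + Suc j + 1)" by (rule fast_fast_omega) (simp add: q_def)
    also have "\<dots> \<le> fast (q x + Suc j + 1 + 2) 1" by (rule fast_omega_le_fast)
    also have "q x + Suc j + 1 + 2 = K x" by (simp add: K_def)
    finally show ?thesis .
  qed
  define net where "net x = budget_net (K x) (program_machine (tested_code C) x)" for x
  define b where "b x = net_bound (K x) (program_machine (tested_code C) x)" for x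
  define h where "h w = pres_code (b (word_num w)) (net_pres (net (word_num w)) (loc 16 0) a)" for w
  have "pr (\<lambda>e. b (e 0))" unfolding b_def net_bound_def program_machine_sel by (intro pr_intros prK)
  then have "prw (\<lambda>e. pres_code (b (e 0)) (net_pres (net (e 0)) (loc 16 0) a))"
    unfolding net_def
    by (rule prw_pres_code[where A = "\<lambda>x. net_pres (budget_net (K x) (program_machine (tested_code C) x)) (loc 16 0) a",
      OF pr_program_net[OF prK] _ pr_var])
  then have "prim_rec_word h"
    unfolding prim_rec_word_def h_def
    by (intro exI[of _ "\<lambda>x. word_num (pres_code (b x) (net_pres (net x) (loc 16 0) a))"]) (simp add: prim_rec1_iff)
  moreover have "w \<in> L \<longleftrightarrow> h w \<in> rsa_emptiness \<Sigma> \<nu> D" for w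
  proof -
    let ?x = "word_num w"
    obtain n where n: "n \<le> c * fast_omega (p (length w)) + c" "answers_within M L w n" using M(2) by blast
    obtain T where T: "T \<le> B (?x + n)" "exec C ((\<lambda>_. 0)(0 := ?x)) T ((\<lambda>_. 0)(4 := of_bool (w \<notin> L)))"
      using C[rule_format, OF n(2)] by (elim exE conjE)
    have "?x + T + 1 \<le> fast (K ?x) 1"
      using bound[of n ?x] n(1) T(1) unfolding num_length_word_num by linarith
    from program_net_accepts[OF T(2) this]
    have "w \<notin> L \<longleftrightarrow> (\<exists>n. net_accepts (net ?x) (loc 16 0) n 0 (\<lambda>_. 0))" unfolding net_def by simp
    moreover have "loc 16 0 < b ?x" by (simp add: loc_def b_def net_bound_def)
    then have "h w \<in> rsa_emptiness \<Sigma> \<nu> D \<longleftrightarrow> (\<forall>n. \<not> net_accepts (net ?x) (loc 16 0) n 0 (\<lambda>_. 0))"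
      unfolding h_def using rsa_code_emptiness[OF D _ _ a \<Sigma>(2)] budget_net_wf[OF program_machine_wf]
      unfolding b_def net_def by blast
    ultimately show ?thesis by blast
  qed
  ultimately show ?thesis unfolding prim_rec_reducible_def by blast
qed

theorem theorem4p2:
  fixes \<Sigma> :: "'a set" and \<nu> :: "'a \<Rightarrow> nat" and D :: "'d set"
  assumes "finite \<Sigma>" and "\<Sigma> \<noteq> {}" and "inj_on \<nu> \<Sigma>" and "infinite D"
  shows "decidable (rsa_emptiness \<Sigma> \<nu> D) \<and> F_omega_complete (rsa_emptiness \<Sigma> \<nu> D)"
  unfolding F_omega_complete_def
  using rsa_emptiness_upper[OF assms(1,3,4)] rsa_emptiness_hard[OF assms(2,3,4)] by blast


end
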